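(* Let $\gamma>1$ and let $(q_i)_{i\ge1}$ be a probability distribution on $\mathbb N=\{1,2,\dots\}$ with $q_i\asymp i^{-\gamma}$, and assume that $q_i\sim c\,i^{-\gamma}$ as $i\to\infty$, with $c>0$. Let $(\tilde G_t)_{t\ge0}$ be the corresponding Poisson version of the rank 1 simple random graphs. Let $W:(0,\infty)^2\to[0,1]$ be the graphon $$W(x,y)=1-\exp\bigl(-2c^2x^{-\gamma}y^{-\gamma}\bigr).$$ Then, almost surely, the stretched empirical graphon satisfies $W_{\tilde G_t,\,t^{1/(2\gamma)}}\to_{\mathsf{GP}}W$ as $t\to\infty$. As a consequence, $\tilde G_t\to_{\mathsf{GS}}W$ almost surely as $t\to\infty$.
   Context: $f\asymp g$ for non-negative sequences means that $c_0g(i)\le f(i)\le C_0g(i)$ for all $i$, for some constants $c_0,C_0>0$; $f\sim g$ means $f/g\to1$. The graphs $\tilde G_t$: put $\mu_{ij}:=2q_iq_j$ for $i\neq j$ and $\mu_{ii}:=0$. For each pair $i<j$, copies of the edge $ij$ arrive according to a Poisson process on $[0,\infty)$ with rate $\mu_{ij}$, independently for different pairs. $\tilde G_t$ is the simple graph whose edges are the pairs $ij$ that have arrived at least once in $[0,t]$ (multiple copies merged) and whose vertex set is the set of endpoints of these edges. It is almost surely finite for every $t<\infty$. Graphons on $\mathbb R_+=(0,\infty)$ and their random graphs: a graphon on $\mathbb R_+$ is a symmetric measurable function $W:\mathbb R_+^2\to[0,1]$. For $r\ge0$, let $\{\eta_i\}_{i\ge1}$ be the points of a Poisson process on $\mathbb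 R_+$ with intensity $r$; conditionally on these points, let $\bar G_r(W)$ be the graph with vertex set $\mathbb N$ having an edge $ij$ with probability $W(\eta_i,\eta_j)$, independently for every pair $i<j$ (no loops); $G_r(W)$ is the unlabelled graph obtained from $\bar G_r(W)$ by deleting all isolated vertices and ignoring labels. Only $W$ for which $G_r(W)$ is almost surely finite for every $r<\infty$ are considered. The graphs $G_r(W)$ are naturally coupled for all $r\ge0$ as an increasing process: take a unit-rate Poisson process of points $(\eta_i,s_i)$ on $\mathbb R_+\times[0,\infty)$, decide each edge $ij$ once with probability $W(\eta_i,\eta_j)$, and let $G_r(W)$ be spanned by the edges among points with $s_i\le r$. Let $(G_{\tau_k}(W))_{k}$ be the sequence of different graphs that occur in $(G_r(W))_{r\ge0}$, in order of appearance. Convergence: $W_n\to_{\mathsf{GP}}W$ means that $G_r(W_n)\to G_r(W)$ in distribution for every $r<\infty$. $W_n\to_{\mathsf{GS}}W$ means that $(G_{\tau_k}(W_n))_k\to(G_{\tau_k}(W))_k$ in distribution (as random sequences of finite unlabelled graphs, with the product topology). The same definitions are used for a continuous parameter $t\to\infty$. When the graphons $W_{\tilde G_t,s}$ are random, the almost sure statements mean that for almost every realization of $(\tilde G_t)_{t\ge0}$ the convergence holds for the resulting deterministic family of graphons (i.e. with distributions taken conditionally on the graphs $\tilde G_t$). Stretched graphons: for a finite graph $G$ with vertices labelled $1,\dots,v(G)$ and $s>0$, $W_{G,s}:\mathbb R_+^2\to\{0,1\}$ is defined by $W_{G,s}(x,y):=W_G(\lceil sx\rceil,\lceil sy\rceil)$,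 where $W_G(i,j)=1$ if $i,j\le v(G)$ are adjacent in $G$, and $W_G(i,j)=0$ otherwise (in particular if $\max(i,j)>v(G)$). The choice of labelling does not affect the distributions of the random graphs $G_r(W_{G,s})$. $\tilde G_t\to_{\mathsf{GS}}W$ means $W_{\tilde G_t,1}\to_{\mathsf{GS}}W$ (the relation $\to_{\mathsf{GS}}$ is not affected by stretching). *)

theory Defs
  imports "HOL-Probability.Probability" "HOL-Library.Landau_Symbols"
begin

section \<open>Finite simple graphs and unlabelled graphs\<close>

text \<open>
  None of the random graphs considered here has isolated vertices, so a graph is given by its
  edge set, a set of two-element sets; its vertex set is the union of the edges.
\<close>

definition fin_graph :: "'v set set \<Rightarrow> bool" where
  "fin_graph E \<longleftrightarrow> finite E \<and> (\<forall>e\<in>E. card e = 2)"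

definition graph_iso :: "nat set set \<Rightarrow> nat set set \<Rightarrow> bool" where
  "graph_iso E F \<longleftrightarrow> fin_graph E \<and> fin_graph F \<and>
     (\<exists>f. bij_betw f (\<Union>E) (\<Union>F) \<and> (\<lambda>e. f ` e) ` E = F)"

lemma graph_iso_refl: "fin_graph E \<Longrightarrow> graph_iso E E"
  unfolding graph_iso_def by (auto intro!: exI[of _ "\<lambda>x. x"] simp: bij_betw_def)

lemma graph_iso_sym:
  assumes "graph_iso E F"
  shows "graph_iso F E"
proof -
  obtain f where f: "bij_betw f (\<Union>E) (\<Union>F)" and F: "(\<lambda>e. f ` e) ` E = F"
    using assms by (auto simp: graph_iso_def)
  let ?g = "inv_into (\<Union>E) f"
  have "?g ` (f ` e) = e" if "e \<in> E" for e
    using f that by (intro inv_into_image_cancel) (auto simp: bij_betw_def)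
  then have "(\<lambda>e. ?g ` e) ` F = E"
    unfolding F[symmetric] image_image by simp
  moreover have "bij_betw ?g (\<Union>F) (\<Union>E)"
    using f by (rule bij_betw_inv_into)
  ultimately show ?thesis
    using assms unfolding graph_iso_def by blast
qed

lemma graph_iso_trans:
  assumes "graph_iso E F" "graph_iso F H"
  shows "graph_iso E H"
proof -
  obtain f g where f: "bij_betw f (\<Union>E) (\<Union>F)" and F: "(\<lambda>e. f ` e) ` E = F"
    and g: "bij_betw g (\<Union>F) (\<Union>H)" and H: "(\<lambda>e. g ` e) ` F = H"
    using assms by (auto simp: graph_iso_def)
  have "bij_betw (g \<circ> f) (\<Union>E) (\<Union>H)"
    using f g by (rule bij_betw_trans)
  moreover have "(\<lambda>e. (g \<circ> f) ` e) ` E = H"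
    unfolding H[symmetric] F[symmetric] by (simp add: image_comp comp_def)
  ultimately show ?thesis
    using assms unfolding graph_iso_def by blast
qed

quotient_type ugraph = "nat set set" / partial: graph_iso
proof (rule part_equivpI)
  show "\<exists>E. graph_iso E E"
    by (rule exI[of _ "{}"], rule graph_iso_refl) (simp add: fin_graph_def)
  show "symp graph_iso"
    by (rule sympI) (rule graph_iso_sym)
  show "transp graph_iso"
    by (rule transpI) (rule graph_iso_trans)
qed

text \<open>An infinite edge set (which below occurs on null events only) is sent to the empty graph.\<close>

definition unlabelled :: "nat set set \<Rightarrow> ugraph" where
  "unlabelled E = (if finite E then abs_ugraph E else abs_ugraph {})"

text \<open>
  The set of finite unlabelled graphs is discrete; the type \<^typ>\<open>nat \<Rightarrow> ugraph\<close> then carries the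
  product topology.
\<close>

instantiation ugraph :: discrete_topology
begin

definition open_ugraph :: "ugraph set \<Rightarrow> bool" where
  "open_ugraph A \<longleftrightarrow> True"

instance
  by standard (simp_all add: open_ugraph_def)

end


section \<open>Convergence in distribution\<close>

definition weakly_converges ::
  "('i \<Rightarrow> 'a::topological_space measure) \<Rightarrow> 'a measure \<Rightarrow> 'i filter \<Rightarrow> bool" where
  "weakly_converges \<mu> \<nu> F \<longleftrightarrow>
     (\<forall>f :: 'a \<Rightarrow> real. continuous_on UNIV f \<longrightarrow> bounded (range f) \<longrightarrow>
        ((\<lambda>i. \<integral>x. f x \<partial>\<mu> i) \<longlongrightarrow> (\<integral>x. f x \<partial>\<nu>)) F)"


section \<open>Poisson processes\<close>

text \<open>Written out with point probabilities so that the mean may be 0.\<close>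

definition poisson_distributed :: "'w measure \<Rightarrow> ('w \<Rightarrow> nat) \<Rightarrow> real \<Rightarrow> bool" where
  "poisson_distributed M X l \<longleftrightarrow>
     X \<in> M \<rightarrow>\<^sub>M count_space UNIV \<and>
     (\<forall>k. measure M {\<omega> \<in> space M. X \<omega> = k} = exp (- l) * l ^ k / fact k)"

text \<open>
  A Poisson process on \<open>[0,\<infinity>)\<close>, given by its counting function: \<open>N t\<close> is the number of points
  in \<open>[0,t]\<close>.
\<close>

definition poisson_counting_process :: "'w measure \<Rightarrow> real \<Rightarrow> (real \<Rightarrow> 'w \<Rightarrow> nat) \<Rightarrow> bool" where
  "poisson_counting_process M rate N \<longleftrightarrow>
     (\<forall>t\<ge>0. N t \<in> M \<rightarrow>\<^sub>M count_space UNIV) \<and>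
     (AE \<omega> in M. N 0 \<omega> = 0 \<and> mono_on {0..} (\<lambda>t. N t \<omega>) \<and>
        (\<forall>t\<ge>0. continuous (at_right t) (\<lambda>u. real (N u \<omega>)))) \<and>
     (\<forall>s t. 0 \<le> s \<longrightarrow> s \<le> t \<longrightarrow>
        poisson_distributed M (\<lambda>\<omega>. N t \<omega> - N s \<omega>) (rate * (t - s))) \<and>
     (\<forall>t :: nat \<Rightarrow> real. 0 \<le> t 0 \<longrightarrow> mono t \<longrightarrow>
        prob_space.indep_vars M (\<lambda>_. count_space UNIV)
          (\<lambda>k \<omega>. N (t (Suc k)) \<omega> - N (t k) \<omega>) UNIV)"

text \<open>
  A Poisson process with an infinite intensity measure \<open>\<nu>\<close>, given by an enumeration
  \<open>\<xi> 0, \<xi> 1, \<dots>\<close> of its points. (Independence over finitely many disjoint sets is the case where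
  all further \<open>A k\<close> are empty.)
\<close>

definition poisson_point_process :: "'w measure \<Rightarrow> 'a measure \<Rightarrow> (nat \<Rightarrow> 'w \<Rightarrow> 'a) \<Rightarrow> bool" where
  "poisson_point_process M \<nu> \<xi> \<longleftrightarrow>
     (\<forall>i. \<xi> i \<in> M \<rightarrow>\<^sub>M \<nu>) \<and>
     (\<forall>A\<in>sets \<nu>. emeasure \<nu> A < \<infinity> \<longrightarrow>
        (AE \<omega> in M. finite {i. \<xi> i \<omega> \<in> A}) \<and>
        poisson_distributed M (\<lambda>\<omega>. card {i. \<xi> i \<omega> \<in> A}) (measure \<nu> A)) \<and>
     (\<forall>A :: nat \<Rightarrow> 'a set. disjoint_family A \<longrightarrow>
        (\<forall>k. A k \<in> sets \<nu> \<and> emeasure \<nu> (A k) < \<infinity>) \<longrightarrow>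
        prob_space.indep_vars M (\<lambda>_. count_space UNIV)
          (\<lambda>k \<omega>. card {i. \<xi> i \<omega> \<in> A k}) UNIV)"


section \<open>Poisson version of the rank 1 simple random graphs\<close>

definition rank1_rate :: "(nat \<Rightarrow> real) \<Rightarrow> nat \<Rightarrow> nat \<Rightarrow> real" where
  "rank1_rate q i j = (if i = j then 0 else 2 * q i * q j)"

definition edge_pairs :: "(nat \<times> nat) set" where
  "edge_pairs = {(i, j). 1 \<le> i \<and> i < j}"

text \<open>\<open>N i j t\<close> is the number of copies of the edge \<open>ij\<close>, \<open>1 \<le> i < j\<close>, arrived in \<open>[0,t]\<close>.\<close>

definition rank1_arrivals ::
  "'w measure \<Rightarrow> (nat \<Rightarrow> real) \<Rightarrow> (nat \<Rightarrow> nat \<Rightarrow> real \<Rightarrow> 'w \<Rightarrow> nat) \<Rightarrow> bool" where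
  "rank1_arrivals M q N \<longleftrightarrow>
     prob_space M \<and>
     (\<forall>(i, j)\<in>edge_pairs. poisson_counting_process M (rank1_rate q i j) (N i j)) \<and>
     prob_space.indep_vars M (\<lambda>_. PiM {0..} (\<lambda>_. count_space UNIV))
       (\<lambda>(i, j) \<omega>. \<lambda>t\<in>{0..}. N i j t \<omega>) edge_pairs"

definition arrived_graph ::
  "(nat \<Rightarrow> nat \<Rightarrow> real \<Rightarrow> 'w \<Rightarrow> nat) \<Rightarrow> real \<Rightarrow> 'w \<Rightarrow> nat set set" where
  "arrived_graph N t \<omega> = {{i, j} |i j. (i, j) \<in> edge_pairs \<and> 1 \<le> N i j t \<omega>}"


section \<open>Graphons on \<open>(0,\<infinity>)\<close> and their random graphs\<close>

text \<open>Only the values of \<open>W\<close> on \<open>(0,\<infinity>)\<^sup>2\<close> matter.\<close>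

definition graphon :: "(real \<Rightarrow> real \<Rightarrow> real) \<Rightarrow> bool" where
  "graphon W \<longleftrightarrow>
     (\<lambda>(x, y). W x y) \<in> borel_measurable (restrict_space borel ({0<..} \<times> {0<..})) \<and>
     (\<forall>x>0. \<forall>y>0. W x y = W y x \<and> 0 \<le> W x y \<and> W x y \<le> 1)"

text \<open>
  The randomness used to sample from graphons: the points \<open>(\<eta>\<^sub>i, s\<^sub>i) = \<xi> i\<close> of a unit-rate Poisson
  process on \<open>(0,\<infinity>) \<times> [0,\<infinity>)\<close>, and independent uniform \<open>U i j\<close>, \<open>i < j\<close>, independent of the points.
  The edge \<open>ij\<close> is present iff \<open>U i j < W \<eta>\<^sub>i \<eta>\<^sub>j\<close>, which realizes edges that are conditionally
  independent with probabilities \<open>W \<eta>\<^sub>i \<eta>\<^sub>j\<close>. The law of the resulting graph process does not depend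
  on the choice of \<open>P\<close>, \<open>\<xi>\<close>, \<open>U\<close>.
\<close>

definition graphon_sampling ::
  "'p measure \<Rightarrow> (nat \<Rightarrow> 'p \<Rightarrow> real \<times> real) \<Rightarrow> (nat \<Rightarrow> nat \<Rightarrow> 'p \<Rightarrow> real) \<Rightarrow> bool" where
  "graphon_sampling P \<xi> U \<longleftrightarrow>
     prob_space P \<and>
     poisson_point_process P (restrict_space lborel ({0<..} \<times> {0..})) \<xi> \<and>
     (\<forall>i j. i < j \<longrightarrow> U i j \<in> borel_measurable P \<and>
        distr P borel (U i j) = uniform_measure lborel {0..1}) \<and>
     prob_space.indep_vars P (\<lambda>_. borel) (\<lambda>(i, j). U i j) {(i, j). i < j} \<and>
     prob_space.indep_set P
       (sets (vimage_algebra (space P) (\<lambda>\<omega> i. \<xi> i \<omega>)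
          (PiM UNIV (\<lambda>_. restrict_space lborel ({0<..} \<times> {0..})))))
       (sets (vimage_algebra (space P) (\<lambda>\<omega>. \<lambda>(i, j)\<in>{(i, j). i < j}. U i j \<omega>)
          (PiM {(i, j). i < j} (\<lambda>_. borel))))"

definition sampled_edges ::
  "(nat \<Rightarrow> 'p \<Rightarrow> real \<times> real) \<Rightarrow> (nat \<Rightarrow> nat \<Rightarrow> 'p \<Rightarrow> real) \<Rightarrow> (real \<Rightarrow> real \<Rightarrow> real) \<Rightarrow>
   real \<Rightarrow> 'p \<Rightarrow> nat set set" where
  "sampled_edges \<xi> U W r \<omega> =
     {{i, j} |i j. i < j \<and> snd (\<xi> i \<omega>) \<le> r \<and> snd (\<xi> j \<omega>) \<le> r \<and>
        U i j \<omega> < W (fst (\<xi> i \<omega>)) (fst (\<xi> j \<omega>))}"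

definition graphon_graph ::
  "(nat \<Rightarrow> 'p \<Rightarrow> real \<times> real) \<Rightarrow> (nat \<Rightarrow> nat \<Rightarrow> 'p \<Rightarrow> real) \<Rightarrow> (real \<Rightarrow> real \<Rightarrow> real) \<Rightarrow>
   real \<Rightarrow> 'p \<Rightarrow> ugraph" where
  "graphon_graph \<xi> U W r \<omega> = unlabelled (sampled_edges \<xi> U W r \<omega>)"

text \<open>
  The times \<open>\<tau>\<^sub>0 = 0 < \<tau>\<^sub>1 < \<dots>\<close> at which a piecewise constant right-continuous path on \<open>[0,\<infinity>)\<close>
  takes a new value. If the path never changes after \<open>\<tau>\<^sub>k\<close>, the sequence is continued
  by \<open>\<tau>\<^sub>k\<close>.
\<close>

fun jump_time :: "(real \<Rightarrow> 'a) \<Rightarrow> nat \<Rightarrow> real" where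
  "jump_time g 0 = 0"
| "jump_time g (Suc k) =
     (let \<tau> = jump_time g k; S = {r. \<tau> < r \<and> g r \<noteq> g \<tau>} in if S = {} then \<tau> else Inf S)"

text \<open>
  The sequence of different graphs occurring in \<open>(G\<^sub>r(W))\<close>, \<open>r \<ge> 0\<close>. It starts with \<open>G\<^sub>0(W)\<close>, which
  is almost surely empty. The second alternative is a null event for the graphons under
  consideration.
\<close>

definition graph_sequence ::
  "(nat \<Rightarrow> 'p \<Rightarrow> real \<times> real) \<Rightarrow> (nat \<Rightarrow> nat \<Rightarrow> 'p \<Rightarrow> real) \<Rightarrow> (real \<Rightarrow> real \<Rightarrow> real) \<Rightarrow>
   'p \<Rightarrow> nat \<Rightarrow> ugraph" where
  "graph_sequence \<xi> U W \<omega> k =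
     (if \<forall>r\<ge>0. finite (sampled_edges \<xi> U W r \<omega>)
      then graphon_graph \<xi> U W (jump_time (\<lambda>r. graphon_graph \<xi> U W r \<omega>) k) \<omega>
      else unlabelled {})"

definition admissible_graphon ::
  "'p measure \<Rightarrow> (nat \<Rightarrow> 'p \<Rightarrow> real \<times> real) \<Rightarrow> (nat \<Rightarrow> nat \<Rightarrow> 'p \<Rightarrow> real) \<Rightarrow>
   (real \<Rightarrow> real \<Rightarrow> real) \<Rightarrow> bool" where
  "admissible_graphon P \<xi> U W \<longleftrightarrow>
     graphon W \<and> (\<forall>r\<ge>0. AE \<omega> in P. finite (sampled_edges \<xi> U W r \<omega>))"

definition GP_converges ::
  "'p measure \<Rightarrow> (nat \<Rightarrow> 'p \<Rightarrow> real \<times> real) \<Rightarrow> (nat \<Rightarrow> nat \<Rightarrow> 'p \<Rightarrow> real) \<Rightarrow>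
   ('i \<Rightarrow> real \<Rightarrow> real \<Rightarrow> real) \<Rightarrow> (real \<Rightarrow> real \<Rightarrow> real) \<Rightarrow> 'i filter \<Rightarrow> bool" where
  "GP_converges P \<xi> U Wn W F \<longleftrightarrow>
     (\<forall>n. admissible_graphon P \<xi> U (Wn n)) \<and> admissible_graphon P \<xi> U W \<and>
     (\<forall>r\<ge>0. weakly_converges (\<lambda>n. distr P borel (graphon_graph \<xi> U (Wn n) r))
                             (distr P borel (graphon_graph \<xi> U W r)) F)"

definition GS_converges ::
  "'p measure \<Rightarrow> (nat \<Rightarrow> 'p \<Rightarrow> real \<times> real) \<Rightarrow> (nat \<Rightarrow> nat \<Rightarrow> 'p \<Rightarrow> real) \<Rightarrow>
   ('i \<Rightarrow> real \<Rightarrow> real \<Rightarrow> real) \<Rightarrow> (real \<Rightarrow> real \<Rightarrow> real) \<Rightarrow> 'i filter \<Rightarrow> bool" where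
  "GS_converges P \<xi> U Wn W F \<longleftrightarrow>
     (\<forall>n. admissible_graphon P \<xi> U (Wn n)) \<and> admissible_graphon P \<xi> U W \<and>
     weakly_converges (\<lambda>n. distr P borel (graph_sequence \<xi> U (Wn n)))
                      (distr P borel (graph_sequence \<xi> U W)) F"


section \<open>Stretched graphons\<close>

text \<open>A rule that labels the vertices of every finite graph \<open>E\<close> by \<open>1, \<dots>, v(E)\<close>.\<close>

definition vertex_labelling :: "('v set set \<Rightarrow> nat \<Rightarrow> 'v) \<Rightarrow> bool" where
  "vertex_labelling lab \<longleftrightarrow>
     (\<forall>E. fin_graph E \<longrightarrow> bij_betw (lab E) {1..card (\<Union>E)} (\<Union>E))"

text \<open>The graphon \<open>W\<^sub>G\<^sub>,\<^sub>s\<close>, where \<open>l\<close> maps the labels \<open>1, \<dots>, v(G)\<close> to the vertices of \<open>G\<close>.\<close>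

definition stretched_graphon ::
  "'v set set \<Rightarrow> (nat \<Rightarrow> 'v) \<Rightarrow> real \<Rightarrow> real \<Rightarrow> real \<Rightarrow> real" where
  "stretched_graphon E l s x y =
     (let i = nat \<lceil>s * x\<rceil>; j = nat \<lceil>s * y\<rceil>; V = {1..card (\<Union>E)} in
      if i \<in> V \<and> j \<in> V \<and> {l i, l j} \<in> E then 1 else 0)"

end

theory Submission
  imports Defs "HOL-Real_Asymp.Real_Asymp"
begin

text \<open>
  Sampling from the empirical graphon \<open>W\<^bsub>G,u\<^esub>\<close> up to time \<open>\<rho>\<close> places Poisson many points on each
  vertex of \<open>G\<close>, with mean \<open>\<rho> / u\<close>, and shows the subgraph of \<open>G\<close> induced by the vertices hit so
  far. At the grid time \<open>t = n powr (2 * \<gamma>)\<close>, with \<open>\<rho> / u = R / n\<close>, the edge \<open>xy\<close> of the arrival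
  graph is present with probability \<open>1 - exp (- 2 * q x * q y * t)\<close>, and this is close to
  \<open>W (x / n) (y / n)\<close> because \<open>q x\<close> is close to \<open>c * x powr (- \<gamma>)\<close>. So if the arrival graph is
  averaged out, sampling from it and sampling from \<open>W\<close> are the same experiment up to small errors:
  put a grid of cells (vertex) \<open>\<times>\<close> (time slot) on the plane, note which cells are occupied, and let
  independent coins decide the edges between the occupied vertices. The law of the set of
  occupied cells is explicit (\<open>occupied_law\<close>), so it does not matter how the Poisson points are
  enumerated or how the vertices of the graph are labelled.

  The law given the arrival graph is close to this average. The variance of a conditional
  probability is the covariance of two independent samples drawn from the same arrival graph. Two
  samples that share at most one vertex use disjoint sets of edges and are uncorrelated, and two
  samples share two vertices with probability \<open>O(1 / n\<^sup>2)\<close>. This is summable, so Chebyshev and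
  Borel-Cantelli give almost sure convergence along the grid (\<open>AE_quenched_mean_close\<close>).

  Two approximations make this work. First, \<open>W\<close> is not integrable, so the vertices are truncated to the
  window \<open>n div k < x \<le> n * k\<^sup>2\<close>. A vertex below the window is hit with probability at most about
  \<open>R / k\<close>, and edges that leave the window upwards contribute \<open>O(k powr (1 - \<gamma>))\<close>. Second, times
  between grid points are compared with the grid point before: the graph only grows, and an edge
  that arrives in between is sampled with small probability. The number of edges that matter for
  either reason is a sum of independent indicators with controlled mean (\<open>AE_few_missed\<close>).

  Both modes of convergence are read off one object, the history: the set of unlabelled
  graphs seen up to a time \<open>R\<close>. The graph gains edges whenever it changes, so ordering this set by
  the number of edges recovers the graph sequence, and its largest element is the graph at time
  \<open>R\<close>. The estimate for histories (\<open>history_convergence\<close>) involves \<open>\<rho>\<close> and \<open>u\<close> only through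
  \<open>\<rho> / u\<close>. With \<open>u = t powr (1 / (2 * \<gamma>))\<close> it gives the first claim; with \<open>u = 1\<close> it gives the
  second, once it is known that the graph sampled from \<open>W\<close> changes infinitely often
  (\<open>AE_history_large\<close>).
\<close>

section \<open>Unlabelled graphs and histories of growing graphs\<close>

text \<open>
  On isomorphism classes this is well defined because isomorphic graphs have equally many edges.
\<close>

definition edge_count :: "ugraph \<Rightarrow> nat" where
  "edge_count u = card (rep_ugraph u)"

lemma graph_iso_card:
  assumes "graph_iso E F"
  shows "card E = card F"
proof -
  obtain f where f: "inj_on f (\<Union>E)" and F: "(\<lambda>e. f ` e) ` E = F"
    using assms by (auto simp: graph_iso_def bij_betw_def)
  have "inj_on (\<lambda>e. f ` e) E"
    using f by (intro inj_onI) (metis Sup_upper inj_on_image_eq_iff)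
  then show ?thesis
    using F by (metis card_image)
qed

lemma edge_count_unlabelled:
  assumes "fin_graph E"
  shows "edge_count (unlabelled E) = card E"
proof -
  have "graph_iso (rep_ugraph (abs_ugraph E)) E"
    using assms Quotient3_ugraph Quotient3_rep_abs graph_iso_refl by fastforce
  then show ?thesis
    using assms by (simp add: edge_count_def unlabelled_def fin_graph_def graph_iso_card)
qed

text \<open>
  Renaming the vertices is invisible in the unlabelled graph. This is what identifies graphs on the
  indices of Poisson points with graphs on the vertices that the points hit.
\<close>

lemma unlabelled_image:
  assumes "fin_graph E" "inj_on f (\<Union>E)"
  shows "unlabelled ((\<lambda>e. f ` e) ` E) = unlabelled E"
proof -
  have fin: "fin_graph ((\<lambda>e. f ` e) ` E)"
    using assms by (auto simp: fin_graph_def intro!: card_image[THEN trans] intro: inj_on_subset)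
  have "bij_betw f (\<Union>E) (\<Union>((\<lambda>e. f ` e) ` E))"
    using assms(2) by (auto simp: bij_betw_def)
  then have "graph_iso E ((\<lambda>e. f ` e) ` E)"
    using assms fin by (auto simp: graph_iso_def)
  then have "abs_ugraph E = abs_ugraph ((\<lambda>e. f ` e) ` E)"
    using Quotient3_ugraph Quotient3_rel_abs by fast
  then show ?thesis
    using assms(1) fin by (simp add: unlabelled_def fin_graph_def)
qed

lemma countable_fin_graphs: "countable {E :: nat set set. fin_graph E}"
proof -
  have "{E :: nat set set. fin_graph E} \<subseteq> {E. finite E \<and> E \<subseteq> {e. finite e}}"
    by (auto simp: fin_graph_def intro: card_ge_0_finite)
  moreover have "countable {E. finite E \<and> E \<subseteq> {e :: nat set. finite e}}"
    by (intro countable_Collect_finite_subset) (simp add: countable_Collect_finite)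
  ultimately show ?thesis
    by (rule countable_subset)
qed

instance ugraph :: countable
proof
  have "(UNIV :: ugraph set) = abs_ugraph ` {E. fin_graph E}"
  proof (intro set_eqI iffI)
    fix u :: ugraph
    have "u = abs_ugraph (rep_ugraph u)" "graph_iso (rep_ugraph u) (rep_ugraph u)"
      using Quotient3_ugraph Quotient3_abs_rep Quotient3_rep_reflp by (metis, metis)
    then show "u \<in> abs_ugraph ` {E. fin_graph E}"
      by (auto simp: graph_iso_def)
  qed auto
  then have "countable (UNIV :: ugraph set)"
    using countable_fin_graphs by (metis countable_image)
  then show "\<exists>to_nat :: ugraph \<Rightarrow> nat. inj to_nat"
    by (auto simp: countable_def)
qed

instance ugraph :: second_countable_topology
proof
  show "\<exists>B :: ugraph set set. countable B \<and> open = generate_topology B"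
  proof (intro exI conjI)
    show "countable ((\<lambda>u :: ugraph. {u}) ` UNIV)"
      by simp
    have "generate_topology (range (\<lambda>u :: ugraph. {u})) A" for A :: "ugraph set"
    proof -
      have "generate_topology (range (\<lambda>u :: ugraph. {u})) (\<Union>((\<lambda>u. {u}) ` A))"
        by (rule generate_topology.UN) (auto intro: generate_topology.Basis)
      then show ?thesis by simp
    qed
    then show "open = generate_topology (range (\<lambda>u :: ugraph. {u}))"
      by (auto simp: fun_eq_iff open_ugraph_def)
  qed
qed

text \<open>
  In the history of a growing graph different members have different numbers of edges, so the rank by
  number of edges is the position in the graph sequence.
\<close>

definition kth :: "ugraph set \<Rightarrow> nat \<Rightarrow> ugraph \<Rightarrow> bool" where
  "kth S k u \<longleftrightarrow> u \<in> S \<and> card {u' \<in> S. edge_count u' < edge_count u} = k"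

text \<open>
  Right-continuity is stated at one point \<open>r + d\<close> only; by monotonicity the edge set is then constant
  on \<open>[r, r + d]\<close>.
\<close>

locale growing_graph =
  fixes E :: "real \<Rightarrow> nat set set"
  assumes fin: "\<And>r. fin_graph (E r)"
    and mono: "\<And>r r'. r \<le> r' \<Longrightarrow> E r \<subseteq> E r'"
    and right_const: "\<And>r. \<exists>d>0. E (r + d) = E r"
begin

definition g :: "real \<Rightarrow> ugraph" where "g r = unlabelled (E r)"

lemma ec: "edge_count (g r) = card (E r)"
  unfolding g_def by (rule edge_count_unlabelled[OF fin])

lemma ec_less_iff: "edge_count (g r) < edge_count (g r') \<longleftrightarrow> E r \<subset> E r'"
proof
  assume "edge_count (g r) < edge_count (g r')"
  then have "card (E r) < card (E r')" by (simp add: ec)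
  then have "\<not> E r' \<subseteq> E r"
    using fin[of r] card_mono[of "E r" "E r'"] by (auto simp: fin_graph_def)
  then show "E r \<subset> E r'"
    using mono[of r r'] mono[of r' r] by (cases "r \<le> r'") auto
next
  assume "E r \<subset> E r'"
  then show "edge_count (g r) < edge_count (g r')"
    using fin[of r'] psubset_card_mono[of "E r'" "E r"] by (auto simp: ec fin_graph_def)
qed

text \<open>
  Edge sets of the process are nested, so an isomorphism between two of them, which preserves the
  number of edges, forces equality.
\<close>

lemma g_eq_iff: "g r = g r' \<longleftrightarrow> E r = E r'"
proof
  assume "g r = g r'"
  then have "\<not> E r \<subset> E r'" "\<not> E r' \<subset> E r"
    by (simp_all flip: ec_less_iff)
  then show "E r = E r'"
    using mono[of r r'] mono[of r' r] by (metis linear psubsetI)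
qed (simp add: g_def)

text \<open>
  The graphs seen strictly before the graph at time \<open>r\<close> appeared.
\<close>

definition lower :: "real \<Rightarrow> ugraph set" where
  "lower r = g ` {r'. 0 \<le> r' \<and> E r' \<subset> E r}"

lemma finite_image: "finite (g ` {r'. 0 \<le> r' \<and> E r' \<subseteq> E r})"
proof -
  have "g ` {r'. 0 \<le> r' \<and> E r' \<subseteq> E r} \<subseteq> unlabelled ` Pow (E r)"
    by (auto simp: g_def)
  moreover have "finite (unlabelled ` Pow (E r))"
    using fin[of r] by (simp add: fin_graph_def)
  ultimately show ?thesis
    by (rule finite_subset)
qed

lemma finite_lower: "finite (lower r)"
  unfolding lower_def by (rule finite_subset[OF _ finite_image[of r]]) auto

lemma finite_history: "finite (g ` {0..R})"
  by (rule finite_subset[OF _ finite_image[of R]]) (use mono in fastforce)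

lemma jump_nontrivial:
  assumes "\<tau> = jump_time g k" "0 \<le> \<tau>" "r0 > \<tau>" "g r0 \<noteq> g \<tau>"
  defines "\<tau>' \<equiv> jump_time g (Suc k)"
  shows "\<tau> < \<tau>'" "E \<tau> \<subset> E \<tau>'" "\<And>r. \<tau> \<le> r \<Longrightarrow> r < \<tau>' \<Longrightarrow> E r = E \<tau>"
proof -
  define S where "S = {r. \<tau> < r \<and> g r \<noteq> g \<tau>}"
  have ne: "S \<noteq> {}" using assms by (auto simp: S_def)
  have bdd: "bdd_below S" by (rule bdd_belowI[of _ \<tau>]) (auto simp: S_def)
  have t': "\<tau>' = Inf S"
    using ne unfolding \<tau>'_def jump_time.simps assms(1)[symmetric] Let_def S_def[symmetric] by simp
  obtain d where d: "d > 0" "E (\<tau> + d) = E \<tau>" using right_const by blast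
  have "\<tau> + d \<le> r" if "r \<in> S" for r
  proof (rule ccontr)
    assume "\<not> ?thesis"
    then have "E r \<subseteq> E \<tau>" "E \<tau> \<subseteq> E r"
      using that mono[of r "\<tau> + d"] mono[of \<tau> r] d by (auto simp: S_def)
    then show False using that by (auto simp: S_def g_eq_iff)
  qed
  then have "\<tau> + d \<le> \<tau>'" unfolding t' using ne by (intro cInf_greatest)
  then show lt: "\<tau> < \<tau>'" using d by simp
  show const: "E r = E \<tau>" if "\<tau> \<le> r" "r < \<tau>'" for r
  proof (rule ccontr)
    assume "E r \<noteq> E \<tau>"
    then have "r \<in> S" using that by (cases "r = \<tau>") (auto simp: S_def g_eq_iff)
    then have "\<tau>' \<le> r" unfolding t' using bdd by (intro cInf_lower)
    then show False using that by simp
  qed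
  obtain d' where d': "d' > 0" "E (\<tau>' + d') = E \<tau>'" using right_const by blast
  have "E \<tau>' \<noteq> E \<tau>"
  proof
    assume eq: "E \<tau>' = E \<tau>"
    have "\<tau>' + d' \<le> r" if "r \<in> S" for r
    proof (rule ccontr)
      assume "\<not> ?thesis"
      moreover have "\<tau>' \<le> r" unfolding t' using bdd that by (intro cInf_lower)
      ultimately have "E r \<subseteq> E \<tau>'" "E \<tau>' \<subseteq> E r"
        using mono[of r "\<tau>' + d'"] mono[of \<tau>' r] d' by auto
      then show False using that eq by (auto simp: S_def g_eq_iff)
    qed
    then have "\<tau>' + d' \<le> \<tau>'" using ne t' by (metis cInf_greatest)
    then show False using d' by simp
  qed
  then show "E \<tau> \<subset> E \<tau>'" using mono[of \<tau> \<tau>'] lt by auto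
qed

text \<open>
  Each genuine jump adds exactly one graph, the one just left, to the set of earlier graphs. The second
  alternative is the convention for a path that has stopped changing.
\<close>

lemma jump_time_rank:
  "0 \<le> jump_time g k \<and>
    (card (lower (jump_time g k)) = k \<or>
     card (lower (jump_time g k)) < k \<and> (\<forall>r\<ge>jump_time g k. E r = E (jump_time g k)))"
proof (induction k)
  case 0
  have "lower 0 = {}" using mono by (force simp: lower_def)
  then show ?case by simp
next
  case (Suc k)
  define \<tau> where "\<tau> = jump_time g k"
  define \<tau>' where "\<tau>' = jump_time g (Suc k)"
  have pos: "0 \<le> \<tau>" using Suc by (simp add: \<tau>_def)
  show ?case
  proof (cases "\<exists>r0>\<tau>. g r0 \<noteq> g \<tau>")
    case True
    then obtain r0 where r0: "r0 > \<tau>" "g r0 \<noteq> g \<tau>" by blast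
    note j = jump_nontrivial[OF \<tau>_def pos r0, folded \<tau>'_def]
    have "lower \<tau>' = insert (g \<tau>) (lower \<tau>)"
    proof (intro set_eqI iffI)
      fix u assume "u \<in> lower \<tau>'"
      then obtain r where r: "u = g r" "0 \<le> r" "E r \<subset> E \<tau>'" by (auto simp: lower_def)
      then have "r < \<tau>'" using mono[of \<tau>' r] by (cases "r < \<tau>'") auto
      show "u \<in> insert (g \<tau>) (lower \<tau>)"
      proof (cases "E r = E \<tau>")
        case True then show ?thesis using r by (simp add: g_def)
      next
        case False
        then have "r < \<tau>" using j(3)[of r] \<open>r < \<tau>'\<close> by fastforce
        then show ?thesis using r False mono[of r \<tau>] by (auto simp: lower_def)
      qed
    next
      fix u assume "u \<in> insert (g \<tau>) (lower \<tau>)"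
      then show "u \<in> lower \<tau>'" using j(2) pos by (auto simp: lower_def)
    qed
    moreover have "g \<tau> \<notin> lower \<tau>" by (auto simp: lower_def g_eq_iff)
    ultimately have "card (lower \<tau>') = Suc (card (lower \<tau>))" by (simp add: finite_lower)
    moreover have "E r0 \<noteq> E \<tau>" using r0 by (simp add: g_eq_iff)
    moreover have "card (lower \<tau>) = k" using Suc r0(1) calculation unfolding \<tau>_def[symmetric] by (metis less_imp_le)
    ultimately show ?thesis using j(1) pos unfolding \<tau>'_def by simp
  next
    case False
    then have S: "{r. \<tau> < r \<and> g r \<noteq> g \<tau>} = {}" by auto
    have eq: "\<tau>' = \<tau>" unfolding \<tau>'_def jump_time.simps \<tau>_def[symmetric] Let_def using S by simp
    have "\<forall>r\<ge>\<tau>. E r = E \<tau>"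
      using False by (metis order_le_less g_eq_iff)
    then show ?thesis
      using Suc unfolding \<tau>'_def[symmetric] \<tau>_def[symmetric] eq by (metis less_SucI lessI)
  qed
qed

lemma lower_history:
  assumes "0 \<le> r" "g r \<in> g ` {0..R}"
  shows "{u \<in> g ` {0..R}. edge_count u < edge_count (g r)} = lower r"
proof -
  obtain r1 where r1: "0 \<le> r1" "r1 \<le> R" "E r = E r1" using assms by (auto simp: g_eq_iff)
  show ?thesis
  proof (intro set_eqI iffI)
    fix u assume "u \<in> {u \<in> g ` {0..R}. edge_count u < edge_count (g r)}"
    then show "u \<in> lower r" by (auto simp: lower_def ec_less_iff)
  next
    fix u assume "u \<in> lower r"
    then obtain r' where r': "u = g r'" "0 \<le> r'" "E r' \<subset> E r" by (auto simp: lower_def)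
    then have "r' \<le> R" using r1 mono[of r1 r'] by (cases "r' \<le> R") auto
    then show "u \<in> {u \<in> g ` {0..R}. edge_count u < edge_count (g r)}"
      using r' by (auto simp: ec_less_iff)
  qed
qed

lemma kth_jump_time:
  assumes "k < card (g ` {0..R})"
  shows "kth (g ` {0..R}) k (g (jump_time g k))"
proof -
  define \<tau> where "\<tau> = jump_time g k"
  have H: "0 \<le> \<tau>" "card (lower \<tau>) = k \<or> card (lower \<tau>) < k \<and> (\<forall>r\<ge>\<tau>. E r = E \<tau>)"
    using jump_time_rank[of k] by (auto simp: \<tau>_def)
  have card: "card (lower \<tau>) = k"
  proof (rule ccontr)
    assume "\<not> ?thesis"
    then have *: "card (lower \<tau>) < k" and const: "\<And>r. r \<ge> \<tau> \<Longrightarrow> E r = E \<tau>" using H by metis+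
    have "g ` {0..R} \<subseteq> insert (g \<tau>) (lower \<tau>)"
    proof
      fix u assume "u \<in> g ` {0..R}"
      then obtain r where r: "u = g r" "0 \<le> r" by auto
      have "E r \<subseteq> E \<tau>" using const[of r] mono[of r \<tau>] by (metis linear subset_refl)
      then show "u \<in> insert (g \<tau>) (lower \<tau>)"
        using r by (auto simp: lower_def g_eq_iff)
    qed
    then have "card (g ` {0..R}) \<le> card (insert (g \<tau>) (lower \<tau>))"
      by (intro card_mono) (simp_all add: finite_lower)
    also have "\<dots> \<le> k" using *(1) finite_lower by (simp add: card_insert_if)
    finally show False using assms by simp
  qed
  have mem: "g \<tau> \<in> g ` {0..R}"
  proof (rule ccontr)
    assume n: "g \<tau> \<notin> g ` {0..R}"
    have "g ` {0..R} \<subseteq> lower \<tau>"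
    proof
      fix u assume "u \<in> g ` {0..R}"
      then obtain r where r: "u = g r" "0 \<le> r" "r \<le> R" by auto
      have "\<tau> > R" using n H by force
      moreover have "g \<tau> \<noteq> g r" using n r by auto
      ultimately have "E r \<subset> E \<tau>" using r mono[of r \<tau>] by (auto simp: g_eq_iff)
      then show "u \<in> lower \<tau>" using r by (auto simp: lower_def)
    qed
    then have "card (g ` {0..R}) \<le> k"
      using card card_mono[OF finite_lower] by metis
    then show False using assms by simp
  qed
  show ?thesis
    unfolding kth_def \<tau>_def[symmetric] using mem lower_history[OF H(1) mem] card by simp
qed

lemma kth_unique:
  assumes "kth (g ` {0..R}) k u" "kth (g ` {0..R}) k u'"
  shows "u = u'"
proof -
  obtain r r' where r: "u = g r" "0 \<le> r" "u' = g r'" "0 \<le> r'" 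
    using assms by (auto simp: kth_def)
  have c: "card (lower r) = card (lower r')"
    using assms lower_history[of r R] lower_history[of r' R] unfolding kth_def r(1,3) by (simp add: r)
  have aux: "card (lower a) < card (lower b)" if "E a \<subset> E b" "0 \<le> a" for a b
  proof (intro psubset_card_mono finite_lower psubsetI)
    show "lower a \<subseteq> lower b" using that(1) unfolding lower_def by blast
    have "g a \<in> lower b" "g a \<notin> lower a" using that by (auto simp: lower_def g_eq_iff)
    then show "lower a \<noteq> lower b" by auto
  qed
  have "E r = E r'"
    using aux[of r r'] aux[of r' r] r c mono[of r r'] mono[of r' r] by (cases "r \<le> r'") auto
  then show ?thesis using r by (simp add: g_def)
qed

lemma kth_less_card:
  assumes "kth (g ` {0..R}) k u"
  shows "k < card (g ` {0..R})"
proof -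
  have "{u' \<in> g ` {0..R}. edge_count u' < edge_count u} \<subset> g ` {0..R}"
    using assms by (auto simp: kth_def)
  then show ?thesis
    using assms psubset_card_mono[OF finite_history] by (auto simp: kth_def)
qed

lemma jump_time_terminal:
  assumes "\<And>i :: nat. card (g ` {0..real i}) \<le> k" "real i \<ge> jump_time g k"
  shows "g (jump_time g k) = g (real i)"
proof -
  define \<tau> where "\<tau> = jump_time g k"
  have H: "0 \<le> \<tau>" "card (lower \<tau>) = k \<or> card (lower \<tau>) < k \<and> (\<forall>r\<ge>\<tau>. E r = E \<tau>)"
    using jump_time_rank[of k] by (auto simp: \<tau>_def)
  obtain i0 :: nat where i0: "\<tau> \<le> real i0" using real_arch_simple by blast
  have "card (lower \<tau>) \<noteq> k"
  proof
    assume c: "card (lower \<tau>) = k"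
    have "insert (g \<tau>) (lower \<tau>) \<subseteq> g ` {0..real i0}"
    proof
      fix u assume "u \<in> insert (g \<tau>) (lower \<tau>)"
      then obtain r where r: "u = g r" "0 \<le> r" "E r \<subset> E \<tau> \<or> r = \<tau>" using H(1) by (auto simp: lower_def)
      then have "r \<le> \<tau>" using mono[of \<tau> r] by (cases "r \<le> \<tau>") auto
      then show "u \<in> g ` {0..real i0}" using r i0 by auto
    qed
    then have "card (insert (g \<tau>) (lower \<tau>)) \<le> card (g ` {0..real i0})"
      by (intro card_mono finite_history)
    moreover have "g \<tau> \<notin> lower \<tau>" by (auto simp: lower_def g_eq_iff)
    ultimately show False using c assms(1)[of i0] by (simp add: finite_lower)
  qed
  then have "E (real i) = E \<tau>"
    using H assms(2) unfolding \<tau>_def[symmetric] by metis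
  then show ?thesis
    unfolding \<tau>_def[symmetric] by (simp add: g_def)
qed

text \<open>
  The position in the sequence is expressed by the histories at integer times alone. These are countably
  many events, which makes the graph sequence measurable.
\<close>

lemma jump_graph_iff:
  "g (jump_time g k) = u \<longleftrightarrow>
    (\<exists>i :: nat. kth (g ` {0..real i}) k u) \<or>
    (\<forall>i :: nat. card (g ` {0..real i}) \<le> k) \<and> (\<exists>i0 :: nat. \<forall>i\<ge>i0. g (real i) = u)"
  (is "?L \<longleftrightarrow> ?A \<or> ?B")
proof (cases "\<forall>i :: nat. card (g ` {0..real i}) \<le> k")
  case True
  then have nA: "\<not> ?A" using kth_less_card by (metis leD)
  obtain i1 :: nat where i1: "jump_time g k \<le> real i1" using real_arch_simple by blast
  have eq: "g (jump_time g k) = g (real i)" if "i \<ge> i1" for i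
    using jump_time_terminal[of k i] True i1 that by (meson of_nat_mono order_trans)
  show ?thesis
  proof
    assume ?L
    then show "?A \<or> ?B" using True eq by metis
  next
    assume "?A \<or> ?B"
    then obtain i0 where "\<forall>i\<ge>i0. g (real i) = u" using nA by auto
    then show ?L using eq[of "max i0 i1"] by simp
  qed
next
  case False
  then obtain i where i: "k < card (g ` {0..real i})" by (auto simp: not_le)
  note k = kth_jump_time[OF i]
  show ?thesis
  proof
    assume ?L then show "?A \<or> ?B" using k by auto
  next
    assume "?A \<or> ?B"
    then obtain j where j: "kth (g ` {0..real j}) k u" using False by auto
    have "kth (g ` {0..real j}) k (g (jump_time g k))"
      using kth_jump_time kth_less_card[OF j] by blast
    then show ?L using j kth_unique by blast
  qed
qed

end

text \<open>
  The edge set at time \<open>r\<close> of a process whose vertex \<open>i\<close> is born at time \<open>s i\<close>.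
\<close>

definition birth_edges :: "(nat \<Rightarrow> real) \<Rightarrow> (nat \<Rightarrow> nat \<Rightarrow> bool) \<Rightarrow> real \<Rightarrow> nat set set" where
  "birth_edges s adj r = {{i, j} |i j. i < j \<and> s i \<le> r \<and> s j \<le> r \<and> adj i j}"

lemma birth_edges_mono: "r \<le> r' \<Longrightarrow> birth_edges s adj r \<subseteq> birth_edges s adj r'"
  unfolding birth_edges_def by force

text \<open>
  Right-continuity: only finitely many edges appear during \<open>(r, r + 1]\<close>, and each has a birth time
  larger than \<open>r\<close>.
\<close>

lemma growing_graph_birth_edges:
  assumes fin: "\<And>r. finite (birth_edges s adj r)"
  shows "growing_graph (birth_edges s adj)"
proof
  fix r r' :: real
  show "fin_graph (birth_edges s adj r)"
    using fin[of r] by (auto simp: fin_graph_def birth_edges_def card_2_iff)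
  show "birth_edges s adj r \<subseteq> birth_edges s adj r'" if "r \<le> r'"
    using that by (rule birth_edges_mono)
  define D where "D = birth_edges s adj (r + 1) - birth_edges s adj r"
  have "eventually (\<lambda>d. e \<notin> birth_edges s adj (r + d)) (at_right 0)" if eD: "e \<in> D" for e
  proof -
    obtain i j where ij: "i < j" "e = {i, j}" "adj i j"
      using eD unfolding D_def birth_edges_def by blast
    moreover have "e \<notin> birth_edges s adj r" using eD by (simp add: D_def)
    ultimately have *: "r < max (s i) (s j)" unfolding birth_edges_def by (auto simp: less_max_iff_disj)
    have "eventually (\<lambda>d. d < max (s i) (s j) - r) (at_right 0)"
      using * by (intro order_tendstoD[OF tendsto_ident_at]) simp
    then show ?thesis
    proof eventually_elim
      case (elim d)
      show ?case
      proof
        assume "e \<in> birth_edges s adj (r + d)"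
        then obtain i' j' where "i' < j'" "{i, j} = {i', j'}" "s i' \<le> r + d" "s j' \<le> r + d"
          by (auto simp: birth_edges_def ij(2))
        then have "max (s i) (s j) \<le> r + d" by (auto simp: doubleton_eq_iff)
        then show False using elim by (simp add: max_def split: if_splits)
      qed
    qed
  qed
  moreover have "finite D" unfolding D_def using fin by simp
  ultimately have "eventually (\<lambda>d. \<forall>e\<in>D. e \<notin> birth_edges s adj (r + d)) (at_right 0)"
    by (simp add: eventually_ball_finite)
  moreover have "eventually (\<lambda>d. 0 < d \<and> d < (1::real)) (at_right 0)"
    by (auto simp: eventually_at_right_field intro: exI[of _ 1])
  ultimately have "eventually (\<lambda>d. (\<forall>e\<in>D. e \<notin> birth_edges s adj (r + d)) \<and> 0 < d \<and> d < 1) (at_right 0)"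
    by eventually_elim simp
  then obtain d where d: "0 < d" "d < 1" "\<forall>e\<in>D. e \<notin> birth_edges s adj (r + d)"
    using eventually_happens'[OF trivial_limit_at_right_real] by blast
  have "birth_edges s adj (r + d) = birth_edges s adj r"
    using d birth_edges_mono[of "r + d" "r + 1" s adj] birth_edges_mono[of r "r + d" s adj]
    unfolding D_def by auto
  then show "\<exists>d>0. birth_edges s adj (r + d) = birth_edges s adj r"
    using d by blast
qed

text \<open>
  The counterpart of a history after discretisation: \<open>(x, a) \<in> B\<close> means that vertex \<open>x\<close> is hit during the
  time slot \<open>a\<close>, and \<open>F\<close> contains the edges between vertices.
\<close>

definition discrete_history :: "nat \<Rightarrow> (nat \<times> nat) set \<Rightarrow> nat set set \<Rightarrow> ugraph set" where
  "discrete_history m B F =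
     (\<lambda>a. unlabelled {e \<in> F. e \<subseteq> {x. \<exists>a'\<le>a. (x, a') \<in> B}}) ` {0..m}"

lemma discrete_history_cong:
  assumes "\<And>e. e \<subseteq> fst ` B \<Longrightarrow> e \<in> F \<longleftrightarrow> e \<in> F'"
  shows "discrete_history m B F = discrete_history m B F'"
proof -
  have "{e \<in> F. e \<subseteq> {x. \<exists>a'\<le>a. (x, a') \<in> B}} = {e \<in> F'. e \<subseteq> {x. \<exists>a'\<le>a. (x, a') \<in> B}}" for a
  proof -
    have "{x. \<exists>a'\<le>a. (x, a') \<in> B} \<subseteq> fst ` B" by force
    then show ?thesis using assms by (metis (lifting) subset_trans)
  qed
  then show ?thesis unfolding discrete_history_def by simp
qed

text \<open>
  If no two points share a vertex or a slot, then the slots put the points in the same order as the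
  exact times do. The sets of points present at the times in \<open>[0, \<rho>]\<close> are therefore the sets of points
  in the first \<open>a\<close> slots, and \<open>x\<close> is an isomorphism onto the graph induced by \<open>F\<close>.
\<close>

lemma history_match:
  fixes s :: "nat \<Rightarrow> real" and x a :: "nat \<Rightarrow> nat"
  assumes Q: "finite Q" and F: "\<And>e. e \<in> F \<Longrightarrow> card e = 2"
    and adj: "\<And>i j. i < j \<Longrightarrow> s i \<le> \<rho> \<Longrightarrow> s j \<le> \<rho> \<Longrightarrow>
                adj i j \<longleftrightarrow> i \<in> Q \<and> j \<in> Q \<and> {x i, x j} \<in> F"
    and x: "inj_on x Q" and a: "inj_on a Q" "a ` Q \<subseteq> {1..m}"
    and ord: "\<And>i j. i \<in> Q \<Longrightarrow> j \<in> Q \<Longrightarrow> a i < a j \<Longrightarrow> s i < s j"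
    and s: "\<And>i. i \<in> Q \<Longrightarrow> 0 < s i \<and> s i \<le> \<rho>" and "0 \<le> \<rho>"
  shows "(\<lambda>r. unlabelled (birth_edges s adj r)) ` {0..\<rho>} =
         discrete_history m ((\<lambda>i. (x i, a i)) ` Q) F"
proof -
  define f where "f P = unlabelled {e \<in> F. e \<subseteq> x ` P}" for P
  have 1: "unlabelled (birth_edges s adj r) = f {i \<in> Q. s i \<le> r}" if r: "r \<le> \<rho>" for r
  proof -
    let ?E = "birth_edges s adj r"
    have sub: "\<Union>?E \<subseteq> Q"
      using adj r unfolding birth_edges_def by fastforce
    have "?E \<subseteq> Pow Q" using sub by blast
    then have "finite ?E" using Q by (meson finite_Pow_iff finite_subset)
    then have "fin_graph ?E" by (auto simp: fin_graph_def birth_edges_def card_2_iff)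
    moreover have "inj_on x (\<Union>?E)" using x sub by (rule inj_on_subset)
    ultimately have "unlabelled ?E = unlabelled ((\<lambda>e. x ` e) ` ?E)"
      by (simp add: unlabelled_image)
    also have "(\<lambda>e. x ` e) ` ?E = {e \<in> F. e \<subseteq> x ` {i \<in> Q. s i \<le> r}}"
    proof (intro set_eqI iffI)
      fix e assume "e \<in> (\<lambda>e. x ` e) ` ?E"
      then obtain i j where "i < j" "s i \<le> r" "s j \<le> r" "adj i j" "e = {x i, x j}"
        by (auto simp: birth_edges_def)
      then show "e \<in> {e \<in> F. e \<subseteq> x ` {i \<in> Q. s i \<le> r}}" using adj r by auto
    next
      fix e assume e: "e \<in> {e \<in> F. e \<subseteq> x ` {i \<in> Q. s i \<le> r}}"
      then obtain y z where yz: "e = {y, z}" "y \<noteq> z" using F by (metis (no_types, lifting) card_2_iff mem_Collect_eq)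
      then obtain i j where ij: "y = x i" "z = x j" "i \<in> Q" "j \<in> Q" "s i \<le> r" "s j \<le> r"
        using e by auto
      then have "i < j \<or> j < i" using yz by (metis linorder_neqE_nat)
      then show "e \<in> (\<lambda>e. x ` e) ` ?E"
      proof
        assume "i < j"
        then have "adj i j" using adj[of i j] ij r e yz by auto
        then have "{i, j} \<in> ?E" unfolding birth_edges_def using \<open>i < j\<close> ij by blast
        then show ?thesis using ij yz by (auto intro!: image_eqI[of _ _ "{i, j}"])
      next
        assume "j < i"
        then have "adj j i" using adj[of j i] ij r e yz by (auto simp: insert_commute)
        then have "{j, i} \<in> ?E" unfolding birth_edges_def using \<open>j < i\<close> ij by blast
        then show ?thesis using ij yz by (auto intro!: image_eqI[of _ _ "{j, i}"])
      qed
    qed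
    finally show ?thesis by (simp add: f_def)
  qed
  have 2: "{y. \<exists>a'\<le>b. (y, a') \<in> (\<lambda>i. (x i, a i)) ` Q} = x ` {i \<in> Q. a i \<le> b}" for b
    by auto
  have "(\<lambda>r. {i \<in> Q. s i \<le> r}) ` {0..\<rho>} = (\<lambda>b. {i \<in> Q. a i \<le> b}) ` {0..m}"
  proof (intro set_eqI iffI)
    fix P assume "P \<in> (\<lambda>r. {i \<in> Q. s i \<le> r}) ` {0..\<rho>}"
    then obtain r where P: "P = {i \<in> Q. s i \<le> r}" by blast
    show "P \<in> (\<lambda>b. {i \<in> Q. a i \<le> b}) ` {0..m}"
    proof (cases "P = {}")
      case True
      have "{i \<in> Q. a i \<le> 0} = {}" using a(2) by force
      then show ?thesis using True by (auto intro!: image_eqI[of _ _ 0])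
    next
      case False
      have fP: "finite (a ` P)" using Q P by simp
      obtain i where i: "i \<in> P" "a i = Max (a ` P)" using Max_in[OF fP] False by fastforce
      have "P = {j \<in> Q. a j \<le> a i}"
      proof (intro set_eqI iffI)
        fix j assume "j \<in> P"
        then show "j \<in> {j \<in> Q. a j \<le> a i}" using fP i P by auto
      next
        fix j assume j: "j \<in> {j \<in> Q. a j \<le> a i}"
        then have "j = i \<or> s j < s i"
          using a(1) i P ord[of j i] by (auto simp: le_less inj_on_def)
        then show "j \<in> P" using i P j by auto
      qed
      moreover have "a i \<in> {0..m}" using a(2) i P by force
      ultimately show ?thesis by (rule image_eqI)
    qed
  next
    fix P assume "P \<in> (\<lambda>b. {i \<in> Q. a i \<le> b}) ` {0..m}"
    then obtain b where P: "P = {i \<in> Q. a i \<le> b}" by blast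
    show "P \<in> (\<lambda>r. {i \<in> Q. s i \<le> r}) ` {0..\<rho>}"
    proof (cases "P = {}")
      case True
      have "{i \<in> Q. s i \<le> 0} = {}" using s by force
      then show ?thesis using True \<open>0 \<le> \<rho>\<close> by (auto intro!: image_eqI[of _ _ 0])
    next
      case False
      have fP: "finite (s ` P)" using Q P by simp
      obtain i where i: "i \<in> P" "s i = Max (s ` P)" using Max_in[OF fP] False by fastforce
      have "P = {j \<in> Q. s j \<le> s i}"
      proof (intro set_eqI iffI)
        fix j assume "j \<in> P"
        then show "j \<in> {j \<in> Q. s j \<le> s i}" using fP i P by auto
      next
        fix j assume j: "j \<in> {j \<in> Q. s j \<le> s i}"
        then have "\<not> a i < a j" using ord[of i j] i P by force
        then show "j \<in> P" using i P j by auto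
      qed
      moreover have "s i \<in> {0..\<rho>}" using s[of i] i P by force
      ultimately show ?thesis by (rule image_eqI)
    qed
  qed
  then have "f ` (\<lambda>r. {i \<in> Q. s i \<le> r}) ` {0..\<rho>} = f ` (\<lambda>b. {i \<in> Q. a i \<le> b}) ` {0..m}"
    by simp
  then show ?thesis
    unfolding discrete_history_def 2 by (simp add: image_image 1 f_def)
qed

section \<open>Tools from probability theory\<close>

text \<open>
  The probability that a random subset of \<open>I\<close>, containing each \<open>e\<close> independently with probability
  \<open>p e\<close>, equals \<open>T\<close>.
\<close>

definition subset_weight :: "('e \<Rightarrow> real) \<Rightarrow> 'e set \<Rightarrow> 'e set \<Rightarrow> real" where
  "subset_weight p I T = (\<Prod>e\<in>I. if e \<in> T then p e else 1 - p e)"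

lemma (in prob_space) prob_random_subset:
  assumes "indep_vars N X I" "finite I"
    and meas: "\<And>e. e \<in> I \<Longrightarrow> {x \<in> space (N e). A e x} \<in> sets (N e)"
    and p: "\<And>e. e \<in> I \<Longrightarrow> prob {\<omega> \<in> space M. A e (X e \<omega>)} = p e"
    and "T \<subseteq> I"
  shows "prob {\<omega> \<in> space M. {e \<in> I. A e (X e \<omega>)} = T} = subset_weight p I T"
proof (cases "I = {}")
  case True
  then show ?thesis using assms by (simp add: subset_weight_def prob_space)
next
  case False
  let ?B = "\<lambda>e. {\<omega> \<in> space M. A e (X e \<omega>) \<longleftrightarrow> e \<in> T}"
  have rv: "X e \<in> measurable M (N e)" if "e \<in> I" for e
    using assms(1) that by (auto simp: indep_vars_def)
  have "indep_events ?B I"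
  proof (rule indep_eventsI_indep_vars[OF assms(1)])
    fix e assume e: "e \<in> I"
    have "{x \<in> space (N e). A e x \<longleftrightarrow> e \<in> T} =
      (if e \<in> T then {x \<in> space (N e). A e x} else space (N e) - {x \<in> space (N e). A e x})" by auto
    then show "{x \<in> space (N e). A e x \<longleftrightarrow> e \<in> T} \<in> sets (N e)" using meas[OF e] by auto
  qed
  then have "prob (\<Inter>e\<in>I. ?B e) = (\<Prod>e\<in>I. prob (?B e))"
    using False assms(2) unfolding indep_events_def by blast
  also have "(\<Inter>e\<in>I. ?B e) = {\<omega> \<in> space M. {e \<in> I. A e (X e \<omega>)} = T}"
    using False \<open>T \<subseteq> I\<close> by auto
  also have "(\<Prod>e\<in>I. prob (?B e)) = subset_weight p I T"
    unfolding subset_weight_def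
  proof (rule prod.cong)
    fix e assume e: "e \<in> I"
    have ev: "{\<omega> \<in> space M. A e (X e \<omega>)} \<in> events"
      using measurable_sets[OF rv[OF e] meas[OF e]] measurable_space[OF rv[OF e]]
      by (auto simp: vimage_def Int_def conj_commute cong: conj_cong)
    show "prob (?B e) = (if e \<in> T then p e else 1 - p e)"
      using prob_neg[OF ev] p[OF e] by simp
  qed simp
  finally show ?thesis .
qed

lemma countable_exhaustion:
  assumes "countable I"
  obtains F :: "nat \<Rightarrow> 'e set" where "incseq F" "\<And>n. finite (F n)" "\<And>n. F n \<subseteq> I" "(\<Union>n. F n) = I"
proof
  let ?F = "\<lambda>n. {e \<in> I. to_nat_on I e < n}"
  show "incseq ?F" by (auto simp: incseq_def)
  show "finite (?F n)" for n
    by (rule inj_on_finite[of "to_nat_on I" _ "{..<n}"])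
       (use assms inj_on_to_nat_on[of I] in \<open>auto intro: inj_on_subset\<close>)
  show "?F n \<subseteq> I" for n by auto
  show "(\<Union>n. ?F n) = I" by auto
qed

lemma (in prob_space) prob_UN_countable_le:
  assumes "countable I" "\<And>e. e \<in> I \<Longrightarrow> A e \<in> events"
    and "\<And>F. finite F \<Longrightarrow> F \<subseteq> I \<Longrightarrow> (\<Sum>e\<in>F. prob (A e)) \<le> b"
  shows "prob (\<Union>e\<in>I. A e) \<le> b"
proof -
  obtain F :: "nat \<Rightarrow> 'b set" where F: "incseq F" "\<And>n. finite (F n)" "\<And>n. F n \<subseteq> I" "(\<Union>n. F n) = I"
    using countable_exhaustion[OF assms(1)] by metis
  have "(\<lambda>n. prob (\<Union>e\<in>F n. A e)) \<longlonglongrightarrow> prob (\<Union>n. \<Union>e\<in>F n. A e)"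
  proof (rule finite_Lim_measure_incseq)
    have "(\<Union>e\<in>F n. A e) \<in> events" for n
      using F(2,3) assms(2) by (intro sets.finite_UN) blast+
    then show "range (\<lambda>n. \<Union>e\<in>F n. A e) \<subseteq> events" by blast
    show "incseq (\<lambda>n. \<Union>e\<in>F n. A e)" using F(1) by (auto simp: incseq_def)
  qed
  moreover have "(\<Union>n. \<Union>e\<in>F n. A e) = (\<Union>e\<in>I. A e)" using F(4) by blast
  moreover have "prob (\<Union>e\<in>F n. A e) \<le> b" for n
    proof -
    have "prob (\<Union>e\<in>F n. A e) \<le> (\<Sum>e\<in>F n. prob (A e))"
      using F(2,3) assms(2) by (intro finite_measure_subadditive_finite) blast+
    also have "\<dots> \<le> b" using assms(3) F(2,3) by blast
    finally show ?thesis .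
  qed
  ultimately show ?thesis by (metis LIMSEQ_le_const2)
qed

text \<open>
  The intersection of the covers is a null event that contains every point where \<open>Q\<close> fails.
\<close>

lemma (in prob_space) AE_from_small_covers:
  assumes "\<And>i :: nat. Z i \<in> events" "\<And>i. prob (Z i) \<le> b i" "b \<longlonglongrightarrow> 0"
    and "\<And>i. {\<omega> \<in> space M. \<not> Q \<omega>} \<subseteq> Z i"
  shows "AE \<omega> in M. Q \<omega>"
proof -
  have "prob (\<Inter>i. Z i) \<le> 0"
  proof (rule LIMSEQ_le_const[OF assms(3)])
    have "prob (\<Inter>i. Z i) \<le> b i" for i
      using assms(1) by (intro order_trans[OF finite_measure_mono assms(2)]) auto
    then show "\<exists>N. \<forall>n\<ge>N. prob (\<Inter>i. Z i) \<le> b n" by blast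
  qed
  then have "(\<Inter>i. Z i) \<in> null_sets M"
    using assms(1) by (auto simp: null_sets_def emeasure_eq_measure measure_le_0_iff)
  then show ?thesis by (rule AE_I') (use assms(4) in auto)
qed

text \<open>
  Chebyshev: for pairwise independent events the variance of the number that occur is at most its mean.
\<close>

lemma (in prob_space) prob_many_events_finite:
  assumes "finite F" "\<And>e. e \<in> F \<Longrightarrow> A e \<in> events"
    and indep: "\<And>e e'. e \<in> F \<Longrightarrow> e' \<in> F \<Longrightarrow> e \<noteq> e' \<Longrightarrow> prob (A e \<inter> A e') = prob (A e) * prob (A e')"
    and \<mu>: "(\<Sum>e\<in>F. prob (A e)) \<le> \<mu>" "\<mu> > 0"
  shows "prob {\<omega> \<in> space M. 2 * \<mu> < real (card {e \<in> F. \<omega> \<in> A e})} \<le> 1 / \<mu>"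
proof -
  define X :: "'a \<Rightarrow> real" where "X \<omega> = (\<Sum>e\<in>F. indicator (A e) \<omega>)" for \<omega>
  have [measurable]: "A e \<in> events" if "e \<in> F" for e using assms that by simp
  have Xm [measurable]: "X \<in> borel_measurable M"
    unfolding X_def by measurable
  have int: "integrable M (\<lambda>\<omega>. indicator (A e) \<omega> * indicator (A e') \<omega> :: real)" if "e \<in> F" "e' \<in> F" for e e'
    using that by (simp add: indicator_inter_arith[symmetric] less_top[symmetric])
  have sq: "X \<omega> ^ 2 = (\<Sum>e\<in>F. \<Sum>e'\<in>F. indicator (A e) \<omega> * indicator (A e') \<omega>)" for \<omega>
    by (simp add: X_def power2_eq_square sum_product)
  have intsq: "integrable M (\<lambda>\<omega>. X \<omega> ^ 2)"
    unfolding sq using int by auto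
  have intX: "integrable M X"
    unfolding X_def using assms(2) by (intro Bochner_Integration.integrable_sum) (simp add: less_top[symmetric])
  have EX: "expectation X = (\<Sum>e\<in>F. prob (A e))"
    unfolding X_def using assms(2) by (subst Bochner_Integration.integral_sum) (auto simp: less_top[symmetric])
  have "expectation (\<lambda>\<omega>. X \<omega> ^ 2) = (\<Sum>e\<in>F. \<Sum>e'\<in>F. prob (A e \<inter> A e'))"
    unfolding sq using int assms(2)
    by (subst Bochner_Integration.integral_sum, (auto)[1], intro sum.cong refl,
        subst Bochner_Integration.integral_sum, (auto)[1], intro sum.cong refl)
       (simp add: indicator_inter_arith[symmetric])
  also have "\<dots> \<le> (\<Sum>e\<in>F. \<Sum>e'\<in>F. prob (A e) * prob (A e') + (if e = e' then prob (A e) else 0))"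
    by (intro sum_mono) (auto simp: indep)
  also have "\<dots> = (\<Sum>e\<in>F. prob (A e))^2 + (\<Sum>e\<in>F. prob (A e))"
    using assms(1) by (simp add: sum.distrib sum_product power2_eq_square)
  finally have var: "variance X \<le> \<mu>"
    using variance_eq[OF intX intsq] EX \<mu> by simp
  have "prob {\<omega> \<in> space M. 2 * \<mu> < real (card {e \<in> F. \<omega> \<in> A e})} \<le>
        prob {\<omega> \<in> space M. \<mu> \<le> \<bar>X \<omega> - expectation X\<bar>}"
  proof (rule finite_measure_mono)
    have "X \<omega> = real (card {e \<in> F. \<omega> \<in> A e})" for \<omega>
      using assms(1) by (simp add: X_def indicator_def sum.If_cases Int_def)
    then show "{\<omega> \<in> space M. 2 * \<mu> < real (card {e \<in> F. \<omega> \<in> A e})} \<subseteq> {\<omega> \<in> space M. \<mu> \<le> \<bar>X \<omega> - expectation X\<bar>}"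
      using EX \<mu> by auto
  qed measurable
  also have "\<dots> \<le> variance X / \<mu>^2"
    by (rule Chebyshev_inequality[OF Xm intsq \<mu>(2)])
  also have "\<dots> \<le> \<mu> / \<mu>^2"
    using var by (intro divide_right_mono) auto
  finally show ?thesis using \<mu> by (simp add: power2_eq_square)
qed

lemma (in prob_space) prob_many_events:
  assumes I: "countable I" and ev: "\<And>e. e \<in> I \<Longrightarrow> A e \<in> events"
    and indep: "\<And>e e'. e \<in> I \<Longrightarrow> e' \<in> I \<Longrightarrow> e \<noteq> e' \<Longrightarrow> prob (A e \<inter> A e') = prob (A e) * prob (A e')"
    and \<mu>: "\<And>F. finite F \<Longrightarrow> F \<subseteq> I \<Longrightarrow> (\<Sum>e\<in>F. prob (A e)) \<le> \<mu>" "\<mu> > 0"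
  shows "\<exists>Z\<in>events. prob Z \<le> 1 / \<mu> \<and>
     (\<forall>\<omega>\<in>space M - Z. finite {e \<in> I. \<omega> \<in> A e} \<and> real (card {e \<in> I. \<omega> \<in> A e}) \<le> 2 * \<mu>)"
proof -
  obtain F :: "nat \<Rightarrow> 'b set" where F: "incseq F" "\<And>n. finite (F n)" "\<And>n. F n \<subseteq> I" "(\<Union>n. F n) = I"
    using countable_exhaustion[OF I] by metis
  define Z where "Z n = {\<omega> \<in> space M. 2 * \<mu> < real (card {e \<in> F n. \<omega> \<in> A e})}" for n
  have Zm: "Z n \<in> events" for n
  proof -
    have [measurable]: "A e \<in> events" if "e \<in> F n" for e using ev F(3) that by blast
    have "real (card {e \<in> F n. \<omega> \<in> A e}) = (\<Sum>e\<in>F n. indicator (A e) \<omega>)" for \<omega>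
      using F(2) by (simp add: indicator_def sum.If_cases Int_def)
    then show ?thesis unfolding Z_def by simp
  qed
  have Zb: "prob (Z n) \<le> 1 / \<mu>" for n
    unfolding Z_def
  proof (rule prob_many_events_finite[OF F(2)])
    show "\<And>e. e \<in> F n \<Longrightarrow> A e \<in> events" using ev F(3) by blast
    show "\<And>e e'. e \<in> F n \<Longrightarrow> e' \<in> F n \<Longrightarrow> e \<noteq> e' \<Longrightarrow> prob (A e \<inter> A e') = prob (A e) * prob (A e')"
      using indep F(3) by blast
  qed (use \<mu> F in auto)
  have inc: "incseq Z"
  proof (rule incseq_SucI, rule subsetI)
    fix n \<omega> assume "\<omega> \<in> Z n"
    moreover have "card {e \<in> F n. \<omega> \<in> A e} \<le> card {e \<in> F (Suc n). \<omega> \<in> A e}"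
      using F(1,2) by (intro card_mono) (auto simp: incseq_Suc_iff)
    ultimately show "\<omega> \<in> Z (Suc n)" by (auto simp: Z_def)
  qed
  have "(\<lambda>n. prob (Z n)) \<longlonglongrightarrow> prob (\<Union>n. Z n)"
    using Zm inc by (intro finite_Lim_measure_incseq) auto
  then have "prob (\<Union>n. Z n) \<le> 1 / \<mu>" using Zb by (metis LIMSEQ_le_const2)
  moreover have "finite {e \<in> I. \<omega> \<in> A e} \<and> real (card {e \<in> I. \<omega> \<in> A e}) \<le> 2 * \<mu>"
    if \<omega>: "\<omega> \<in> space M - (\<Union>n. Z n)" for \<omega>
  proof -
    have *: "card G \<le> nat \<lfloor>2 * \<mu>\<rfloor>" if G: "finite G" "G \<subseteq> {e \<in> I. \<omega> \<in> A e}" for G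
    proof -
      have "\<exists>n. G \<subseteq> F n"
        using G
      proof (induction G rule: finite_induct)
        case (insert e G)
        then obtain n n' where "G \<subseteq> F n" "e \<in> F n'" using F(4) by auto
        then have "insert e G \<subseteq> F (max n n')"
          using F(1) by (meson incseq_def insert_subsetI max.cobounded1 max.cobounded2 order_trans subsetD)
        then show ?case by blast
      qed auto
      then obtain n where n: "G \<subseteq> F n" by blast
      have "card G \<le> card {e \<in> F n. \<omega> \<in> A e}" using n G F(2) by (intro card_mono) auto
      moreover have "real (card {e \<in> F n. \<omega> \<in> A e}) \<le> 2 * \<mu>" using \<omega> by (auto simp: Z_def not_less)
      ultimately show ?thesis by (simp add: le_nat_floor)
    qed
    have "finite {e \<in> I. \<omega> \<in> A e} \<and> card {e \<in> I. \<omega> \<in> A e} \<le> nat \<lfloor>2 * \<mu>\<rfloor>"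
      using * by (rule finite_if_finite_subsets_card_bdd) 
    then show ?thesis using \<mu>(2) by linarith
  qed
  ultimately show ?thesis using Zm by (intro bexI[of _ "\<Union>n. Z n"]) auto
qed

text \<open>
  The variance is the double sum of \<open>w b * w b'\<close> times a covariance. The covariance is at most 1, and it
  vanishes unless the footprints meet. Bounding the indicator of meeting by the number of common
  elements \<open>e\<close> turns the double sum into \<open>\<Sum>e. (\<Sum>b. w b * [e \<in> foot b])\<^sup>2\<close>.
\<close>

lemma (in prob_space) prob_weighted_average_deviation:
  fixes w :: "'b \<Rightarrow> real" and X :: "'b \<Rightarrow> 'a \<Rightarrow> real" and foot :: "'b \<Rightarrow> 'e set" and a \<kappa> :: real
  assumes "finite S" "\<And>b. b \<in> S \<Longrightarrow> 0 \<le> w b"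
    and X: "\<And>b. b \<in> S \<Longrightarrow> X b \<in> borel_measurable M"
    and X01: "\<And>b \<omega>. b \<in> S \<Longrightarrow> 0 \<le> X b \<omega> \<and> X b \<omega> \<le> 1"
    and "finite I" and foot: "\<And>b. b \<in> S \<Longrightarrow> foot b \<subseteq> I"
    and uncorr: "\<And>b b'. b \<in> S \<Longrightarrow> b' \<in> S \<Longrightarrow> foot b \<inter> foot b' = {} \<Longrightarrow>
        expectation (\<lambda>\<omega>. X b \<omega> * X b' \<omega>) = expectation (X b) * expectation (X b')"
    and \<kappa>: "\<And>e. e \<in> I \<Longrightarrow> (\<Sum>b\<in>{b \<in> S. e \<in> foot b}. w b) \<le> \<kappa>"
    and a: "a > 0"
  shows "prob {\<omega> \<in> space M. a \<le> \<bar>(\<Sum>b\<in>S. w b * X b \<omega>) - (\<Sum>b\<in>S. w b * expectation (X b))\<bar>}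
           \<le> card I * \<kappa>\<^sup>2 / a\<^sup>2"
proof -
  define Y where "Y \<omega> = (\<Sum>b\<in>S. w b * X b \<omega>)" for \<omega>
  have [measurable]: "X b \<in> borel_measurable M" if "b \<in> S" for b using X that by simp
  have Ym [measurable]: "Y \<in> borel_measurable M" unfolding Y_def by measurable
  have iX: "integrable M (X b)" if "b \<in> S" for b
    using X01[OF that] that by (intro integrable_const_bound[of _ 1]) auto
  have X2: "0 \<le> X b \<omega> * X b' \<omega>" "X b \<omega> * X b' \<omega> \<le> 1" if "b \<in> S" "b' \<in> S" for b b' \<omega>
    using X01[of b \<omega>] X01[of b' \<omega>] that by (auto intro: mult_le_one)
  have iXX: "integrable M (\<lambda>\<omega>. X b \<omega> * X b' \<omega>)" if "b \<in> S" "b' \<in> S" for b b'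
    using X2[OF that] that by (intro integrable_const_bound[of _ 1]) auto
  have sq: "Y \<omega> ^ 2 = (\<Sum>b\<in>S. \<Sum>b'\<in>S. w b * w b' * (X b \<omega> * X b' \<omega>))" for \<omega>
    unfolding Y_def power2_eq_square sum_product by (intro sum.cong refl) (simp add: mult_ac)
  have iY: "integrable M Y" unfolding Y_def using iX by auto
  have iYY: "integrable M (\<lambda>\<omega>. Y \<omega> ^ 2)" unfolding sq using iXX by auto
  have EY: "expectation Y = (\<Sum>b\<in>S. w b * expectation (X b))"
    unfolding Y_def using iX by (subst Bochner_Integration.integral_sum) auto
  have EYY: "expectation (\<lambda>\<omega>. Y \<omega> ^ 2) = (\<Sum>b\<in>S. \<Sum>b'\<in>S. w b * w b' * expectation (\<lambda>\<omega>. X b \<omega> * X b' \<omega>))"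
    unfolding sq using iXX
    by (subst Bochner_Integration.integral_sum, (auto)[1], intro sum.cong refl,
        subst Bochner_Integration.integral_sum) auto
  have cov: "expectation (\<lambda>\<omega>. X b \<omega> * X b' \<omega>) - expectation (X b) * expectation (X b')
      \<le> (\<Sum>e\<in>I. of_bool (e \<in> foot b) * of_bool (e \<in> foot b'))" if b: "b \<in> S" "b' \<in> S" for b b'
  proof (cases "foot b \<inter> foot b' = {}")
    case True
    then show ?thesis using uncorr[OF b True] by (auto intro!: sum_nonneg)
  next
    case False
    then obtain e where e: "e \<in> foot b" "e \<in> foot b'" by auto
    have "expectation (\<lambda>\<omega>. X b \<omega> * X b' \<omega>) \<le> expectation (\<lambda>_. 1)"
      using X2[OF b] iXX[OF b] by (intro integral_mono) auto
    moreover have "0 \<le> expectation (X b) * expectation (X b')"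
      using X01 b by (intro mult_nonneg_nonneg Bochner_Integration.integral_nonneg) auto
    moreover have "(1 :: real) = (\<Sum>e\<in>{e}. of_bool (e \<in> foot b) * of_bool (e \<in> foot b'))" using e by simp
    moreover have "\<dots> \<le> (\<Sum>e\<in>I. of_bool (e \<in> foot b) * of_bool (e \<in> foot b'))"
      using e foot[OF b(1)] assms(5) by (intro sum_mono2) auto
    ultimately show ?thesis by (simp add: prob_space)
  qed
  have "variance Y = (\<Sum>b\<in>S. \<Sum>b'\<in>S. w b * w b' *
     (expectation (\<lambda>\<omega>. X b \<omega> * X b' \<omega>) - expectation (X b) * expectation (X b')))"
    using variance_eq[OF iY iYY] unfolding EYY EY power2_eq_square[of "sum _ _"] sum_product sum_subtractf[symmetric]
    by (elim trans, intro sum.cong refl) (simp add: algebra_simps)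
  also have "\<dots> \<le> (\<Sum>b\<in>S. \<Sum>b'\<in>S. w b * w b' * (\<Sum>e\<in>I. of_bool (e \<in> foot b) * of_bool (e \<in> foot b')))"
    using assms(2) cov by (intro sum_mono mult_left_mono) auto
  also have "\<dots> = (\<Sum>b\<in>S. \<Sum>b'\<in>S. \<Sum>e\<in>I. (w b * of_bool (e \<in> foot b)) * (w b' * of_bool (e \<in> foot b')))"
    unfolding sum_distrib_left by (intro sum.cong refl) (simp add: mult_ac)
  also have "\<dots> = (\<Sum>b\<in>S. \<Sum>e\<in>I. \<Sum>b'\<in>S. (w b * of_bool (e \<in> foot b)) * (w b' * of_bool (e \<in> foot b')))"
    by (intro sum.cong refl sum.swap)
  also have "\<dots> = (\<Sum>e\<in>I. \<Sum>b\<in>S. \<Sum>b'\<in>S. (w b * of_bool (e \<in> foot b)) * (w b' * of_bool (e \<in> foot b')))"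
    by (rule sum.swap)
  also have "\<dots> = (\<Sum>e\<in>I. (\<Sum>b\<in>S. w b * of_bool (e \<in> foot b)) ^ 2)"
    by (simp add: power2_eq_square sum_product)
  also have "\<dots> \<le> (\<Sum>e\<in>I. \<kappa>\<^sup>2)"
  proof (intro sum_mono power_mono)
    fix e assume e: "e \<in> I"
    have "(\<Sum>b\<in>S. w b * of_bool (e \<in> foot b)) = (\<Sum>b\<in>{b \<in> S. e \<in> foot b}. w b)"
      using assms(1) by (auto simp: of_bool_def if_distrib sum.If_cases Int_def cong: if_cong)
    then show "(\<Sum>b\<in>S. w b * of_bool (e \<in> foot b)) \<le> \<kappa>" using \<kappa>[OF e] by simp
    show "0 \<le> (\<Sum>b\<in>S. w b * of_bool (e \<in> foot b))" using assms(2) by (intro sum_nonneg) auto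
  qed
  finally have var: "variance Y \<le> card I * \<kappa>\<^sup>2" by simp
  have "prob {\<omega> \<in> space M. a \<le> \<bar>Y \<omega> - expectation Y\<bar>} \<le> variance Y / a\<^sup>2"
    by (rule Chebyshev_inequality[OF Ym iYY a])
  also have "\<dots> \<le> card I * \<kappa>\<^sup>2 / a\<^sup>2" using var by (intro divide_right_mono) auto
  finally show ?thesis unfolding EY Y_def .
qed

text \<open>
  The maps \<open>d k\<close> cut the space into countably many cells, which get finer with \<open>k\<close> and on which \<open>f\<close>
  finally varies by less than \<open>e\<close>. Up to probability \<open>e\<close> the variable \<open>Y\<close> lives on finitely many such cells, so
  a lower bound for the probability of each single cell bounds the expectation of \<open>f\<close> from below.
\<close>

lemma (in prob_space) expectation_lower_bound_of_cells:
  fixes X :: "'i \<Rightarrow> 'a \<Rightarrow> 'c::topological_space" and d :: "nat \<Rightarrow> 'c \<Rightarrow> 'b::countable"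
    and f :: "'c \<Rightarrow> real"
  assumes X: "\<And>i. X i \<in> M \<rightarrow>\<^sub>M borel" and Y: "Y \<in> M \<rightarrow>\<^sub>M borel"
    and d: "\<And>k b. d k -` {b} \<in> sets borel"
    and refine: "\<And>k l x y. k \<le> l \<Longrightarrow> d l x = d l y \<Longrightarrow> d k x = d k y"
    and osc: "\<And>x e. e > 0 \<Longrightarrow> \<exists>k. \<forall>y y'. d k y = d k x \<longrightarrow> d k y' = d k x \<longrightarrow> \<bar>f y - f y'\<bar> < e"
    and f: "f \<in> borel_measurable borel" "\<And>x. 0 \<le> f x" "\<And>x. f x \<le> C"
    and low: "\<And>k b e. e > 0 \<Longrightarrow> \<forall>\<^sub>F i in F. prob {\<omega> \<in> space M. d k (X i \<omega>) = b} \<ge>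
                prob {\<omega> \<in> space M. d k (Y \<omega>) = b} - e"
    and "\<delta> > 0"
  shows "\<forall>\<^sub>F i in F. expectation (\<lambda>\<omega>. f (X i \<omega>)) \<ge> expectation (\<lambda>\<omega>. f (Y \<omega>)) - \<delta>"
proof -
  have C: "0 \<le> C" using f(2,3) order_trans by blast
  define e where "e = \<delta> / (2 + 3 * C)"
  have e: "e > 0" "(2 + 3 * C) * e = \<delta>" using C \<open>\<delta> > 0\<close> by (auto simp: e_def)
  \<comment> \<open>The union of the cells of level \<open>k\<close> on which \<open>f\<close> varies by less than \<open>e\<close>.\<close>
  define G where "G k = {x. \<forall>y y'. d k y = d k x \<longrightarrow> d k y' = d k x \<longrightarrow> \<bar>f y - f y'\<bar> < e}" for k
  have dmeas: "{\<omega> \<in> space M. d k (Z \<omega>) \<in> B} \<in> events" if [measurable]: "Z \<in> M \<rightarrow>\<^sub>M borel" for k B Z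
  proof -
    have "d k -` B = (\<Union>b\<in>B. d k -` {b})" by auto
    then have "d k -` B \<in> sets borel" using d by (auto intro!: sets.countable_UN'')
    then have "Z -` (d k -` B) \<inter> space M \<in> events" by (intro measurable_sets) auto
    also have "Z -` (d k -` B) \<inter> space M = {\<omega> \<in> space M. d k (Z \<omega>) \<in> B}" by auto
    finally show ?thesis .
  qed
  have Gset: "x \<in> G k \<longleftrightarrow> d k x \<in> d k ` G k" for x k
    unfolding G_def by (force simp: image_iff)
  have "(\<lambda>k. prob {\<omega> \<in> space M. d k (Y \<omega>) \<in> d k ` G k}) \<longlonglongrightarrow> prob (\<Union>k. {\<omega> \<in> space M. d k (Y \<omega>) \<in> d k ` G k})"
  proof (rule finite_Lim_measure_incseq)
    show "range (\<lambda>k. {\<omega> \<in> space M. d k (Y \<omega>) \<in> d k ` G k}) \<subseteq> events" using dmeas[OF Y] by blast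
    have "G k \<subseteq> G l" if "k \<le> l" for k l
      using refine[OF that] unfolding G_def by blast
    then show "incseq (\<lambda>k. {\<omega> \<in> space M. d k (Y \<omega>) \<in> d k ` G k})"
      by (auto simp: incseq_def Gset[symmetric])
  qed
  also have "(\<Union>k. {\<omega> \<in> space M. d k (Y \<omega>) \<in> d k ` G k}) = space M"
  proof -
    have "\<exists>k. x \<in> G k" for x using osc[OF e(1)] unfolding G_def by simp
    then show ?thesis by blast
  qed
  finally have "\<forall>\<^sub>F k in sequentially. prob {\<omega> \<in> space M. d k (Y \<omega>) \<in> d k ` G k} > 1 - e"
    using e by (intro order_tendstoD(1)) (auto simp: prob_space)
  then obtain k where k: "prob {\<omega> \<in> space M. d k (Y \<omega>) \<in> d k ` G k} > 1 - e"
    using eventually_happens'[OF sequentially_bot] by blast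
  define B where "B n = {b \<in> d k ` G k. to_nat b < n}" for n
  have "(\<lambda>n. prob {\<omega> \<in> space M. d k (Y \<omega>) \<in> B n}) \<longlonglongrightarrow> prob (\<Union>n. {\<omega> \<in> space M. d k (Y \<omega>) \<in> B n})"
  proof (rule finite_Lim_measure_incseq)
    show "range (\<lambda>n. {\<omega> \<in> space M. d k (Y \<omega>) \<in> B n}) \<subseteq> events" using dmeas[OF Y] by blast
    show "incseq (\<lambda>n. {\<omega> \<in> space M. d k (Y \<omega>) \<in> B n})" by (auto simp: incseq_def B_def)
  qed
  also have "(\<Union>n. {\<omega> \<in> space M. d k (Y \<omega>) \<in> B n}) = {\<omega> \<in> space M. d k (Y \<omega>) \<in> d k ` G k}"
    by (auto simp: B_def)
  finally have "\<forall>\<^sub>F n in sequentially. prob {\<omega> \<in> space M. d k (Y \<omega>) \<in> B n} > 1 - e"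
    using k by (intro order_tendstoD(1))
  then obtain n where n: "prob {\<omega> \<in> space M. d k (Y \<omega>) \<in> B n} > 1 - e"
    using eventually_happens'[OF sequentially_bot] by blast
  have fin: "finite (B n)"
    by (rule inj_on_finite[of to_nat _ "{..<n}"]) (auto simp: B_def inj_on_def)
  have "\<exists>x. x \<in> G k \<and> d k x = b" if "b \<in> B n" for b using that by (auto simp: B_def)
  then obtain r where r: "\<And>b. b \<in> B n \<Longrightarrow> r b \<in> G k \<and> d k (r b) = b" by metis
  have close: "\<bar>f x - f (r b)\<bar> < e" if "b \<in> B n" "d k x = b" for b x
    using r[OF that(1)] that by (auto simp: G_def)
  let ?p = "\<lambda>Z b. prob {\<omega> \<in> space M. d k (Z \<omega>) = b}"
  have dmeas1 [measurable]: "{\<omega> \<in> space M. d k (Z \<omega>) = b} \<in> events" if "Z \<in> M \<rightarrow>\<^sub>M borel" for Z b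
    using dmeas[OF that, of k "{b}"] by simp
  have fint: "integrable M (\<lambda>\<omega>. f (Z \<omega>))" if [measurable]: "Z \<in> M \<rightarrow>\<^sub>M borel" for Z
    using f by (intro integrable_const_bound[of _ C]) auto
  have sint: "integrable M (\<lambda>\<omega>. \<Sum>b\<in>B n. h b * indicator {\<omega> \<in> space M. d k (Z \<omega>) = b} \<omega>)"
    and sval: "expectation (\<lambda>\<omega>. \<Sum>b\<in>B n. h b * indicator {\<omega> \<in> space M. d k (Z \<omega>) = b} \<omega>) = (\<Sum>b\<in>B n. h b * ?p Z b)"
    if Z: "Z \<in> M \<rightarrow>\<^sub>M borel" for Z and h :: "'b \<Rightarrow> real"
  proof -
    have i: "integrable M (\<lambda>\<omega>. h b * indicator {\<omega> \<in> space M. d k (Z \<omega>) = b} \<omega>)" for b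
      using dmeas1[OF Z] by (intro integrable_mult_right) (simp add: less_top[symmetric])
    show "integrable M (\<lambda>\<omega>. \<Sum>b\<in>B n. h b * indicator {\<omega> \<in> space M. d k (Z \<omega>) = b} \<omega>)"
      using i by auto
    show "expectation (\<lambda>\<omega>. \<Sum>b\<in>B n. h b * indicator {\<omega> \<in> space M. d k (Z \<omega>) = b} \<omega>) = (\<Sum>b\<in>B n. h b * ?p Z b)"
      using i dmeas1[OF Z] by (subst Bochner_Integration.integral_sum) auto
  qed
  have pick: "(\<Sum>b\<in>B n. h b * indicator {\<omega> \<in> space M. d k (Z \<omega>) = b} \<omega>) = (if d k (Z \<omega>) \<in> B n then h (d k (Z \<omega>)) else 0)"
    if "\<omega> \<in> space M" for Z \<omega> and h :: "'b \<Rightarrow> real"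
    using that fin by (simp add: indicator_def if_distrib[of "(*) _"] sum.delta cong: if_cong)
  have psum: "(\<Sum>b\<in>B n. ?p Z b) = prob {\<omega> \<in> space M. d k (Z \<omega>) \<in> B n}" if Z: "Z \<in> M \<rightarrow>\<^sub>M borel" for Z
  proof -
    have "prob (\<Union>b\<in>B n. {\<omega> \<in> space M. d k (Z \<omega>) = b}) = (\<Sum>b\<in>B n. ?p Z b)"
      using fin dmeas1[OF Z] by (intro finite_measure_finite_Union) (auto simp: disjoint_family_on_def)
    moreover have "(\<Union>b\<in>B n. {\<omega> \<in> space M. d k (Z \<omega>) = b}) = {\<omega> \<in> space M. d k (Z \<omega>) \<in> B n}" by auto
    ultimately show ?thesis by simp
  qed
  have upper: "expectation (\<lambda>\<omega>. f (Y \<omega>)) \<le> (\<Sum>b\<in>B n. f (r b) * ?p Y b) + e + C * e"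
  proof -
    let ?N = "{\<omega> \<in> space M. \<not> d k (Y \<omega>) \<in> B n}"
    have N: "?N \<in> events" using dmeas[OF Y, of k "- B n"] by simp
    have pN: "prob ?N \<le> e" using n prob_neg[OF dmeas[OF Y, of k "B n"]] by simp
    have "expectation (\<lambda>\<omega>. f (Y \<omega>)) \<le> expectation (\<lambda>\<omega>.
        (\<Sum>b\<in>B n. f (r b) * indicator {\<omega> \<in> space M. d k (Y \<omega>) = b} \<omega>) + e + C * indicator ?N \<omega>)"
    proof (rule integral_mono)
      show "integrable M (\<lambda>\<omega>. (\<Sum>b\<in>B n. f (r b) * indicator {\<omega> \<in> space M. d k (Y \<omega>) = b} \<omega>) + e + C * indicator ?N \<omega>)"
        using sint[OF Y, of "\<lambda>b. f (r b)"] N by (intro Bochner_Integration.integrable_add) (auto simp: less_top[symmetric])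
      fix \<omega> assume \<omega>: "\<omega> \<in> space M"
      show "f (Y \<omega>) \<le> (\<Sum>b\<in>B n. f (r b) * indicator {\<omega> \<in> space M. d k (Y \<omega>) = b} \<omega>) + e + C * indicator ?N \<omega>"
        unfolding pick[OF \<omega>, of "\<lambda>b. f (r b)" Y]
        using close[of "d k (Y \<omega>)" "Y \<omega>"] f(3)[of "Y \<omega>"] \<omega> e by (auto simp: indicator_def)
    qed (rule fint[OF Y])
    also have "\<dots> = (\<Sum>b\<in>B n. f (r b) * ?p Y b) + e + C * prob ?N"
    proof -
      have iN: "integrable M (\<lambda>\<omega>. C * indicator ?N \<omega>)" using N by (auto simp: less_top[symmetric])
      show ?thesis
        using sint[OF Y, of "\<lambda>b. f (r b)"] N iN
        by (simp add: sval[OF Y, of "\<lambda>b. f (r b)"] prob_space)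
    qed
    also have "\<dots> \<le> (\<Sum>b\<in>B n. f (r b) * ?p Y b) + e + C * e"
      using pN C by (simp add: mult_left_mono)
    finally show ?thesis .
  qed
  have lower: "(\<Sum>b\<in>B n. f (r b) * ?p (X i) b) - e \<le> expectation (\<lambda>\<omega>. f (X i \<omega>))" for i
  proof -
    have "(\<Sum>b\<in>B n. f (r b) * ?p (X i) b) - e = expectation (\<lambda>\<omega>.
        (\<Sum>b\<in>B n. f (r b) * indicator {\<omega> \<in> space M. d k (X i \<omega>) = b} \<omega>) - e)"
      using sint[OF X, of "\<lambda>b. f (r b)"] by (simp add: sval[OF X, of "\<lambda>b. f (r b)"] prob_space)
    also have "\<dots> \<le> expectation (\<lambda>\<omega>. f (X i \<omega>))"
    proof (rule integral_mono)
      show "integrable M (\<lambda>\<omega>. (\<Sum>b\<in>B n. f (r b) * indicator {\<omega> \<in> space M. d k (X i \<omega>) = b} \<omega>) - e)"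
        using sint[OF X, of "\<lambda>b. f (r b)"] by simp
      fix \<omega> assume \<omega>: "\<omega> \<in> space M"
      show "(\<Sum>b\<in>B n. f (r b) * indicator {\<omega> \<in> space M. d k (X i \<omega>) = b} \<omega>) - e \<le> f (X i \<omega>)"
        unfolding pick[OF \<omega>, of "\<lambda>b. f (r b)" "X i"]
        using close[of "d k (X i \<omega>)" "X i \<omega>"] f(2)[of "X i \<omega>"] e by auto
    qed (rule fint[OF X])
    finally show ?thesis .
  qed
  define e' where "e' = e / (1 + card (B n))"
  have e': "e' > 0" "card (B n) * e' \<le> e" using e by (auto simp: e'_def field_simps)
  have "\<forall>\<^sub>F i in F. \<forall>b\<in>B n. ?p (X i) b \<ge> ?p Y b - e'"
    using low[OF e'(1)] fin by (intro eventually_ball_finite) auto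
  then show ?thesis
  proof eventually_elim
    case (elim i)
    have le: "(\<Sum>b\<in>B n. f (r b) * ?p Y b) - C * e \<le> (\<Sum>b\<in>B n. f (r b) * ?p (X i) b)"
    proof -
      have "(\<Sum>b\<in>B n. f (r b) * ?p Y b) - (\<Sum>b\<in>B n. f (r b) * ?p (X i) b) =
          (\<Sum>b\<in>B n. f (r b) * (?p Y b - ?p (X i) b))"
        by (simp add: right_diff_distrib sum_subtractf)
      also have "\<dots> \<le> (\<Sum>b\<in>B n. C * e')"
      proof (rule sum_mono)
        fix b assume b: "b \<in> B n"
        have "f (r b) * (?p Y b - ?p (X i) b) \<le> f (r b) * e'"
          using elim b f(2) by (intro mult_left_mono) auto
        also have "\<dots> \<le> C * e'" using f(3) e'(1) by (intro mult_right_mono) auto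
        finally show "f (r b) * (?p Y b - ?p (X i) b) \<le> C * e'" .
      qed
      also have "\<dots> = C * (card (B n) * e')" by simp
      also have "\<dots> \<le> C * e" using e'(2) C by (intro mult_left_mono)
      finally show ?thesis by simp
    qed
    then show ?case
    proof -
      have "0 \<le> C * e" "2 * e + 3 * (C * e) = \<delta>" using e C by (simp_all add: algebra_simps)
      then show ?thesis using le upper lower[of i] by linarith
    qed
  qed
qed

text \<open>
  Lower bounds for the probabilities of cells suffice: the lower bound on expectations is applied to \<open>f\<close>
  and to \<open>- f\<close>.
\<close>

lemma (in prob_space) weakly_converges_if_cells_converge:
  fixes X :: "'i \<Rightarrow> 'a \<Rightarrow> 'c::topological_space" and d :: "nat \<Rightarrow> 'c \<Rightarrow> 'b::countable"
  assumes X: "\<And>i. X i \<in> M \<rightarrow>\<^sub>M borel" and Y: "Y \<in> M \<rightarrow>\<^sub>M borel"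
    and d: "\<And>k b. d k -` {b} \<in> sets borel"
    and refine: "\<And>k l x y. k \<le> l \<Longrightarrow> d l x = d l y \<Longrightarrow> d k x = d k y"
    and osc: "\<And>(f :: 'c \<Rightarrow> real) x e. continuous_on UNIV f \<Longrightarrow> e > 0 \<Longrightarrow>
        \<exists>k. \<forall>y y'. d k y = d k x \<longrightarrow> d k y' = d k x \<longrightarrow> \<bar>f y - f y'\<bar> < e"
    and low: "\<And>k b e. e > 0 \<Longrightarrow> \<forall>\<^sub>F i in F. prob {\<omega> \<in> space M. d k (X i \<omega>) = b} \<ge>
                prob {\<omega> \<in> space M. d k (Y \<omega>) = b} - e"
  shows "weakly_converges (\<lambda>i. distr M borel (X i)) (distr M borel Y) F"
  unfolding weakly_converges_def
proof (intro allI impI)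
  fix f :: "'c \<Rightarrow> real" assume f: "continuous_on UNIV f" "bounded (range f)"
  then obtain C where C: "\<And>x. \<bar>f x\<bar> \<le> C" by (auto simp: bounded_iff)
  have fm [measurable]: "f \<in> borel_measurable borel"
    using f(1) by (rule borel_measurable_continuous_onI)
  have int: "integrable M (\<lambda>\<omega>. f (Z \<omega>))" if [measurable]: "Z \<in> M \<rightarrow>\<^sub>M borel" for Z
    using C by (intro integrable_const_bound[of _ C]) auto
  have low1: "\<forall>\<^sub>F i in F. expectation (\<lambda>\<omega>. s * f (X i \<omega>)) \<ge> expectation (\<lambda>\<omega>. s * f (Y \<omega>)) - \<delta>"
    if "\<delta> > 0" "\<bar>s\<bar> = 1" for \<delta> s :: real
  proof -
    let ?h = "\<lambda>x. s * f x + C"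
    have sf: "\<bar>s * f x\<bar> \<le> C" for x using C[of x] that(2) by (simp add: abs_mult)
    have "\<forall>\<^sub>F i in F. expectation (\<lambda>\<omega>. ?h (X i \<omega>)) \<ge> expectation (\<lambda>\<omega>. ?h (Y \<omega>)) - \<delta>"
    proof (rule expectation_lower_bound_of_cells[OF X Y d refine _ _ _ _ low that(1), where C = "2 * C"])
      show "\<exists>k. \<forall>y y'. d k y = d k x \<longrightarrow> d k y' = d k x \<longrightarrow> \<bar>?h y - ?h y'\<bar> < e" if "e > 0" for x e
      proof -
        have "continuous_on UNIV (\<lambda>x. s * f x)" using f(1) by (intro continuous_intros)
        then show ?thesis using osc[OF _ that] by simp
      qed
      show "0 \<le> ?h x" "?h x \<le> 2 * C" for x using sf[of x] by auto
    qed auto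
    then show ?thesis
      using int[OF X] int[OF Y] by (simp add: prob_space)
  qed
  have "((\<lambda>i. expectation (\<lambda>\<omega>. f (X i \<omega>))) \<longlongrightarrow> expectation (\<lambda>\<omega>. f (Y \<omega>))) F"
  proof (rule tendstoI)
    fix e :: real assume "e > 0"
    then have e: "e / 2 > 0" by simp
    show "\<forall>\<^sub>F i in F. dist (expectation (\<lambda>\<omega>. f (X i \<omega>))) (expectation (\<lambda>\<omega>. f (Y \<omega>))) < e"
      using low1[OF e, of 1, simplified] low1[OF e, of "-1", simplified]
      by eventually_elim (use \<open>e > 0\<close> in \<open>auto simp: dist_real_def\<close>)
  qed
  then show "((\<lambda>i. \<integral>x. f x \<partial>distr M borel (X i)) \<longlongrightarrow> (\<integral>x. f x \<partial>distr M borel Y)) F"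
    using X Y by (simp add: integral_distr)
qed

section \<open>Sampling from a graphon\<close>

text \<open>
  This bounds the expected number of ordered pairs of distinct points in a set by the square of its
  measure, however the points are enumerated.
\<close>

lemma (in prob_space) poisson_second_factorial_moment:
  assumes "poisson_distributed M N l" "l \<ge> 0"
  shows "(\<integral>\<^sup>+\<omega>. of_nat (N \<omega> * (N \<omega> - 1)) \<partial>M) = ennreal (l\<^sup>2)"
proof -
  have [measurable]: "N \<in> M \<rightarrow>\<^sub>M count_space UNIV" using assms by (simp add: poisson_distributed_def)
  have pr: "measure M {\<omega> \<in> space M. N \<omega> = k} = exp (- l) * l ^ k / fact k" for k
    using assms by (simp add: poisson_distributed_def)
  define h :: "nat \<Rightarrow> real" where "h k = real (k * (k - 1)) * (exp (- l) * l ^ k / fact k)" for k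
  have em: "emeasure M {\<omega> \<in> space M. N \<omega> = k} = ennreal (exp (- l) * l ^ k / fact k)" for k
    by (simp add: emeasure_eq_measure pr)
  have "(\<integral>\<^sup>+\<omega>. of_nat (N \<omega> * (N \<omega> - 1)) \<partial>M) =
     (\<integral>\<^sup>+\<omega>. (\<Sum>k. of_nat (k * (k - 1)) * indicator {\<omega> \<in> space M. N \<omega> = k} \<omega>) \<partial>M)"
  proof (rule nn_integral_cong)
    fix \<omega> assume "\<omega> \<in> space M"
    have "(\<Sum>k. of_nat (k * (k - 1)) * indicator {\<omega> \<in> space M. N \<omega> = k} \<omega> :: ennreal) =
      (\<Sum>k\<in>{N \<omega>}. of_nat (k * (k - 1)) * indicator {\<omega> \<in> space M. N \<omega> = k} \<omega>)"
      by (rule suminf_finite) auto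
    then show "of_nat (N \<omega> * (N \<omega> - 1)) = (\<Sum>k. of_nat (k * (k - 1)) * indicator {\<omega> \<in> space M. N \<omega> = k} \<omega> :: ennreal)"
      using \<open>\<omega> \<in> space M\<close> by simp
  qed
  also have "\<dots> = (\<Sum>k. \<integral>\<^sup>+\<omega>. of_nat (k * (k - 1)) * indicator {\<omega> \<in> space M. N \<omega> = k} \<omega> \<partial>M)"
    by (intro nn_integral_suminf) measurable
  also have "\<dots> = (\<Sum>k. ennreal (h k))"
  proof (rule suminf_cong)
    fix k
    have "(\<integral>\<^sup>+\<omega>. of_nat (k * (k - 1)) * indicator {\<omega> \<in> space M. N \<omega> = k} \<omega> \<partial>M) =
      of_nat (k * (k - 1)) * emeasure M {\<omega> \<in> space M. N \<omega> = k}"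
      by (simp add: nn_integral_cmult_indicator)
    also have "\<dots> = ennreal (h k)"
    proof (cases "k \<ge> 2")
      case True
      then show ?thesis using assms(2)
        unfolding h_def em ennreal_of_nat_eq_real_of_nat
        by (intro ennreal_mult[symmetric]) auto
    next
      case False
      then have "k = 0 \<or> k = 1" by auto
      then show ?thesis by (auto simp: h_def)
    qed
    finally show "(\<integral>\<^sup>+\<omega>. of_nat (k * (k - 1)) * indicator {\<omega> \<in> space M. N \<omega> = k} \<omega> \<partial>M) = ennreal (h k)" .
  qed
  also have "\<dots> = ennreal (l\<^sup>2)"
  proof (rule suminf_ennreal_eq)
    show "0 \<le> h k" for k using assms(2) by (simp add: h_def)
    have shift: "h (k + 2) = l\<^sup>2 * exp (- l) * (l ^ k / fact k)" for k
    proof -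
      have f: "fact (k + 2) = real (k + 2) * real (k + 1) * fact k"
        by (simp add: numeral_2_eq_2 algebra_simps)
      have "real ((k + 2) * (k + 2 - 1)) = real (k + 2) * real (k + 1)" by (simp add: algebra_simps)
      then show ?thesis
        unfolding h_def f power_add by simp
    qed
    have "(\<lambda>k. l ^ k / fact k) sums exp l" using exp_converges[of l] by (simp add: field_simps)
    then have "(\<lambda>k. l\<^sup>2 * exp (- l) * (l ^ k / fact k)) sums (l\<^sup>2 * exp (- l) * exp l)"
      by (rule sums_mult)
    moreover have "l\<^sup>2 * exp (- l) * exp l = l\<^sup>2" by (simp add: exp_minus)
    ultimately have "(\<lambda>k. h (k + 2)) sums l\<^sup>2" unfolding shift by metis
    then show "h sums l\<^sup>2" by (subst (asm) sums_iff_shift) (simp add: h_def numeral_2_eq_2)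
  qed
  finally show ?thesis .
qed

locale sampling = prob_space P for P :: "'p measure" +
  fixes \<xi> :: "nat \<Rightarrow> 'p \<Rightarrow> real \<times> real" and U :: "nat \<Rightarrow> nat \<Rightarrow> 'p \<Rightarrow> real"
  assumes sampling: "graphon_sampling P \<xi> U"
begin

abbreviation \<nu> :: "(real \<times> real) measure" where "\<nu> \<equiv> restrict_space lborel ({0<..} \<times> {0..})"

text \<open>
  The information carried by the points and by the coins; the two are independent.
\<close>

abbreviation \<sigma>\<xi> :: "'p measure" where
  "\<sigma>\<xi> \<equiv> vimage_algebra (space P) (\<lambda>\<omega> i. \<xi> i \<omega>) (PiM UNIV (\<lambda>_. \<nu>))"

abbreviation \<sigma>U :: "'p measure" where
  "\<sigma>U \<equiv> vimage_algebra (space P) (\<lambda>\<omega>. \<lambda>(i, j)\<in>{(i, j). i < j}. U i j \<omega>) (PiM {(i, j). i < j} (\<lambda>_. borel))"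

lemma space_\<nu>: "space \<nu> = {0<..} \<times> {0..}" by (simp add: space_restrict_space)

lemma \<xi>_measurable [measurable]: "\<xi> i \<in> P \<rightarrow>\<^sub>M \<nu>"
  using sampling by (auto simp: graphon_sampling_def poisson_point_process_def)

lemma U_measurable [measurable]: "i < j \<Longrightarrow> U i j \<in> borel_measurable P"
  using sampling by (auto simp: graphon_sampling_def)

lemma \<xi>_pos: "\<omega> \<in> space P \<Longrightarrow> 0 < fst (\<xi> i \<omega>)" "\<omega> \<in> space P \<Longrightarrow> 0 \<le> snd (\<xi> i \<omega>)"
  using measurable_space[OF \<xi>_measurable, of \<omega> i] by (auto simp: space_\<nu>)

lemma \<nu>_borel: "(\<lambda>x. x) \<in> \<nu> \<rightarrow>\<^sub>M borel"
  by (metis measurable_id measurable_restrict_space1 measurable_lborel2 id_def measurable_ident_sets sets_lborel)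

lemma \<xi>_borel [measurable]: "\<xi> i \<in> borel_measurable P"
  using measurable_compose[OF \<xi>_measurable \<nu>_borel] by simp

lemma fst_\<xi> [measurable]: "(\<lambda>\<omega>. fst (\<xi> i \<omega>)) \<in> borel_measurable P"
  and snd_\<xi> [measurable]: "(\<lambda>\<omega>. snd (\<xi> i \<omega>)) \<in> borel_measurable P"
  using \<xi>_borel[of i] by (auto simp: borel_prod[symmetric])

lemma space_\<sigma>: "space \<sigma>\<xi> = space P" "space \<sigma>U = space P" by (simp_all)

lemma \<xi>_\<sigma>\<xi> [measurable]: "\<xi> i \<in> \<sigma>\<xi> \<rightarrow>\<^sub>M \<nu>"
proof -
  have "(\<lambda>\<omega> i. \<xi> i \<omega>) \<in> \<sigma>\<xi> \<rightarrow>\<^sub>M PiM UNIV (\<lambda>_. \<nu>)"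
    by (rule measurable_vimage_algebra1) (use measurable_space[OF \<xi>_measurable] in \<open>auto simp: space_PiM\<close>)
  from measurable_compose[OF this measurable_component_singleton[of i UNIV]] show ?thesis by simp
qed

lemma U_\<sigma>U [measurable]: "i < j \<Longrightarrow> U i j \<in> borel_measurable \<sigma>U"
proof -
  assume ij: "i < j"
  have "(\<lambda>\<omega>. \<lambda>(i, j)\<in>{(i, j). i < j}. U i j \<omega>) \<in> \<sigma>U \<rightarrow>\<^sub>M PiM {(i, j). i < j} (\<lambda>_. borel)"
    by (rule measurable_vimage_algebra1) (auto simp: space_PiM)
  from measurable_compose[OF this measurable_component_singleton[of "(i, j)"]] show ?thesis
    using ij by simp
qed

lemma indep_\<sigma>:
  assumes "A \<in> sets \<sigma>\<xi>" "B \<in> sets \<sigma>U"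
  shows "prob (A \<inter> B) = prob A * prob B"
  using sampling assms unfolding graphon_sampling_def by (meson indep_setD)

lemma \<sigma>_events: "A \<in> sets \<sigma>\<xi> \<Longrightarrow> A \<in> events" "A \<in> sets \<sigma>U \<Longrightarrow> A \<in> events"
  using sampling unfolding graphon_sampling_def by (meson indep_set_def indep_setD_ev1 indep_setD_ev2 subsetD)+

lemma prob_U:
  assumes "i < j" "Z \<in> sets borel"
  shows "prob {\<omega> \<in> space P. U i j \<omega> \<in> Z} = measure lborel ({0..1} \<inter> Z)"
proof -
  have d: "distr P borel (U i j) = uniform_measure lborel {0..1}"
    using sampling assms by (auto simp: graphon_sampling_def)
  have "prob {\<omega> \<in> space P. U i j \<omega> \<in> Z} = measure (distr P borel (U i j)) Z"
    using assms by (subst measure_distr) (auto intro!: arg_cong[of _ _ prob])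
  also have "\<dots> = measure lborel ({0..1} \<inter> Z)"
    unfolding d using assms by (subst measure_uniform_measure) auto
  finally show ?thesis .
qed

lemma prob_U_less:
  assumes "i < j" "0 \<le> p" "p \<le> 1"
  shows "prob {\<omega> \<in> space P. U i j \<omega> < p} = p"
proof -
  have "{0..1} \<inter> {..<p} = {0..<p}" using assms by auto
  then show ?thesis using prob_U[of i j "{..<p}"] assms by simp
qed

lemma prob_U_interval:
  assumes "i < j" "a \<le> b"
  shows "prob {\<omega> \<in> space P. U i j \<omega> \<in> {a..b}} \<le> b - a"
proof -
  have "measure lborel ({0..1} \<inter> {a..b}) \<le> measure lborel {a..b}"
    by (intro measure_mono_fmeasurable) (auto simp: fmeasurable_def emeasure_lborel_Icc_eq)
  then show ?thesis using prob_U[of i j "{a..b}"] assms by simp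
qed

lemma AE_U: "AE \<omega> in P. \<forall>i j. i < j \<longrightarrow> 0 \<le> U i j \<omega> \<and> U i j \<omega> < 1"
proof -
  have "AE \<omega> in P. i < j \<longrightarrow> 0 \<le> U i j \<omega> \<and> U i j \<omega> < 1" for i j
  proof (cases "i < j")
    case True
    have "{0..1} \<inter> {0..<1} = {0..<1::real}" by auto
    then have "prob {\<omega> \<in> space P. U i j \<omega> \<in> {0..<1}} = 1"
      using prob_U[OF True, of "{0..<1}"] by simp
    then show ?thesis using True by (subst (asm) prob_Collect_eq_1) auto
  qed simp
  then show ?thesis by (simp add: AE_all_countable)
qed

lemma poisson_count:
  assumes "C \<in> sets \<nu>" "emeasure \<nu> C < \<infinity>"
  shows "AE \<omega> in P. finite {i. \<xi> i \<omega> \<in> C}"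
    and "poisson_distributed P (\<lambda>\<omega>. card {i. \<xi> i \<omega> \<in> C}) (measure \<nu> C)"
  using sampling assms by (auto simp: graphon_sampling_def poisson_point_process_def)

lemma prob_no_point:
  assumes [measurable]: "C \<in> sets \<nu>" and "emeasure \<nu> C < \<infinity>"
  shows "prob {\<omega> \<in> space P. \<forall>i. \<xi> i \<omega> \<notin> C} = exp (- measure \<nu> C)"
proof -
  have "(\<lambda>\<omega>. card {i. \<xi> i \<omega> \<in> C}) \<in> P \<rightarrow>\<^sub>M count_space UNIV"
    using poisson_count(2)[OF assms] by (simp add: poisson_distributed_def)
  then have [measurable]: "Measurable.pred P (\<lambda>\<omega>. card {i. \<xi> i \<omega> \<in> C} = 0)" by measurable
  have "prob {\<omega> \<in> space P. \<forall>i. \<xi> i \<omega> \<notin> C} = prob {\<omega> \<in> space P. card {i. \<xi> i \<omega> \<in> C} = 0}"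
    by (rule finite_measure_eq_AE) (use poisson_count(1)[OF assms] in \<open>auto elim: eventually_mono\<close>)
  also have "\<dots> = exp (- measure \<nu> C)"
    using poisson_count(2)[OF assms] unfolding poisson_distributed_def by (elim conjE allE[of _ 0]) simp
  finally show ?thesis .
qed

lemma prob_point_le:
  assumes [measurable]: "C \<in> sets \<nu>" and "emeasure \<nu> C < \<infinity>"
  shows "prob {\<omega> \<in> space P. \<exists>i. \<xi> i \<omega> \<in> C} \<le> measure \<nu> C"
proof -
  have "prob {\<omega> \<in> space P. \<exists>i. \<xi> i \<omega> \<in> C} = 1 - prob {\<omega> \<in> space P. \<forall>i. \<xi> i \<omega> \<notin> C}"
    by (subst prob_neg[symmetric]) auto
  then show ?thesis using prob_no_point[OF assms] exp_ge_add_one_self[of "- measure \<nu> C"] by simp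
qed

text \<open>
  A union bound over index pairs. The coin of a pair is independent of the points, and the expected
  number of pairs of points in \<open>C\<close> is at most the square of the measure of \<open>C\<close>.
\<close>

lemma prob_pair_le:
  assumes C [measurable]: "C \<in> sets \<nu>" and Cfin: "emeasure \<nu> C < \<infinity>"
    and Z [measurable]: "Z \<in> sets borel" and b: "\<And>i j. i < j \<Longrightarrow> prob {\<omega> \<in> space P. U i j \<omega> \<in> Z} \<le> b"
  shows "prob {\<omega> \<in> space P. \<exists>i j. i < j \<and> \<xi> i \<omega> \<in> C \<and> \<xi> j \<omega> \<in> C \<and> U i j \<omega> \<in> Z} \<le> (measure \<nu> C)\<^sup>2 * b"
proof -
  let ?I = "{(i, j :: nat). i < j}"
  define A where "A = (\<lambda>(i, j). {\<omega> \<in> space P. \<xi> i \<omega> \<in> C \<and> \<xi> j \<omega> \<in> C})"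
  define B where "B = (\<lambda>(i, j). {\<omega> \<in> space P. U i j \<omega> \<in> Z})"
  have A\<sigma>: "A e \<in> sets \<sigma>\<xi>" for e
  proof -
    obtain i j where e: "e = (i, j)" by (cases e)
    have "{\<omega> \<in> space \<sigma>\<xi>. \<xi> i \<omega> \<in> C \<and> \<xi> j \<omega> \<in> C} \<in> sets \<sigma>\<xi>" by measurable
    then show ?thesis by (simp add: A_def e)
  qed
  have B\<sigma>: "B e \<in> sets \<sigma>U" if eI: "e \<in> ?I" for e
  proof -
    obtain i j where e: "e = (i, j)" "i < j" using eI by blast
    note [measurable] = U_\<sigma>U[OF e(2)]
    have "{\<omega> \<in> space \<sigma>U. U i j \<omega> \<in> Z} \<in> sets \<sigma>U" by measurable
    then show ?thesis by (simp add: B_def e)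
  qed
  have b0: "0 \<le> b" using b[of 0 1] measure_nonneg order_trans by (meson zero_less_one)
  have "prob (\<Union>e\<in>?I. A e \<inter> B e) \<le> (measure \<nu> C)\<^sup>2 * b"
  proof (rule prob_UN_countable_le)
    show "countable ?I" by simp
    show "A e \<inter> B e \<in> events" if "e \<in> ?I" for e
      using \<sigma>_events A\<sigma> B\<sigma> that by blast
    fix F assume F: "finite F" "F \<subseteq> ?I"
    have Aev: "A e \<in> events" for e using A\<sigma> \<sigma>_events by blast
    have "(\<Sum>e\<in>F. prob (A e \<inter> B e)) \<le> (\<Sum>e\<in>F. prob (A e) * b)"
    proof (rule sum_mono)
      fix e assume e: "e \<in> F"
      have "prob (B e) \<le> b" using b F e by (auto simp: B_def)
      then show "prob (A e \<inter> B e) \<le> prob (A e) * b"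
        using indep_\<sigma>[OF A\<sigma> B\<sigma>[of e]] F(2) e by (metis (no_types, lifting) measure_nonneg mult_left_mono subsetD)
    qed
    also have "\<dots> = (\<Sum>e\<in>F. prob (A e)) * b" by (simp add: sum_distrib_right)
    also have "\<dots> \<le> (measure \<nu> C)\<^sup>2 * b"
    proof (intro mult_right_mono b0)
      have "ennreal (\<Sum>e\<in>F. prob (A e)) = (\<Sum>e\<in>F. emeasure P (A e))"
        by (simp add: emeasure_eq_measure)
      also have "\<dots> = (\<integral>\<^sup>+\<omega>. (\<Sum>e\<in>F. indicator (A e) \<omega>) \<partial>P)"
        using Aev by (simp add: nn_integral_sum)
      also have "\<dots> \<le> (\<integral>\<^sup>+\<omega>. of_nat (card {i. \<xi> i \<omega> \<in> C} * (card {i. \<xi> i \<omega> \<in> C} - 1)) \<partial>P)"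
      proof (rule nn_integral_mono_AE)
        show "AE \<omega> in P. (\<Sum>e\<in>F. indicator (A e) \<omega>) \<le> (of_nat (card {i. \<xi> i \<omega> \<in> C} * (card {i. \<xi> i \<omega> \<in> C} - 1)) :: ennreal)"
          using poisson_count(1)[OF C Cfin]
        proof eventually_elim
          case (elim \<omega>)
          let ?S = "{i. \<xi> i \<omega> \<in> C}"
          have "(\<Sum>e\<in>F. indicator (A e) \<omega> :: ennreal) = of_nat (card {e \<in> F. \<omega> \<in> A e})"
            using F(1) by (simp add: indicator_def sum.If_cases Int_def)
          also have "card {e \<in> F. \<omega> \<in> A e} \<le> card (?S \<times> ?S - Id_on ?S)"
            using elim F(2) by (intro card_mono) (auto simp: A_def Id_on_def)
          also have "card (?S \<times> ?S - Id_on ?S) = card ?S * card ?S - card ?S"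
          proof -
            have "card (Id_on ?S) = card ?S"
            proof -
              have "Id_on ?S = (\<lambda>x. (x, x)) ` ?S" by (auto simp: Id_on_def)
              then show ?thesis by (simp add: card_image inj_on_def)
            qed
            then show ?thesis using elim by (subst card_Diff_subset) (auto simp: Id_on_def card_cartesian_product)
          qed
          finally show ?case by (simp add: diff_mult_distrib2 of_nat_mono)
        qed
      qed
      also have "\<dots> = ennreal ((measure \<nu> C)\<^sup>2)"
        using poisson_count(2)[OF C Cfin] by (rule poisson_second_factorial_moment) simp
      finally show "(\<Sum>e\<in>F. prob (A e)) \<le> (measure \<nu> C)\<^sup>2"
        by (simp add: ennreal_le_iff)
    qed
    finally show "(\<Sum>e\<in>F. prob (A e \<inter> B e)) \<le> (measure \<nu> C)\<^sup>2 * b" .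
  qed
  also have "(\<Union>e\<in>?I. A e \<inter> B e) = {\<omega> \<in> space P. \<exists>i j. i < j \<and> \<xi> i \<omega> \<in> C \<and> \<xi> j \<omega> \<in> C \<and> U i j \<omega> \<in> Z}"
    by (auto simp: A_def B_def)
  finally show ?thesis .
qed

lemma prob_two_points_le:
  assumes C [measurable]: "C \<in> sets \<nu>" and Cfin: "emeasure \<nu> C < \<infinity>"
  shows "prob {\<omega> \<in> space P. \<exists>i j. i \<noteq> j \<and> \<xi> i \<omega> \<in> C \<and> \<xi> j \<omega> \<in> C} \<le> (measure \<nu> C)\<^sup>2"
proof -
  have "{\<omega> \<in> space P. \<exists>i j. i \<noteq> j \<and> \<xi> i \<omega> \<in> C \<and> \<xi> j \<omega> \<in> C} =
    {\<omega> \<in> space P. \<exists>i j. i < j \<and> \<xi> i \<omega> \<in> C \<and> \<xi> j \<omega> \<in> C \<and> U i j \<omega> \<in> UNIV}"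
    by simp (metis linorder_neqE_nat nat_neq_iff)
  then show ?thesis using prob_pair_le[OF assms, of UNIV 1] by simp
qed

text \<open>
  The points select an index \<open>k\<close>, and then an event of the coins that belongs to \<open>k\<close> is tested. If these
  events all have the same probability, then the selection is independent of the outcome.
\<close>

lemma prob_decoupled:
  assumes "countable K" and A: "\<And>k. k \<in> K \<Longrightarrow> A k \<in> sets \<sigma>\<xi>" and B: "\<And>k. k \<in> K \<Longrightarrow> B k \<in> sets \<sigma>U"
    and disj: "disjoint_family_on A K" and c: "\<And>k. k \<in> K \<Longrightarrow> prob (B k) = c"
  shows "prob (\<Union>k\<in>K. A k \<inter> B k) = prob (\<Union>k\<in>K. A k) * c"
proof -
  have disj': "disjoint_family_on (\<lambda>k. A k \<inter> B k) K"
    using disj by (auto simp: disjoint_family_on_def)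
  have c0: "0 \<le> c" if "K \<noteq> {}" using that c measure_nonneg by (metis ex_in_conv)
  have "emeasure P (\<Union>k\<in>K. A k \<inter> B k) = (\<integral>\<^sup>+k. emeasure P (A k \<inter> B k) \<partial>count_space K)"
    using A B \<sigma>_events disj' assms(1) by (intro emeasure_UN_countable) auto
  also have "\<dots> = (\<integral>\<^sup>+k. emeasure P (A k) * ennreal c \<partial>count_space K)"
  proof (rule nn_integral_cong)
    fix k assume "k \<in> space (count_space K)"
    then have k: "k \<in> K" by simp
    then have "prob (A k \<inter> B k) = prob (A k) * c" using indep_\<sigma>[OF A B] c by simp
    then show "emeasure P (A k \<inter> B k) = emeasure P (A k) * ennreal c"
      using c0 k unfolding emeasure_eq_measure by (metis empty_iff ennreal_mult measure_nonneg)
  qed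
  also have "\<dots> = (\<integral>\<^sup>+k. emeasure P (A k) \<partial>count_space K) * ennreal c"
    by (rule nn_integral_multc) simp
  also have "(\<integral>\<^sup>+k. emeasure P (A k) \<partial>count_space K) = emeasure P (\<Union>k\<in>K. A k)"
    using A \<sigma>_events disj assms(1) by (intro emeasure_UN_countable[symmetric]) auto
  finally show ?thesis
  proof (cases "K = {}")
    case False
    assume "emeasure P (\<Union>k\<in>K. A k \<inter> B k) = emeasure P (\<Union>k\<in>K. A k) * ennreal c"
    then show ?thesis using c0[OF False] by (simp add: emeasure_eq_measure ennreal_mult[symmetric])
  qed simp
qed

end

lemma finite_birth_edges_reached:
  assumes "finite (birth_edges s adj r)" "birth_edges s adj r \<noteq> {}"
  obtains i where "s i \<le> r" "birth_edges s adj (s i) = birth_edges s adj r"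
proof -
  let ?E = "birth_edges s adj r"
  define b where "b e = Max (s ` e)" for e
  have b: "b e \<in> s ` e \<and> b e \<le> r \<and> (\<forall>i\<in>e. s i \<le> b e)" if eE: "e \<in> ?E" for e
  proof -
    obtain i j where e: "e = {i, j}" "s i \<le> r" "s j \<le> r" using eE unfolding birth_edges_def by blast
    have "finite (s ` e)" "s ` e \<noteq> {}" by (auto simp: e(1))
    then have "b e \<in> s ` e" "\<forall>i\<in>e. s i \<le> b e" unfolding b_def using Max_in Max_ge by auto
    then show ?thesis using e by auto
  qed
  obtain e where e: "e \<in> ?E" "b e = Max (b ` ?E)" using Max_in[of "b ` ?E"] assms by fastforce
  have le: "b e' \<le> b e" if "e' \<in> ?E" for e' unfolding e(2) using assms(1) that by auto
  obtain i where i: "b e = s i" "s i \<le> r" using b[OF e(1)] by (metis imageE)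
  have "?E \<subseteq> birth_edges s adj (s i)"
  proof
    fix e' assume e': "e' \<in> ?E"
    then obtain j k where jk: "e' = {j, k}" "j < k" "adj j k" unfolding birth_edges_def by blast
    then have "s j \<le> s i" "s k \<le> s i" using b[OF e'] le[OF e'] i by auto
    then show "e' \<in> birth_edges s adj (s i)" using jk unfolding birth_edges_def by blast
  qed
  then have "birth_edges s adj (s i) = ?E" using birth_edges_mono[OF i(2)] by blast
  then show thesis using that i by blast
qed

context sampling
begin

abbreviation edges_at :: "(real \<Rightarrow> real \<Rightarrow> real) \<Rightarrow> real \<Rightarrow> 'p \<Rightarrow> nat set set" where
  "edges_at \<equiv> sampled_edges \<xi> U"

abbreviation graph_at :: "(real \<Rightarrow> real \<Rightarrow> real) \<Rightarrow> real \<Rightarrow> 'p \<Rightarrow> ugraph" where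
  "graph_at \<equiv> graphon_graph \<xi> U"

definition history :: "(real \<Rightarrow> real \<Rightarrow> real) \<Rightarrow> real \<Rightarrow> 'p \<Rightarrow> ugraph set" where
  "history W R \<omega> = (\<lambda>r. graph_at W r \<omega>) ` {0..R}"

lemma edges_at_birth_edges:
  "edges_at W r \<omega> =
     birth_edges (\<lambda>i. snd (\<xi> i \<omega>)) (\<lambda>i j. U i j \<omega> < W (fst (\<xi> i \<omega>)) (fst (\<xi> j \<omega>))) r"
  by (simp add: sampled_edges_def birth_edges_def)

lemma edges_at_mono: "r \<le> r' \<Longrightarrow> edges_at W r \<omega> \<subseteq> edges_at W r' \<omega>"
  unfolding edges_at_birth_edges by (rule birth_edges_mono)

lemma fin_graph_edges_at: "finite (edges_at W r \<omega>) \<Longrightarrow> fin_graph (edges_at W r \<omega>)"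
  by (auto simp: fin_graph_def sampled_edges_def card_2_iff)

text \<open>
  The graph changes only at times of points, so countably many random times determine the history.
\<close>

lemma history_eq:
  assumes \<omega>: "\<omega> \<in> space P" and fin: "finite (edges_at W R \<omega>)" and "0 \<le> R"
  shows "history W R \<omega> = insert (graph_at W 0 \<omega>) {u. \<exists>i. snd (\<xi> i \<omega>) \<le> R \<and> u = graph_at W (snd (\<xi> i \<omega>)) \<omega>}"
proof (intro set_eqI iffI)
  fix u assume "u \<in> history W R \<omega>"
  then obtain r where r: "0 \<le> r" "r \<le> R" "u = graph_at W r \<omega>" by (auto simp: history_def)
  show "u \<in> insert (graph_at W 0 \<omega>) {u. \<exists>i. snd (\<xi> i \<omega>) \<le> R \<and> u = graph_at W (snd (\<xi> i \<omega>)) \<omega>}"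
  proof (cases "edges_at W r \<omega> = {}")
    case True
    then have "edges_at W 0 \<omega> = {}" using edges_at_mono[OF r(1)] by blast
    then show ?thesis using r True by (simp add: graphon_graph_def)
  next
    case False
    have "finite (edges_at W r \<omega>)" using fin edges_at_mono[OF r(2)] finite_subset by blast
    then obtain i where "snd (\<xi> i \<omega>) \<le> r" "edges_at W (snd (\<xi> i \<omega>)) \<omega> = edges_at W r \<omega>"
      using False finite_birth_edges_reached unfolding edges_at_birth_edges by blast
    then have "u = graph_at W (snd (\<xi> i \<omega>)) \<omega>" "snd (\<xi> i \<omega>) \<le> R"
      using r unfolding graphon_graph_def by auto
    then show ?thesis by blast
  qed
qed (use \<xi>_pos[OF \<omega>] \<open>0 \<le> R\<close> in \<open>auto simp: history_def\<close>)

lemma growing_graph_edges_at: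
  assumes "\<omega> \<in> space P" "\<And>i :: nat. finite (edges_at W (real i) \<omega>)"
  shows "growing_graph (\<lambda>r. edges_at W r \<omega>)"
proof -
  have "finite (edges_at W r \<omega>)" for r
  proof -
    obtain i :: nat where "r \<le> real i" using real_arch_simple by blast
    then show ?thesis using edges_at_mono assms(2) finite_subset by metis
  qed
  then show ?thesis using growing_graph_birth_edges unfolding edges_at_birth_edges by blast
qed

lemma measurable_graphon:
  assumes "graphon W"
  shows "(\<lambda>\<omega>. W (fst (\<xi> i \<omega>)) (fst (\<xi> j \<omega>))) \<in> borel_measurable P"
proof -
  have 1: "(\<lambda>\<omega>. (fst (\<xi> i \<omega>), fst (\<xi> j \<omega>))) \<in> P \<rightarrow>\<^sub>M restrict_space borel ({0<..} \<times> {0<..})"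
    using \<xi>_pos by (intro measurable_restrict_space2) (auto simp: borel_prod[symmetric])
  have 2: "(\<lambda>(x, y). W x y) \<in> borel_measurable (restrict_space borel ({0<..} \<times> {0<..}))"
    using assms by (simp add: graphon_def)
  show ?thesis using measurable_compose[OF 1 2] by simp
qed

lemma measurable_edges_at:
  assumes W: "graphon W" and T [measurable]: "T \<in> borel_measurable P"
  shows "(\<lambda>\<omega>. let E = edges_at W (T \<omega>) \<omega> in if finite E then E else {}) \<in> P \<rightarrow>\<^sub>M count_space {E. fin_graph E}"
    and "{\<omega> \<in> space P. finite (edges_at W (T \<omega>) \<omega>)} \<in> events"
proof -
  note [measurable] = measurable_graphon[OF W]
  have pm: "Measurable.pred P (\<lambda>\<omega>. snd (\<xi> i \<omega>) \<le> T \<omega> \<and> snd (\<xi> j \<omega>) \<le> T \<omega> \<and>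
      U i j \<omega> < W (fst (\<xi> i \<omega>)) (fst (\<xi> j \<omega>)))" if ij: "i < j" for i j
    using U_measurable[OF ij] by measurable
  have eq: "{\<omega> \<in> space P. edges_at W (T \<omega>) \<omega> = F} \<in> events" if F: "fin_graph F" for F
  proof -
    have "edges_at W (T \<omega>) \<omega> = F \<longleftrightarrow> (\<forall>i j. i < j \<longrightarrow> ((snd (\<xi> i \<omega>) \<le> T \<omega> \<and> snd (\<xi> j \<omega>) \<le> T \<omega> \<and>
      U i j \<omega> < W (fst (\<xi> i \<omega>)) (fst (\<xi> j \<omega>))) \<longleftrightarrow> {i, j} \<in> F))" (is "?L \<longleftrightarrow> ?R") for \<omega>
    proof
      show "?L \<Longrightarrow> ?R" by (auto simp: sampled_edges_def doubleton_eq_iff)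
      assume R: ?R
      show ?L
      proof (intro set_eqI iffI)
        fix e assume "e \<in> F"
        then obtain x y where "e = {x, y}" "x \<noteq> y" using F unfolding fin_graph_def by (meson card_2_iff)
        then obtain i j where ij: "e = {i, j}" "i < j" by (metis insert_commute linorder_neqE_nat)
        then show "e \<in> edges_at W (T \<omega>) \<omega>" using R \<open>e \<in> F\<close> unfolding sampled_edges_def by blast
      qed (use R in \<open>auto simp: sampled_edges_def\<close>)
    qed
    moreover have "Measurable.pred P (\<lambda>\<omega>. \<forall>i j. i < j \<longrightarrow> ((snd (\<xi> i \<omega>) \<le> T \<omega> \<and> snd (\<xi> j \<omega>) \<le> T \<omega> \<and>
      U i j \<omega> < W (fst (\<xi> i \<omega>)) (fst (\<xi> j \<omega>))) \<longleftrightarrow> {i, j} \<in> F))"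
    proof (intro pred_intros_countable)
      fix i j show "Measurable.pred P (\<lambda>\<omega>. i < j \<longrightarrow> ((snd (\<xi> i \<omega>) \<le> T \<omega> \<and> snd (\<xi> j \<omega>) \<le> T \<omega> \<and>
        U i j \<omega> < W (fst (\<xi> i \<omega>)) (fst (\<xi> j \<omega>))) \<longleftrightarrow> {i, j} \<in> F))"
        using pm[of i j] by (cases "i < j") auto
    qed
    ultimately show ?thesis by (simp add: pred_def)
  qed
  have "{\<omega> \<in> space P. finite (edges_at W (T \<omega>) \<omega>)} =
    (\<Union>F\<in>{E. fin_graph E}. {\<omega> \<in> space P. edges_at W (T \<omega>) \<omega> = F})"
    using fin_graph_edges_at by (auto simp: fin_graph_def)
  also have "\<dots> \<in> events" using eq countable_fin_graphs by (intro sets.countable_UN'') auto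
  finally show fin: "{\<omega> \<in> space P. finite (edges_at W (T \<omega>) \<omega>)} \<in> events" .
  show "(\<lambda>\<omega>. let E = edges_at W (T \<omega>) \<omega> in if finite E then E else {}) \<in> P \<rightarrow>\<^sub>M count_space {E. fin_graph E}"
  proof (subst measurable_count_space_eq_countable[OF countable_fin_graphs], intro conjI ballI)
    show "(\<lambda>\<omega>. let E = edges_at W (T \<omega>) \<omega> in if finite E then E else {}) \<in> space P \<rightarrow> {E. fin_graph E}"
      using fin_graph_edges_at by (auto simp: Let_def fin_graph_def[of "{}"])
    fix F :: "nat set set" assume F: "F \<in> {E. fin_graph E}"
    have "(\<lambda>\<omega>. let E = edges_at W (T \<omega>) \<omega> in if finite E then E else {}) -` {F} \<inter> space P =
      {\<omega> \<in> space P. edges_at W (T \<omega>) \<omega> = F} \<union>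
      (if F = {} then space P - {\<omega> \<in> space P. finite (edges_at W (T \<omega>) \<omega>)} else {})"
      using F by (auto simp: Let_def fin_graph_def split: if_splits)
    then show "(\<lambda>\<omega>. let E = edges_at W (T \<omega>) \<omega> in if finite E then E else {}) -` {F} \<inter> space P \<in> events"
      using eq[of F] F fin by auto
  qed
qed

lemma measurable_graph_at:
  assumes W: "graphon W" and T: "T \<in> borel_measurable P"
  shows "(\<lambda>\<omega>. graph_at W (T \<omega>) \<omega>) \<in> P \<rightarrow>\<^sub>M count_space UNIV"
proof -
  have "graph_at W (T \<omega>) \<omega> = unlabelled (let E = edges_at W (T \<omega>) \<omega> in if finite E then E else {})" for \<omega>
    by (simp add: graphon_graph_def unlabelled_def Let_def)
  then show ?thesis
    using measurable_compose[OF measurable_edges_at(1)[OF assms], of unlabelled "count_space UNIV"] by simp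
qed

lemma history_event:
  assumes W: "graphon W" and R: "0 \<le> R"
  shows "{\<omega> \<in> space P. finite (edges_at W R \<omega>) \<and> \<phi> (history W R \<omega>)} \<in> events"
proof -
  note [measurable] = measurable_edges_at(2)[OF W, of "\<lambda>_. R"]
  have [measurable]: "(\<lambda>\<omega>. graph_at W 0 \<omega>) \<in> P \<rightarrow>\<^sub>M count_space UNIV"
    "\<And>i. (\<lambda>\<omega>. graph_at W (snd (\<xi> i \<omega>)) \<omega>) \<in> P \<rightarrow>\<^sub>M count_space UNIV"
    using measurable_graph_at[OF W] by auto
  have S: "{\<omega> \<in> space P. finite (edges_at W R \<omega>) \<and> history W R \<omega> = S} \<in> events" for S
  proof -
    have "{\<omega> \<in> space P. finite (edges_at W R \<omega>) \<and> history W R \<omega> = S} =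
      {\<omega> \<in> space P. finite (edges_at W R \<omega>)} \<inter> {\<omega> \<in> space P. graph_at W 0 \<omega> \<in> S \<and>
        (\<forall>i. snd (\<xi> i \<omega>) \<le> R \<longrightarrow> graph_at W (snd (\<xi> i \<omega>)) \<omega> \<in> S) \<and>
        (\<forall>u. u \<in> S \<longrightarrow> u = graph_at W 0 \<omega> \<or> (\<exists>i. snd (\<xi> i \<omega>) \<le> R \<and> u = graph_at W (snd (\<xi> i \<omega>)) \<omega>))}"
      using history_eq[OF _ _ R] by auto
    also have "\<dots> \<in> events"
      by (intro sets.Int, measurable)
    finally show ?thesis .
  qed
  have fin: "finite (history W R \<omega>)" if fE: "finite (edges_at W R \<omega>)" for \<omega>
  proof -
    have "history W R \<omega> \<subseteq> unlabelled ` Pow (edges_at W R \<omega>)"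
      using edges_at_mono by (auto simp: history_def graphon_graph_def)
    then show ?thesis using fE by (meson finite_Pow_iff finite_imageI finite_subset)
  qed
  have "{\<omega> \<in> space P. finite (edges_at W R \<omega>) \<and> \<phi> (history W R \<omega>)} =
    (\<Union>S\<in>{S. finite S \<and> \<phi> S}. {\<omega> \<in> space P. finite (edges_at W R \<omega>) \<and> history W R \<omega> = S})"
    using fin by auto
  also have "\<dots> \<in> events"
  proof (rule sets.countable_UN'')
    show "countable {S :: ugraph set. finite S \<and> \<phi> S}"
      by (rule countable_subset[OF _ countable_Collect_finite]) auto
  qed (use S in auto)
  finally show ?thesis .
qed

lemma graph_sequence_iff:
  assumes \<omega>: "\<omega> \<in> space P" and fin: "\<And>i :: nat. finite (edges_at W (real i) \<omega>)"
  shows "graph_sequence \<xi> U W \<omega> k = u \<longleftrightarrow>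
    (\<exists>i :: nat. kth (history W (real i) \<omega>) k u) \<or>
    (\<forall>i :: nat. card (history W (real i) \<omega>) \<le> k) \<and> (\<exists>i0 :: nat. \<forall>i\<ge>i0. graph_at W (real i) \<omega> = u)"
proof -
  interpret growing_graph "\<lambda>r. edges_at W r \<omega>" by (rule growing_graph_edges_at[OF assms])
  have g: "g = (\<lambda>r. graph_at W r \<omega>)" by (simp add: fun_eq_iff g_def graphon_graph_def)
  have "\<forall>r\<ge>0. finite (edges_at W r \<omega>)" using fin growing_graph.fin by (metis fin_graph_def growing_graph_axioms)
  then show ?thesis
    using jump_graph_iff[of k u] unfolding g by (simp add: graph_sequence_def history_def)
qed

lemma graph_sequence_kth:
  assumes \<omega>: "\<omega> \<in> space P" and fin: "\<And>i :: nat. finite (edges_at W (real i) \<omega>)"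
  shows "kth (history W R \<omega>) k u \<Longrightarrow> graph_sequence \<xi> U W \<omega> k = u"
    and "k < card (history W R \<omega>) \<Longrightarrow> kth (history W R \<omega>) k (graph_sequence \<xi> U W \<omega> k)"
proof -
  interpret growing_graph "\<lambda>r. edges_at W r \<omega>" by (rule growing_graph_edges_at[OF assms])
  have g: "g = (\<lambda>r. graph_at W r \<omega>)" by (simp add: fun_eq_iff g_def graphon_graph_def)
  have "\<forall>r\<ge>0. finite (edges_at W r \<omega>)" using fin growing_graph.fin by (metis fin_graph_def growing_graph_axioms)
  then have s: "graph_sequence \<xi> U W \<omega> k = g (jump_time g k)" by (simp add: graph_sequence_def g)
  have h: "history W R \<omega> = g ` {0..R}" by (simp add: history_def g)
  show "k < card (history W R \<omega>) \<Longrightarrow> kth (history W R \<omega>) k (graph_sequence \<xi> U W \<omega> k)"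
    using kth_jump_time unfolding h s by blast
  show "kth (history W R \<omega>) k u \<Longrightarrow> graph_sequence \<xi> U W \<omega> k = u"
    using kth_jump_time kth_less_card kth_unique unfolding h s by metis
qed

lemma measurable_graph_sequence:
  assumes W: "graphon W"
  shows "graph_sequence \<xi> U W \<in> P \<rightarrow>\<^sub>M borel"
proof (rule measurable_coordinatewise_then_product)
  fix k
  have Fev: "{\<omega> \<in> space P. finite (edges_at W (real i) \<omega>)} \<in> events" for i :: nat
    using measurable_edges_at(2)[OF W, of "\<lambda>_. real i"] by simp
  define F where "F = {\<omega> \<in> space P. \<forall>i :: nat. finite (edges_at W (real i) \<omega>)}"
  have F: "F \<in> events" unfolding F_def using Fev by (intro sets.sets_Collect) 
  have "{\<omega> \<in> space P. graph_sequence \<xi> U W \<omega> k = u} \<in> events" for u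
  proof -
    have "{\<omega> \<in> space P. graph_sequence \<xi> U W \<omega> k = u} =
      (F \<inter> ((\<Union>i :: nat. {\<omega> \<in> space P. finite (edges_at W (real i) \<omega>) \<and> kth (history W (real i) \<omega>) k u}) \<union>
        ((\<Inter>i :: nat. {\<omega> \<in> space P. finite (edges_at W (real i) \<omega>) \<and> card (history W (real i) \<omega>) \<le> k}) \<inter>
         (\<Union>i0 :: nat. \<Inter>i\<in>{i0..}. {\<omega> \<in> space P. graph_at W (real i) \<omega> = u})))) \<union>
      (if u = unlabelled {} then space P - F else {})" (is "?L = ?R")
    proof (intro set_eqI)
      fix \<omega>
      show "\<omega> \<in> ?L \<longleftrightarrow> \<omega> \<in> ?R"
      proof (cases "\<omega> \<in> F")
        case True
        then have "\<omega> \<in> space P" "\<And>i :: nat. finite (edges_at W (real i) \<omega>)" by (auto simp: F_def)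
        from graph_sequence_iff[OF this] this show ?thesis using True by auto
      next
        case False
        have "\<not> (\<forall>r\<ge>0. finite (edges_at W r \<omega>))" if "\<omega> \<in> space P"
          using False that unfolding F_def by (auto intro!: of_nat_0_le_iff)
        then show ?thesis using False by (auto simp: graph_sequence_def)
      qed
    qed
    also have "\<dots> \<in> events"
    proof -
      have 1: "{\<omega> \<in> space P. finite (edges_at W (real i) \<omega>) \<and> \<phi> (history W (real i) \<omega>)} \<in> events" for i :: nat and \<phi>
        by (rule history_event[OF W]) simp
      have "(\<lambda>\<omega>. graph_at W (real i) \<omega>) \<in> P \<rightarrow>\<^sub>M count_space UNIV" for i :: nat
        by (rule measurable_graph_at[OF W]) simp
      then have "(\<lambda>\<omega>. graph_at W (real i) \<omega>) -` {u} \<inter> space P \<in> events" for i :: nat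
        by (rule measurable_sets) simp
      then have 2: "{\<omega> \<in> space P. graph_at W (real i) \<omega> = u} \<in> events" for i :: nat
        by (simp add: vimage_def Int_def conj_commute)
      show ?thesis
        using F 1[of _ "\<lambda>S. kth S k u"] 1[of _ "\<lambda>S. card S \<le> k"] 2
        by (auto intro!: sets.Un sets.Int sets.countable_UN' sets.countable_INT')
    qed
    finally show ?thesis .
  qed
  then have "(\<lambda>\<omega>. graph_sequence \<xi> U W \<omega> k) \<in> P \<rightarrow>\<^sub>M count_space UNIV"
    by (auto simp: measurable_count_space_eq_countable vimage_def Int_def conj_commute)
  then show "(\<lambda>\<omega>. graph_sequence \<xi> U W \<omega> k) \<in> P \<rightarrow>\<^sub>M borel"
    by (rule measurable_compose) simp
qed

end

section \<open>Discretisation of the sampling points\<close>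

text \<open>
  The positions that \<open>stretched_graphon\<close> rounds to the label \<open>k\<close> at scale \<open>u\<close>.
\<close>

definition strip :: "real \<Rightarrow> nat \<Rightarrow> real set" where
  "strip u k = {y. 0 < y \<and> nat \<lceil>u * y\<rceil> = k}"

lemma strip_eq:
  assumes "u > 0"
  shows "strip u k = (if k = 0 then {} else {(real k - 1) / u<..real k / u})"
proof (cases "k = 0")
  case True
  have "0 < nat \<lceil>u * y\<rceil>" if "0 < y" for y using that assms by simp
  then show ?thesis using True by (force simp: strip_def)
next
  case False
  have ceil: "nat \<lceil>u * y\<rceil> = k \<longleftrightarrow> real k - 1 < u * y \<and> u * y \<le> real k" for y
  proof -
    have "nat \<lceil>u * y\<rceil> = k \<longleftrightarrow> \<lceil>u * y\<rceil> = int k" using False by auto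
    also have "\<dots> \<longleftrightarrow> real k - 1 < u * y \<and> u * y \<le> real k" by (simp add: ceiling_eq_iff)
    finally show ?thesis .
  qed
  then have "y \<in> strip u k \<longleftrightarrow> y \<in> {(real k - 1) / u<..real k / u}" for y
  proof -
    have "0 < y" if "(real k - 1) / u < y"
    proof -
      have "0 \<le> (real k - 1) / u" using False assms by simp
      then show ?thesis using that by linarith
    qed
    then show ?thesis
      using ceil[of y] assms by (auto simp: strip_def field_simps)
  qed
  then have "strip u k = {(real k - 1) / u<..real k / u}" by (rule set_eqI)
  then show ?thesis using False by simp
qed

lemma strip_measure:
  assumes "u > 0"
  shows "strip u k \<in> sets borel" "emeasure lborel (strip u k) \<le> ennreal (1 / u)"
    "k \<ge> 1 \<Longrightarrow> emeasure lborel (strip u k) = ennreal (1 / u)" "strip u k \<subseteq> {0<..}"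
proof -
  show "strip u k \<in> sets borel" by (simp add: strip_eq[OF assms])
  show 1: "emeasure lborel (strip u k) = ennreal (1 / u)" if "k \<ge> 1"
  proof -
    have "real k / u - (real k - 1) / u = 1 / u" by (simp add: diff_divide_distrib)
    moreover have "(real k - 1) / u \<le> real k / u" using assms by (simp add: divide_right_mono)
    ultimately show ?thesis using that by (simp add: strip_eq[OF assms])
  qed
  show "emeasure lborel (strip u k) \<le> ennreal (1 / u)"
    using 1 by (cases "k = 0") (auto simp: strip_eq[OF assms])
  show "strip u k \<subseteq> {0<..}" by (auto simp: strip_def)
qed

lemma strip_disjoint: "y \<in> strip u k \<Longrightarrow> y \<in> strip u k' \<Longrightarrow> k = k'"
  by (simp add: strip_def)

lemma (in sampling) emeasure_Times:
  assumes "A \<in> sets borel" "A \<subseteq> {0<..}" "B \<in> sets borel" "B \<subseteq> {0..}"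
  shows "A \<times> B \<in> sets \<nu>" "emeasure \<nu> (A \<times> B) = emeasure lborel A * emeasure lborel B"
proof -
  have "A \<times> B \<in> sets (borel \<Otimes>\<^sub>M borel)" using assms by auto
  then have b: "A \<times> B \<in> sets lborel" unfolding borel_prod by simp
  have "{0<..} \<times> {0..} \<in> sets (borel \<Otimes>\<^sub>M borel :: (real \<times> real) measure)" by auto
  then have "{0<..} \<times> {0..} \<in> sets (lborel :: (real \<times> real) measure)" unfolding borel_prod by simp
  then have S: "{0<..} \<times> {0..} \<inter> space lborel \<in> sets (lborel :: (real \<times> real) measure)" by simp
  show "A \<times> B \<in> sets \<nu>" using sets_restrict_space_iff[OF S] b assms by auto
  have "emeasure \<nu> (A \<times> B) = emeasure lborel (A \<times> B)"
  proof (rule emeasure_restrict_space[OF S])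
    show "A \<times> B \<subseteq> {0<..} \<times> {0..}" using assms by (intro Sigma_mono) auto
  qed
  also have "\<dots> = emeasure (lborel \<Otimes>\<^sub>M lborel) (A \<times> B)" by (simp add: lborel_prod)
  also have "\<dots> = emeasure lborel A * emeasure lborel B"
    using assms by (intro lborel.emeasure_pair_measure_Times) auto
  finally show "emeasure \<nu> (A \<times> B) = emeasure lborel A * emeasure lborel B" .
qed

text \<open>
  A point at time 0 would fall into no time slot.
\<close>

lemma (in sampling) AE_time_pos: "AE \<omega> in P. \<forall>i. 0 < snd (\<xi> i \<omega>)"
proof -
  have m: "{0<..} \<times> {0} \<in> sets \<nu>" and e: "emeasure \<nu> ({0<..} \<times> {0}) = 0"
    using emeasure_Times[of "{0<..}" "{0}"] by auto
  have "prob {\<omega> \<in> space P. \<exists>i. \<xi> i \<omega> \<in> {0<..} \<times> {0}} \<le> 0"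
    using prob_point_le[OF m] e by (simp add: measure_def)
  then have "prob {\<omega> \<in> space P. \<exists>i. \<xi> i \<omega> \<in> {0<..} \<times> {0}} = 0" by (simp add: measure_le_0_iff)
  moreover have "{\<omega> \<in> space P. \<exists>i. \<xi> i \<omega> \<in> {0<..} \<times> {0}} \<in> events"
  proof -
    note [measurable] = m
    show ?thesis by measurable
  qed
  ultimately have "AE \<omega> in P. \<not> (\<exists>i. \<xi> i \<omega> \<in> {0<..} \<times> {0})"
    by (subst (asm) prob_eq_0) auto
  then show ?thesis
    using AE_space by eventually_elim (use \<xi>_pos in \<open>force simp: mem_Times_iff less_le\<close>)
qed

text \<open>
  Vertex \<open>x\<close> owns the strip with number \<open>pos x\<close>, and time up to \<open>\<rho>\<close> is cut into \<open>m\<close> slots. For the limit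
  graphon \<open>pos\<close> is the identity, for a finite graph it inverts the labelling of the vertices.
\<close>

locale cells = sampling +
  fixes u \<rho> :: real and pos :: "nat \<Rightarrow> nat" and m :: nat and V :: "nat set"
  assumes u: "u > 0" and \<rho>: "\<rho> > 0" and pos: "inj pos" "\<And>x. x \<in> V \<Longrightarrow> pos x \<ge> 1"
    and m: "m \<ge> 1" and V: "finite V"
begin

definition lam :: real where "lam = \<rho> / u"

definition col :: "nat \<Rightarrow> (real \<times> real) set" where
  "col x = strip u (pos x) \<times> {0..\<rho>}"

definition cell :: "nat \<times> nat \<Rightarrow> (real \<times> real) set" where
  "cell = (\<lambda>(x, a). strip u (pos x) \<times> strip (real m / \<rho>) a)"

definition row :: "nat \<Rightarrow> (real \<times> real) set" where
  "row a = (\<Union>x\<in>V. cell (x, a))"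

definition occupied :: "'a \<Rightarrow> (nat \<times> nat) set" where
  "occupied \<omega> = {c \<in> V \<times> {1..m}. \<exists>i. \<xi> i \<omega> \<in> cell c}"

text \<open>
  On this event the occupied cells determine the number of points on each vertex and their order.
\<close>

definition separated :: "'a \<Rightarrow> bool" where
  "separated \<omega> \<longleftrightarrow>
     (\<forall>x\<in>V. \<forall>i j. i \<noteq> j \<longrightarrow> \<not> (\<xi> i \<omega> \<in> col x \<and> \<xi> j \<omega> \<in> col x)) \<and>
     (\<forall>a\<in>{1..m}. \<forall>i j. i \<noteq> j \<longrightarrow> \<not> (\<xi> i \<omega> \<in> row a \<and> \<xi> j \<omega> \<in> row a))"

lemma lam: "0 < lam" unfolding lam_def using u \<rho> by simp

lemma m\<rho>: "real m / \<rho> > 0" using m \<rho> by simp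

lemma col_measure:
  shows [measurable]: "col x \<in> sets \<nu>" and "emeasure \<nu> (col x) \<le> ennreal lam" "measure \<nu> (col x) \<le> lam"
    "emeasure \<nu> (col x) < \<infinity>"
proof -
  note s = strip_measure[OF u]
  show "col x \<in> sets \<nu>" unfolding col_def using s by (intro emeasure_Times) auto
  have "emeasure \<nu> (col x) = emeasure lborel (strip u (pos x)) * emeasure lborel {0..\<rho>}"
    unfolding col_def using s by (intro emeasure_Times) auto
  also have "\<dots> \<le> ennreal (1 / u) * ennreal \<rho>"
    using s(2) \<rho> by (intro mult_mono) auto
  also have "\<dots> = ennreal lam" using u \<rho> by (simp add: ennreal_mult[symmetric] lam_def)
  finally show 1: "emeasure \<nu> (col x) \<le> ennreal lam" .
  then show "measure \<nu> (col x) \<le> lam"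
    unfolding measure_def using lam by (simp add: enn2real_leI)
  show "emeasure \<nu> (col x) < \<infinity>" using 1 by (auto simp: less_top[symmetric] top_unique)
qed

lemma cell_measure:
  shows [measurable]: "cell c \<in> sets \<nu>" and "emeasure \<nu> (cell c) \<le> ennreal (lam / m)"
    "c \<in> V \<times> {1..m} \<Longrightarrow> emeasure \<nu> (cell c) = ennreal (lam / m)"
proof -
  note s = strip_measure[OF u] and t = strip_measure[OF m\<rho>]
  obtain x a where c: "c = (x, a)" by (cases c)
  have t4: "strip (real m / \<rho>) a \<subseteq> {0..}" using t(4)[of a] by auto
  show "cell c \<in> sets \<nu>" unfolding cell_def c prod.case using s t t4 by (intro emeasure_Times) auto
  have 1: "emeasure \<nu> (cell c) = emeasure lborel (strip u (pos x)) * emeasure lborel (strip (real m / \<rho>) a)"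
    unfolding cell_def c using s t t4 by (simp add: emeasure_Times)
  have 2: "ennreal (1 / u) * ennreal (1 / (real m / \<rho>)) = ennreal (lam / m)"
    using u \<rho> by (simp add: ennreal_mult[symmetric] lam_def)
  show "emeasure \<nu> (cell c) \<le> ennreal (lam / m)"
    unfolding 1 2[symmetric] using s(2) t(2) by (intro mult_mono) auto
  show "emeasure \<nu> (cell c) = ennreal (lam / m)" if "c \<in> V \<times> {1..m}"
    unfolding 1 2[symmetric] using s(3)[of "pos x"] t(3)[of a] that pos(2)[of x] c by simp
qed

lemma cell_fin: "emeasure \<nu> (cell c) < \<infinity>"
  using cell_measure(2)[of c] by (auto simp: less_top[symmetric] top_unique)

lemma row_measure:
  shows [measurable]: "row a \<in> sets \<nu>" and "emeasure \<nu> (row a) < \<infinity>" "measure \<nu> (row a) \<le> card V * lam / m"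
proof -
  show "row a \<in> sets \<nu>" unfolding row_def using V by (intro sets.finite_UN) auto
  have "emeasure \<nu> (row a) \<le> (\<Sum>x\<in>V. emeasure \<nu> (cell (x, a)))"
    unfolding row_def using V by (intro emeasure_subadditive_finite) auto
  also have "\<dots> \<le> (\<Sum>x\<in>V. ennreal (lam / m))" by (intro sum_mono cell_measure)
  also have "\<dots> = ennreal (card V * lam / m)"
    using lam by (simp add: ennreal_of_nat_eq_real_of_nat ennreal_mult[symmetric])
  finally have 1: "emeasure \<nu> (row a) \<le> ennreal (card V * lam / m)" .
  then show "emeasure \<nu> (row a) < \<infinity>" by (auto simp: less_top[symmetric] top_unique)
  show "measure \<nu> (row a) \<le> card V * lam / m"
    using 1 lam unfolding measure_def by (simp add: enn2real_leI)
qed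

lemma cell_subset_col: "a \<le> m \<Longrightarrow> cell (x, a) \<subseteq> col x"
proof -
  assume "a \<le> m"
  have "y \<le> \<rho>" if "y \<in> strip (real m / \<rho>) a" for y
  proof -
    have "y \<le> real a / (real m / \<rho>)" using that by (auto simp: strip_eq[OF m\<rho>] split: if_splits)
    also have "\<dots> \<le> real m / (real m / \<rho>)" using \<open>a \<le> m\<close> m\<rho> by (intro divide_right_mono) auto
    finally show ?thesis using m \<rho> by simp
  qed
  then show ?thesis by (auto simp: cell_def col_def strip_def intro: less_imp_le)
qed

lemma cell_disjoint: "p \<in> cell c \<Longrightarrow> p \<in> cell c' \<Longrightarrow> c = c'"
  using strip_disjoint pos(1) by (auto simp: cell_def inj_def split: prod.splits)

lemma occupied_event: "{\<omega> \<in> space P. occupied \<omega> = B} \<in> sets \<sigma>\<xi>"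
proof -
  have "occupied \<omega> = B \<longleftrightarrow> B \<subseteq> V \<times> {1..m} \<and> (\<forall>c. c \<in> V \<times> {1..m} \<longrightarrow> ((\<exists>i. \<xi> i \<omega> \<in> cell c) \<longleftrightarrow> c \<in> B))" for \<omega>
    unfolding occupied_def by blast
  moreover have "{\<omega> \<in> space \<sigma>\<xi>. B \<subseteq> V \<times> {1..m} \<and> (\<forall>c. c \<in> V \<times> {1..m} \<longrightarrow> ((\<exists>i. \<xi> i \<omega> \<in> cell c) \<longleftrightarrow> c \<in> B))} \<in> sets \<sigma>\<xi>"
    by measurable
  ultimately have "{\<omega> \<in> space \<sigma>\<xi>. occupied \<omega> = B} \<in> sets \<sigma>\<xi>" by (simp only:)
  then show ?thesis by simp
qed

text \<open>
  Disjoint cells contain independent Poisson numbers of points. The law depends on \<open>\<rho>\<close> and \<open>u\<close> only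
  through \<open>\<rho> / u\<close> and not at all on \<open>pos\<close>.
\<close>

lemma occupied_law:
  assumes "B \<subseteq> V \<times> {1..m}"
  shows "prob {\<omega> \<in> space P. occupied \<omega> = B} = subset_weight (\<lambda>_. 1 - exp (- (lam / m))) (V \<times> {1..m}) B"
proof -
  let ?J = "V \<times> {1..m}"
  have fJ: "finite ?J" using V by simp
  obtain f where f: "bij_betw f {..<card ?J} ?J"
    using ex_bij_betw_nat_finite[OF fJ] by (auto simp: atLeast0LessThan)
  define A where "A k = (if k < card ?J then cell (f k) else {})" for k
  define N where "N k \<omega> = card {i. \<xi> i \<omega> \<in> A k}" for k \<omega>
  have "disjoint_family A"
  proof -
    have "A k \<inter> A l = {}" if "k \<noteq> l" for k l
    proof (cases "k < card ?J \<and> l < card ?J")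
      case True
      then have "f k \<noteq> f l" using f that unfolding bij_betw_def inj_on_def by blast
      then have "cell (f k) \<inter> cell (f l) = {}" using cell_disjoint by blast
      then show ?thesis using True by (simp add: A_def)
    qed (auto simp: A_def)
    then show ?thesis by (auto simp: disjoint_family_on_def)
  qed
  moreover have Am: "A k \<in> sets \<nu> \<and> emeasure \<nu> (A k) < \<infinity>" for k
    using cell_fin by (auto simp: A_def)
  ultimately have ind: "indep_vars (\<lambda>_. count_space UNIV) N UNIV"
    using sampling unfolding graphon_sampling_def poisson_point_process_def N_def by blast
  have indI: "indep_vars (\<lambda>_. count_space UNIV) N {..<card ?J}"
    by (rule indep_vars_subset[OF ind]) auto
  have AEfin: "AE \<omega> in P. \<forall>k. finite {i. \<xi> i \<omega> \<in> A k}"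
    using poisson_count(1) Am by (simp add: AE_all_countable)
  have Nm [measurable]: "N k \<in> P \<rightarrow>\<^sub>M count_space UNIV" for k
    using ind by (auto simp: indep_vars_def)
  have p: "prob {\<omega> \<in> space P. N k \<omega> \<noteq> 0} = 1 - exp (- (lam / m))" if k: "k \<in> {..<card ?J}" for k
  proof -
    have "f k \<in> ?J" using f k by (auto simp: bij_betw_def)
    then have meas: "measure \<nu> (A k) = lam / m"
      using cell_measure(3)[of "f k"] k lam by (simp add: A_def measure_def)
    have "prob {\<omega> \<in> space P. N k \<omega> = 0} = exp (- (lam / m))"
      using poisson_count(2)[of "A k"] Am[of k] meas unfolding poisson_distributed_def N_def
      by (auto elim: allE[of _ 0])
    moreover have "prob {\<omega> \<in> space P. N k \<omega> \<noteq> 0} = 1 - prob {\<omega> \<in> space P. N k \<omega> = 0}"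
      by (rule prob_neg) measurable
    ultimately show ?thesis by simp
  qed
  define T where "T = {k \<in> {..<card ?J}. f k \<in> B}"
  have "prob {\<omega> \<in> space P. {k \<in> {..<card ?J}. N k \<omega> \<noteq> 0} = T} =
    subset_weight (\<lambda>_. 1 - exp (- (lam / m))) {..<card ?J} T"
    using p by (intro prob_random_subset[OF indI]) (auto simp: T_def)
  also have "\<dots> = subset_weight (\<lambda>_. 1 - exp (- (lam / m))) ?J B"
    unfolding subset_weight_def prod.reindex_bij_betw[OF f, symmetric]
    by (intro prod.cong) (auto simp: T_def)
  also have "prob {\<omega> \<in> space P. {k \<in> {..<card ?J}. N k \<omega> \<noteq> 0} = T} = prob {\<omega> \<in> space P. occupied \<omega> = B}"
  proof (rule finite_measure_eq_AE)
    show "AE \<omega> in P. \<omega> \<in> {\<omega> \<in> space P. {k \<in> {..<card ?J}. N k \<omega> \<noteq> 0} = T} \<longleftrightarrow>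
      \<omega> \<in> {\<omega> \<in> space P. occupied \<omega> = B}"
      using AEfin
    proof eventually_elim
      case (elim \<omega>)
      have occ: "occupied \<omega> = f ` {k \<in> {..<card ?J}. N k \<omega> \<noteq> 0}"
      proof -
        have N: "(\<exists>i. \<xi> i \<omega> \<in> cell (f k)) \<longleftrightarrow> N k \<omega> \<noteq> 0" if "k < card ?J" for k
        proof -
          have "finite {i. \<xi> i \<omega> \<in> A k}" using elim by blast
          then show ?thesis using that by (auto simp: N_def A_def card_eq_0_iff)
        qed
        have "?J = f ` {..<card ?J}" using f by (simp add: bij_betw_def)
        then have "occupied \<omega> = {c \<in> f ` {..<card ?J}. \<exists>i. \<xi> i \<omega> \<in> cell c}"
          unfolding occupied_def by (simp only:)
        also have "\<dots> = f ` {k \<in> {..<card ?J}. \<exists>i. \<xi> i \<omega> \<in> cell (f k)}" by blast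
        also have "{k \<in> {..<card ?J}. \<exists>i. \<xi> i \<omega> \<in> cell (f k)} = {k \<in> {..<card ?J}. N k \<omega> \<noteq> 0}"
          using N by auto
        finally show ?thesis .
      qed
      have BT: "B = f ` T"
      proof -
        have "B \<subseteq> f ` {..<card ?J}" using f assms unfolding bij_betw_def by blast
        then show ?thesis unfolding T_def by blast
      qed
      have "occupied \<omega> = B \<longleftrightarrow> {k \<in> {..<card ?J}. N k \<omega> \<noteq> 0} = T"
        unfolding occ BT using f by (intro inj_on_image_eq_iff[of f "{..<card ?J}"]) (auto simp: bij_betw_def T_def)
      then show ?case by auto
    qed
    have "{k \<in> {..<card ?J}. N k \<omega> \<noteq> 0} = T \<longleftrightarrow> (\<forall>k. k < card ?J \<longrightarrow> (N k \<omega> \<noteq> 0 \<longleftrightarrow> k \<in> T))" for \<omega>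
      unfolding T_def by blast
    moreover have "{\<omega> \<in> space P. \<forall>k. k < card ?J \<longrightarrow> (N k \<omega> \<noteq> 0 \<longleftrightarrow> k \<in> T)} \<in> events"
      by measurable
    ultimately show "{\<omega> \<in> space P. {k \<in> {..<card ?J}. N k \<omega> \<noteq> 0} = T} \<in> events" by (simp only:)
    show "{\<omega> \<in> space P. occupied \<omega> = B} \<in> events"
      using occupied_event \<sigma>_events by blast
  qed
  finally show ?thesis .
qed

lemma separated_event [measurable]: "{\<omega> \<in> space P. separated \<omega>} \<in> sets \<sigma>\<xi>"
proof -
  have "{\<omega> \<in> space \<sigma>\<xi>. separated \<omega>} \<in> sets \<sigma>\<xi>"
    unfolding separated_def using V by measurable
  then show ?thesis by simp
qed

text \<open>
  With \<open>O(m)\<close> vertices and \<open>lam = O(1 / m)\<close> both terms are \<open>O(1 / m)\<close>.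
\<close>

lemma prob_not_separated:
  "prob {\<omega> \<in> space P. \<not> separated \<omega>} \<le> card V * lam\<^sup>2 + (card V * lam)\<^sup>2 / m"
proof -
  let ?X = "\<lambda>x. {\<omega> \<in> space P. \<exists>i j. i \<noteq> j \<and> \<xi> i \<omega> \<in> col x \<and> \<xi> j \<omega> \<in> col x}"
  let ?Y = "\<lambda>a. {\<omega> \<in> space P. \<exists>i j. i \<noteq> j \<and> \<xi> i \<omega> \<in> row a \<and> \<xi> j \<omega> \<in> row a}"
  have [measurable]: "?X x \<in> events" "?Y a \<in> events" for x a by measurable
  have X: "prob (\<Union>x\<in>V. ?X x) \<le> card V * lam\<^sup>2"
  proof -
    have "prob (\<Union>x\<in>V. ?X x) \<le> (\<Sum>x\<in>V. prob (?X x))"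
      using V by (intro finite_measure_subadditive_finite) auto
    also have "\<dots> \<le> (\<Sum>x\<in>V. lam\<^sup>2)"
    proof (rule sum_mono)
      fix x
      have "prob (?X x) \<le> (measure \<nu> (col x))\<^sup>2"
        using col_measure by (intro prob_two_points_le)
      also have "\<dots> \<le> lam\<^sup>2" using col_measure(3) by (intro power_mono) auto
      finally show "prob (?X x) \<le> lam\<^sup>2" .
    qed
    finally show ?thesis by simp
  qed
  have Y: "prob (\<Union>a\<in>{1..m}. ?Y a) \<le> (card V * lam)\<^sup>2 / m"
  proof -
    have "prob (\<Union>a\<in>{1..m}. ?Y a) \<le> (\<Sum>a\<in>{1..m}. prob (?Y a))"
      by (intro finite_measure_subadditive_finite) auto
    also have "\<dots> \<le> (\<Sum>a\<in>{1..m}. (card V * lam / m)\<^sup>2)"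
    proof (rule sum_mono)
      fix a
      have "prob (?Y a) \<le> (measure \<nu> (row a))\<^sup>2"
        using row_measure by (intro prob_two_points_le)
      also have "\<dots> \<le> (card V * lam / m)\<^sup>2" using row_measure(3) by (intro power_mono) auto
      finally show "prob (?Y a) \<le> (card V * lam / m)\<^sup>2" .
    qed
    also have "\<dots> = (card V * lam)\<^sup>2 / m" using m by (simp add: power2_eq_square field_simps)
    finally show ?thesis by simp
  qed
  have "prob {\<omega> \<in> space P. \<not> separated \<omega>} \<le> prob ((\<Union>x\<in>V. ?X x) \<union> (\<Union>a\<in>{1..m}. ?Y a))"
  proof (rule finite_measure_mono)
    show "{\<omega> \<in> space P. \<not> separated \<omega>} \<subseteq> (\<Union>x\<in>V. ?X x) \<union> (\<Union>a\<in>{1..m}. ?Y a)"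
      unfolding separated_def by blast
    show "(\<Union>x\<in>V. ?X x) \<union> (\<Union>a\<in>{1..m}. ?Y a) \<in> events"
      using V by (intro sets.Un sets.finite_UN) auto
  qed
  also have "\<dots> \<le> prob (\<Union>x\<in>V. ?X x) + prob (\<Union>a\<in>{1..m}. ?Y a)"
    using V by (intro measure_Un_le sets.finite_UN) auto
  finally show ?thesis using X Y by simp
qed

lemma AE_finite_points: "AE \<omega> in P. finite {i. \<exists>x\<in>V. \<xi> i \<omega> \<in> col x}"
proof -
  have "AE \<omega> in P. \<forall>x\<in>V. finite {i. \<xi> i \<omega> \<in> col x}"
    using V col_measure poisson_count(1) by (simp add: AE_finite_all)
  then show ?thesis
  proof eventually_elim
    case (elim \<omega>)
    have "{i. \<exists>x\<in>V. \<xi> i \<omega> \<in> col x} = (\<Union>x\<in>V. {i. \<xi> i \<omega> \<in> col x})" by auto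
    then show ?case using V elim by simp
  qed
qed

lemma history_separated:
  assumes \<omega>: "\<omega> \<in> space P" and sep: "separated \<omega>" and tpos: "\<And>i. 0 < snd (\<xi> i \<omega>)"
    and fin: "finite {i. \<exists>x\<in>V. \<xi> i \<omega> \<in> col x}"
    and F: "\<And>e. e \<in> F \<Longrightarrow> card e = 2"
    and adj: "\<And>i j. i < j \<Longrightarrow> snd (\<xi> i \<omega>) \<le> \<rho> \<Longrightarrow> snd (\<xi> j \<omega>) \<le> \<rho> \<Longrightarrow>
       U i j \<omega> < W (fst (\<xi> i \<omega>)) (fst (\<xi> j \<omega>)) \<longleftrightarrow>
       (\<exists>x\<in>V. \<exists>y\<in>V. \<xi> i \<omega> \<in> col x \<and> \<xi> j \<omega> \<in> col y \<and> {x, y} \<in> F)"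
  shows "history W \<rho> \<omega> = discrete_history m (occupied \<omega>) F"
proof -
  define Q where "Q = {i. \<exists>x\<in>V. \<xi> i \<omega> \<in> col x}"
  define x where "x i = inv pos (nat \<lceil>u * fst (\<xi> i \<omega>)\<rceil>)" for i
  define a where "a i = nat \<lceil>real m / \<rho> * snd (\<xi> i \<omega>)\<rceil>" for i
  have col_x: "x i = y" if "\<xi> i \<omega> \<in> col y" for i y
    using that pos(1) by (auto simp: x_def col_def strip_def mem_Times_iff)
  have Q: "i \<in> Q \<Longrightarrow> x i \<in> V \<and> \<xi> i \<omega> \<in> col (x i)" for i
    using col_x by (auto simp: Q_def)
  have a: "a i \<in> {1..m}" if "i \<in> Q" for i
  proof -
    have "snd (\<xi> i \<omega>) \<le> \<rho>" using Q[OF that] by (auto simp: col_def)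
    then have "real m / \<rho> * snd (\<xi> i \<omega>) \<le> real m / \<rho> * \<rho>" using m\<rho> by (intro mult_left_mono) auto
    then have "real m / \<rho> * snd (\<xi> i \<omega>) \<le> real m" using \<rho> by simp
    moreover have "0 < real m / \<rho> * snd (\<xi> i \<omega>)" using m\<rho> tpos[of i] by (rule mult_pos_pos)
    ultimately show ?thesis unfolding a_def by (auto simp: nat_le_iff ceiling_le_iff Suc_le_eq)
  qed
  have cell: "\<xi> i \<omega> \<in> cell (x i, a i)" if "i \<in> Q" for i
    using Q[OF that] tpos[of i] by (auto simp: cell_def col_def strip_def a_def mem_Times_iff)
  have occ: "occupied \<omega> = (\<lambda>i. (x i, a i)) ` Q"
  proof (intro set_eqI iffI)
    fix c assume "c \<in> occupied \<omega>"
    then obtain i where i: "c \<in> V \<times> {1..m}" "\<xi> i \<omega> \<in> cell c" by (auto simp: occupied_def)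
    then have "i \<in> Q" using cell_subset_col[of "snd c" "fst c"] by (cases c) (auto simp: Q_def)
    then show "c \<in> (\<lambda>i. (x i, a i)) ` Q" using cell_disjoint[OF i(2) cell] by blast
  next
    fix c assume "c \<in> (\<lambda>i. (x i, a i)) ` Q"
    then show "c \<in> occupied \<omega>" using Q a cell by (auto simp: occupied_def)
  qed
  have "(\<lambda>r. unlabelled (birth_edges (\<lambda>i. snd (\<xi> i \<omega>)) (\<lambda>i j. U i j \<omega> < W (fst (\<xi> i \<omega>)) (fst (\<xi> j \<omega>))) r)) ` {0..\<rho>}
     = discrete_history m ((\<lambda>i. (x i, a i)) ` Q) F"
  proof (rule history_match)
    show "finite Q" using fin by (simp add: Q_def)
    show "card e = 2" if "e \<in> F" for e using F that .
    show "U i j \<omega> < W (fst (\<xi> i \<omega>)) (fst (\<xi> j \<omega>)) \<longleftrightarrow> i \<in> Q \<and> j \<in> Q \<and> {x i, x j} \<in> F"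
      if "i < j" "snd (\<xi> i \<omega>) \<le> \<rho>" "snd (\<xi> j \<omega>) \<le> \<rho>" for i j
      unfolding adj[OF that] using col_x Q by (auto simp: Q_def) 
    show "inj_on x Q"
      using sep Q unfolding separated_def by (metis inj_onI)
    show "inj_on a Q"
    proof (rule inj_onI, rule ccontr)
      fix i j assume ij: "i \<in> Q" "j \<in> Q" "a i = a j" "i \<noteq> j"
      have "\<xi> i \<omega> \<in> row (a i)" "\<xi> j \<omega> \<in> row (a i)" using cell ij Q unfolding row_def by (metis UN_I)+
      then show False using sep a ij unfolding separated_def by blast
    qed
    show "a ` Q \<subseteq> {1..m}" using a by blast
    show "snd (\<xi> i \<omega>) < snd (\<xi> j \<omega>)" if "a i < a j" for i j
    proof (rule ccontr)
      assume "\<not> ?thesis"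
      then have "real m / \<rho> * snd (\<xi> j \<omega>) \<le> real m / \<rho> * snd (\<xi> i \<omega>)" using m\<rho> by (intro mult_left_mono) auto
      then have "a j \<le> a i" unfolding a_def by (intro nat_mono ceiling_mono)
      then show False using that by simp
    qed
    show "0 < snd (\<xi> i \<omega>) \<and> snd (\<xi> i \<omega>) \<le> \<rho>" if "i \<in> Q" for i
      using Q[OF that] tpos by (auto simp: col_def)
    show "0 \<le> \<rho>" using \<rho> by simp
  qed
  then show ?thesis unfolding history_def graphon_graph_def edges_at_birth_edges occ .
qed

end

section \<open>Sampling from a stretched finite graph\<close>

lemma graphon_stretched:
  "graphon (stretched_graphon E l s)"
proof -
  let ?h = "\<lambda>i j. if i \<in> {1..card (\<Union>E)} \<and> j \<in> {1..card (\<Union>E)} \<and> {l i, l j} \<in> E then 1 else (0 :: real)"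
  have eq: "stretched_graphon E l s x y = ?h (nat \<lceil>s * x\<rceil>) (nat \<lceil>s * y\<rceil>)" for x y
    by (simp add: stretched_graphon_def Let_def)
  have [measurable]: "(\<lambda>p :: real \<times> real. nat \<lceil>s * fst p\<rceil>) \<in> (borel \<Otimes>\<^sub>M borel) \<rightarrow>\<^sub>M count_space UNIV"
    "(\<lambda>p :: real \<times> real. nat \<lceil>s * snd p\<rceil>) \<in> (borel \<Otimes>\<^sub>M borel) \<rightarrow>\<^sub>M count_space UNIV"
    by measurable
  have "(\<lambda>p. ?h (nat \<lceil>s * fst p\<rceil>) (nat \<lceil>s * snd p\<rceil>)) \<in> borel_measurable (borel \<Otimes>\<^sub>M borel)"
    by measurable
  then have "(\<lambda>(x, y). stretched_graphon E l s x y) \<in> borel_measurable borel"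
    unfolding borel_prod by (simp add: eq case_prod_beta)
  then have "(\<lambda>(x, y). stretched_graphon E l s x y) \<in> borel_measurable (restrict_space borel ({0<..} \<times> {0<..}))"
    by (rule measurable_restrict_space1)
  then show ?thesis
    by (auto simp: graphon_def eq insert_commute)
qed

lemma (in sampling) AE_finite_points_rectangle:
  "AE \<omega> in P. finite {i. fst (\<xi> i \<omega>) \<le> b \<and> snd (\<xi> i \<omega>) \<le> r}"
proof -
  have m: "{0<..b} \<times> {0..r} \<in> sets \<nu>"
    and e: "emeasure \<nu> ({0<..b} \<times> {0..r}) = emeasure lborel {0<..b} * emeasure lborel {0..r}"
    by (intro emeasure_Times; auto)+
  have "emeasure lborel {0<..b} * emeasure lborel {0..r} < \<infinity>"
  proof -
    have "emeasure lborel {0<..b} < \<infinity>" "emeasure lborel {0..r} < \<infinity>"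
      by (cases "0 \<le> b"; simp) (simp add: emeasure_lborel_Icc_eq)
    then show ?thesis by (simp add: ennreal_mult_less_top)
  qed
  then have "AE \<omega> in P. finite {i. \<xi> i \<omega> \<in> {0<..b} \<times> {0..r}}"
    using poisson_count(1)[OF m] e by simp
  then show ?thesis
    using AE_space
  proof eventually_elim
    case (elim \<omega>)
    have "{i. fst (\<xi> i \<omega>) \<le> b \<and> snd (\<xi> i \<omega>) \<le> r} = {i. \<xi> i \<omega> \<in> {0<..b} \<times> {0..r}}"
      using \<xi>_pos[OF elim(2)] by (auto simp: mem_Times_iff)
    then show ?case using elim by simp
  qed
qed

lemma (in sampling) admissible_stretched:
  assumes "s \<ge> 0"
  shows "admissible_graphon P \<xi> U (stretched_graphon E l s)"
proof -
  have "AE \<omega> in P. finite (edges_at (stretched_graphon E l s) r \<omega>)" for r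
    using AE_finite_points_rectangle[of "card (\<Union>E) / s" r] AE_U
  proof eventually_elim
    case (elim \<omega>)
    let ?I = "{i. fst (\<xi> i \<omega>) \<le> card (\<Union>E) / s \<and> snd (\<xi> i \<omega>) \<le> r}"
    have le: "x \<le> card (\<Union>E) / s" if "nat \<lceil>s * x\<rceil> \<in> {1..card (\<Union>E)}" for x
    proof -
      have "s * x \<le> card (\<Union>E)" "s * x > 0" using that by (auto simp: nat_le_iff ceiling_le_iff Suc_le_eq)
      then have "s > 0" using assms by (cases "s = 0") auto
      then show ?thesis using \<open>s * x \<le> card (\<Union>E)\<close> by (simp add: field_simps)
    qed
    have "edges_at (stretched_graphon E l s) r \<omega> \<subseteq> Pow ?I"
    proof
      fix e assume "e \<in> edges_at (stretched_graphon E l s) r \<omega>"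
      then obtain i j where ij: "e = {i, j}" "i < j" "snd (\<xi> i \<omega>) \<le> r" "snd (\<xi> j \<omega>) \<le> r"
        "U i j \<omega> < stretched_graphon E l s (fst (\<xi> i \<omega>)) (fst (\<xi> j \<omega>))" unfolding sampled_edges_def by blast
      moreover have "0 \<le> U i j \<omega>" using elim(2) ij(2) by blast
      ultimately have "stretched_graphon E l s (fst (\<xi> i \<omega>)) (fst (\<xi> j \<omega>)) \<noteq> 0" by linarith
      then have "nat \<lceil>s * fst (\<xi> i \<omega>)\<rceil> \<in> {1..card (\<Union>E)}" "nat \<lceil>s * fst (\<xi> j \<omega>)\<rceil> \<in> {1..card (\<Union>E)}"
        unfolding stretched_graphon_def Let_def by (meson)+
      then show "e \<in> Pow ?I" using le ij by simp
    qed
    then show ?case using elim(1) finite_subset by blast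
  qed
  then show ?thesis by (simp add: admissible_graphon_def graphon_stretched)
qed

lemma (in prob_space) prob_diff_le:
  assumes "A \<in> events" "A' \<in> events" "Z \<in> events"
    and "AE \<omega> in M. \<omega> \<notin> Z \<longrightarrow> (\<omega> \<in> A \<longleftrightarrow> \<omega> \<in> A')"
  shows "\<bar>prob A - prob A'\<bar> \<le> prob Z"
proof -
  have 1: "prob A \<le> prob (A' \<union> Z)" "prob A' \<le> prob (A \<union> Z)"
    using assms by (auto intro!: finite_measure_mono_AE elim!: eventually_mono)
  have "prob (A' \<union> Z) \<le> prob A' + prob Z" "prob (A \<union> Z) \<le> prob A + prob Z"
    using assms by (auto intro: measure_Un_le)
  then show ?thesis using 1 by linarith
qed

lemma (in prob_space) prob_finite_valued:
  assumes "finite S" "\<And>\<omega>. \<omega> \<in> space M \<Longrightarrow> Y \<omega> \<in> S" and ev: "\<And>s. s \<in> S \<Longrightarrow> {\<omega> \<in> space M. Y \<omega> = s} \<in> events"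
  shows "{\<omega> \<in> space M. \<phi> (Y \<omega>)} \<in> events"
    and "prob {\<omega> \<in> space M. \<phi> (Y \<omega>)} = (\<Sum>s\<in>S. prob {\<omega> \<in> space M. Y \<omega> = s} * of_bool (\<phi> s))"
proof -
  have eq: "{\<omega> \<in> space M. \<phi> (Y \<omega>)} = (\<Union>s\<in>{s \<in> S. \<phi> s}. {\<omega> \<in> space M. Y \<omega> = s})"
    using assms(2) by auto
  show "{\<omega> \<in> space M. \<phi> (Y \<omega>)} \<in> events" unfolding eq using assms(1) ev by (intro sets.finite_UN) auto
  have "prob (\<Union>s\<in>{s \<in> S. \<phi> s}. {\<omega> \<in> space M. Y \<omega> = s}) = (\<Sum>s\<in>{s \<in> S. \<phi> s}. prob {\<omega> \<in> space M. Y \<omega> = s})"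
    using assms(1) ev by (intro finite_measure_finite_Union) (auto simp: disjoint_family_on_def)
  also have "\<dots> = (\<Sum>s\<in>S. prob {\<omega> \<in> space M. Y \<omega> = s} * of_bool (\<phi> s))"
    using assms(1) by (intro sum.mono_neutral_cong_left) auto
  finally show "prob {\<omega> \<in> space M. \<phi> (Y \<omega>)} = (\<Sum>s\<in>S. prob {\<omega> \<in> space M. Y \<omega> = s} * of_bool (\<phi> s))"
    unfolding eq .
qed

context cells
begin

definition weight :: "(nat \<times> nat) set \<Rightarrow> real" where
  "weight B = subset_weight (\<lambda>_. 1 - exp (- (lam / m))) (V \<times> {1..m}) B"

lemma prob_occupied:
  "{\<omega> \<in> space P. \<phi> (occupied \<omega>)} \<in> events"
  "prob {\<omega> \<in> space P. \<phi> (occupied \<omega>)} = (\<Sum>B\<in>Pow (V \<times> {1..m}). weight B * of_bool (\<phi> B))"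
proof -
  have "finite (Pow (V \<times> {1..m}))" using V by simp
  moreover have "occupied \<omega> \<in> Pow (V \<times> {1..m})" for \<omega> by (auto simp: occupied_def)
  moreover have "{\<omega> \<in> space P. occupied \<omega> = B} \<in> events" for B
    using occupied_event \<sigma>_events by blast
  ultimately have *: "{\<omega> \<in> space P. \<phi> (occupied \<omega>)} \<in> events"
    "prob {\<omega> \<in> space P. \<phi> (occupied \<omega>)} =
      (\<Sum>B\<in>Pow (V \<times> {1..m}). prob {\<omega> \<in> space P. occupied \<omega> = B} * of_bool (\<phi> B))"
    by (rule prob_finite_valued)+
  show "{\<omega> \<in> space P. \<phi> (occupied \<omega>)} \<in> events" by fact
  show "prob {\<omega> \<in> space P. \<phi> (occupied \<omega>)} = (\<Sum>B\<in>Pow (V \<times> {1..m}). weight B * of_bool (\<phi> B))"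
    unfolding *(2) weight_def by (intro sum.cong refl) (simp add: occupied_law)
qed

lemma col_pair_measure:
  shows [measurable]: "col x \<union> col y \<in> sets \<nu>" and "emeasure \<nu> (col x \<union> col y) < \<infinity>"
    "measure \<nu> (col x \<union> col y) \<le> 2 * lam"
proof -
  show "col x \<union> col y \<in> sets \<nu>" by measurable
  have "emeasure \<nu> (col x \<union> col y) \<le> emeasure \<nu> (col x) + emeasure \<nu> (col y)"
    by (intro emeasure_subadditive) auto
  also have "\<dots> \<le> ennreal lam + ennreal lam" by (intro add_mono col_measure)
  also have "\<dots> = ennreal (2 * lam)" using lam by (simp add: ennreal_plus[symmetric] del: ennreal_plus)
  finally have 1: "emeasure \<nu> (col x \<union> col y) \<le> ennreal (2 * lam)" .
  then show "emeasure \<nu> (col x \<union> col y) < \<infinity>" by (auto simp: less_top[symmetric] top_unique)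
  show "measure \<nu> (col x \<union> col y) \<le> 2 * lam"
    using 1 lam unfolding measure_def by (simp add: enn2real_leI)
qed

text \<open>
  The probability that two given vertices are both hit; it is the bound required of the weights in
  \<open>prob_weighted_average_deviation\<close>.
\<close>

lemma sum_weight_edge:
  assumes "x \<in> V" "y \<in> V" "x \<noteq> y"
  shows "(\<Sum>B\<in>{B \<in> Pow (V \<times> {1..m}). x \<in> fst ` B \<and> y \<in> fst ` B}. weight B) \<le> 4 * lam\<^sup>2"
proof -
  note [measurable] = col_measure(1)
  have "(\<Sum>B\<in>{B \<in> Pow (V \<times> {1..m}). x \<in> fst ` B \<and> y \<in> fst ` B}. weight B) =
      (\<Sum>B\<in>Pow (V \<times> {1..m}). weight B * of_bool (x \<in> fst ` B \<and> y \<in> fst ` B))"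
    using V by (intro sum.mono_neutral_cong_left) auto
  also have "\<dots> = prob {\<omega> \<in> space P. x \<in> fst ` occupied \<omega> \<and> y \<in> fst ` occupied \<omega>}"
    using prob_occupied(2)[of "\<lambda>B. x \<in> fst ` B \<and> y \<in> fst ` B"] by simp
  also have "\<dots> \<le> prob {\<omega> \<in> space P. \<exists>i j. i \<noteq> j \<and> \<xi> i \<omega> \<in> col x \<union> col y \<and> \<xi> j \<omega> \<in> col x \<union> col y}"
  proof (rule finite_measure_mono)
    have occ: "\<exists>i. \<xi> i \<omega> \<in> col z" if "z \<in> fst ` occupied \<omega>" for z \<omega>
      using that cell_subset_col unfolding occupied_def by fastforce
    have ne: "i \<noteq> j" if "\<xi> i \<omega> \<in> col x" "\<xi> j \<omega> \<in> col y" for i j \<omega>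
    proof
      assume "i = j"
      then have "pos x = pos y" using that by (auto simp: col_def strip_def)
      then show False using pos(1) assms(3) by (simp add: inj_eq)
    qed
    show "{\<omega> \<in> space P. x \<in> fst ` occupied \<omega> \<and> y \<in> fst ` occupied \<omega>} \<subseteq>
      {\<omega> \<in> space P. \<exists>i j. i \<noteq> j \<and> \<xi> i \<omega> \<in> col x \<union> col y \<and> \<xi> j \<omega> \<in> col x \<union> col y}"
    proof (rule Collect_mono, rule impI, elim conjE, intro conjI)
      fix \<omega> assume "x \<in> fst ` occupied \<omega>" "y \<in> fst ` occupied \<omega>"
      then obtain i j where "\<xi> i \<omega> \<in> col x" "\<xi> j \<omega> \<in> col y" using occ by metis
      then show "\<exists>i j. i \<noteq> j \<and> \<xi> i \<omega> \<in> col x \<union> col y \<and> \<xi> j \<omega> \<in> col x \<union> col y" using ne by blast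
    qed
  qed measurable
  also have "\<dots> \<le> (measure \<nu> (col x \<union> col y))\<^sup>2"
    by (intro prob_two_points_le col_pair_measure)
  also have "\<dots> \<le> (2 * lam)\<^sup>2"
    by (intro power_mono col_pair_measure) auto
  finally show ?thesis by (simp add: power2_eq_square)
qed

lemma point_in_cols:
  assumes "finite X"
  shows "{\<omega> \<in> space P. \<exists>x\<in>X. \<exists>i. \<xi> i \<omega> \<in> col x} \<in> events"
    and "prob {\<omega> \<in> space P. \<exists>x\<in>X. \<exists>i. \<xi> i \<omega> \<in> col x} \<le> card X * lam"
proof -
  note [measurable] = col_measure(1)
  have m: "{\<omega> \<in> space P. \<exists>i. \<xi> i \<omega> \<in> col x} \<in> events" for x by measurable
  have eq: "{\<omega> \<in> space P. \<exists>x\<in>X. \<exists>i. \<xi> i \<omega> \<in> col x} = (\<Union>x\<in>X. {\<omega> \<in> space P. \<exists>i. \<xi> i \<omega> \<in> col x})" by auto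
  show "{\<omega> \<in> space P. \<exists>x\<in>X. \<exists>i. \<xi> i \<omega> \<in> col x} \<in> events"
    unfolding eq using m assms by (intro sets.finite_UN) auto
  have "prob (\<Union>x\<in>X. {\<omega> \<in> space P. \<exists>i. \<xi> i \<omega> \<in> col x}) \<le> (\<Sum>x\<in>X. prob {\<omega> \<in> space P. \<exists>i. \<xi> i \<omega> \<in> col x})"
    using m assms by (intro finite_measure_subadditive_finite) auto
  also have "\<dots> \<le> (\<Sum>x\<in>X. lam)"
    using prob_point_le col_measure by (intro sum_mono) (meson order_trans)
  finally show "prob {\<omega> \<in> space P. \<exists>x\<in>X. \<exists>i. \<xi> i \<omega> \<in> col x} \<le> card X * lam" unfolding eq by simp
qed

end

text \<open>
  \<open>E\<close> is the sampled graph and \<open>E0\<close> its discretised counterpart on the window \<open>V\<close>. Each edge on which they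
  differ touches the vertices \<open>X0\<close> below the window or belongs to the small set \<open>D\<close>.
\<close>

locale quenched = cells +
  fixes E :: "nat set set" and l :: "nat \<Rightarrow> nat" and X0 :: "nat set" and D E0 :: "nat set set"
  assumes E: "fin_graph E" and l: "bij_betw l {1..card (\<Union>E)} (\<Union>E)"
    and pos_l: "\<And>k. k \<in> {1..card (\<Union>E)} \<Longrightarrow> pos (l k) = k"
    and X0: "finite X0" and D: "finite D" "\<And>e. e \<in> D \<Longrightarrow> card e = 2"
    and E0: "E0 \<subseteq> E" "\<Union>E0 \<subseteq> V"
    and covered: "\<And>e. e \<in> E \<Longrightarrow> e \<inter> X0 \<noteq> {} \<or> e \<in> E0 \<or> e \<in> D"
begin

abbreviation WE :: "real \<Rightarrow> real \<Rightarrow> real" where "WE \<equiv> stretched_graphon E l u"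

text \<open>
  Outside this event no sampled pair notices a difference between \<open>E\<close> and \<open>E0\<close>.
\<close>

definition stray :: "'a set" where
  "stray = {\<omega> \<in> space P. \<exists>x\<in>X0. \<exists>i. \<xi> i \<omega> \<in> col x} \<union>
     (\<Union>e\<in>D. {\<omega> \<in> space P. \<exists>i j. i \<noteq> j \<and> \<xi> i \<omega> \<in> (\<Union>x\<in>e. col x) \<and> \<xi> j \<omega> \<in> (\<Union>x\<in>e. col x)})"

lemma stray:
  shows "stray \<in> events" and "prob stray \<le> card X0 * lam + 4 * card D * lam\<^sup>2"
proof -
  note [measurable] = col_measure(1)
  let ?Z = "\<lambda>e. {\<omega> \<in> space P. \<exists>i j. i \<noteq> j \<and> \<xi> i \<omega> \<in> (\<Union>x\<in>e. col x) \<and> \<xi> j \<omega> \<in> (\<Union>x\<in>e. col x)}"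
  have Z: "?Z e \<in> events \<and> prob (?Z e) \<le> 4 * lam\<^sup>2" if "e \<in> D" for e
  proof -
    obtain x y where e: "e = {x, y}" using D(2)[OF \<open>e \<in> D\<close>] by (meson card_2_iff)
    have "prob (?Z e) \<le> (measure \<nu> (col x \<union> col y))\<^sup>2"
      using prob_two_points_le[OF col_pair_measure(1,2), of x y] unfolding e by simp
    also have "\<dots> \<le> (2 * lam)\<^sup>2" by (intro power_mono col_pair_measure) auto
    finally show ?thesis unfolding e by (simp add: power2_eq_square)
  qed
  show "stray \<in> events"
    unfolding stray_def using point_in_cols[OF X0] Z D by (intro sets.Un sets.finite_UN) auto
  have "prob stray \<le> prob {\<omega> \<in> space P. \<exists>x\<in>X0. \<exists>i. \<xi> i \<omega> \<in> col x} + prob (\<Union>e\<in>D. ?Z e)"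
    unfolding stray_def using point_in_cols[OF X0] Z D by (intro measure_Un_le sets.finite_UN) auto
  also have "prob (\<Union>e\<in>D. ?Z e) \<le> (\<Sum>e\<in>D. prob (?Z e))"
    using Z D by (intro finite_measure_subadditive_finite) auto
  also have "\<dots> \<le> (\<Sum>e\<in>D. 4 * lam\<^sup>2)" using Z by (intro sum_mono) auto
  finally show "prob stray \<le> card X0 * lam + 4 * card D * lam\<^sup>2"
    using point_in_cols(2)[OF X0] by simp
qed

lemma WE_eq: "0 < y \<Longrightarrow> 0 < z \<Longrightarrow>
   WE y z = of_bool (\<exists>x x'. {x, x'} \<in> E \<and> y \<in> strip u (pos x) \<and> z \<in> strip u (pos x'))"
proof -
  assume yz: "0 < y" "0 < z"
  let ?N = "{1..card (\<Union>E)}"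
  let ?i = "nat \<lceil>u * y\<rceil>" and ?j = "nat \<lceil>u * z\<rceil>"
  have "?i \<in> ?N \<and> ?j \<in> ?N \<and> {l ?i, l ?j} \<in> E \<longleftrightarrow>
    (\<exists>x x'. {x, x'} \<in> E \<and> y \<in> strip u (pos x) \<and> z \<in> strip u (pos x'))" (is "?L \<longleftrightarrow> ?R")
  proof
    assume ?L
    then show ?R using pos_l yz unfolding strip_def by (intro exI[of _ "l ?i"] exI[of _ "l ?j"]) auto
  next
    assume ?R
    then obtain x x' where x: "{x, x'} \<in> E" "y \<in> strip u (pos x)" "z \<in> strip u (pos x')" by blast
    then have "x \<in> \<Union>E" "x' \<in> \<Union>E" by auto
    then obtain k k' where k: "k \<in> ?N" "x = l k" "k' \<in> ?N" "x' = l k'" using l unfolding bij_betw_def by blast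
    then have "?i = k" "?j = k'" using x pos_l by (auto simp: strip_def)
    then show ?L using k x by simp
  qed
  then show ?thesis by (simp add: stretched_graphon_def Let_def)
qed

lemma adjacency:
  assumes \<omega>: "\<omega> \<in> space P" "\<omega> \<notin> stray" and Uij: "0 \<le> U i j \<omega>" "U i j \<omega> < 1" and "i \<noteq> j"
    and le: "snd (\<xi> i \<omega>) \<le> \<rho>" "snd (\<xi> j \<omega>) \<le> \<rho>"
  shows "U i j \<omega> < WE (fst (\<xi> i \<omega>)) (fst (\<xi> j \<omega>)) \<longleftrightarrow>
    (\<exists>x\<in>V. \<exists>y\<in>V. \<xi> i \<omega> \<in> col x \<and> \<xi> j \<omega> \<in> col y \<and> {x, y} \<in> E0)"
proof -
  note p = \<xi>_pos[OF \<omega>(1)]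
  have col: "\<xi> k \<omega> \<in> col x \<longleftrightarrow> fst (\<xi> k \<omega>) \<in> strip u (pos x)" if "snd (\<xi> k \<omega>) \<le> \<rho>" for k x
    using p[of k] that by (auto simp: col_def mem_Times_iff)
  have "U i j \<omega> < WE (fst (\<xi> i \<omega>)) (fst (\<xi> j \<omega>)) \<longleftrightarrow>
    (\<exists>x y. {x, y} \<in> E \<and> \<xi> i \<omega> \<in> col x \<and> \<xi> j \<omega> \<in> col y)"
    unfolding WE_eq[OF p(1) p(1)] col[OF le(1)] col[OF le(2)] of_bool_def using Uij by (simp split: if_split)
  also have "\<dots> \<longleftrightarrow> (\<exists>x\<in>V. \<exists>y\<in>V. \<xi> i \<omega> \<in> col x \<and> \<xi> j \<omega> \<in> col y \<and> {x, y} \<in> E0)"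
  proof
    assume "\<exists>x y. {x, y} \<in> E \<and> \<xi> i \<omega> \<in> col x \<and> \<xi> j \<omega> \<in> col y"
    then obtain x y where xy: "{x, y} \<in> E" "\<xi> i \<omega> \<in> col x" "\<xi> j \<omega> \<in> col y" by blast
    have "{x, y} \<inter> X0 = {}" using \<omega> xy unfolding stray_def by blast
    moreover have "{x, y} \<notin> D" using \<omega> xy \<open>i \<noteq> j\<close> unfolding stray_def by blast
    ultimately have "{x, y} \<in> E0" using covered[OF xy(1)] by blast
    then show "\<exists>x\<in>V. \<exists>y\<in>V. \<xi> i \<omega> \<in> col x \<and> \<xi> j \<omega> \<in> col y \<and> {x, y} \<in> E0" using E0(2) xy by blast
  qed (use E0 in blast)
  finally show ?thesis .
qed

text \<open>
  Outside \<open>stray\<close> and the event of coinciding points the history is a function of the occupied cells,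
  whose law is known.
\<close>

lemma history_law:
  "\<bar>prob {\<omega> \<in> space P. finite (edges_at WE \<rho> \<omega>) \<and> \<phi> (history WE \<rho> \<omega>)} -
     (\<Sum>B\<in>Pow (V \<times> {1..m}). weight B * of_bool (\<phi> (discrete_history m B E0)))\<bar>
   \<le> card X0 * lam + 4 * card D * lam\<^sup>2 + card V * lam\<^sup>2 + (card V * lam)\<^sup>2 / m"
proof -
  have sep: "{\<omega> \<in> space P. \<not> separated \<omega>} \<in> events"
  proof -
    have "{\<omega> \<in> space P. \<not> separated \<omega>} = space P - {\<omega> \<in> space P. separated \<omega>}" by auto
    then show ?thesis using \<sigma>_events(1)[OF separated_event] by (metis sets.compl_sets)
  qed
  let ?Z = "stray \<union> {\<omega> \<in> space P. \<not> separated \<omega>}"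
  have "\<bar>prob {\<omega> \<in> space P. finite (edges_at WE \<rho> \<omega>) \<and> \<phi> (history WE \<rho> \<omega>)} -
     prob {\<omega> \<in> space P. \<phi> (discrete_history m (occupied \<omega>) E0)}\<bar> \<le> prob ?Z"
  proof (rule prob_diff_le)
    show "{\<omega> \<in> space P. finite (edges_at WE \<rho> \<omega>) \<and> \<phi> (history WE \<rho> \<omega>)} \<in> events"
      using \<rho> by (intro history_event graphon_stretched) auto
    show "{\<omega> \<in> space P. \<phi> (discrete_history m (occupied \<omega>) E0)} \<in> events"
      by (rule prob_occupied(1))
    show "?Z \<in> events" using sep stray by auto
    have "AE \<omega> in P. finite (edges_at WE \<rho> \<omega>)"
      using admissible_stretched[of u E l] u \<rho> by (auto simp: admissible_graphon_def)
    then show "AE \<omega> in P. \<omega> \<notin> ?Z \<longrightarrow>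
      (\<omega> \<in> {\<omega> \<in> space P. finite (edges_at WE \<rho> \<omega>) \<and> \<phi> (history WE \<rho> \<omega>)} \<longleftrightarrow>
       \<omega> \<in> {\<omega> \<in> space P. \<phi> (discrete_history m (occupied \<omega>) E0)})"
      using AE_U AE_time_pos AE_finite_points AE_space
    proof eventually_elim
      case (elim \<omega>)
      show ?case
      proof
        assume nZ: "\<omega> \<notin> ?Z"
        have "history WE \<rho> \<omega> = discrete_history m (occupied \<omega>) E0"
        proof (rule history_separated[OF elim(5)])
          show "separated \<omega>" using nZ elim(5) by blast
          show "card e = 2" if "e \<in> E0" for e using E E0(1) that by (auto simp: fin_graph_def)
          fix i j :: nat assume ij: "i < j" "snd (\<xi> i \<omega>) \<le> \<rho>" "snd (\<xi> j \<omega>) \<le> \<rho>"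
          have "\<omega> \<notin> stray" "i \<noteq> j" "0 \<le> U i j \<omega>" "U i j \<omega> < 1" using nZ elim(2) ij(1) by auto
          then show "U i j \<omega> < WE (fst (\<xi> i \<omega>)) (fst (\<xi> j \<omega>)) \<longleftrightarrow>
            (\<exists>x\<in>V. \<exists>y\<in>V. \<xi> i \<omega> \<in> col x \<and> \<xi> j \<omega> \<in> col y \<and> {x, y} \<in> E0)"
            using adjacency[OF elim(5)] ij by blast
        qed (use elim in blast)+
        then show "\<omega> \<in> {\<omega> \<in> space P. finite (edges_at WE \<rho> \<omega>) \<and> \<phi> (history WE \<rho> \<omega>)} \<longleftrightarrow>
          \<omega> \<in> {\<omega> \<in> space P. \<phi> (discrete_history m (occupied \<omega>) E0)}" using elim by simp
      qed
    qed
  qed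
  also have "\<dots> \<le> prob stray + prob {\<omega> \<in> space P. \<not> separated \<omega>}"
    using stray sep by (intro measure_Un_le) auto
  finally show ?thesis
    using stray(2) prob_not_separated 
    unfolding prob_occupied(2)[of "\<lambda>B. \<phi> (discrete_history m B E0)"] by linarith
qed

lemma graph_at_stable:
  assumes r: "0 \<le> r" "r \<le> \<rho>"
  shows "prob {\<omega> \<in> space P. graph_at WE r \<omega> \<noteq> graph_at WE \<rho> \<omega>} \<le>
    card X0 * lam + 4 * card D * lam\<^sup>2 + card V * (\<rho> - r) / u"
proof -
  let ?C = "\<lambda>x. strip u (pos x) \<times> {r<..\<rho>}"
  let ?Y = "\<lambda>x. {\<omega> \<in> space P. \<exists>i. \<xi> i \<omega> \<in> ?C x}"
  have C: "?C x \<in> sets \<nu>" "emeasure \<nu> (?C x) \<le> ennreal ((\<rho> - r) / u)" for x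
  proof -
    note s = strip_measure[OF u, of "pos x"]
    have 1: "{r<..\<rho>} \<subseteq> {0..}" using r by auto
    show "?C x \<in> sets \<nu>" using s 1 by (intro emeasure_Times) auto
    have "emeasure \<nu> (?C x) = emeasure lborel (strip u (pos x)) * emeasure lborel {r<..\<rho>}"
      using s 1 by (intro emeasure_Times) auto
    also have "\<dots> \<le> ennreal (1 / u) * ennreal (\<rho> - r)"
      using s(2) r by (intro mult_mono) auto
    also have "\<dots> = ennreal ((\<rho> - r) / u)" using u r by (simp add: ennreal_mult[symmetric])
    finally show "emeasure \<nu> (?C x) \<le> ennreal ((\<rho> - r) / u)" .
  qed
  note [measurable] = C(1)
  have Y: "prob (?Y x) \<le> (\<rho> - r) / u" for x
  proof -
    have "emeasure \<nu> (?C x) < \<infinity>" using C(2)[of x] by (auto simp: less_top[symmetric] top_unique)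
    then have "prob (?Y x) \<le> measure \<nu> (?C x)" using C(1) by (intro prob_point_le)
    also have "\<dots> \<le> (\<rho> - r) / u" using C(2)[of x] r u unfolding measure_def by (intro enn2real_leI) auto
    finally show ?thesis .
  qed
  have [measurable]: "?Y x \<in> events" for x by measurable
  have "prob {\<omega> \<in> space P. graph_at WE r \<omega> \<noteq> graph_at WE \<rho> \<omega>} \<le> prob (stray \<union> (\<Union>x\<in>V. ?Y x))"
  proof (rule finite_measure_mono_AE)
    show "stray \<union> (\<Union>x\<in>V. ?Y x) \<in> events" using stray V by (intro sets.Un sets.finite_UN) auto
    show "AE \<omega> in P. \<omega> \<in> {\<omega> \<in> space P. graph_at WE r \<omega> \<noteq> graph_at WE \<rho> \<omega>} \<longrightarrow> \<omega> \<in> stray \<union> (\<Union>x\<in>V. ?Y x)"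
      using AE_U AE_space
    proof eventually_elim
      case (elim \<omega>)
      show ?case
      proof (rule impI, rule ccontr)
        assume ne: "\<omega> \<in> {\<omega> \<in> space P. graph_at WE r \<omega> \<noteq> graph_at WE \<rho> \<omega>}"
          and n: "\<omega> \<notin> stray \<union> (\<Union>x\<in>V. ?Y x)"
        have "edges_at WE \<rho> \<omega> \<subseteq> edges_at WE r \<omega>"
        proof
          fix e assume "e \<in> edges_at WE \<rho> \<omega>"
          then obtain i j where ij: "e = {i, j}" "i < j" "snd (\<xi> i \<omega>) \<le> \<rho>" "snd (\<xi> j \<omega>) \<le> \<rho>"
            "U i j \<omega> < WE (fst (\<xi> i \<omega>)) (fst (\<xi> j \<omega>))" unfolding sampled_edges_def by blast
          have "\<omega> \<notin> stray" "i \<noteq> j" "0 \<le> U i j \<omega>" "U i j \<omega> < 1" using n elim(1) ij(2) by auto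
          then obtain x y where xy: "x \<in> V" "y \<in> V" "\<xi> i \<omega> \<in> col x" "\<xi> j \<omega> \<in> col y"
            using adjacency[OF elim(2), of i j] ij by blast
          have "snd (\<xi> i \<omega>) \<le> r" "snd (\<xi> j \<omega>) \<le> r"
          proof -
            have "\<xi> k \<omega> \<notin> ?C z" if "z \<in> V" for k z
            proof
              assume "\<xi> k \<omega> \<in> ?C z"
              then have "\<omega> \<in> ?Y z" using elim(2) by (intro CollectI conjI exI[of _ k])
              then have "\<omega> \<in> (\<Union>x\<in>V. ?Y x)" using \<open>z \<in> V\<close> by (rule UN_I[rotated])
              then show False using n by (meson UnI2)
            qed
            then have "\<xi> i \<omega> \<notin> ?C x" "\<xi> j \<omega> \<notin> ?C y" using xy(1,2) by metis+
            then show "snd (\<xi> i \<omega>) \<le> r" "snd (\<xi> j \<omega>) \<le> r"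
              using xy ij by (auto simp: col_def mem_Times_iff)
          qed
          then show "e \<in> edges_at WE r \<omega>" using ij unfolding sampled_edges_def by blast
        qed
        then have "edges_at WE r \<omega> = edges_at WE \<rho> \<omega>" using edges_at_mono[OF r(2)] by blast
        then show False using ne by (simp add: graphon_graph_def)
      qed
    qed
  qed
  also have "\<dots> \<le> prob stray + prob (\<Union>x\<in>V. ?Y x)"
    using stray V by (intro measure_Un_le sets.finite_UN) auto
  also have "prob (\<Union>x\<in>V. ?Y x) \<le> (\<Sum>x\<in>V. prob (?Y x))"
    using V by (intro finite_measure_subadditive_finite) auto
  also have "\<dots> \<le> (\<Sum>x\<in>V. (\<rho> - r) / u)" using Y by (intro sum_mono) auto
  finally show ?thesis using stray(2) by simp
qed

end

section \<open>Sampling from the limit graphon\<close>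

lemma (in prob_space) indep_sets_reindex:
  assumes F: "indep_sets F I" and h: "inj_on h J" "h ` J \<subseteq> I"
  shows "indep_sets (\<lambda>j. F (h j)) J"
proof (rule indep_setsI)
  show "F (h j) \<subseteq> events" if "j \<in> J" for j
    using F h(2) that unfolding indep_sets_def by blast
  fix A K assume K: "K \<noteq> {}" "K \<subseteq> J" "finite K" and A: "\<forall>j\<in>K. A j \<in> F (h j)"
  have hK: "inj_on h K" using h(1) K(2) by (rule inj_on_subset)
  have inv: "inv_into K h (h j) = j" if "j \<in> K" for j using hK that by simp
  have "prob (\<Inter>i\<in>h ` K. A (inv_into K h i)) = (\<Prod>i\<in>h ` K. prob (A (inv_into K h i)))"
    using K A h(2) inv by (intro indep_setsD[OF F]) auto
  also have "(\<Inter>i\<in>h ` K. A (inv_into K h i)) = (\<Inter>j\<in>K. A j)" using inv by auto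
  also have "(\<Prod>i\<in>h ` K. prob (A (inv_into K h i))) = (\<Prod>j\<in>K. prob (A j))"
    by (subst prod.reindex[OF hK]) (simp add: inv)
  finally show "prob (\<Inter>j\<in>K. A j) = (\<Prod>j\<in>K. prob (A j))" .
qed

lemma (in prob_space) indep_vars_reindex:
  assumes X: "indep_vars (\<lambda>_. N) X I" and h: "inj_on h J" "h ` J \<subseteq> I"
  shows "indep_vars (\<lambda>_. N) (\<lambda>j. X (h j)) J"
  using indep_sets_reindex[OF _ h, of "\<lambda>i. {X i -` A \<inter> space M |A. A \<in> sets N}"] X h(2)
  unfolding indep_vars_def2 by blast

context sampling
begin

text \<open>
  The coin of an unordered pair.
\<close>

definition Usym :: "nat \<Rightarrow> nat \<Rightarrow> 'p \<Rightarrow> real" where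
  "Usym i j = U (min i j) (max i j)"

lemma Usym_less: "i < j \<Longrightarrow> Usym i j = U i j" "i < j \<Longrightarrow> Usym j i = U i j"
  by (simp_all add: Usym_def)

lemma Usym_\<sigma>U: "i \<noteq> j \<Longrightarrow> Usym i j \<in> borel_measurable \<sigma>U"
  unfolding Usym_def by (rule U_\<sigma>U) simp

text \<open>
  \<open>\<kappa>\<close> maps each vertex to the index of the point on it. Different pairs of vertices get different
  pairs of indices, hence independent coins.
\<close>

lemma prob_edges_between:
  fixes I :: "(nat \<times> nat) set" and \<kappa> :: "nat \<Rightarrow> nat"
  assumes I: "finite I" "I \<subseteq> {(x, y). x < y}" and \<kappa>: "inj_on \<kappa> (fst ` I \<union> snd ` I)"
    and p: "\<And>x y. 0 \<le> p x y \<and> p x y \<le> 1" and T: "T \<subseteq> I"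
  shows "prob {\<omega> \<in> space P. {(x, y) \<in> I. Usym (\<kappa> x) (\<kappa> y) \<omega> < p x y} = T} = subset_weight (\<lambda>(x, y). p x y) I T"
proof -
  define h where "h = (\<lambda>(x, y). (min (\<kappa> x) (\<kappa> y), max (\<kappa> x) (\<kappa> y)))"
  have ne: "\<kappa> x \<noteq> \<kappa> y" if "(x, y) \<in> I" for x y
  proof -
    have "x \<in> fst ` I" "y \<in> snd ` I" using that by force+
    moreover have "x \<noteq> y" using subsetD[OF I(2) that] by simp
    ultimately show ?thesis using \<kappa> unfolding inj_on_def by blast
  qed
  have h1: "h ` I \<subseteq> {(i, j). i < j}"
  proof (rule image_subsetI)
    fix e assume e: "e \<in> I"
    obtain x y where xy: "e = (x, y)" by (cases e)
    show "h e \<in> {(i, j). i < j}" using ne[of x y] e by (simp add: h_def xy min_def max_def)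
  qed
  have h2: "inj_on h I"
  proof (rule inj_onI)
    fix e e' assume e: "e \<in> I" "e' \<in> I" "h e = h e'"
    obtain x y x' y' where xy: "e = (x, y)" "e' = (x', y')" by (cases e, cases e')
    have lt: "x < y" "x' < y'" using e I(2) xy by auto
    have mem: "x \<in> fst ` I \<union> snd ` I" "y \<in> fst ` I \<union> snd ` I" "x' \<in> fst ` I \<union> snd ` I" "y' \<in> fst ` I \<union> snd ` I"
      using e xy by force+
    have "{\<kappa> x, \<kappa> y} = {\<kappa> x', \<kappa> y'}"
      using e(3) unfolding xy h_def by (auto simp: min_def max_def split: if_splits)
    then have "\<kappa> ` {x, y} = \<kappa> ` {x', y'}" by simp
    then have "{x, y} = {x', y'}"
      using inj_on_image_eq_iff[OF \<kappa>, of "{x, y}" "{x', y'}"] mem by simp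
    then show "e = e'" using lt xy by (auto simp: doubleton_eq_iff)
  qed
  have h3: "indep_vars (\<lambda>_. borel) (\<lambda>(i, j). U i j) {(i, j). i < j}"
    using sampling unfolding graphon_sampling_def by blast
  have "indep_vars (\<lambda>_. borel) (\<lambda>e. (\<lambda>(i, j). U i j) (h e)) I"
    by (rule indep_vars_reindex[OF h3 h2 h1])
  moreover have "(\<lambda>e. (\<lambda>(i, j). U i j) (h e)) = (\<lambda>(x, y). Usym (\<kappa> x) (\<kappa> y))"
    by (auto simp: h_def Usym_def)
  ultimately have ind: "indep_vars (\<lambda>_. borel) (\<lambda>(x, y). Usym (\<kappa> x) (\<kappa> y)) I" by simp
  have "prob {\<omega> \<in> space P. {e \<in> I. (case e of (x, y) \<Rightarrow> Usym (\<kappa> x) (\<kappa> y)) \<omega> < (case e of (x, y) \<Rightarrow> p x y)} = T} =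
    subset_weight (\<lambda>(x, y). p x y) I T"
  proof (rule prob_random_subset[OF ind I(1) _ _ T])
    fix e assume e: "e \<in> I"
    obtain x y where xy: "e = (x, y)" by (cases e)
    show "prob {\<omega> \<in> space P. (case e of (x, y) \<Rightarrow> Usym (\<kappa> x) (\<kappa> y)) \<omega> < (case e of (x, y) \<Rightarrow> p x y)} = (\<lambda>(x, y). p x y) e"
      using p[of x y] ne[of x y] e unfolding xy Usym_def by (simp add: prob_U_less)
  qed simp
  moreover have "{e \<in> I. (case e of (x, y) \<Rightarrow> Usym (\<kappa> x) (\<kappa> y)) \<omega> < (case e of (x, y) \<Rightarrow> p x y)} =
      {(x, y) \<in> I. Usym (\<kappa> x) (\<kappa> y) \<omega> < p x y}" for \<omega> by auto
  ultimately show ?thesis by simp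
qed

end

definition pairs_of :: "nat set \<Rightarrow> (nat \<times> nat) set" where
  "pairs_of X = {(x, y). x < y \<and> x \<in> X \<and> y \<in> X}"

definition edges_of :: "(nat \<times> nat) set \<Rightarrow> nat set set" where
  "edges_of T = (\<lambda>(x, y). {x, y}) ` T"

lemma finite_pairs_of: "finite X \<Longrightarrow> finite (pairs_of X)"
  by (rule finite_subset[of _ "X \<times> X"]) (auto simp: pairs_of_def)

text \<open>
  The probability of \<open>\<phi>\<close> for the discrete history on the occupied cells \<open>B\<close>, when the pair \<open>xy\<close> of
  vertices is an edge with probability \<open>p x y\<close>, independently for all pairs.
\<close>

definition annealed :: "nat \<Rightarrow> (nat \<Rightarrow> nat \<Rightarrow> real) \<Rightarrow> (ugraph set \<Rightarrow> bool) \<Rightarrow> (nat \<times> nat) set \<Rightarrow> real" where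
  "annealed m p \<phi> B = (\<Sum>T\<in>Pow (pairs_of (fst ` B)). subset_weight (\<lambda>(x, y). p x y) (pairs_of (fst ` B)) T *
      of_bool (\<phi> (discrete_history m B (edges_of T))))"

text \<open>
  \<open>p\<close> approximates \<open>W\<close> on the window \<open>V\<close> up to \<open>\<delta>\<close>, and \<open>w\<close> bounds \<open>W\<close> on pairs of strips that
  avoid \<open>X0\<close> but leave the window; \<open>\<tau>\<close> bounds the total of \<open>w\<close>.
\<close>

locale limiting = cells +
  fixes W :: "real \<Rightarrow> real \<Rightarrow> real" and p w :: "nat \<Rightarrow> nat \<Rightarrow> real" and X0 :: "nat set" and \<delta> \<tau> :: real
  assumes W: "graphon W" and X0: "finite X0"
    and cover: "\<And>y. 0 < y \<Longrightarrow> \<exists>x. y \<in> strip u (pos x)"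
    and p01: "\<And>x y. 0 \<le> p x y \<and> p x y \<le> 1" and p_sym: "\<And>x y. p x y = p y x"
    and \<delta>: "0 \<le> \<delta>"
    and close: "\<And>x y y1 y2. x \<in> V \<Longrightarrow> y \<in> V \<Longrightarrow> y1 \<in> strip u (pos x) \<Longrightarrow> y2 \<in> strip u (pos y) \<Longrightarrow>
        \<bar>W y1 y2 - p x y\<bar> \<le> \<delta>"
    and w: "\<And>x y. 0 \<le> w x y"
    and tail: "\<And>x y y1 y2. x \<notin> X0 \<Longrightarrow> y \<notin> X0 \<Longrightarrow> \<not> (x \<in> V \<and> y \<in> V) \<Longrightarrow>
        y1 \<in> strip u (pos x) \<Longrightarrow> y2 \<in> strip u (pos y) \<Longrightarrow> W y1 y2 \<le> w x y"
    and \<tau>: "\<And>F. finite F \<Longrightarrow> F \<subseteq> {(x, y). x \<notin> X0 \<and> y \<notin> X0 \<and> \<not> (x \<in> V \<and> y \<in> V)} \<Longrightarrow>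
        (\<Sum>(x, y)\<in>F. w x y) \<le> \<tau>"
begin

definition far_pairs :: "(nat \<times> nat) set" where
  "far_pairs = {(x, y). x \<notin> X0 \<and> y \<notin> X0 \<and> \<not> (x \<in> V \<and> y \<in> V)}"

definition pair_event :: "nat \<Rightarrow> nat \<Rightarrow> real set \<Rightarrow> 'a set" where
  "pair_event x y Z = {\<omega> \<in> space P. \<exists>i j. i < j \<and> \<xi> i \<omega> \<in> col x \<union> col y \<and> \<xi> j \<omega> \<in> col x \<union> col y \<and> U i j \<omega> \<in> Z}"

text \<open>
  Outside this event every sampled edge joins two vertices of the window.
\<close>

definition stray :: "'a set" where
  "stray = {\<omega> \<in> space P. \<exists>x\<in>X0. \<exists>i. \<xi> i \<omega> \<in> col x} \<union> (\<Union>(x, y)\<in>far_pairs. pair_event x y {..<w x y})"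

text \<open>
  Outside this event \<open>U < W\<close> and \<open>U < p\<close> are equivalent for each sampled pair in the window.
\<close>

definition undecided :: "'a set" where
  "undecided = (\<Union>(x, y)\<in>V \<times> V. pair_event x y {p x y - \<delta>..p x y + \<delta>})"

lemma pair_event:
  assumes Z: "Z \<in> sets borel" and b: "\<And>i j. i < j \<Longrightarrow> prob {\<omega> \<in> space P. U i j \<omega> \<in> Z} \<le> b"
  shows "pair_event x y Z \<in> events" "prob (pair_event x y Z) \<le> 4 * lam\<^sup>2 * b"
proof -
  note [measurable] = col_pair_measure(1)
  have "Measurable.pred P (\<lambda>\<omega>. i < j \<and> \<xi> i \<omega> \<in> col x \<union> col y \<and> \<xi> j \<omega> \<in> col x \<union> col y \<and> U i j \<omega> \<in> Z)" for i j
    using Z U_measurable[of i j] by (cases "i < j") (simp_all, measurable)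
  then show "pair_event x y Z \<in> events"
    unfolding pair_event_def pred_def[symmetric] by (intro pred_intros_countable)
  have b0: "0 \<le> b" using b[of 0 1] measure_nonneg order_trans by (meson zero_less_one)
  have "prob (pair_event x y Z) \<le> (measure \<nu> (col x \<union> col y))\<^sup>2 * b"
    unfolding pair_event_def by (intro prob_pair_le col_pair_measure Z b)
  also have "\<dots> \<le> (2 * lam)\<^sup>2 * b" by (intro mult_right_mono power_mono col_pair_measure b0) auto
  finally show "prob (pair_event x y Z) \<le> 4 * lam\<^sup>2 * b" by (simp add: power2_eq_square)
qed

lemma stray:
  shows "stray \<in> events" "prob stray \<le> card X0 * lam + 4 * lam\<^sup>2 * \<tau>"
proof -
  have b: "prob {\<omega> \<in> space P. U i j \<omega> \<in> {..<w x y}} \<le> w x y" if "i < j" for i j x y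
  proof (cases "w x y \<le> 1")
    case True
    then show ?thesis using prob_U_less[OF that, of "w x y"] w by simp
  next
    case False
    then show ?thesis using prob_le_1 by (meson linear order_trans)
  qed
  note e = pair_event[of "{..<w x y}" "w x y" x y for x y, OF _ b]
  have ev: "(\<lambda>(x, y). pair_event x y {..<w x y}) c \<in> events" for c using e(1) by (cases c) auto
  have ev2: "(\<Union>(x, y)\<in>far_pairs. pair_event x y {..<w x y}) \<in> events"
    using ev by (intro sets.countable_UN'') auto
  show "stray \<in> events" unfolding stray_def using ev2 point_in_cols[OF X0] by auto
  have "prob (\<Union>(x, y)\<in>far_pairs. pair_event x y {..<w x y}) \<le> 4 * lam\<^sup>2 * \<tau>"
  proof (rule prob_UN_countable_le)
    fix F assume F: "finite F" "F \<subseteq> far_pairs"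
    have "(\<Sum>c\<in>F. prob ((\<lambda>(x, y). pair_event x y {..<w x y}) c)) \<le> (\<Sum>c\<in>F. 4 * lam\<^sup>2 * (\<lambda>(x, y). w x y) c)"
      using e(2) by (intro sum_mono) auto
    also have "\<dots> = 4 * lam\<^sup>2 * (\<Sum>(x, y)\<in>F. w x y)" by (simp add: sum_distrib_left)
    also have "\<dots> \<le> 4 * lam\<^sup>2 * \<tau>" using \<tau>[OF F[unfolded far_pairs_def]] by (intro mult_left_mono) auto
    finally show "(\<Sum>c\<in>F. prob ((\<lambda>(x, y). pair_event x y {..<w x y}) c)) \<le> 4 * lam\<^sup>2 * \<tau>" .
  qed (use ev in auto)
  moreover have "prob stray \<le> prob {\<omega> \<in> space P. \<exists>x\<in>X0. \<exists>i. \<xi> i \<omega> \<in> col x} + prob (\<Union>(x, y)\<in>far_pairs. pair_event x y {..<w x y})"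
    unfolding stray_def using ev2 point_in_cols[OF X0] by (intro measure_Un_le) auto
  ultimately show "prob stray \<le> card X0 * lam + 4 * lam\<^sup>2 * \<tau>" using point_in_cols(2)[OF X0] by linarith
qed

lemma undecided:
  shows "undecided \<in> events" "prob undecided \<le> 8 * (card V * lam)\<^sup>2 * \<delta>"
proof -
  have b: "prob {\<omega> \<in> space P. U i j \<omega> \<in> {p x y - \<delta>..p x y + \<delta>}} \<le> 2 * \<delta>" if "i < j" for i j x y
    using prob_U_interval[OF that, of "p x y - \<delta>" "p x y + \<delta>"] \<delta> by simp
  note e = pair_event[of "{p x y - \<delta>..p x y + \<delta>}" "2 * \<delta>" x y for x y, OF _ b]
  have ev: "(\<lambda>(x, y). pair_event x y {p x y - \<delta>..p x y + \<delta>}) c \<in> events" for c using e(1) by (cases c) auto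
  show "undecided \<in> events" unfolding undecided_def using ev V by (intro sets.finite_UN) auto
  have "prob undecided \<le> (\<Sum>c\<in>V \<times> V. prob ((\<lambda>(x, y). pair_event x y {p x y - \<delta>..p x y + \<delta>}) c))"
    unfolding undecided_def using ev V by (intro finite_measure_subadditive_finite) auto
  also have "\<dots> \<le> (\<Sum>c\<in>V \<times> V. 4 * lam\<^sup>2 * (2 * \<delta>))" using e(2) by (intro sum_mono) auto
  also have "\<dots> = 8 * (card V * lam)\<^sup>2 * \<delta>" by (simp add: card_cartesian_product power2_eq_square)
  finally show "prob undecided \<le> 8 * (card V * lam)\<^sup>2 * \<delta>" .
qed

lemma edge_in_V:
  assumes \<omega>: "\<omega> \<in> space P" "\<omega> \<notin> stray" and "i < j" "U i j \<omega> < W (fst (\<xi> i \<omega>)) (fst (\<xi> j \<omega>))"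
    and le: "snd (\<xi> i \<omega>) \<le> \<rho>" "snd (\<xi> j \<omega>) \<le> \<rho>"
  shows "\<exists>x\<in>V. \<exists>y\<in>V. \<xi> i \<omega> \<in> col x \<and> \<xi> j \<omega> \<in> col y"
proof -
  note pp = \<xi>_pos[OF \<omega>(1)]
  obtain x y where xy: "fst (\<xi> i \<omega>) \<in> strip u (pos x)" "fst (\<xi> j \<omega>) \<in> strip u (pos y)"
    using cover pp by blast
  have col: "\<xi> i \<omega> \<in> col x" "\<xi> j \<omega> \<in> col y" using xy le pp by (auto simp: col_def mem_Times_iff)
  have n0: "x \<notin> X0" "y \<notin> X0" using \<omega> col unfolding stray_def by blast+
  have "x \<in> V \<and> y \<in> V"
  proof (rule ccontr)
    assume nV: "\<not> (x \<in> V \<and> y \<in> V)"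
    then have "U i j \<omega> < w x y" using tail[OF n0 nV xy] assms(4) by simp
    then have "\<omega> \<in> pair_event x y {..<w x y}" using \<omega>(1) col \<open>i < j\<close> unfolding pair_event_def by blast
    moreover have "(x, y) \<in> far_pairs" using n0 nV by (simp add: far_pairs_def)
    ultimately show False using \<omega>(2) unfolding stray_def by blast
  qed
  then show ?thesis using col by blast
qed

text \<open>
  Only finitely many points fall into the strips of the window, so infinitely many edges need an edge
  that leaves it.
\<close>

lemma prob_infinite:
  "prob {\<omega> \<in> space P. infinite (edges_at W \<rho> \<omega>)} \<le> card X0 * lam + 4 * lam\<^sup>2 * \<tau>"
proof -
  have "prob {\<omega> \<in> space P. infinite (edges_at W \<rho> \<omega>)} \<le> prob stray"
  proof (rule finite_measure_mono_AE[OF _ stray(1)])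
    show "AE \<omega> in P. \<omega> \<in> {\<omega> \<in> space P. infinite (edges_at W \<rho> \<omega>)} \<longrightarrow> \<omega> \<in> stray"
      using AE_finite_points AE_space
    proof eventually_elim
      case (elim \<omega>)
      have "finite (edges_at W \<rho> \<omega>)" if n: "\<omega> \<notin> stray"
      proof -
        have "edges_at W \<rho> \<omega> \<subseteq> Pow {i. \<exists>x\<in>V. \<xi> i \<omega> \<in> col x}"
        proof
          fix e assume "e \<in> edges_at W \<rho> \<omega>"
          then obtain i j where "e = {i, j}" "i < j" "snd (\<xi> i \<omega>) \<le> \<rho>" "snd (\<xi> j \<omega>) \<le> \<rho>"
            "U i j \<omega> < W (fst (\<xi> i \<omega>)) (fst (\<xi> j \<omega>))" unfolding sampled_edges_def by blast
          then show "e \<in> Pow {i. \<exists>x\<in>V. \<xi> i \<omega> \<in> col x}" using edge_in_V[OF elim(2) n, of i j] by blast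
        qed
        then show ?thesis using elim(1) by (meson finite_Pow_iff finite_subset)
      qed
      then show ?case by blast
    qed
  qed
  then show ?thesis using stray(2) by linarith
qed

definition Fedges :: "'a \<Rightarrow> nat set set" where
  "Fedges \<omega> = {{x, y} |x y i j. x \<in> V \<and> y \<in> V \<and> x \<noteq> y \<and> i \<noteq> j \<and> \<xi> i \<omega> \<in> col x \<and> \<xi> j \<omega> \<in> col y \<and> Usym i j \<omega> < p x y}"

lemma sepD:
  "separated \<omega> \<Longrightarrow> x \<in> V \<Longrightarrow> \<xi> i \<omega> \<in> col x \<Longrightarrow> \<xi> j \<omega> \<in> col x \<Longrightarrow> i = j"
  unfolding separated_def by blast

lemma col_unique: "q \<in> col x \<Longrightarrow> q \<in> col y \<Longrightarrow> x = y"
  using pos(1) by (auto simp: col_def strip_def inj_def)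

lemma Fedges_iff:
  assumes "separated \<omega>" "x \<in> V" "y \<in> V" "x \<noteq> y" "\<xi> i \<omega> \<in> col x" "\<xi> j \<omega> \<in> col y"
  shows "{x, y} \<in> Fedges \<omega> \<longleftrightarrow> Usym i j \<omega> < p x y"
proof
  assume "{x, y} \<in> Fedges \<omega>"
  then obtain x' y' i' j' where *: "{x, y} = {x', y'}" "x' \<in> V" "y' \<in> V" "\<xi> i' \<omega> \<in> col x'" "\<xi> j' \<omega> \<in> col y'"
    "Usym i' j' \<omega> < p x' y'" unfolding Fedges_def by blast
  then consider "x' = x" "y' = y" | "x' = y" "y' = x" by (auto simp: doubleton_eq_iff)
  then show "Usym i j \<omega> < p x y"
  proof cases
    case 1
    then have "i' = i" "j' = j" using * assms sepD by metis+
    then show ?thesis using 1 * by simp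
  next
    case 2
    then have "i' = j" "j' = i" using * assms sepD by metis+
    then show ?thesis using 2 * p_sym by (simp add: Usym_def min.commute max.commute)
  qed
next
  assume "Usym i j \<omega> < p x y"
  moreover have "i \<noteq> j" using assms col_unique by blast
  ultimately show "{x, y} \<in> Fedges \<omega>" unfolding Fedges_def using assms by blast
qed

lemma adjacency:
  assumes \<omega>: "\<omega> \<in> space P" "\<omega> \<notin> stray" "\<omega> \<notin> undecided" and sep: "separated \<omega>" and "i < j"
    and le: "snd (\<xi> i \<omega>) \<le> \<rho>" "snd (\<xi> j \<omega>) \<le> \<rho>"
  shows "U i j \<omega> < W (fst (\<xi> i \<omega>)) (fst (\<xi> j \<omega>)) \<longleftrightarrow>
    (\<exists>x\<in>V. \<exists>y\<in>V. \<xi> i \<omega> \<in> col x \<and> \<xi> j \<omega> \<in> col y \<and> {x, y} \<in> Fedges \<omega>)"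
proof -
  have eq: "U i j \<omega> < W (fst (\<xi> i \<omega>)) (fst (\<xi> j \<omega>)) \<longleftrightarrow> {x, y} \<in> Fedges \<omega>"
    if xy: "x \<in> V" "y \<in> V" "\<xi> i \<omega> \<in> col x" "\<xi> j \<omega> \<in> col y" for x y
  proof -
    have "x \<noteq> y" using sepD[OF sep, of x i j] xy \<open>i < j\<close> by auto
    have "U i j \<omega> \<notin> {p x y - \<delta>..p x y + \<delta>}"
    proof
      assume "U i j \<omega> \<in> {p x y - \<delta>..p x y + \<delta>}"
      then have "\<omega> \<in> pair_event x y {p x y - \<delta>..p x y + \<delta>}"
        using \<omega>(1) xy \<open>i < j\<close> unfolding pair_event_def by blast
      then show False using \<omega>(3) xy unfolding undecided_def by blast
    qed
    moreover have "\<bar>W (fst (\<xi> i \<omega>)) (fst (\<xi> j \<omega>)) - p x y\<bar> \<le> \<delta>"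
      using xy by (intro close) (auto simp: col_def)
    ultimately have "U i j \<omega> < W (fst (\<xi> i \<omega>)) (fst (\<xi> j \<omega>)) \<longleftrightarrow> U i j \<omega> < p x y"
      using \<delta> by auto
    then show ?thesis
      using Fedges_iff[OF sep xy(1,2) \<open>x \<noteq> y\<close> xy(3,4)] Usym_less[OF \<open>i < j\<close>] by simp
  qed
  show ?thesis
    using eq edge_in_V[OF \<omega>(1,2) \<open>i < j\<close> _ le] by blast
qed

lemma finite_occupied: "B \<subseteq> V \<times> {1..m} \<Longrightarrow> finite (fst ` B)"
  by (rule finite_subset[OF _ V]) auto

text \<open>
  The indices of the points on the occupied vertices are a function of the points. For each choice of
  these indices the coins between them have the same law, so \<open>prob_decoupled\<close> applies.
\<close>

lemma conditional_law:
  assumes B: "B \<subseteq> V \<times> {1..m}"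
  shows "{\<omega> \<in> space P. separated \<omega> \<and> occupied \<omega> = B \<and> \<phi> (discrete_history m B (Fedges \<omega>))} \<in> events"
    and "prob {\<omega> \<in> space P. separated \<omega> \<and> occupied \<omega> = B \<and> \<phi> (discrete_history m B (Fedges \<omega>))} =
      prob {\<omega> \<in> space P. separated \<omega> \<and> occupied \<omega> = B} * annealed m p \<phi> B"
proof -
  define X where "X = fst ` B"
  have finX: "finite X" and XV: "X \<subseteq> V" using finite_occupied[OF B] B by (auto simp: X_def)
  define I where "I = pairs_of X"
  have finI: "finite I" unfolding I_def using finX by (rule finite_pairs_of)
  \<comment> \<open>The possible assignments of point indices to the occupied vertices.\<close>
  define K where "K = {\<kappa> \<in> X \<rightarrow>\<^sub>E (UNIV :: nat set). inj_on \<kappa> X}"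
  define A where "A \<kappa> = {\<omega> \<in> space P. separated \<omega> \<and> occupied \<omega> = B \<and> (\<forall>x\<in>X. \<xi> (\<kappa> x) \<omega> \<in> col x)}" for \<kappa>
  define Y where "Y \<kappa> \<omega> = {(x, y) \<in> I. Usym (\<kappa> x) (\<kappa> y) \<omega> < p x y}" for \<kappa> \<omega>
  define C where "C \<kappa> = {\<omega> \<in> space P. \<phi> (discrete_history m B (edges_of (Y \<kappa> \<omega>)))}" for \<kappa>
  have cK: "countable K"
  proof (rule countable_subset)
    show "K \<subseteq> X \<rightarrow>\<^sub>E (UNIV :: nat set)" by (auto simp: K_def)
    show "countable (X \<rightarrow>\<^sub>E (UNIV :: nat set))" by (rule countable_PiE[OF finX]) simp
  qed
  have A\<sigma>: "A \<kappa> \<in> sets \<sigma>\<xi>" for \<kappa>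
  proof -
    note [measurable] = col_measure(1)
    have "{\<omega> \<in> space \<sigma>\<xi>. \<forall>x\<in>X. \<xi> (\<kappa> x) \<omega> \<in> col x} \<in> sets \<sigma>\<xi>" using finX by measurable
    then have 1: "{\<omega> \<in> space P. \<forall>x\<in>X. \<xi> (\<kappa> x) \<omega> \<in> col x} \<in> sets \<sigma>\<xi>" by simp
    have "A \<kappa> = {\<omega> \<in> space P. separated \<omega>} \<inter> {\<omega> \<in> space P. occupied \<omega> = B} \<inter> {\<omega> \<in> space P. \<forall>x\<in>X. \<xi> (\<kappa> x) \<omega> \<in> col x}"
      by (auto simp: A_def)
    then show ?thesis by (simp only:) (intro sets.Int 1 separated_event occupied_event)
  qed
  have Usym_ne: "\<kappa> x \<noteq> \<kappa> y" if "\<kappa> \<in> K" "(x, y) \<in> I" for \<kappa> x y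
    using that by (auto simp: K_def I_def pairs_of_def inj_on_def)
  have Y\<sigma>: "{\<omega> \<in> space P. Y \<kappa> \<omega> = T} \<in> sets \<sigma>U" if \<kappa>: "\<kappa> \<in> K" for \<kappa> T
  proof -
    have "{\<omega> \<in> space P. Y \<kappa> \<omega> = T} = {\<omega> \<in> space \<sigma>U. T \<subseteq> I \<and> (\<forall>(x, y)\<in>I. Usym (\<kappa> x) (\<kappa> y) \<omega> < p x y \<longleftrightarrow> (x, y) \<in> T)}"
      unfolding Y_def space_\<sigma> by blast
    also have "\<dots> \<in> sets \<sigma>U"
    proof -
      have "Measurable.pred \<sigma>U (\<lambda>\<omega>. (\<lambda>(x, y). Usym (\<kappa> x) (\<kappa> y) \<omega> < p x y \<longleftrightarrow> (x, y) \<in> T) c)" if "c \<in> I" for c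
      proof -
        obtain x y where c: "c = (x, y)" by (cases c)
        note [measurable] = Usym_\<sigma>U[OF Usym_ne[OF \<kappa>, of x y]]
        show ?thesis using that unfolding c prod.case by measurable
      qed
      then have "Measurable.pred \<sigma>U (\<lambda>\<omega>. \<forall>(x, y)\<in>I. Usym (\<kappa> x) (\<kappa> y) \<omega> < p x y \<longleftrightarrow> (x, y) \<in> T)"
        using finI by (intro pred_intros_finite) auto
      then show ?thesis unfolding pred_def by (auto simp del: space_vimage_algebra intro: sets.sets_Collect_conj)
    qed
    finally show ?thesis .
  qed
  have YI: "Y \<kappa> \<omega> \<in> Pow I" for \<kappa> \<omega> by (auto simp: Y_def)
  have C\<sigma>: "C \<kappa> \<in> sets \<sigma>U" if "\<kappa> \<in> K" for \<kappa>
  proof -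
    have "C \<kappa> = (\<Union>T\<in>{T \<in> Pow I. \<phi> (discrete_history m B (edges_of T))}. {\<omega> \<in> space P. Y \<kappa> \<omega> = T})"
      using YI by (auto simp: C_def)
    also have "\<dots> \<in> sets \<sigma>U" using finI Y\<sigma>[OF that] by (intro sets.finite_UN) auto
    finally show ?thesis .
  qed
  have Cp: "prob (C \<kappa>) = annealed m p \<phi> B" if \<kappa>: "\<kappa> \<in> K" for \<kappa>
  proof -
    have "prob (C \<kappa>) = (\<Sum>T\<in>Pow I. prob {\<omega> \<in> space P. Y \<kappa> \<omega> = T} * of_bool (\<phi> (discrete_history m B (edges_of T))))"
      unfolding C_def
    proof (rule prob_finite_valued(2)[of "Pow I" "Y \<kappa>" "\<lambda>T. \<phi> (discrete_history m B (edges_of T))"])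
      show "{\<omega> \<in> space P. Y \<kappa> \<omega> = T} \<in> events" for T by (rule \<sigma>_events(2)[OF Y\<sigma>[OF \<kappa>]])
    qed (use finI YI in auto)
    also have "\<dots> = annealed m p \<phi> B"
      unfolding annealed_def X_def[symmetric] I_def[symmetric]
    proof (intro sum.cong refl)
      fix T assume T: "T \<in> Pow I"
      have "fst ` I \<union> snd ` I \<subseteq> X" by (auto simp: I_def pairs_of_def)
      then have "inj_on \<kappa> (fst ` I \<union> snd ` I)" using \<kappa> by (auto simp: K_def intro: inj_on_subset)
      then have "prob {\<omega> \<in> space P. Y \<kappa> \<omega> = T} = subset_weight (\<lambda>(x, y). p x y) I T"
        unfolding Y_def using T finI p01 by (intro prob_edges_between) (auto simp: I_def pairs_of_def)
      then show "prob {\<omega> \<in> space P. Y \<kappa> \<omega> = T} * of_bool (\<phi> (discrete_history m B (edges_of T))) =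
        subset_weight (\<lambda>(x, y). p x y) I T * of_bool (\<phi> (discrete_history m B (edges_of T)))" by simp
    qed
    finally show ?thesis .
  qed
  have disj: "disjoint_family_on A K"
  proof -
    have "\<kappa> = \<kappa>'" if "\<kappa> \<in> K" "\<kappa>' \<in> K" "\<omega> \<in> A \<kappa>" "\<omega> \<in> A \<kappa>'" for \<kappa> \<kappa>' \<omega>
    proof (rule PiE_ext[of _ X "\<lambda>_. UNIV"])
      fix x assume x: "x \<in> X"
      have "separated \<omega>" "\<xi> (\<kappa> x) \<omega> \<in> col x" "\<xi> (\<kappa>' x) \<omega> \<in> col x" using that x by (auto simp: A_def)
      then show "\<kappa> x = \<kappa>' x" using sepD x XV by blast
    qed (use that in \<open>auto simp: K_def\<close>)
    then show ?thesis unfolding disjoint_family_on_def by blast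
  qed
  have UA: "(\<Union>\<kappa>\<in>K. A \<kappa>) = {\<omega> \<in> space P. separated \<omega> \<and> occupied \<omega> = B}"
  proof (intro set_eqI iffI)
    fix \<omega> assume \<omega>: "\<omega> \<in> {\<omega> \<in> space P. separated \<omega> \<and> occupied \<omega> = B}"
    have "\<exists>i. \<xi> i \<omega> \<in> col x" if xX: "x \<in> X" for x
    proof -
      obtain a where "(x, a) \<in> occupied \<omega>" using xX \<omega> unfolding X_def by force
      then show ?thesis using cell_subset_col[of a x] unfolding occupied_def by auto
    qed
    then obtain \<kappa> where \<kappa>: "\<And>x. x \<in> X \<Longrightarrow> \<xi> (\<kappa> x) \<omega> \<in> col x" by metis
    have "inj_on \<kappa> X" by (rule inj_onI) (metis \<kappa> col_unique)
    then have "restrict \<kappa> X \<in> K" by (auto simp: K_def inj_on_def)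
    moreover have "\<omega> \<in> A (restrict \<kappa> X)" using \<omega> \<kappa> by (simp add: A_def)
    ultimately show "\<omega> \<in> (\<Union>\<kappa>\<in>K. A \<kappa>)" by blast
  qed (auto simp: A_def)
  have AC: "A \<kappa> \<inter> C \<kappa> = A \<kappa> \<inter> {\<omega> \<in> space P. \<phi> (discrete_history m B (Fedges \<omega>))}" if \<kappa>: "\<kappa> \<in> K" for \<kappa>
  proof -
    have "discrete_history m B (edges_of (Y \<kappa> \<omega>)) = discrete_history m B (Fedges \<omega>)" if \<omega>: "\<omega> \<in> A \<kappa>" for \<omega>
    proof (rule discrete_history_cong)
      fix e assume e: "e \<subseteq> fst ` B"
      have sep: "separated \<omega>" and pt: "\<And>x. x \<in> X \<Longrightarrow> \<xi> (\<kappa> x) \<omega> \<in> col x" using \<omega> by (auto simp: A_def)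
      have iff: "{x, y} \<in> Fedges \<omega> \<longleftrightarrow> (x, y) \<in> Y \<kappa> \<omega>" if "x < y" "x \<in> X" "y \<in> X" for x y
        using Fedges_iff[OF sep, of x y "\<kappa> x" "\<kappa> y"] that pt XV by (auto simp: Y_def I_def pairs_of_def)
      show "e \<in> edges_of (Y \<kappa> \<omega>) \<longleftrightarrow> e \<in> Fedges \<omega>"
      proof
        assume "e \<in> edges_of (Y \<kappa> \<omega>)"
        then obtain x y where xy: "e = {x, y}" "(x, y) \<in> Y \<kappa> \<omega>" by (auto simp: edges_of_def)
        then have "x < y" "x \<in> X" "y \<in> X" by (auto simp: Y_def I_def pairs_of_def)
        then show "e \<in> Fedges \<omega>" using iff xy by blast
      next
        assume F: "e \<in> Fedges \<omega>"
        then obtain x' y' where "e = {x', y'}" "x' \<noteq> y'" unfolding Fedges_def by blast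
        then obtain x y where xy: "e = {x, y}" "x < y" by (metis insert_commute linorder_neqE_nat)
        then have "(x, y) \<in> Y \<kappa> \<omega>" using iff[of x y] e F unfolding X_def by simp
        then show "e \<in> edges_of (Y \<kappa> \<omega>)" unfolding edges_of_def xy(1) by force
      qed
    qed
    then show ?thesis by (auto simp: C_def A_def)
  qed
  have "{\<omega> \<in> space P. separated \<omega> \<and> occupied \<omega> = B \<and> \<phi> (discrete_history m B (Fedges \<omega>))} =
    (\<Union>\<kappa>\<in>K. A \<kappa>) \<inter> {\<omega> \<in> space P. \<phi> (discrete_history m B (Fedges \<omega>))}" unfolding UA by blast
  also have "\<dots> = (\<Union>\<kappa>\<in>K. A \<kappa> \<inter> C \<kappa>)" using AC by blast
  finally have eq: "{\<omega> \<in> space P. separated \<omega> \<and> occupied \<omega> = B \<and> \<phi> (discrete_history m B (Fedges \<omega>))} =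
    (\<Union>\<kappa>\<in>K. A \<kappa> \<inter> C \<kappa>)" .
  show "{\<omega> \<in> space P. separated \<omega> \<and> occupied \<omega> = B \<and> \<phi> (discrete_history m B (Fedges \<omega>))} \<in> events"
    unfolding eq using cK A\<sigma> C\<sigma> \<sigma>_events by (intro sets.countable_UN') (auto intro!: sets.Int)
  show "prob {\<omega> \<in> space P. separated \<omega> \<and> occupied \<omega> = B \<and> \<phi> (discrete_history m B (Fedges \<omega>))} =
      prob {\<omega> \<in> space P. separated \<omega> \<and> occupied \<omega> = B} * annealed m p \<phi> B"
    unfolding eq UA[symmetric] by (rule prob_decoupled[OF cK A\<sigma> C\<sigma> disj Cp])
qed

lemma weight_eq: "B \<in> Pow (V \<times> {1..m}) \<Longrightarrow> weight B = prob {\<omega> \<in> space P. occupied \<omega> = B}"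
  by (simp add: weight_def occupied_law)

lemma annealed_bounds:
  assumes "B \<subseteq> V \<times> {1..m}"
  shows "0 \<le> annealed m p \<phi> B" "annealed m p \<phi> B \<le> 1"
proof -
  let ?I = "pairs_of (fst ` B)"
  have fin: "finite ?I" using finite_occupied[OF assms] by (rule finite_pairs_of)
  have w0: "0 \<le> subset_weight (\<lambda>(x, y). p x y) ?I T" for T
    unfolding subset_weight_def using p01 by (intro prod_nonneg) (auto split: prod.splits)
  show "0 \<le> annealed m p \<phi> B" unfolding annealed_def using w0 by (intro sum_nonneg) auto
  have "annealed m p \<phi> B \<le> (\<Sum>T\<in>Pow ?I. subset_weight (\<lambda>(x, y). p x y) ?I T)"
    unfolding annealed_def using w0 by (intro sum_mono) (auto simp: of_bool_def)
  also have "\<dots> = (\<Sum>T\<in>Pow ?I. prob {\<omega> \<in> space P. {(x, y) \<in> ?I. Usym x y \<omega> < p x y} = T})"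
    using fin p01 by (intro sum.cong refl prob_edges_between[of _ "\<lambda>x. x", symmetric]) (auto simp: pairs_of_def)
  also have "\<dots> = prob (\<Union>T\<in>Pow ?I. {\<omega> \<in> space P. {(x, y) \<in> ?I. Usym x y \<omega> < p x y} = T})"
  proof (rule finite_measure_finite_Union[symmetric])
    show "(\<lambda>T. {\<omega> \<in> space P. {(x, y) \<in> ?I. Usym x y \<omega> < p x y} = T}) ` Pow ?I \<subseteq> events"
    proof clarify
      fix T
      have "Measurable.pred P (\<lambda>\<omega>. (\<lambda>(x, y). Usym x y \<omega> < p x y \<longleftrightarrow> (x, y) \<in> T) c)" if "c \<in> ?I" for c
      proof -
        obtain x y where c: "c = (x, y)" by (cases c)
        then have "x < y" using that by (auto simp: pairs_of_def)
        then have [measurable]: "Usym x y \<in> borel_measurable P" unfolding Usym_def by (intro U_measurable) simp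
        show ?thesis unfolding c prod.case by measurable
      qed
      then have "Measurable.pred P (\<lambda>\<omega>. \<forall>c\<in>?I. (\<lambda>(x, y). Usym x y \<omega> < p x y \<longleftrightarrow> (x, y) \<in> T) c)"
        using fin by (intro pred_intros_finite) auto
      then have ev: "{\<omega> \<in> space P. \<forall>c\<in>?I. (\<lambda>(x, y). Usym x y \<omega> < p x y \<longleftrightarrow> (x, y) \<in> T) c} \<in> events"
        by (simp add: pred_def)
      have "{\<omega> \<in> space P. {(x, y) \<in> ?I. Usym x y \<omega> < p x y} = T} =
        (if T \<subseteq> ?I then {\<omega> \<in> space P. \<forall>c\<in>?I. (\<lambda>(x, y). Usym x y \<omega> < p x y \<longleftrightarrow> (x, y) \<in> T) c} else {})"
        by auto
      then show "{\<omega> \<in> space P. {(x, y) \<in> ?I. Usym x y \<omega> < p x y} = T} \<in> events" using ev by simp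
    qed
  qed (use fin in \<open>auto simp: disjoint_family_on_def\<close>)
  also have "\<dots> \<le> 1" by (rule prob_le_1)
  finally show "annealed m p \<phi> B \<le> 1" .
qed

text \<open>
  The history agrees with the discretised one except on the events bounded before, and the latter
  is averaged over its coins by \<open>conditional_law\<close>. The last term counts twice because the event
  \<open>separated\<close> is imposed first and dropped afterwards.
\<close>

lemma history_law:
  assumes adm: "AE \<omega> in P. finite (edges_at W \<rho> \<omega>)"
  shows "\<bar>prob {\<omega> \<in> space P. finite (edges_at W \<rho> \<omega>) \<and> \<phi> (history W \<rho> \<omega>)} -
     (\<Sum>B\<in>Pow (V \<times> {1..m}). weight B * annealed m p \<phi> B)\<bar>
   \<le> card X0 * lam + 4 * lam\<^sup>2 * \<tau> + 8 * (card V * lam)\<^sup>2 * \<delta> + 2 * (card V * lam\<^sup>2 + (card V * lam)\<^sup>2 / m)"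
proof -
  let ?J = "V \<times> {1..m}"
  let ?S = "\<lambda>B. {\<omega> \<in> space P. separated \<omega> \<and> occupied \<omega> = B}"
  let ?N = "{\<omega> \<in> space P. \<not> separated \<omega>}"
  have sep0: "{\<omega> \<in> space P. separated \<omega>} \<in> events"
    using \<sigma>_events(1)[OF separated_event] .
  have sep: "?N \<in> events"
  proof -
    have "?N = space P - {\<omega> \<in> space P. separated \<omega>}" by auto
    then show ?thesis using sep0 by (metis sets.compl_sets)
  qed
  have occ: "{\<omega> \<in> space P. occupied \<omega> = B} \<in> events" for B using \<sigma>_events(1)[OF occupied_event] .
  have S: "?S B \<in> events" for B
  proof -
    have "?S B = {\<omega> \<in> space P. separated \<omega>} \<inter> {\<omega> \<in> space P. occupied \<omega> = B}" by auto
    then show ?thesis by (simp only:) (intro sets.Int sep0 occ)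
  qed
  have finJ: "finite (Pow ?J)" using V by simp
  have occJ: "occupied \<omega> \<in> Pow ?J" for \<omega> by (auto simp: occupied_def)
  let ?A = "{\<omega> \<in> space P. separated \<omega> \<and> \<phi> (discrete_history m (occupied \<omega>) (Fedges \<omega>))}"
  have A: "?A = (\<Union>B\<in>Pow ?J. {\<omega> \<in> space P. separated \<omega> \<and> occupied \<omega> = B \<and> \<phi> (discrete_history m B (Fedges \<omega>))})"
    using occJ by blast
  have Aev: "?A \<in> events"
    unfolding A using finJ conditional_law(1) by (intro sets.finite_UN) auto
  have "prob ?A = (\<Sum>B\<in>Pow ?J. prob {\<omega> \<in> space P. separated \<omega> \<and> occupied \<omega> = B \<and> \<phi> (discrete_history m B (Fedges \<omega>))})"
    unfolding A using finJ conditional_law(1)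
    by (intro finite_measure_finite_Union) (auto simp: disjoint_family_on_def)
  also have "\<dots> = (\<Sum>B\<in>Pow ?J. prob (?S B) * annealed m p \<phi> B)"
    by (intro sum.cong refl conditional_law(2)) auto
  finally have pA: "prob ?A = (\<Sum>B\<in>Pow ?J. prob (?S B) * annealed m p \<phi> B)" .
  have "(\<Sum>B\<in>Pow ?J. weight B * annealed m p \<phi> B) - prob ?A =
    (\<Sum>B\<in>Pow ?J. (weight B - prob (?S B)) * annealed m p \<phi> B)"
    unfolding pA by (simp add: sum_subtractf left_diff_distrib)
  moreover have "0 \<le> (weight B - prob (?S B)) * annealed m p \<phi> B \<and>
      (weight B - prob (?S B)) * annealed m p \<phi> B \<le> prob (?N \<inter> {\<omega> \<in> space P. occupied \<omega> = B})" if B: "B \<in> Pow ?J" for B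
  proof -
    have "prob {\<omega> \<in> space P. occupied \<omega> = B} = prob (?S B \<union> (?N \<inter> {\<omega> \<in> space P. occupied \<omega> = B}))"
      by (intro arg_cong[of _ _ prob]) auto
    also have "\<dots> = prob (?S B) + prob (?N \<inter> {\<omega> \<in> space P. occupied \<omega> = B})"
      using S sep occ by (intro finite_measure_Union) auto
    finally have "weight B - prob (?S B) = prob (?N \<inter> {\<omega> \<in> space P. occupied \<omega> = B})" using weight_eq[OF B] by simp
    then show ?thesis using annealed_bounds[of B \<phi>] B by (simp add: mult_left_le)
  qed
  ultimately have d0: "0 \<le> (\<Sum>B\<in>Pow ?J. weight B * annealed m p \<phi> B) - prob ?A"
    and d1: "(\<Sum>B\<in>Pow ?J. weight B * annealed m p \<phi> B) - prob ?A \<le> (\<Sum>B\<in>Pow ?J. prob (?N \<inter> {\<omega> \<in> space P. occupied \<omega> = B}))"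
    by (auto intro: sum_nonneg sum_mono)
  have "(\<Sum>B\<in>Pow ?J. prob (?N \<inter> {\<omega> \<in> space P. occupied \<omega> = B})) =
    prob (\<Union>B\<in>Pow ?J. ?N \<inter> {\<omega> \<in> space P. occupied \<omega> = B})"
    using finJ sep occ by (intro finite_measure_finite_Union[symmetric]) (auto simp: disjoint_family_on_def)
  also have "(\<Union>B\<in>Pow ?J. ?N \<inter> {\<omega> \<in> space P. occupied \<omega> = B}) = ?N" using occJ by blast
  finally have d2: "(\<Sum>B\<in>Pow ?J. prob (?N \<inter> {\<omega> \<in> space P. occupied \<omega> = B})) = prob ?N" .
  let ?Z = "(stray \<union> undecided) \<union> ?N"
  let ?H = "{\<omega> \<in> space P. finite (edges_at W \<rho> \<omega>) \<and> \<phi> (history W \<rho> \<omega>)}"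
  have "\<bar>prob ?H - prob ?A\<bar> \<le> prob ?Z"
  proof (rule prob_diff_le)
    show "?H \<in> events" using \<rho> W by (intro history_event) auto
    show "?A \<in> events" by (rule Aev)
    show "?Z \<in> events" using stray undecided sep by auto
    show "AE \<omega> in P. \<omega> \<notin> ?Z \<longrightarrow> (\<omega> \<in> ?H \<longleftrightarrow> \<omega> \<in> ?A)"
      using adm AE_time_pos AE_finite_points AE_space
    proof eventually_elim
      case (elim \<omega>)
      show ?case
      proof
        assume nZ: "\<omega> \<notin> ?Z"
        then have sep: "separated \<omega>" and nb: "\<omega> \<notin> stray" "\<omega> \<notin> undecided" using elim(4) by auto
        have "history W \<rho> \<omega> = discrete_history m (occupied \<omega>) (Fedges \<omega>)"
        proof (rule history_separated[OF elim(4) sep])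
          show "card e = 2" if "e \<in> Fedges \<omega>" for e using that by (auto simp: Fedges_def)
          show "U i j \<omega> < W (fst (\<xi> i \<omega>)) (fst (\<xi> j \<omega>)) \<longleftrightarrow>
            (\<exists>x\<in>V. \<exists>y\<in>V. \<xi> i \<omega> \<in> col x \<and> \<xi> j \<omega> \<in> col y \<and> {x, y} \<in> Fedges \<omega>)"
            if "i < j" "snd (\<xi> i \<omega>) \<le> \<rho>" "snd (\<xi> j \<omega>) \<le> \<rho>" for i j
            using adjacency[OF elim(4) nb sep that] .
        qed (use elim in blast)+
        then show "\<omega> \<in> ?H \<longleftrightarrow> \<omega> \<in> ?A" using elim sep by simp
      qed
    qed
  qed
  also have "\<dots> \<le> prob (stray \<union> undecided) + prob ?N" using stray undecided sep by (intro measure_Un_le) auto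
  also have "prob (stray \<union> undecided) \<le> prob stray + prob undecided" using stray undecided by (intro measure_Un_le) auto
  finally have "\<bar>prob ?H - prob ?A\<bar> \<le> prob stray + prob undecided + prob ?N" by simp
  then have "\<bar>prob ?H - (\<Sum>B\<in>Pow ?J. weight B * annealed m p \<phi> B)\<bar> \<le> prob stray + prob undecided + 2 * prob ?N"
    using d0 d1 unfolding d2 abs_le_iff by simp
  also have "\<dots> \<le> (card X0 * lam + 4 * lam\<^sup>2 * \<tau>) + 8 * (card V * lam)\<^sup>2 * \<delta> + 2 * (card V * lam\<^sup>2 + (card V * lam)\<^sup>2 / m)"
    using stray(2) undecided(2) prob_not_separated by (intro add_mono mult_left_mono) auto
  finally show ?thesis .
qed

end

section \<open>The arrival processes\<close>

lemma measurable_true_set: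
  assumes "finite A"
  shows "(\<lambda>f. {e \<in> A. f e}) \<in> PiM A (\<lambda>_. count_space UNIV) \<rightarrow>\<^sub>M count_space (Pow A)"
proof (subst measurable_count_space_eq_countable)
  show "countable (Pow A)" using assms by (simp add: countable_finite)
  show "(\<lambda>f. {e \<in> A. f e}) \<in> space (PiM A (\<lambda>_. count_space UNIV)) \<rightarrow> Pow A \<and>
    (\<forall>T\<in>Pow A. (\<lambda>f. {e \<in> A. f e}) -` {T} \<inter> space (PiM A (\<lambda>_. count_space UNIV)) \<in> sets (PiM A (\<lambda>_. count_space UNIV)))"
  proof (intro conjI ballI)
    fix T assume "T \<in> Pow A"
    then have eq: "(\<lambda>f. {e \<in> A. f e}) -` {T} \<inter> space (PiM A (\<lambda>_. count_space UNIV)) =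
      {f \<in> space (PiM A (\<lambda>_. count_space UNIV)). \<forall>e\<in>A. f e \<longleftrightarrow> e \<in> T}" by auto
    have "Measurable.pred (PiM A (\<lambda>_. count_space UNIV)) (\<lambda>f. \<forall>e\<in>A. f e \<longleftrightarrow> e \<in> T)"
      using assms by (intro pred_intros_finite) measurable
    then show "(\<lambda>f. {e \<in> A. f e}) -` {T} \<inter> space (PiM A (\<lambda>_. count_space UNIV)) \<in> sets (PiM A (\<lambda>_. count_space UNIV))"
      unfolding eq pred_def .
  qed auto
qed

locale arrivals = prob_space M for M :: "'w measure" +
  fixes q :: "nat \<Rightarrow> real" and N :: "nat \<Rightarrow> nat \<Rightarrow> real \<Rightarrow> 'w \<Rightarrow> nat"
  assumes arrivals: "rank1_arrivals M q N" and q0: "\<And>i. i \<ge> 1 \<Longrightarrow> q i \<ge> 0"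
begin

definition present :: "real \<Rightarrow> 'w \<Rightarrow> (nat \<times> nat) set" where
  "present t \<omega> = {(x, y) \<in> edge_pairs. 1 \<le> N x y t \<omega>}"

text \<open>
  The value 0 for the index 0, which is not a vertex, makes this a probability for all arguments.
\<close>

definition arrival_prob :: "real \<Rightarrow> nat \<Rightarrow> nat \<Rightarrow> real" where
  "arrival_prob t x y = (if 1 \<le> x \<and> 1 \<le> y then 1 - exp (- (2 * q x * q y * t)) else 0)"

lemma arrived_graph_eq: "arrived_graph N t \<omega> = edges_of (present t \<omega>)"
  by (auto simp: arrived_graph_def edges_of_def present_def)

lemma counting:
  assumes "(x, y) \<in> edge_pairs"
  shows "poisson_counting_process M (2 * q x * q y) (N x y)"
  using arrivals assms by (auto simp: rank1_arrivals_def rank1_rate_def edge_pairs_def)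

lemma N_measurable:
  assumes "e \<in> edge_pairs" "t \<ge> 0"
  shows "(\<lambda>\<omega>. N (fst e) (snd e) t \<omega>) \<in> M \<rightarrow>\<^sub>M count_space UNIV"
  using counting[of "fst e" "snd e"] assms by (simp add: poisson_counting_process_def)

lemma AE_mono: "AE \<omega> in M. \<forall>(x, y)\<in>edge_pairs. N x y 0 \<omega> = 0 \<and> mono_on {0..} (\<lambda>t. N x y t \<omega>)"
proof -
  have "AE \<omega> in M. \<forall>e\<in>edge_pairs. N (fst e) (snd e) 0 \<omega> = 0 \<and> mono_on {0..} (\<lambda>t. N (fst e) (snd e) t \<omega>)"
  proof (subst AE_ball_countable, simp, intro ballI)
    fix e assume "e \<in> edge_pairs"
    then have "poisson_counting_process M (2 * q (fst e) * q (snd e)) (N (fst e) (snd e))" using counting by simp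
    then show "AE \<omega> in M. N (fst e) (snd e) 0 \<omega> = 0 \<and> mono_on {0..} (\<lambda>t. N (fst e) (snd e) t \<omega>)"
      unfolding poisson_counting_process_def by auto
  qed
  then show ?thesis by eventually_elim auto
qed

lemma present_mono:
  assumes "\<forall>(x, y)\<in>edge_pairs. N x y 0 \<omega> = 0 \<and> mono_on {0..} (\<lambda>t. N x y t \<omega>)" "0 \<le> s" "s \<le> t"
  shows "present s \<omega> \<subseteq> present t \<omega>"
proof clarify
  fix x y assume xy: "(x, y) \<in> present s \<omega>"
  then have "mono_on {0..} (\<lambda>t. N x y t \<omega>)" using assms(1) by (auto simp: present_def)
  then have "N x y s \<omega> \<le> N x y t \<omega>" using assms(2,3) by (auto simp: mono_on_def)
  then show "(x, y) \<in> present t \<omega>" using xy by (auto simp: present_def)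
qed

lemma prob_increment_pos:
  assumes e: "(x, y) \<in> edge_pairs" and t: "0 \<le> s" "s \<le> t"
  shows "prob {\<omega> \<in> space M. N x y t \<omega> - N x y s \<omega> \<noteq> 0} = 1 - exp (- (2 * q x * q y * (t - s)))"
proof -
  have pd: "poisson_distributed M (\<lambda>\<omega>. N x y t \<omega> - N x y s \<omega>) (2 * q x * q y * (t - s))"
    using counting[OF e] t unfolding poisson_counting_process_def by blast
  then have m: "(\<lambda>\<omega>. N x y t \<omega> - N x y s \<omega>) \<in> M \<rightarrow>\<^sub>M count_space UNIV"
    by (simp add: poisson_distributed_def)
  have "{\<omega> \<in> space M. N x y t \<omega> - N x y s \<omega> = 0} \<in> events"
    using measurable_sets[OF m, of "{0}"] by (simp add: vimage_def Int_def conj_commute)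
  then have "prob {\<omega> \<in> space M. N x y t \<omega> - N x y s \<omega> \<noteq> 0} = 1 - prob {\<omega> \<in> space M. N x y t \<omega> - N x y s \<omega> = 0}"
    by (rule prob_neg)
  also have "prob {\<omega> \<in> space M. N x y t \<omega> - N x y s \<omega> = 0} = exp (- (2 * q x * q y * (t - s)))"
    using pd unfolding poisson_distributed_def by (elim conjE allE[of _ 0]) simp
  finally show ?thesis .
qed

lemma present_event:
  assumes "e \<in> edge_pairs" "t \<ge> 0"
  shows "{\<omega> \<in> space M. 1 \<le> N (fst e) (snd e) t \<omega>} \<in> events"
  using measurable_sets[OF N_measurable[OF assms], of "{1..}"] by (simp add: vimage_def Int_def conj_commute)

lemma prob_present:
  assumes e: "(x, y) \<in> edge_pairs" and t: "0 \<le> t"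
  shows "prob {\<omega> \<in> space M. 1 \<le> N x y t \<omega>} = arrival_prob t x y"
proof -
  have ev: "{\<omega> \<in> space M. 1 \<le> N x y t \<omega>} \<in> events" using present_event[of "(x, y)" t] assms by simp
  have "(\<lambda>\<omega>. N x y t \<omega> - N x y 0 \<omega>) \<in> M \<rightarrow>\<^sub>M count_space UNIV"
    using counting[OF e] t unfolding poisson_counting_process_def poisson_distributed_def by blast
  from measurable_sets[OF this, of "- {0}"]
  have ev2: "{\<omega> \<in> space M. N x y t \<omega> - N x y 0 \<omega> \<noteq> 0} \<in> events" by (simp add: vimage_def Int_def conj_commute)
  have "prob {\<omega> \<in> space M. 1 \<le> N x y t \<omega>} = prob {\<omega> \<in> space M. N x y t \<omega> - N x y 0 \<omega> \<noteq> 0}"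
  proof (rule finite_measure_eq_AE[OF _ ev ev2])
    show "AE \<omega> in M. \<omega> \<in> {\<omega> \<in> space M. 1 \<le> N x y t \<omega>} \<longleftrightarrow> \<omega> \<in> {\<omega> \<in> space M. N x y t \<omega> - N x y 0 \<omega> \<noteq> 0}"
      using AE_mono by eventually_elim (use e in auto)
  qed
  then show ?thesis using prob_increment_pos[OF e order_refl t] e by (simp add: arrival_prob_def edge_pairs_def)
qed

lemma prob_new_le:
  assumes e: "(x, y) \<in> edge_pairs" and t: "0 \<le> s" "s \<le> t"
  shows "{\<omega> \<in> space M. N x y s \<omega> = 0 \<and> 1 \<le> N x y t \<omega>} \<in> events"
    "prob {\<omega> \<in> space M. N x y s \<omega> = 0 \<and> 1 \<le> N x y t \<omega>} \<le> 2 * q x * q y * (t - s)"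
proof -
  have m: "(\<lambda>\<omega>. N x y s \<omega>) \<in> M \<rightarrow>\<^sub>M count_space UNIV" "(\<lambda>\<omega>. N x y t \<omega>) \<in> M \<rightarrow>\<^sub>M count_space UNIV"
    using N_measurable[of "(x, y)"] assms by auto
  note [measurable] = m
  show "{\<omega> \<in> space M. N x y s \<omega> = 0 \<and> 1 \<le> N x y t \<omega>} \<in> events" by measurable
  have "prob {\<omega> \<in> space M. N x y s \<omega> = 0 \<and> 1 \<le> N x y t \<omega>} \<le> prob {\<omega> \<in> space M. N x y t \<omega> - N x y s \<omega> \<noteq> 0}"
  proof (rule finite_measure_mono)
    have "(\<lambda>\<omega>. N x y t \<omega> - N x y s \<omega>) \<in> M \<rightarrow>\<^sub>M count_space UNIV"
      using counting[OF e] t unfolding poisson_counting_process_def poisson_distributed_def by blast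
    from measurable_sets[OF this, of "- {0}"]
    show "{\<omega> \<in> space M. N x y t \<omega> - N x y s \<omega> \<noteq> 0} \<in> events" by (simp add: vimage_def Int_def conj_commute)
  qed auto
  also have "\<dots> \<le> 2 * q x * q y * (t - s)"
    unfolding prob_increment_pos[OF assms] using exp_ge_add_one_self[of "- (2 * q x * q y * (t - s))"] by simp
  finally show "prob {\<omega> \<in> space M. N x y s \<omega> = 0 \<and> 1 \<le> N x y t \<omega>} \<le> 2 * q x * q y * (t - s)" .
qed

lemma indep_paths:
  "indep_vars (\<lambda>_. PiM {0..} (\<lambda>_. count_space UNIV)) (\<lambda>(i, j) \<omega>. \<lambda>t\<in>{0..}. N i j t \<omega>) edge_pairs"
  using arrivals by (simp add: rank1_arrivals_def)

lemma indep_present: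
  assumes "t \<ge> 0"
  shows "indep_vars (\<lambda>_. count_space UNIV) (\<lambda>e \<omega>. 1 \<le> N (fst e) (snd e) t \<omega>) edge_pairs"
proof -
  have m: "(\<lambda>f. 1 \<le> f t) \<in> PiM {0..} (\<lambda>_. count_space (UNIV :: nat set)) \<rightarrow>\<^sub>M count_space UNIV"
    by (rule measurable_compose[OF measurable_component_singleton]) (use assms in auto)
  have "indep_vars (\<lambda>_. count_space UNIV) (\<lambda>e \<omega>. 1 \<le> ((\<lambda>(i, j) \<omega>. \<lambda>t\<in>{0..}. N i j t \<omega>) e \<omega>) t) edge_pairs"
    by (rule indep_vars_compose2[OF indep_paths m])
  then show ?thesis using assms by (simp add: case_prod_beta)
qed

lemma pairs_of_subset: "X \<subseteq> {1..} \<Longrightarrow> pairs_of X \<subseteq> edge_pairs"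
  by (auto simp: pairs_of_def edge_pairs_def)

lemma present_law:
  assumes "t \<ge> 0" "finite I" "I \<subseteq> edge_pairs" "T \<subseteq> I"
  shows "{\<omega> \<in> space M. present t \<omega> \<inter> I = T} \<in> events"
    and "prob {\<omega> \<in> space M. present t \<omega> \<inter> I = T} = subset_weight (\<lambda>(x, y). arrival_prob t x y) I T"
proof -
  have eq: "present t \<omega> \<inter> I = {e \<in> I. 1 \<le> N (fst e) (snd e) t \<omega>}" for \<omega>
    using assms(3) by (auto simp: present_def)
  have ind: "indep_vars (\<lambda>_. count_space UNIV) (\<lambda>e \<omega>. 1 \<le> N (fst e) (snd e) t \<omega>) I"
    by (rule indep_vars_subset[OF indep_present[OF assms(1)] assms(3)])
  show "prob {\<omega> \<in> space M. present t \<omega> \<inter> I = T} = subset_weight (\<lambda>(x, y). arrival_prob t x y) I T"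
    unfolding eq
  proof (rule prob_random_subset[OF ind assms(2) _ _ assms(4)])
    fix e assume "e \<in> I"
    then show "prob {\<omega> \<in> space M. 1 \<le> N (fst e) (snd e) t \<omega>} = (\<lambda>(x, y). arrival_prob t x y) e"
      using prob_present[of "fst e" "snd e" t] assms by (auto simp: case_prod_beta)
  qed simp
  have "{\<omega> \<in> space M. present t \<omega> \<inter> I = T} =
    {\<omega> \<in> space M. \<forall>e\<in>I. 1 \<le> N (fst e) (snd e) t \<omega> \<longleftrightarrow> e \<in> T}"
    unfolding eq using assms(4) by blast
  also have "\<dots> \<in> events"
  proof -
    have "Measurable.pred M (\<lambda>\<omega>. 1 \<le> N (fst e) (snd e) t \<omega> \<longleftrightarrow> e \<in> T)" if "e \<in> I" for e
    proof -
      have [measurable]: "(\<lambda>\<omega>. N (fst e) (snd e) t \<omega>) \<in> M \<rightarrow>\<^sub>M count_space UNIV"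
        using N_measurable that assms by blast
      show ?thesis by measurable
    qed
    then have "Measurable.pred M (\<lambda>\<omega>. \<forall>e\<in>I. 1 \<le> N (fst e) (snd e) t \<omega> \<longleftrightarrow> e \<in> T)"
      using assms(2) by (intro pred_intros_finite) auto
    then show ?thesis by (simp add: pred_def)
  qed
  finally show "{\<omega> \<in> space M. present t \<omega> \<inter> I = T} \<in> events" .
qed

text \<open>
  Only the edges between occupied vertices enter. The events for \<open>B\<close> and \<open>B'\<close> therefore depend on
  disjoint sets of arrival processes as soon as \<open>B\<close> and \<open>B'\<close> have at most one vertex in common.
\<close>

definition test :: "nat \<Rightarrow> (ugraph set \<Rightarrow> bool) \<Rightarrow> real \<Rightarrow> (nat \<times> nat) set \<Rightarrow> 'w \<Rightarrow> bool" where
  "test m \<phi> t B \<omega> \<longleftrightarrow> \<phi> (discrete_history m B (edges_of (present t \<omega> \<inter> pairs_of (fst ` B))))"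

lemma prob_test:
  assumes "t \<ge> 0" "finite (fst ` B)" "fst ` B \<subseteq> {1..}"
  shows "{\<omega> \<in> space M. test m \<phi> t B \<omega>} \<in> events"
    and "prob {\<omega> \<in> space M. test m \<phi> t B \<omega>} = annealed m (arrival_prob t) \<phi> B"
proof -
  let ?I = "pairs_of (fst ` B)"
  have I: "finite ?I" "?I \<subseteq> edge_pairs" using assms finite_pairs_of pairs_of_subset by blast+
  have *: "finite (Pow ?I)" "\<And>\<omega>. present t \<omega> \<inter> ?I \<in> Pow ?I"
    "\<And>T. T \<in> Pow ?I \<Longrightarrow> {\<omega> \<in> space M. present t \<omega> \<inter> ?I = T} \<in> events"
    using I present_law(1)[OF assms(1) I] by auto
  note pf = prob_finite_valued[OF *, of "\<lambda>T. \<phi> (discrete_history m B (edges_of T))"]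
  show "{\<omega> \<in> space M. test m \<phi> t B \<omega>} \<in> events" unfolding test_def using pf(1) by simp
  show "prob {\<omega> \<in> space M. test m \<phi> t B \<omega>} = annealed m (arrival_prob t) \<phi> B"
    unfolding test_def annealed_def using pf(2) present_law(2)[OF assms(1) I] by simp
qed

lemma test_indep:
  assumes t: "t \<ge> 0" and B: "finite (fst ` B)" "fst ` B \<subseteq> {1..}" and B': "finite (fst ` B')" "fst ` B' \<subseteq> {1..}"
    and disj: "pairs_of (fst ` B) \<inter> pairs_of (fst ` B') = {}"
  shows "prob {\<omega> \<in> space M. test m \<phi> t B \<omega> \<and> test m \<phi> t B' \<omega>} =
    prob {\<omega> \<in> space M. test m \<phi> t B \<omega>} * prob {\<omega> \<in> space M. test m \<phi> t B' \<omega>}"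
proof -
  define S where "S = (\<lambda>C. {f \<in> space (PiM (pairs_of (fst ` C)) (\<lambda>_. count_space (UNIV :: bool set))).
    \<phi> (discrete_history m C (edges_of {e \<in> pairs_of (fst ` C). f e}))})"
  let ?X = "\<lambda>C \<omega>. restrict (\<lambda>e. 1 \<le> N (fst e) (snd e) t \<omega>) (pairs_of (fst ` C))"
  have Sm: "S C \<in> sets (PiM (pairs_of (fst ` C)) (\<lambda>_. count_space UNIV))" if "finite (fst ` C)" for C
  proof -
    have "(\<lambda>f. {e \<in> pairs_of (fst ` C). f e}) -` {T \<in> Pow (pairs_of (fst ` C)). \<phi> (discrete_history m C (edges_of T))} \<inter>
      space (PiM (pairs_of (fst ` C)) (\<lambda>_. count_space UNIV)) \<in> sets (PiM (pairs_of (fst ` C)) (\<lambda>_. count_space UNIV))"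
      by (rule measurable_sets[OF measurable_true_set[OF finite_pairs_of[OF that]]]) auto
    also have "(\<lambda>f. {e \<in> pairs_of (fst ` C). f e}) -` {T \<in> Pow (pairs_of (fst ` C)). \<phi> (discrete_history m C (edges_of T))} \<inter>
      space (PiM (pairs_of (fst ` C)) (\<lambda>_. count_space UNIV)) = S C" by (auto simp: S_def)
    finally show ?thesis .
  qed
  have eq: "test m \<phi> t C \<omega> \<longleftrightarrow> ?X C \<omega> \<in> S C" if "fst ` C \<subseteq> {1..}" for C \<omega>
  proof -
    have "present t \<omega> \<inter> pairs_of (fst ` C) = {e \<in> pairs_of (fst ` C). ?X C \<omega> e}"
      using pairs_of_subset[OF that] by (auto simp: present_def)
    then show ?thesis by (simp add: S_def test_def space_PiM)
  qed
  have "indep_var (PiM (pairs_of (fst ` B)) (\<lambda>_. count_space UNIV)) (?X B) (PiM (pairs_of (fst ` B')) (\<lambda>_. count_space UNIV)) (?X B')"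
    by (rule indep_var_restrict[OF indep_present[OF t] disj pairs_of_subset[OF B(2)] pairs_of_subset[OF B'(2)]])
  from indep_varD[OF this Sm[OF B(1)] Sm[OF B'(1)]]
  have "prob ((\<lambda>\<omega>. (?X B \<omega>, ?X B' \<omega>)) -` (S B \<times> S B') \<inter> space M) =
    prob (?X B -` S B \<inter> space M) * prob (?X B' -` S B' \<inter> space M)" .
  moreover have "(\<lambda>\<omega>. (?X B \<omega>, ?X B' \<omega>)) -` (S B \<times> S B') \<inter> space M = {\<omega> \<in> space M. test m \<phi> t B \<omega> \<and> test m \<phi> t B' \<omega>}"
    using eq[OF B(2)] eq[OF B'(2)] by auto
  moreover have "?X C -` S C \<inter> space M = {\<omega> \<in> space M. test m \<phi> t C \<omega>}" if "fst ` C \<subseteq> {1..}" for C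
    using eq[OF that] by auto
  ultimately show ?thesis using B(2) B'(2) by simp
qed

text \<open>
  The footprint of \<open>B\<close> is the set of pairs of its vertices. It meets the footprint of \<open>B'\<close> only if
  both contain some two vertices \<open>x\<close> and \<open>y\<close>, and \<open>\<kappa>\<close> bounds the weight of that.
\<close>

lemma quenched_average_deviation:
  fixes \<kappa> a :: real
  assumes t: "t \<ge> 0" and V: "finite V" "V \<subseteq> {1..}"
    and w: "\<And>B. B \<subseteq> V \<times> {1..m} \<Longrightarrow> 0 \<le> w B"
    and \<kappa>: "\<And>x y. x \<in> V \<Longrightarrow> y \<in> V \<Longrightarrow> x \<noteq> y \<Longrightarrow>
       (\<Sum>B\<in>{B \<in> Pow (V \<times> {1..m}). x \<in> fst ` B \<and> y \<in> fst ` B}. w B) \<le> \<kappa>" and a: "a > 0"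
  shows "prob {\<omega> \<in> space M. a \<le> \<bar>(\<Sum>B\<in>Pow (V \<times> {1..m}). w B * of_bool (test m \<phi> t B \<omega>)) -
      (\<Sum>B\<in>Pow (V \<times> {1..m}). w B * annealed m (arrival_prob t) \<phi> B)\<bar>} \<le> (real (card V))\<^sup>2 * \<kappa>\<^sup>2 / a\<^sup>2"
proof -
  let ?S = "Pow (V \<times> {1..m})"
  have finB: "finite (fst ` B)" and Bsub: "fst ` B \<subseteq> {1..}" and BV: "fst ` B \<subseteq> V" if "B \<in> ?S" for B
  proof -
    show "fst ` B \<subseteq> V" using that by auto
    then show "finite (fst ` B)" "fst ` B \<subseteq> {1..}" using V finite_subset by blast+
  qed
  have ev: "{\<omega> \<in> space M. test m \<phi> t B \<omega>} \<in> events"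
    and pr: "prob {\<omega> \<in> space M. test m \<phi> t B \<omega>} = annealed m (arrival_prob t) \<phi> B" if "B \<in> ?S" for B
    using prob_test[OF t finB Bsub] that by blast+
  have Eb: "expectation (\<lambda>\<omega>. of_bool (Q \<omega>)) = prob {\<omega> \<in> space M. Q \<omega>}"
    if "{\<omega> \<in> space M. Q \<omega>} \<in> events" for Q
  proof -
    have "expectation (\<lambda>\<omega>. of_bool (Q \<omega>)) = expectation (indicator {\<omega> \<in> space M. Q \<omega>} :: _ \<Rightarrow> real)"
      by (rule Bochner_Integration.integral_cong) (auto simp: indicator_def)
    then show ?thesis using that by simp
  qed
  have "prob {\<omega> \<in> space M. a \<le> \<bar>(\<Sum>B\<in>?S. w B * of_bool (test m \<phi> t B \<omega>)) -
      (\<Sum>B\<in>?S. w B * expectation (\<lambda>\<omega>. of_bool (test m \<phi> t B \<omega>)))\<bar>} \<le> card (pairs_of V) * \<kappa>\<^sup>2 / a\<^sup>2"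
  proof (rule prob_weighted_average_deviation[where foot = "\<lambda>B. pairs_of (fst ` B)" and I = "pairs_of V"])
    show "finite ?S" "finite (pairs_of V)" using V finite_pairs_of by auto
    show "(\<lambda>\<omega>. of_bool (test m \<phi> t B \<omega>) :: real) \<in> borel_measurable M" if "B \<in> ?S" for B
    proof -
      have [measurable]: "Measurable.pred M (\<lambda>\<omega>. test m \<phi> t B \<omega>)" using ev[OF that] by (simp add: pred_def)
      show ?thesis unfolding of_bool_def by measurable
    qed
    show "pairs_of (fst ` B) \<subseteq> pairs_of V" if "B \<in> ?S" for B using BV[OF that] by (auto simp: pairs_of_def)
    show "expectation (\<lambda>\<omega>. of_bool (test m \<phi> t B \<omega>) * of_bool (test m \<phi> t B' \<omega>) :: real) =
      expectation (\<lambda>\<omega>. of_bool (test m \<phi> t B \<omega>)) * expectation (\<lambda>\<omega>. of_bool (test m \<phi> t B' \<omega>))"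
      if B: "B \<in> ?S" "B' \<in> ?S" "pairs_of (fst ` B) \<inter> pairs_of (fst ` B') = {}" for B B'
    proof -
      have "{\<omega> \<in> space M. test m \<phi> t B \<omega> \<and> test m \<phi> t B' \<omega>} =
        {\<omega> \<in> space M. test m \<phi> t B \<omega>} \<inter> {\<omega> \<in> space M. test m \<phi> t B' \<omega>}" by auto
      then have e2: "{\<omega> \<in> space M. test m \<phi> t B \<omega> \<and> test m \<phi> t B' \<omega>} \<in> events"
        by (simp only:) (intro sets.Int ev B)
      have "expectation (\<lambda>\<omega>. of_bool (test m \<phi> t B \<omega>) * of_bool (test m \<phi> t B' \<omega>) :: real) =
        expectation (\<lambda>\<omega>. of_bool (test m \<phi> t B \<omega> \<and> test m \<phi> t B' \<omega>))"
        by (intro Bochner_Integration.integral_cong) auto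
      also have "\<dots> = prob {\<omega> \<in> space M. test m \<phi> t B \<omega>} * prob {\<omega> \<in> space M. test m \<phi> t B' \<omega>}"
        unfolding Eb[OF e2] by (rule test_indep[OF t finB Bsub finB Bsub B(3)]) (use B in auto)
      finally show ?thesis unfolding Eb[OF ev[OF B(1)]] Eb[OF ev[OF B(2)]] .
    qed
    fix e assume "e \<in> pairs_of V"
    then obtain x y where e: "e = (x, y)" "x < y" "x \<in> V" "y \<in> V" by (auto simp: pairs_of_def)
    then have "{b \<in> ?S. e \<in> pairs_of (fst ` b)} = {B \<in> ?S. x \<in> fst ` B \<and> y \<in> fst ` B}" by (auto simp: pairs_of_def)
    then show "(\<Sum>b\<in>{b \<in> ?S. e \<in> pairs_of (fst ` b)}. w b) \<le> \<kappa>" using \<kappa>[of x y] e by simp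
  qed (use w a in auto)
  also have "\<dots> \<le> (real (card V))\<^sup>2 * \<kappa>\<^sup>2 / a\<^sup>2"
  proof -
    have "card (pairs_of V) \<le> card (V \<times> V)"
      using V by (intro card_mono) (auto simp: pairs_of_def)
    then have "real (card (pairs_of V)) \<le> (real (card V))\<^sup>2"
      unfolding card_cartesian_product power2_eq_square of_nat_mult[symmetric] of_nat_le_iff .
    then show ?thesis by (intro divide_right_mono mult_right_mono) auto
  qed
  also have "(\<Sum>B\<in>?S. w B * expectation (\<lambda>\<omega>. of_bool (test m \<phi> t B \<omega>))) = (\<Sum>B\<in>?S. w B * annealed m (arrival_prob t) \<phi> B)"
    using ev pr Eb by (intro sum.cong refl) simp
  finally show ?thesis .
qed

text \<open>
  Edges at time \<open>t\<close>, with both ends above \<open>a\<close>, that are absent from the window up to \<open>b\<close> at the earlier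
  time \<open>s\<close>: they leave the window or arrive after \<open>s\<close>.
\<close>

definition missed :: "nat \<Rightarrow> nat \<Rightarrow> real \<Rightarrow> real \<Rightarrow> 'w \<Rightarrow> (nat \<times> nat) set" where
  "missed a b s t \<omega> = {(x, y) \<in> edge_pairs. a < x \<and> \<not> (y \<le> b \<and> 1 \<le> N x y s \<omega>) \<and> 1 \<le> N x y t \<omega>}"

text \<open>
  The events that a given edge is missed depend on different arrival processes.
\<close>

lemma prob_many_missed:
  assumes st: "0 \<le> s" "s \<le> t" and \<mu>: "\<mu> > 0"
    and sum: "\<And>F. finite F \<Longrightarrow> F \<subseteq> {(x, y) \<in> edge_pairs. a < x} \<Longrightarrow>
       (\<Sum>(x, y)\<in>F. 2 * q x * q y * (if y \<le> b then t - s else t)) \<le> \<mu>"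
  shows "\<exists>Z\<in>events. prob Z \<le> 1 / \<mu> \<and>
     (\<forall>\<omega>\<in>space M - Z. finite (missed a b s t \<omega>) \<and> real (card (missed a b s t \<omega>)) \<le> 2 * \<mu>)"
proof -
  define I where "I = {(x, y) \<in> edge_pairs. a < x}"
  define Q where "Q = (\<lambda>(e :: nat \<times> nat) (f :: real \<Rightarrow> nat). \<not> (snd e \<le> b \<and> 1 \<le> f s) \<and> 1 \<le> f t)"
  define A where "A e = {\<omega> \<in> space M. Q e ((\<lambda>(i, j) \<omega>. \<lambda>t\<in>{0..}. N i j t \<omega>) e \<omega>)}" for e
  have Aeq: "A (x, y) = {\<omega> \<in> space M. \<not> (y \<le> b \<and> 1 \<le> N x y s \<omega>) \<and> 1 \<le> N x y t \<omega>}" for x y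
    using st by (simp add: A_def Q_def)
  have "indep_vars (\<lambda>_. PiM {0..} (\<lambda>_. count_space UNIV)) (\<lambda>(i, j) \<omega>. \<lambda>t\<in>{0..}. N i j t \<omega>) I"
    by (rule indep_vars_subset[OF indep_paths]) (auto simp: I_def)
  then have ind: "indep_events A I"
    unfolding A_def
  proof (rule indep_eventsI_indep_vars)
    fix e
    have [measurable]: "(\<lambda>f. f s) \<in> PiM {0..} (\<lambda>_. count_space (UNIV :: nat set)) \<rightarrow>\<^sub>M count_space UNIV"
      "(\<lambda>f. f t) \<in> PiM {0..} (\<lambda>_. count_space (UNIV :: nat set)) \<rightarrow>\<^sub>M count_space UNIV"
      using st by (auto intro: measurable_component_singleton)
    show "{x \<in> space (PiM {0..} (\<lambda>_. count_space UNIV)). Q e x} \<in> sets (PiM {0..} (\<lambda>_. count_space UNIV))"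
      unfolding Q_def by measurable
  qed
  have ev: "A e \<in> events" if "e \<in> I" for e using ind that unfolding indep_events_def by blast
  have "\<exists>Z\<in>events. prob Z \<le> 1 / \<mu> \<and>
     (\<forall>\<omega>\<in>space M - Z. finite {e \<in> I. \<omega> \<in> A e} \<and> real (card {e \<in> I. \<omega> \<in> A e}) \<le> 2 * \<mu>)"
  proof (rule prob_many_events[OF _ ev _ _ \<mu>])
    show "countable I" by simp
    show "prob (A e \<inter> A e') = prob (A e) * prob (A e')" if "e \<in> I" "e' \<in> I" "e \<noteq> e'" for e e'
    proof -
      have "prob (\<Inter>i\<in>{e, e'}. A i) = (\<Prod>i\<in>{e, e'}. prob (A i))"
        using ind that unfolding indep_events_def by (elim conjE allE[of _ "{e, e'}"] impE) auto
      then show ?thesis using that by simp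
    qed
    fix F assume F: "finite F" "F \<subseteq> I"
    have "(\<Sum>e\<in>F. prob (A e)) \<le> (\<Sum>(x, y)\<in>F. 2 * q x * q y * (if y \<le> b then t - s else t))"
    proof (rule sum_mono)
      fix e assume "e \<in> F"
      obtain x y where e: "e = (x, y)" by (cases e)
      have xy: "(x, y) \<in> edge_pairs" using \<open>e \<in> F\<close> F e by (auto simp: I_def)
      have "prob (A (x, y)) \<le> 2 * q x * q y * (if y \<le> b then t - s else t)"
      proof (cases "y \<le> b")
        case True
        then have "A (x, y) = {\<omega> \<in> space M. N x y s \<omega> = 0 \<and> 1 \<le> N x y t \<omega>}"
          unfolding Aeq by auto
        then show ?thesis using prob_new_le(2)[OF xy st] True by simp
      next
        case False
        then have "A (x, y) = {\<omega> \<in> space M. 1 \<le> N x y t \<omega>}" unfolding Aeq by auto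
        then have "prob (A (x, y)) = arrival_prob t x y" using prob_present[OF xy] st by simp
        also have "\<dots> \<le> 2 * q x * q y * t"
          using exp_ge_add_one_self[of "- (2 * q x * q y * t)"] xy by (simp add: arrival_prob_def edge_pairs_def)
        finally show ?thesis using False by simp
      qed
      then show "prob (A e) \<le> (case e of (x, y) \<Rightarrow> 2 * q x * q y * (if y \<le> b then t - s else t))" by (simp add: e)
    qed
    also have "\<dots> \<le> \<mu>" using sum F by (simp add: I_def)
    finally show "(\<Sum>e\<in>F. prob (A e)) \<le> \<mu>" .
  qed
  then obtain Z where Z: "Z \<in> events" "prob Z \<le> 1 / \<mu>"
    "\<And>\<omega>. \<omega> \<in> space M - Z \<Longrightarrow> finite {e \<in> I. \<omega> \<in> A e} \<and> real (card {e \<in> I. \<omega> \<in> A e}) \<le> 2 * \<mu>" by blast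
  have "{e \<in> I. \<omega> \<in> A e} = missed a b s t \<omega>" if "\<omega> \<in> space M" for \<omega>
    using that by (auto simp: missed_def I_def Aeq)
  then show ?thesis using Z by (intro bexI[of _ Z]) auto
qed

text \<open>
  The expected number of edges at time \<open>t\<close> is at most \<open>2 * t\<close> because \<open>q\<close> has total mass 1. With
  \<open>a = b = s = 0\<close> every edge counts as missed.
\<close>

lemma AE_finite_present:
  assumes q: "(q has_sum 1) {1..}"
  shows "AE \<omega> in M. \<forall>j :: nat. finite (present (real j) \<omega>)"
proof (subst AE_all_countable, intro allI)
  fix j :: nat
  define t where "t = real j"
  have t: "0 \<le> t" by (simp add: t_def)
  have sum: "(\<Sum>(x, y)\<in>F. 2 * q x * q y * t) \<le> 2 * t" if F: "finite F" "F \<subseteq> edge_pairs" for F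
  proof -
    have "(\<Sum>(x, y)\<in>F. 2 * q x * q y * t) \<le> (\<Sum>(x, y)\<in>fst ` F \<times> snd ` F. 2 * q x * q y * t)"
    proof (rule sum_mono2)
      fix e assume "e \<in> fst ` F \<times> snd ` F - F"
      then have "1 \<le> fst e" "1 \<le> snd e" using F(2) by (auto simp: edge_pairs_def)
      then show "0 \<le> (case e of (x, y) \<Rightarrow> 2 * q x * q y * t)" using q0 t by (simp add: case_prod_beta)
    qed (use F in force)+
    also have "\<dots> = (\<Sum>x\<in>fst ` F. \<Sum>y\<in>snd ` F. 2 * q x * q y * t)"
      by (simp add: sum.cartesian_product)
    also have "\<dots> = (\<Sum>x\<in>fst ` F. 2 * t * q x * sum q (snd ` F))"
      by (intro sum.cong refl) (simp add: sum_distrib_left mult_ac)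
    also have "\<dots> = 2 * t * (sum q (fst ` F) * sum q (snd ` F))"
      unfolding sum_distrib_right[symmetric] sum_distrib_left[symmetric] by simp
    also have "\<dots> \<le> 2 * t * (1 * 1)"
    proof -
      have s: "sum q G \<le> 1" "0 \<le> sum q G" if "finite G" "G \<subseteq> {1..}" for G
      proof -
        show "sum q G \<le> 1" by (rule finite_sum_le_has_sum[OF q that]) (use q0 in auto)
        show "0 \<le> sum q G" using q0 that by (intro sum_nonneg) auto
      qed
      have "fst ` F \<subseteq> {1..}" "snd ` F \<subseteq> {1..}" using F by (auto simp: edge_pairs_def)
      then show ?thesis using s F t by (intro mult_left_mono mult_mono) auto
    qed
    finally show ?thesis by simp
  qed
  have "\<exists>Z\<in>events. prob Z \<le> 1 / real (Suc i + nat \<lceil>2 * t\<rceil>) \<and> {\<omega> \<in> space M. infinite (present t \<omega>)} \<subseteq> Z" for i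
  proof -
    let ?\<mu> = "real (Suc i + nat \<lceil>2 * t\<rceil>)"
    have le: "2 * t \<le> ?\<mu>" by linarith
    have "\<exists>Z\<in>events. prob Z \<le> 1 / ?\<mu> \<and>
      (\<forall>\<omega>\<in>space M - Z. finite (missed 0 0 0 t \<omega>) \<and> real (card (missed 0 0 0 t \<omega>)) \<le> 2 * ?\<mu>)"
    proof (rule prob_many_missed)
      show "0 < ?\<mu>" by (simp only: of_nat_0_less_iff)
      fix F assume F: "finite F" "F \<subseteq> {(x, y) \<in> edge_pairs. 0 < x}"
      have "(\<Sum>(x, y)\<in>F. 2 * q x * q y * (if y \<le> 0 then t - 0 else t)) = (\<Sum>(x, y)\<in>F. 2 * q x * q y * t)"
        by (intro sum.cong) auto
      also have "\<dots> \<le> ?\<mu>" using sum[OF F(1)] F(2) le by force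
      finally show "(\<Sum>(x, y)\<in>F. 2 * q x * q y * (if y \<le> 0 then t - 0 else t)) \<le> ?\<mu>" .
    qed (use t in auto)
    then obtain Z where Z: "Z \<in> events" "prob Z \<le> 1 / ?\<mu>" "\<And>\<omega>. \<omega> \<in> space M - Z \<Longrightarrow> finite (missed 0 0 0 t \<omega>)" by blast
    have "present t \<omega> = missed 0 0 0 t \<omega>" for \<omega> by (auto simp: present_def missed_def edge_pairs_def)
    then show ?thesis using Z by (intro bexI[of _ Z]) auto
  qed
  then obtain Z where Z: "\<And>i. Z i \<in> events" "\<And>i. prob (Z i) \<le> 1 / real (Suc i + nat \<lceil>2 * t\<rceil>)"
    "\<And>i. {\<omega> \<in> space M. infinite (present t \<omega>)} \<subseteq> Z i" by metis
  show "AE \<omega> in M. finite (present (real j) \<omega>)"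
    using Z(1,2)
  proof (rule AE_from_small_covers)
    show "(\<lambda>i. 1 / real (Suc i + nat \<lceil>2 * t\<rceil>)) \<longlonglongrightarrow> 0" by real_asymp
  qed (use Z(3) in \<open>auto simp: t_def\<close>)
qed

end

section \<open>Power sums and the scaling of the edge probabilities\<close>

text \<open>
  By the mean value theorem; summing it telescopes.
\<close>

lemma powr_le_difference:
  fixes x :: real
  assumes "\<gamma> > 1" "x > 1"
  shows "x powr (- \<gamma>) \<le> ((x - 1) powr (1 - \<gamma>) - x powr (1 - \<gamma>)) / (\<gamma> - 1)"
proof -
  have d: "((\<lambda>y. y powr (1 - \<gamma>)) has_real_derivative (1 - \<gamma>) * y powr (- \<gamma>)) (at y)" if "y > 0" for y
    using that by (auto intro!: derivative_eq_intros)
  have "\<exists>z>x - 1. z < x \<and> x powr (1 - \<gamma>) - (x - 1) powr (1 - \<gamma>) = (x - (x - 1)) * ((1 - \<gamma>) * z powr (- \<gamma>))"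
    by (rule MVT2) (use d assms in auto)
  then obtain z where z: "x - 1 < z" "z < x" "x powr (1 - \<gamma>) - (x - 1) powr (1 - \<gamma>) = (1 - \<gamma>) * z powr (- \<gamma>)" by auto
  have "x powr (- \<gamma>) \<le> z powr (- \<gamma>)" using z assms by (intro powr_mono2') auto
  also have "z powr (- \<gamma>) = ((x - 1) powr (1 - \<gamma>) - x powr (1 - \<gamma>)) / (\<gamma> - 1)"
    using z(3) assms by (simp add: field_simps)
  finally show ?thesis .
qed

lemma sum_powr_tail_le:
  assumes "\<gamma> > 1" "a \<ge> 1" "finite G" "G \<subseteq> {a..}"
  shows "(\<Sum>x\<in>G. real x powr (- \<gamma>)) \<le> \<gamma> / (\<gamma> - 1) * real a powr (1 - \<gamma>)"
proof -
  obtain L where L: "G \<subseteq> {..L}" using assms(3) finite_nat_iff_bounded_le by blast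
  have tele: "(\<Sum>x\<in>{a<..a + d}. real x powr (- \<gamma>)) \<le> (real a powr (1 - \<gamma>) - real (a + d) powr (1 - \<gamma>)) / (\<gamma> - 1)" for d
  proof (induction d)
    case (Suc d)
    have "{a<..a + Suc d} = insert (a + Suc d) {a<..a + d}" by auto
    then have "(\<Sum>x\<in>{a<..a + Suc d}. real x powr (- \<gamma>)) = real (a + Suc d) powr (- \<gamma>) + (\<Sum>x\<in>{a<..a + d}. real x powr (- \<gamma>))"
      by simp
    also have "\<dots> \<le> ((real (a + Suc d) - 1) powr (1 - \<gamma>) - real (a + Suc d) powr (1 - \<gamma>)) / (\<gamma> - 1) +
       (real a powr (1 - \<gamma>) - real (a + d) powr (1 - \<gamma>)) / (\<gamma> - 1)"
      using assms Suc by (intro add_mono powr_le_difference) auto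
    also have "real (a + Suc d) - 1 = real (a + d)" by simp
    finally show ?case by (simp add: diff_divide_distrib)
  qed simp
  have "(\<Sum>x\<in>G. real x powr (- \<gamma>)) \<le> (\<Sum>x\<in>insert a {a<..a + L}. real x powr (- \<gamma>))"
  proof (rule sum_mono2)
    show "G \<subseteq> insert a {a<..a + L}"
    proof
      fix x assume "x \<in> G"
      then have "x \<le> L" "a \<le> x" using L assms(4) by auto
      then show "x \<in> insert a {a<..a + L}" by auto
    qed
  qed auto
  also have "\<dots> = real a powr (- \<gamma>) + (\<Sum>x\<in>{a<..a + L}. real x powr (- \<gamma>))" by simp
  also have "\<dots> \<le> real a powr (1 - \<gamma>) + real a powr (1 - \<gamma>) / (\<gamma> - 1)"
  proof (intro add_mono)
    show "real a powr (- \<gamma>) \<le> real a powr (1 - \<gamma>)" using assms by (intro powr_mono) auto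
    have "(real a powr (1 - \<gamma>) - real (a + L) powr (1 - \<gamma>)) / (\<gamma> - 1) \<le> real a powr (1 - \<gamma>) / (\<gamma> - 1)"
      using assms by (intro divide_right_mono) auto
    then show "(\<Sum>x\<in>{a<..a + L}. real x powr (- \<gamma>)) \<le> real a powr (1 - \<gamma>) / (\<gamma> - 1)" using tele[of L] by linarith
  qed
  also have "\<dots> = \<gamma> / (\<gamma> - 1) * real a powr (1 - \<gamma>)"
  proof -
    have "\<gamma> / (\<gamma> - 1) = 1 + 1 / (\<gamma> - 1)" using assms(1) by (simp add: field_simps)
    then show ?thesis by (simp only: distrib_right) simp
  qed
  finally show ?thesis .
qed

text \<open>
  The map \<open>h\<close> serves for the identity and for the shift \<open>x - 1\<close>, since the left end of the strip of
  \<open>x\<close> is \<open>(x - 1) / n\<close>.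
\<close>

lemma sum_powr_pairs_le:
  fixes h :: "nat \<Rightarrow> nat"
  assumes "\<gamma> > 1" "a \<ge> 1" "b \<ge> 1" "finite F" "F \<subseteq> {(x, y). a \<le> h x \<and> b \<le> h y}" and h: "inj_on h {x. 1 \<le> h x}"
  shows "(\<Sum>(x, y)\<in>F. real (h x) powr (- \<gamma>) * real (h y) powr (- \<gamma>)) \<le>
    (\<gamma> / (\<gamma> - 1))\<^sup>2 * (real a powr (1 - \<gamma>) * real b powr (1 - \<gamma>))"
proof -
  let ?f = "\<lambda>x. real (h x) powr (- \<gamma>)"
  have one: "(\<Sum>x\<in>G. ?f x) \<le> \<gamma> / (\<gamma> - 1) * real d powr (1 - \<gamma>)" if G: "finite G" "G \<subseteq> {x. d \<le> h x}" "d \<ge> 1" for G d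
  proof -
    have "G \<subseteq> {x. 1 \<le> h x}" using G by auto
    then have "inj_on h G" using h by (rule inj_on_subset[rotated])
    then have "(\<Sum>x\<in>G. ?f x) = (\<Sum>x\<in>h ` G. real x powr (- \<gamma>))" by (simp add: sum.reindex)
    also have "\<dots> \<le> \<gamma> / (\<gamma> - 1) * real d powr (1 - \<gamma>)"
      using G assms(1) by (intro sum_powr_tail_le) auto
    finally show ?thesis .
  qed
  have "(\<Sum>(x, y)\<in>F. ?f x * ?f y) \<le> (\<Sum>(x, y)\<in>fst ` F \<times> snd ` F. ?f x * ?f y)"
    using assms(4) by (intro sum_mono2) force+
  also have "\<dots> = (\<Sum>x\<in>fst ` F. ?f x) * (\<Sum>y\<in>snd ` F. ?f y)"
    by (simp add: sum.cartesian_product sum_product)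
  also have "\<dots> \<le> (\<gamma> / (\<gamma> - 1) * real a powr (1 - \<gamma>)) * (\<gamma> / (\<gamma> - 1) * real b powr (1 - \<gamma>))"
  proof (intro mult_mono one)
    show "0 \<le> \<gamma> / (\<gamma> - 1) * real a powr (1 - \<gamma>)" using assms(1) by simp
    show "0 \<le> (\<Sum>y\<in>snd ` F. ?f y)" by (intro sum_nonneg) auto
  qed (use assms in auto)
  finally show ?thesis by (simp add: power2_eq_square mult_ac)
qed

lemma div_ge_half:
  fixes n k :: nat
  assumes "k \<ge> 1" "n \<ge> k"
  shows "real n / (2 * real k) \<le> real (n div k)" "1 \<le> n div k"
proof -
  show 1: "1 \<le> n div k" using assms by (simp add: div_greater_zero_iff Suc_le_eq)
  have "n < k * (n div k) + k" using assms(1) by (metis add_less_cancel_left mult_div_mod_eq mod_less_divisor less_le_trans zero_less_one)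
  also have "\<dots> \<le> k * (n div k) + k * (n div k)" using 1 by (simp add: Suc_le_eq)
  finally have "real n \<le> 2 * real k * real (n div k)" using of_nat_mono[of n "2 * k * (n div k)"] by simp
  then show "real n / (2 * real k) \<le> real (n div k)" using assms by (simp add: field_simps)
qed

text \<open>
  For \<open>a\<close> and \<open>b\<close> of order \<open>n\<close> the sum over pairs scales like \<open>n\<^sup>2\<close>, the number of pairs of
  vertices in the window. The upper end \<open>n * k\<^sup>2\<close> is needed because with \<open>n * k\<close> the product
  \<open>a * b / n\<^sup>2\<close> would not tend to infinity with \<open>k\<close>.
\<close>

lemma tail_scaling:
  assumes "\<gamma> > 1" "k \<ge> 1" "n \<ge> k"
  shows "real n powr (2 * \<gamma>) * (real (n div k) powr (1 - \<gamma>) * real (n * k^2) powr (1 - \<gamma>)) \<le>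
     (real n)\<^sup>2 * (real k / 2) powr (1 - \<gamma>)"
    and "real n powr (2 * \<gamma>) * (real (n div k) powr (1 - \<gamma>) * real (n div k) powr (1 - \<gamma>)) \<le>
     (real n)\<^sup>2 * (2 * real k) powr (2 * (\<gamma> - 1))"
proof -
  have n: "n \<ge> 1" using assms by simp
  have h: "real (n div k) powr (1 - \<gamma>) \<le> (real n / (2 * real k)) powr (1 - \<gamma>)"
    using div_ge_half[OF assms(2,3)] assms n by (intro powr_mono2') auto
  have n2: "real n powr (2 * \<gamma>) = (real n)\<^sup>2 * (real n powr (\<gamma> - 1) * real n powr (\<gamma> - 1))"
  proof -
    have "real n powr (2 * \<gamma>) = real n powr (2 + ((\<gamma> - 1) + (\<gamma> - 1)))" by (simp add: algebra_simps)
    also have "\<dots> = real n powr 2 * (real n powr (\<gamma> - 1) * real n powr (\<gamma> - 1))" by (simp only: powr_add)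
    finally show ?thesis using n by (simp add: powr_numeral)
  qed
  have nn: "real n powr (\<gamma> - 1) * real n powr (1 - \<gamma>) = 1"
    using n by (simp add: powr_add[symmetric])
  have "real n powr (2 * \<gamma>) * (real (n div k) powr (1 - \<gamma>) * real (n * k^2) powr (1 - \<gamma>)) \<le>
    real n powr (2 * \<gamma>) * ((real n / (2 * real k)) powr (1 - \<gamma>) * real (n * k^2) powr (1 - \<gamma>))"
    using h by (intro mult_left_mono mult_right_mono) auto
  also have "(real n / (2 * real k)) powr (1 - \<gamma>) * real (n * k^2) powr (1 - \<gamma>) = (real n * real n * (real k / 2)) powr (1 - \<gamma>)"
    using assms n by (simp add: powr_mult[symmetric] power2_eq_square field_simps)
  also have "\<dots> = real n powr (1 - \<gamma>) * real n powr (1 - \<gamma>) * (real k / 2) powr (1 - \<gamma>)"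
    by (simp only: powr_mult)
  also have "real n powr (2 * \<gamma>) * \<dots> = (real n)\<^sup>2 * (real n powr (\<gamma> - 1) * real n powr (1 - \<gamma>)) *
      (real n powr (\<gamma> - 1) * real n powr (1 - \<gamma>)) * (real k / 2) powr (1 - \<gamma>)"
    unfolding n2 by (simp add: mult_ac)
  finally show "real n powr (2 * \<gamma>) * (real (n div k) powr (1 - \<gamma>) * real (n * k^2) powr (1 - \<gamma>)) \<le>
     (real n)\<^sup>2 * (real k / 2) powr (1 - \<gamma>)" unfolding nn by simp
  have "real n powr (2 * \<gamma>) * (real (n div k) powr (1 - \<gamma>) * real (n div k) powr (1 - \<gamma>)) \<le>
    real n powr (2 * \<gamma>) * ((real n / (2 * real k)) powr (1 - \<gamma>) * (real n / (2 * real k)) powr (1 - \<gamma>))"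
    using h by (intro mult_left_mono mult_mono) auto
  also have "(real n / (2 * real k)) powr (1 - \<gamma>) = real n powr (1 - \<gamma>) * (2 * real k) powr (\<gamma> - 1)"
    using assms n by (simp add: powr_divide powr_minus_divide[of _ "\<gamma> - 1", simplified] powr_diff)
  also have "real n powr (2 * \<gamma>) * (real n powr (1 - \<gamma>) * (2 * real k) powr (\<gamma> - 1) * (real n powr (1 - \<gamma>) * (2 * real k) powr (\<gamma> - 1))) =
    (real n)\<^sup>2 * (real n powr (\<gamma> - 1) * real n powr (1 - \<gamma>)) * (real n powr (\<gamma> - 1) * real n powr (1 - \<gamma>)) *
     ((2 * real k) powr (\<gamma> - 1) * (2 * real k) powr (\<gamma> - 1))"
    unfolding n2 by (simp add: mult_ac)
  also have "\<dots> = (real n)\<^sup>2 * (2 * real k) powr (2 * (\<gamma> - 1))"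
    unfolding nn by (simp add: powr_add[symmetric])
  finally show "real n powr (2 * \<gamma>) * (real (n div k) powr (1 - \<gamma>) * real (n div k) powr (1 - \<gamma>)) \<le>
     (real n)\<^sup>2 * (2 * real k) powr (2 * (\<gamma> - 1))" .
qed

lemma exp_minus_lipschitz:
  fixes a b :: real
  assumes "0 \<le> a" "0 \<le> b"
  shows "\<bar>exp (- a) - exp (- b)\<bar> \<le> \<bar>a - b\<bar>"
proof -
  have *: "exp (- x) - exp (- y) \<le> y - x" if "0 \<le> x" "x \<le> y" for x y :: real
  proof -
    have "exp (- x) - exp (- y) = exp (- x) * (1 - exp (- (y - x)))"
      by (simp add: right_diff_distrib exp_add[symmetric])
    also have "\<dots> \<le> 1 * (y - x)"
    proof (intro mult_mono)
      show "1 - exp (- (y - x)) \<le> y - x" using exp_ge_add_one_self[of "- (y - x)"] by linarith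
      show "0 \<le> 1 - exp (- (y - x))" using that by simp
    qed (use that in auto)
    finally show ?thesis by simp
  qed
  show ?thesis
  proof (cases "a \<le> b")
    case True then show ?thesis using *[of a b] assms exp_le_cancel_iff[of "- b" "- a"] by (simp del: exp_le_cancel_iff)
  next
    case False then show ?thesis using *[of b a] assms exp_le_cancel_iff[of "- a" "- b"] by (simp del: exp_le_cancel_iff)
  qed
qed

lemma div_filterlim:
  assumes "k \<ge> 1"
  shows "filterlim (\<lambda>n :: nat. n div k) at_top sequentially"
proof (rule filterlim_at_top_mono[of "\<lambda>n. n div k"])
  show "filterlim (\<lambda>n :: nat. n div k) at_top sequentially"
    unfolding filterlim_at_top eventually_sequentially
  proof
    fix Z :: nat
    have "Z \<le> n div k" if "n \<ge> Z * k" for n using that assms by (simp add: less_eq_div_iff_mult_less_eq)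
    then show "\<exists>N. \<forall>n\<ge>N. Z \<le> n div k" by blast
  qed
qed simp

text \<open>
  In the window \<open>x \<ge> n / (2 * k)\<close>, so the factor \<open>(x / n) powr (- \<gamma>)\<close> is bounded and \<open>x\<close> is large
  uniformly: both \<open>q x * x powr \<gamma>\<close> and the distortion across one strip are near their limits.
\<close>

lemma rescaled_weight_close:
  fixes q :: "nat \<Rightarrow> real" and \<gamma> c \<eta> :: real
  assumes "\<gamma> > 1" "c > 0" and q: "q \<sim>[at_top] (\<lambda>i. c * real i powr (- \<gamma>))" and k: "k \<ge> 1" and \<eta>: "\<eta> > 0"
  shows "\<forall>\<^sub>F n in sequentially. \<forall>x>n div k. \<forall>y. (real x - 1) / real n < y \<longrightarrow> y \<le> real x / real n \<longrightarrow>
    \<bar>q x * real n powr \<gamma> - c * y powr (- \<gamma>)\<bar> \<le> \<eta> \<and> y powr (- \<gamma>) \<le> (4 * real k) powr \<gamma>"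
proof -
  define f where "f x = q x * real x powr \<gamma>" for x
  have "((\<lambda>x. q x / (c * real x powr (- \<gamma>))) \<longlongrightarrow> 1) sequentially"
  proof (rule asymp_equivD_strong[OF q])
    show "\<forall>\<^sub>F x in sequentially. q x \<noteq> 0 \<or> c * real x powr - \<gamma> \<noteq> 0"
      using eventually_gt_at_top[of 0] by eventually_elim (use assms in auto)
  qed
  then have "((\<lambda>x. c * (q x / (c * real x powr (- \<gamma>)))) \<longlongrightarrow> c * 1) sequentially"
    by (intro tendsto_intros)
  moreover have "\<forall>\<^sub>F x in sequentially. c * (q x / (c * real x powr (- \<gamma>))) = f x"
    using eventually_gt_at_top[of 0] by eventually_elim (use assms in \<open>simp add: f_def powr_minus field_simps\<close>)
  ultimately have f: "f \<longlonglongrightarrow> c" by (simp add: tendsto_cong)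
  have g: "(\<lambda>x :: nat. (1 - 1 / real x) powr (- \<gamma>)) \<longlonglongrightarrow> 1"
  proof -
    have "(\<lambda>x :: nat. (1 - 1 / real x)) \<longlonglongrightarrow> 1" by real_asymp
    then have "(\<lambda>x :: nat. (1 - 1 / real x) powr (- \<gamma>)) \<longlonglongrightarrow> 1 powr (- \<gamma>)" by (intro tendsto_powr) auto
    then show ?thesis by simp
  qed
  let ?K = "(2 * real k) powr \<gamma>"
  have K: "?K > 0" using k by simp
  have "\<forall>\<^sub>F x in sequentially. \<bar>f x - c\<bar> < \<eta> / (2 * ?K)"
    using tendstoD[OF f, of "\<eta> / (2 * ?K)"] \<eta> K by (simp add: dist_real_def)
  moreover have "\<forall>\<^sub>F x in sequentially. \<bar>(1 - 1 / real x) powr (- \<gamma>) - 1\<bar> < \<eta> / (2 * ?K * c)"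
    using tendstoD[OF g, of "\<eta> / (2 * ?K * c)"] \<eta> K assms(2) by (simp add: dist_real_def)
  ultimately have "\<forall>\<^sub>F x in sequentially. \<bar>f x - c\<bar> < \<eta> / (2 * ?K) \<and> \<bar>(1 - 1 / real x) powr (- \<gamma>) - 1\<bar> < \<eta> / (2 * ?K * c)"
    by eventually_elim simp
  then obtain x0 where x0: "\<And>x. x \<ge> x0 \<Longrightarrow> \<bar>f x - c\<bar> < \<eta> / (2 * ?K) \<and> \<bar>(1 - 1 / real x) powr (- \<gamma>) - 1\<bar> < \<eta> / (2 * ?K * c)"
    by (auto simp: eventually_sequentially)
  have "\<forall>\<^sub>F n in sequentially. max x0 1 \<le> n div k"
    using div_filterlim[OF k] unfolding filterlim_at_top by blast
  moreover have "\<forall>\<^sub>F n in sequentially. n \<ge> k" by (rule eventually_ge_at_top)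
  ultimately show ?thesis
  proof eventually_elim
    case (elim n)
    have n: "n \<ge> 1" using elim(2) k by simp
    show ?case
    proof (intro allI impI)
      fix x y assume x: "x > n div k" and y: "(real x - 1) / real n < y" "y \<le> real x / real n"
      have x2: "x \<ge> 2" "x \<ge> x0" using x elim by auto
      have xn: "real n / (2 * real k) \<le> real x" "real n / (2 * real k) \<le> real x - 1"
        using div_ge_half[OF k elim(2)] x by linarith+
      have lo: "1 / (2 * real k) \<le> (real x - 1) / real n" using xn(2) n k by (simp add: field_simps)
      have pos: "0 < (real x - 1) / real n" using x2 n by simp
      have yp: "y > 0" using y(1) pos by linarith
      let ?X = "(real x / real n) powr (- \<gamma>)"
      have XK: "?X \<le> ?K"
      proof -
        have "?X \<le> (1 / (2 * real k)) powr (- \<gamma>)"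
          using xn n k assms by (intro powr_mono2') (auto simp: field_simps)
        also have "\<dots> = ?K" using k by (simp add: powr_divide powr_minus)
        finally show ?thesis .
      qed
      have X0: "?X \<ge> 0" by simp
      have qn: "q x * real n powr \<gamma> = f x * ?X"
        using x2 n by (simp add: f_def powr_divide powr_minus field_simps)
      have ylow: "?X \<le> y powr (- \<gamma>)" using y yp assms by (intro powr_mono2') auto
      have "y powr (- \<gamma>) \<le> ((real x - 1) / real n) powr (- \<gamma>)" using y pos assms by (intro powr_mono2') auto
      also have "(real x - 1) / real n = (real x / real n) * (1 - 1 / real x)" using x2 n by (simp add: field_simps)
      also have "\<dots> powr (- \<gamma>) = ?X * (1 - 1 / real x) powr (- \<gamma>)"
        by (rule powr_mult)
      finally have yup: "y powr (- \<gamma>) \<le> ?X * (1 - 1 / real x) powr (- \<gamma>)" .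
      have "\<bar>y powr (- \<gamma>) - ?X\<bar> \<le> ?X * \<bar>(1 - 1 / real x) powr (- \<gamma>) - 1\<bar>"
      proof -
        have "y powr (- \<gamma>) - ?X \<le> ?X * ((1 - 1 / real x) powr (- \<gamma>) - 1)" using yup by (simp add: right_diff_distrib)
        also have "\<dots> \<le> ?X * \<bar>(1 - 1 / real x) powr (- \<gamma>) - 1\<bar>" by (intro mult_left_mono) auto
        finally show ?thesis using ylow by simp
      qed
      also have "\<dots> \<le> ?K * (\<eta> / (2 * ?K * c))" using XK x0[OF x2(2)] by (intro mult_mono) auto
      also have "\<dots> = \<eta> / (2 * c)" using K by simp
      finally have "c * \<bar>y powr (- \<gamma>) - ?X\<bar> \<le> c * (\<eta> / (2 * c))" using assms(2) by (intro mult_left_mono) auto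
      then have 1: "\<bar>c * y powr (- \<gamma>) - c * ?X\<bar> \<le> \<eta> / 2"
      proof -
        have "\<bar>c * y powr (- \<gamma>) - c * ?X\<bar> = c * \<bar>y powr (- \<gamma>) - ?X\<bar>"
          using assms(2) by (simp add: abs_mult right_diff_distrib[symmetric])
        moreover have "c * (\<eta> / (2 * c)) = \<eta> / 2" using assms(2) by simp
        ultimately show ?thesis using \<open>c * \<bar>y powr (- \<gamma>) - ?X\<bar> \<le> c * (\<eta> / (2 * c))\<close> by linarith
      qed
      have "\<bar>f x * ?X - c * ?X\<bar> = \<bar>f x - c\<bar> * ?X" by (simp add: abs_mult left_diff_distrib[symmetric])
      also have "\<dots> \<le> \<eta> / (2 * ?K) * ?K" using XK x0[OF x2(2)] by (intro mult_mono) auto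
      also have "\<dots> = \<eta> / 2" using K by simp
      finally have 2: "\<bar>q x * real n powr \<gamma> - c * y powr (- \<gamma>)\<bar> \<le> \<eta>" using 1 unfolding qn by linarith
      have "y powr (- \<gamma>) \<le> (1 / (2 * real k)) powr (- \<gamma>)" using y lo assms k by (intro powr_mono2') auto
      also have "\<dots> = ?K" using k by (simp add: powr_divide powr_minus)
      also have "\<dots> \<le> (4 * real k) powr \<gamma>" using assms k by (intro powr_mono2) auto
      finally show "\<bar>q x * real n powr \<gamma> - c * y powr (- \<gamma>)\<bar> \<le> \<eta> \<and> y powr (- \<gamma>) \<le> (4 * real k) powr \<gamma>" using 2 by simp
    qed
  qed
qed

lemma rescaled_probability_close:
  fixes q :: "nat \<Rightarrow> real" and \<gamma> c \<delta> :: real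
  assumes "\<gamma> > 1" "c > 0" and q: "q \<sim>[at_top] (\<lambda>i. c * real i powr (- \<gamma>))" and q0: "\<forall>i\<ge>1. 0 \<le> q i"
    and k: "k \<ge> 1" and \<delta>: "\<delta> > 0"
  shows "\<forall>\<^sub>F n in sequentially. \<forall>x>n div k. \<forall>x'>n div k. \<forall>y y'.
    (real x - 1) / real n < y \<longrightarrow> y \<le> real x / real n \<longrightarrow> (real x' - 1) / real n < y' \<longrightarrow> y' \<le> real x' / real n \<longrightarrow>
    \<bar>(1 - exp (- 2 * c\<^sup>2 * y powr (- \<gamma>) * y' powr (- \<gamma>))) - (1 - exp (- (2 * q x * q x' * real n powr (2 * \<gamma>))))\<bar> \<le> \<delta>"
proof -
  define K where "K = c * (4 * real k) powr \<gamma>"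
  have K: "K > 0" using assms k by (simp add: K_def)
  define \<eta> where "\<eta> = min 1 (\<delta> / (2 * (2 * K + 1)))"
  have \<eta>: "0 < \<eta>" "\<eta> \<le> 1" "2 * (\<eta> * (2 * K + 1)) \<le> \<delta>"
  proof -
    show "0 < \<eta>" "\<eta> \<le> 1" using \<delta> K by (auto simp: \<eta>_def)
    have "\<eta> \<le> \<delta> / (2 * (2 * K + 1))" by (simp add: \<eta>_def)
    then show "2 * (\<eta> * (2 * K + 1)) \<le> \<delta>" using K by (simp add: pos_le_divide_eq mult_ac)
  qed
  show ?thesis
    using rescaled_weight_close[OF assms(1-3) k \<eta>(1)] eventually_ge_at_top[of k]
  proof eventually_elim
    case (elim n)
    show ?case
    proof (intro allI impI)
      fix x x' y y' assume x: "x > n div k" "x' > n div k"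
        and y: "(real x - 1) / real n < y" "y \<le> real x / real n" "(real x' - 1) / real n < y'" "y' \<le> real x' / real n"
      define A A' B B' where "A = q x * real n powr \<gamma>" and "A' = c * y powr (- \<gamma>)"
        and "B = q x' * real n powr \<gamma>" and "B' = c * y' powr (- \<gamma>)"
      have *: "\<bar>A - A'\<bar> \<le> \<eta>" "A' \<le> K" "\<bar>B - B'\<bar> \<le> \<eta>" "B' \<le> K"
        using elim(1) x y assms(2) unfolding A_def A'_def B_def B'_def K_def by auto
      have nn: "0 \<le> A" "0 \<le> A'" "0 \<le> B" "0 \<le> B'"
        using q0 x assms(2) by (auto simp: A_def A'_def B_def B'_def)
      have "\<bar>A * B - A' * B'\<bar> = \<bar>(A - A') * B + A' * (B - B')\<bar>" by (simp add: algebra_simps)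
      also have "\<dots> \<le> \<bar>A - A'\<bar> * B + A' * \<bar>B - B'\<bar>"
        using nn abs_triangle_ineq[of "(A - A') * B" "A' * (B - B')"] by (simp add: abs_mult)
      also have "\<dots> \<le> \<eta> * (K + 1) + K * \<eta>"
        using * nn \<eta> by (intro add_mono mult_mono) auto
      finally have AB: "\<bar>2 * (A' * B') - 2 * (A * B)\<bar> \<le> \<delta>" using \<eta>(3) by (simp add: algebra_simps abs_le_iff)
      have p: "2 * q x * q x' * real n powr (2 * \<gamma>) = 2 * (A * B)"
        by (simp add: A_def B_def powr_add[symmetric])
      have w: "- 2 * c\<^sup>2 * y powr (- \<gamma>) * y' powr (- \<gamma>) = - (2 * (A' * B'))"
        by (simp add: A'_def B'_def power2_eq_square)
      have "\<bar>exp (- (2 * (A' * B'))) - exp (- (2 * (A * B)))\<bar> \<le> \<bar>2 * (A' * B') - 2 * (A * B)\<bar>"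
        using nn by (intro exp_minus_lipschitz) auto
      then show "\<bar>(1 - exp (- 2 * c\<^sup>2 * y powr (- \<gamma>) * y' powr (- \<gamma>))) - (1 - exp (- (2 * q x * q x' * real n powr (2 * \<gamma>))))\<bar> \<le> \<delta>"
        using AB unfolding p w by simp
    qed
  qed
qed

section \<open>Almost sure convergence\<close>

locale rank1 = smp: sampling P \<xi> U + arr: arrivals M q N
  for P :: "'p measure" and \<xi> and U and M :: "'w measure" and q and N +
  fixes \<gamma> c C0 :: real and lab :: "nat set set \<Rightarrow> nat \<Rightarrow> nat" and W :: "real \<Rightarrow> real \<Rightarrow> real"
  assumes \<gamma>: "\<gamma> > 1" and c: "c > 0" and C0: "C0 > 0"
    and q_sum: "(q has_sum 1) {1..}"
    and q_le: "\<And>i. i \<ge> 1 \<Longrightarrow> q i \<le> C0 * real i powr (- \<gamma>)"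
    and q_asymp: "q \<sim>[at_top] (\<lambda>i. c * real i powr (- \<gamma>))"
    and lab: "vertex_labelling lab"
    and W: "W = (\<lambda>x y. 1 - exp (- 2 * c\<^sup>2 * x powr (- \<gamma>) * y powr (- \<gamma>)))"
begin

definition V :: "nat \<Rightarrow> nat \<Rightarrow> nat set" where "V n k = {n div k<..n * k\<^sup>2}"

text \<open>
  The grid is chosen so that \<open>T n powr (1 / (2 * \<gamma>)) = n\<close>. On this grid the variances, of order
  \<open>1 / n\<^sup>2\<close>, are summable, and \<open>T (Suc n) / T n\<close> tends to 1.
\<close>

definition T :: "nat \<Rightarrow> real" where "T n = real n powr (2 * \<gamma>)"

definition G :: real where "G = (\<gamma> / (\<gamma> - 1))\<^sup>2"

definition tail :: "nat \<Rightarrow> real" where "tail k = (real k / 2) powr (1 - \<gamma>)"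

definition cell_weight :: "real \<Rightarrow> nat \<Rightarrow> nat \<Rightarrow> (nat \<times> nat) set \<Rightarrow> real" where
  "cell_weight R n k = subset_weight (\<lambda>_. 1 - exp (- (R / real n / real n))) (V n k \<times> {1..n})"

definition annealed_mean :: "(ugraph set \<Rightarrow> bool) \<Rightarrow> real \<Rightarrow> nat \<Rightarrow> nat \<Rightarrow> real" where
  "annealed_mean \<phi> R n k = (\<Sum>B\<in>Pow (V n k \<times> {1..n}). cell_weight R n k B * annealed n (arr.arrival_prob (T n)) \<phi> B)"

definition quenched_mean :: "(ugraph set \<Rightarrow> bool) \<Rightarrow> real \<Rightarrow> nat \<Rightarrow> nat \<Rightarrow> 'w \<Rightarrow> real" where
  "quenched_mean \<phi> R n k \<omega> = (\<Sum>B\<in>Pow (V n k \<times> {1..n}). cell_weight R n k B * of_bool (arr.test n \<phi> (T n) B \<omega>))"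

definition history_prob :: "(ugraph set \<Rightarrow> bool) \<Rightarrow> (real \<Rightarrow> real \<Rightarrow> real) \<Rightarrow> real \<Rightarrow> real" where
  "history_prob \<phi> W' R = smp.prob {\<omega> \<in> space P. finite (smp.edges_at W' R \<omega>) \<and> \<phi> (smp.history W' R \<omega>)}"

lemma T_nonneg: "0 \<le> T n" by (simp add: T_def)

lemma T_mono: "n \<le> n' \<Longrightarrow> T n \<le> T n'"
  unfolding T_def using \<gamma> by (intro powr_mono2) auto

lemma G_pos: "G > 0" using \<gamma> by (simp add: G_def)

lemma tail_pos: "k \<ge> 1 \<Longrightarrow> tail k > 0" by (simp add: tail_def)

lemma tail_tendsto: "tail \<longlonglongrightarrow> 0"
  unfolding tail_def using \<gamma> by real_asymp

lemma V_facts: "finite (V n k)" "V n k \<subseteq> {1..}" "card (V n k) \<le> n * k\<^sup>2"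
  by (auto simp: V_def)

lemma graphon_W: "graphon W"
proof -
  have "(\<lambda>p :: real \<times> real. 1 - exp (- 2 * c\<^sup>2 * fst p powr (- \<gamma>) * snd p powr (- \<gamma>))) \<in> borel_measurable (borel \<Otimes>\<^sub>M borel)"
    by measurable
  then have "(\<lambda>(x, y). W x y) \<in> borel_measurable borel"
    unfolding W borel_prod by (simp add: case_prod_beta)
  then have "(\<lambda>(x, y). W x y) \<in> borel_measurable (restrict_space borel ({0<..} \<times> {0<..}))"
    by (rule measurable_restrict_space1)
  then show ?thesis
    by (auto simp: graphon_def W mult_ac)
qed

lemma cells_std: "n \<ge> 1 \<Longrightarrow> R > 0 \<Longrightarrow> cells P \<xi> U (real n) R (\<lambda>x. x) n (V n k)"
  by unfold_locales (auto simp: V_def)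

lemma lam_std: "cells.lam (real n) R = R / real n" if "n \<ge> 1" "R > 0"
  using cells.lam_def[OF cells_std[OF that]] .

lemma cell_weight_eq: "cells.weight (real n) R n (V n k) B = cell_weight R n k B" if "n \<ge> 1" "R > 0"
  using cells.weight_def[OF cells_std[OF that]] lam_std[OF that] by (simp add: cell_weight_def)

text \<open>
  A pair that leaves the window upwards has one entry above \<open>n * k\<^sup>2\<close>; the two cases are symmetric.
\<close>

lemma far_sum:
  assumes k: "k \<ge> 1" "n \<ge> k" and F: "finite F"
    "F \<subseteq> {(x, y). x \<notin> {..n div k} \<and> y \<notin> {..n div k} \<and> \<not> (x \<in> V n k \<and> y \<in> V n k)}"
  shows "(\<Sum>(x, y)\<in>F. 2 * c\<^sup>2 * (((real x - 1) / real n) powr (- \<gamma>) * ((real y - 1) / real n) powr (- \<gamma>)))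
     \<le> 4 * c\<^sup>2 * G * (real n)\<^sup>2 * tail k"
proof -
  let ?a = "n div k" and ?b = "n * k\<^sup>2"
  have n: "n \<ge> 1" using k by simp
  have a1: "1 \<le> ?a" using div_ge_half(2)[OF k] .
  have b1: "1 \<le> ?b" using n k by simp
  let ?h = "\<lambda>x :: nat. x - 1"
  let ?s = "\<lambda>F. \<Sum>(x, y)\<in>F. real (?h x) powr (- \<gamma>) * real (?h y) powr (- \<gamma>)"
  have inj: "inj_on ?h {x. 1 \<le> ?h x}" by (auto simp: inj_on_def)
  let ?F1 = "{(x, y) \<in> F. ?b < y}" and ?F2 = "{(x, y) \<in> F. \<not> ?b < y}"
  have sub: "?F1 \<subseteq> F" "?F2 \<subseteq> F" by auto
  have F12: "F = ?F1 \<union> ?F2" "?F1 \<inter> ?F2 = {}" "finite ?F1" "finite ?F2"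
    using finite_subset[OF sub(1) F(1)] finite_subset[OF sub(2) F(1)] by auto
  have 1: "?s ?F1 \<le> G * (real ?a powr (1 - \<gamma>) * real ?b powr (1 - \<gamma>))"
    unfolding G_def using F F12 a1 b1 by (intro sum_powr_pairs_le[OF \<gamma> a1 b1 _ _ inj]) auto
  have 2: "?s ?F2 \<le> G * (real ?b powr (1 - \<gamma>) * real ?a powr (1 - \<gamma>))"
    unfolding G_def
  proof (intro sum_powr_pairs_le[OF \<gamma> b1 a1 F12(4) _ inj] subsetI)
    fix e assume "e \<in> ?F2"
    then obtain x y where e: "e = (x, y)" "?a < x" "?a < y" "\<not> (x \<in> V n k \<and> y \<in> V n k)" "\<not> ?b < y" using F(2) by auto
    then have "?b < x" by (auto simp: V_def)
    then show "e \<in> {(x, y). ?b \<le> x - 1 \<and> ?a \<le> y - 1}" using e by auto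
  qed
  have split: "?s F = ?s ?F1 + ?s ?F2"
    using sum.union_disjoint[OF F12(3,4,2), of "\<lambda>(x, y). real (?h x) powr (- \<gamma>) * real (?h y) powr (- \<gamma>)"] F12(1) by metis
  have tot: "?s F \<le> 2 * G * (real ?a powr (1 - \<gamma>) * real ?b powr (1 - \<gamma>))"
    using 1 2 split by (simp add: mult_ac)
  have nT: "(1 / real n) powr (- \<gamma>) * (1 / real n) powr (- \<gamma>) = real n powr (2 * \<gamma>)"
    using n by (simp add: powr_divide powr_minus powr_add[symmetric])
  have summand: "2 * c\<^sup>2 * (((real x - 1) / real n) powr (- \<gamma>) * ((real y - 1) / real n) powr (- \<gamma>)) =
    2 * c\<^sup>2 * real n powr (2 * \<gamma>) * (real (?h x) powr (- \<gamma>) * real (?h y) powr (- \<gamma>))" if "(x, y) \<in> F" for x y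
  proof -
    have xy: "1 \<le> x" "1 \<le> y" using that F(2) by force+
    have "((real z - 1) / real n) powr (- \<gamma>) = real (?h z) powr (- \<gamma>) * (1 / real n) powr (- \<gamma>)" if "1 \<le> z" for z
      using that by (simp add: powr_mult[symmetric] of_nat_diff)
    then show ?thesis using xy unfolding nT[symmetric] by simp
  qed
  have "(\<Sum>(x, y)\<in>F. 2 * c\<^sup>2 * (((real x - 1) / real n) powr (- \<gamma>) * ((real y - 1) / real n) powr (- \<gamma>))) =
    (\<Sum>(x, y)\<in>F. 2 * c\<^sup>2 * real n powr (2 * \<gamma>) * (real (?h x) powr (- \<gamma>) * real (?h y) powr (- \<gamma>)))"
    using summand by (intro sum.cong refl) auto
  also have "\<dots> = 2 * c\<^sup>2 * real n powr (2 * \<gamma>) * ?s F" by (simp add: sum_distrib_left case_prod_beta)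
  also have "\<dots> \<le> 2 * c\<^sup>2 * real n powr (2 * \<gamma>) * (2 * G * (real ?a powr (1 - \<gamma>) * real ?b powr (1 - \<gamma>)))"
    using tot by (intro mult_left_mono) auto
  also have "\<dots> = 4 * c\<^sup>2 * G * (real n powr (2 * \<gamma>) * (real ?a powr (1 - \<gamma>) * real ?b powr (1 - \<gamma>)))" by simp
  also have "\<dots> \<le> 4 * c\<^sup>2 * G * ((real n)\<^sup>2 * tail k)"
    unfolding tail_def using tail_scaling(1)[OF \<gamma> k] G_pos by (intro mult_left_mono) auto
  finally show ?thesis by (simp add: mult_ac)
qed

lemma limiting_std:
  assumes k: "k \<ge> 1" "n \<ge> k" and R: "R > 0" and \<delta>: "0 \<le> \<delta>"
    and close: "\<And>x x' y y'. x > n div k \<Longrightarrow> x' > n div k \<Longrightarrow>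
      (real x - 1) / real n < y \<Longrightarrow> y \<le> real x / real n \<Longrightarrow> (real x' - 1) / real n < y' \<Longrightarrow> y' \<le> real x' / real n \<Longrightarrow>
      \<bar>(1 - exp (- 2 * c\<^sup>2 * y powr (- \<gamma>) * y' powr (- \<gamma>))) - (1 - exp (- (2 * q x * q x' * real n powr (2 * \<gamma>))))\<bar> \<le> \<delta>"
  shows "limiting P \<xi> U (real n) R (\<lambda>x. x) n (V n k) W (arr.arrival_prob (T n))
     (\<lambda>x y. 2 * c\<^sup>2 * (((real x - 1) / real n) powr (- \<gamma>) * ((real y - 1) / real n) powr (- \<gamma>)))
     {..n div k} \<delta> (4 * c\<^sup>2 * G * (real n)\<^sup>2 * tail k)"
proof -
  have n: "n \<ge> 1" using k by simp
  interpret cells P \<xi> U "real n" R "\<lambda>x. x" n "V n k" by (rule cells_std[OF n R])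
  have n0: "real n > 0" using n by simp
  have st: "(real x - 1) / real n < y \<and> y \<le> real x / real n \<and> 0 < x" if "y \<in> strip (real n) x" for x y
    using that by (auto simp: strip_eq[OF n0] split: if_splits)
  show ?thesis
  proof (intro limiting.intro cells_axioms limiting_axioms.intro)
    show "graphon W" by (rule graphon_W)
    show "\<exists>x. y \<in> strip (real n) x" if "0 < y" for y using that by (auto simp: strip_def)
    show "0 \<le> arr.arrival_prob (T n) x y \<and> arr.arrival_prob (T n) x y \<le> 1" for x y
      using arr.q0 T_nonneg by (auto simp: arr.arrival_prob_def)
    show "arr.arrival_prob (T n) x y = arr.arrival_prob (T n) y x" for x y by (simp add: arr.arrival_prob_def mult_ac)
    show "0 \<le> \<delta>" by (rule \<delta>)
    show "\<bar>W y1 y2 - arr.arrival_prob (T n) x y\<bar> \<le> \<delta>"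
      if "x \<in> V n k" "y \<in> V n k" "y1 \<in> strip (real n) x" "y2 \<in> strip (real n) y" for x y y1 y2
      using close[of x y y1 y2] st[OF that(3)] st[OF that(4)] that(1,2) by (simp add: V_def W arr.arrival_prob_def T_def)
    show "W y1 y2 \<le> 2 * c\<^sup>2 * (((real x - 1) / real n) powr (- \<gamma>) * ((real y - 1) / real n) powr (- \<gamma>))"
      if "x \<notin> {..n div k}" "y \<notin> {..n div k}" "y1 \<in> strip (real n) x" "y2 \<in> strip (real n) y" for x y y1 y2
    proof -
      have x: "1 < x" "1 < y" using that(1,2) div_ge_half(2)[OF k] by auto
      have p: "0 < (real x - 1) / real n" "0 < (real y - 1) / real n" using x n by simp_all
      have "W y1 y2 \<le> 2 * c\<^sup>2 * (y1 powr (- \<gamma>) * y2 powr (- \<gamma>))"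
        unfolding W using exp_ge_add_one_self[of "- 2 * c\<^sup>2 * y1 powr (- \<gamma>) * y2 powr (- \<gamma>)"] by simp
      also have "\<dots> \<le> 2 * c\<^sup>2 * (((real x - 1) / real n) powr (- \<gamma>) * ((real y - 1) / real n) powr (- \<gamma>))"
        using st[OF that(3)] st[OF that(4)] p \<gamma> by (intro mult_left_mono mult_mono powr_mono2') auto
      finally show ?thesis .
    qed
    show "(\<Sum>(x, y)\<in>F. 2 * c\<^sup>2 * (((real x - 1) / real n) powr (- \<gamma>) * ((real y - 1) / real n) powr (- \<gamma>))) \<le>
      4 * c\<^sup>2 * G * (real n)\<^sup>2 * tail k"
      if "finite F" "F \<subseteq> {(x, y). x \<notin> {..n div k} \<and> y \<notin> {..n div k} \<and> \<not> (x \<in> V n k \<and> y \<in> V n k)}" for F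
      by (rule far_sum[OF k that])
  qed auto
qed

text \<open>
  The term \<open>R / n\<close> is due to the index 0, which owns an empty strip.
\<close>

lemma first_cells_le:
  assumes "k \<ge> 1" "n \<ge> k" "R > 0"
  shows "real (card {..n div k}) * (R / real n) \<le> R / real k + R / real n"
proof -
  have "real (n div k) \<le> real n / real k" by (rule of_nat_div_le_of_nat)
  then have "(real (n div k) + 1) * (R / real n) \<le> (real n / real k + 1) * (R / real n)"
    using assms by (intro mult_right_mono) auto
  also have "\<dots> = R / real k + R / real n" using assms by (simp add: field_simps)
  finally show ?thesis by (simp add: add.commute)
qed

text \<open>
  The tail estimate \<open>prob_infinite\<close> is applied on the grid \<open>n = k\<close> and both of its terms vanish as \<open>k\<close>
  grows. It does not involve \<open>\<delta>\<close>, which is set to 1, the trivial distance of two probabilities.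
\<close>

lemma AE_finite_W: "AE \<omega> in P. finite (smp.edges_at W r \<omega>)"
proof -
  define R where "R = max r 1"
  have R: "R > 0" by (simp add: R_def)
  have meas: "{\<omega> \<in> space P. infinite (smp.edges_at W R \<omega>)} \<in> smp.events"
    using smp.measurable_edges_at(2)[OF graphon_W, of "\<lambda>_. R"] by (auto intro: sets.sets_Collect_neg)
  have bound: "smp.prob {\<omega> \<in> space P. infinite (smp.edges_at W R \<omega>)} \<le> R / real k + R / real k + 16 * c\<^sup>2 * G * R\<^sup>2 * tail k"
    if k: "k \<ge> 1" for k
  proof -
    interpret limiting P \<xi> U "real k" R "\<lambda>x. x" k "V k k" W "arr.arrival_prob (T k)"
      "\<lambda>x y. 2 * c\<^sup>2 * (((real x - 1) / real k) powr (- \<gamma>) * ((real y - 1) / real k) powr (- \<gamma>))"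
      "{..k div k}" 1 "4 * c\<^sup>2 * G * (real k)\<^sup>2 * tail k"
    proof (rule limiting_std[OF k order_refl R])
      fix x x' y y'
      assume x: "x > k div k" "x' > k div k"
      have e: "0 < exp (- 2 * c\<^sup>2 * y powr (- \<gamma>) * y' powr (- \<gamma>))" "exp (- 2 * c\<^sup>2 * y powr (- \<gamma>) * y' powr (- \<gamma>)) \<le> 1"
        "0 < exp (- (2 * q x * q x' * real k powr (2 * \<gamma>)))" "exp (- (2 * q x * q x' * real k powr (2 * \<gamma>))) \<le> 1"
        using arr.q0 x by auto
      then show "\<bar>(1 - exp (- 2 * c\<^sup>2 * y powr (- \<gamma>) * y' powr (- \<gamma>))) - (1 - exp (- (2 * q x * q x' * real k powr (2 * \<gamma>))))\<bar> \<le> 1"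
        by linarith
    qed simp
    have lam: "lam = R / real k" by (rule lam_def)
    have "4 * lam\<^sup>2 * (4 * c\<^sup>2 * G * (real k)\<^sup>2 * tail k) = 16 * c\<^sup>2 * G * R\<^sup>2 * tail k"
      using k unfolding lam by (simp add: power_divide)
    then show ?thesis using prob_infinite first_cells_le[OF k order_refl R] unfolding lam by linarith
  qed
  have "smp.prob {\<omega> \<in> space P. infinite (smp.edges_at W R \<omega>)} \<le> 0"
  proof (rule LIMSEQ_le_const)
    have "(\<lambda>k. R / real k + R / real k + 16 * c\<^sup>2 * G * R\<^sup>2 * tail k) \<longlonglongrightarrow> 0 + 0 + 16 * c\<^sup>2 * G * R\<^sup>2 * 0"
      by (intro tendsto_intros tail_tendsto lim_const_over_n)
    then show "(\<lambda>k. R / real k + R / real k + 16 * c\<^sup>2 * G * R\<^sup>2 * tail k) \<longlonglongrightarrow> 0" by simp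
  qed (use bound in blast)
  then have "AE \<omega> in P. \<omega> \<notin> {\<omega> \<in> space P. infinite (smp.edges_at W R \<omega>)}"
    using smp.prob_eq_0[OF meas] by (simp add: measure_le_0_iff)
  then show ?thesis
    using AE_space
  proof eventually_elim
    case (elim \<omega>)
    have "smp.edges_at W r \<omega> \<subseteq> smp.edges_at W R \<omega>" by (rule smp.edges_at_mono) (simp add: R_def)
    then show ?case using elim finite_subset by blast
  qed
qed

lemma admissible_W: "admissible_graphon P \<xi> U W"
  using graphon_W AE_finite_W by (simp add: admissible_graphon_def)

lemma limit_close_to_annealed_mean:
  assumes k: "k \<ge> 1" and R: "R > 0" and e: "e > 0"
  shows "\<forall>\<^sub>F n in sequentially. \<forall>\<phi>. \<bar>history_prob \<phi> W R - annealed_mean \<phi> R n k\<bar> \<le> R / real k + 16 * c\<^sup>2 * G * R\<^sup>2 * tail k + e"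
proof -
  define K where "K = (real k)\<^sup>2 * R"
  have K: "K > 0" using k R by (simp add: K_def)
  define \<delta> where "\<delta> = e / (16 * K\<^sup>2)"
  have \<delta>_choice: "\<delta> > 0" "8 * K\<^sup>2 * \<delta> = e / 2" using e K by (auto simp: \<delta>_def)
  have "(\<lambda>n. R / real n + 2 * (K * R / real n + K\<^sup>2 / real n)) \<longlonglongrightarrow> 0" by real_asymp
  then have "\<forall>\<^sub>F n in sequentially. R / real n + 2 * (K * R / real n + K\<^sup>2 / real n) < e / 2"
    using e by (intro order_tendstoD(2)) auto
  moreover have "\<forall>i\<ge>1. 0 \<le> q i" using arr.q0 by blast
  note rescaled_probability_close[OF \<gamma> c q_asymp this k \<delta>_choice(1)]
  ultimately show ?thesis
    using eventually_ge_at_top[of k]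
  proof eventually_elim
    case (elim n)
    have n: "n \<ge> 1" using k elim(3) by simp
    interpret limiting P \<xi> U "real n" R "\<lambda>x. x" n "V n k" W "arr.arrival_prob (T n)"
      "\<lambda>x y. 2 * c\<^sup>2 * (((real x - 1) / real n) powr (- \<gamma>) * ((real y - 1) / real n) powr (- \<gamma>))"
      "{..n div k}" \<delta> "4 * c\<^sup>2 * G * (real n)\<^sup>2 * tail k"
      by (rule limiting_std[OF k elim(3) R]) (use \<delta>_choice elim(2) in auto)
    have lam: "lam = R / real n" by (rule lam_def)
    have cV: "card (V n k) * lam \<le> K"
    proof -
      have "card (V n k) * lam \<le> real (n * k\<^sup>2) * lam"
        using V_facts(3)[of n k] lam_def n R by (intro mult_right_mono) (simp_all only: of_nat_le_iff, simp)
      then show ?thesis using n unfolding lam K_def by simp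
    qed
    have cV0: "0 \<le> card (V n k) * lam" using lam n R by simp
    show ?case
    proof
      fix \<phi>
      have "\<bar>history_prob \<phi> W R - annealed_mean \<phi> R n k\<bar> \<le> card {..n div k} * lam + 4 * lam\<^sup>2 * (4 * c\<^sup>2 * G * (real n)\<^sup>2 * tail k) +
        8 * (card (V n k) * lam)\<^sup>2 * \<delta> + 2 * (card (V n k) * lam\<^sup>2 + (card (V n k) * lam)\<^sup>2 / n)"
        using history_law[OF AE_finite_W, of \<phi>] unfolding history_prob_def annealed_mean_def cell_weight_eq[OF n R] .
      also have "\<dots> \<le> (R / real k + R / real n) + 16 * c\<^sup>2 * G * R\<^sup>2 * tail k + 8 * K\<^sup>2 * \<delta> + 2 * (K * R / real n + K\<^sup>2 / real n)"
      proof (intro add_mono mult_left_mono mult_right_mono divide_right_mono power_mono cV cV0)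
        show "card {..n div k} * lam \<le> R / real k + R / real n" unfolding lam by (rule first_cells_le[OF k elim(3) R])
        show "4 * lam\<^sup>2 * (4 * c\<^sup>2 * G * (real n)\<^sup>2 * tail k) \<le> 16 * c\<^sup>2 * G * R\<^sup>2 * tail k"
          using n unfolding lam by (simp add: power_divide)
        have "card (V n k) * lam * lam \<le> K * lam" using cV lam n R by (intro mult_right_mono) auto
        then show "card (V n k) * lam\<^sup>2 \<le> K * R / real n" unfolding lam by (simp add: power2_eq_square)
      qed (use \<delta>_choice in auto)
      also have "\<dots> \<le> R / real k + 16 * c\<^sup>2 * G * R\<^sup>2 * tail k + e"
        using elim(1) \<delta>_choice(2) by linarith
      finally show "\<bar>history_prob \<phi> W R - annealed_mean \<phi> R n k\<bar> \<le> R / real k + 16 * c\<^sup>2 * G * R\<^sup>2 * tail k + e" .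
    qed
  qed
qed

end

context rank1
begin

text \<open>
  The window has \<open>O(n)\<close> vertices and two given vertices are both hit with probability \<open>O(1 / n\<^sup>2)\<close>, so
  the variance is \<open>O(1 / n\<^sup>2)\<close>.
\<close>

lemma AE_quenched_mean_close:
  assumes k: "k \<ge> 1" and R: "R > 0" and e: "e > 0"
  shows "AE \<omega> in M. \<forall>\<^sub>F n in sequentially. \<bar>quenched_mean \<phi> R n k \<omega> - annealed_mean \<phi> R n k\<bar> < e"
proof -
  define A where "A n = (if n = 0 then {} else {\<omega> \<in> space M. e \<le> \<bar>quenched_mean \<phi> R n k \<omega> - annealed_mean \<phi> R n k\<bar>})" for n
  have test: "{\<omega> \<in> space M. arr.test n \<phi> (T n) B \<omega>} \<in> arr.events" if "B \<in> Pow (V n k \<times> {1..n})" for n B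
  proof (rule arr.prob_test(1)[OF T_nonneg])
    have sub: "fst ` B \<subseteq> V n k" using that by auto
    show "finite (fst ` B)" by (rule finite_subset[OF sub V_facts(1)])
    show "fst ` B \<subseteq> {1..}" by (rule subset_trans[OF sub V_facts(2)])
  qed
  have quenched_mean: "quenched_mean \<phi> R n k \<in> borel_measurable M" for n
    unfolding quenched_mean_def
  proof (intro borel_measurable_sum)
    fix B assume B: "B \<in> Pow (V n k \<times> {1..n})"
    have [measurable]: "Measurable.pred M (\<lambda>\<omega>. arr.test n \<phi> (T n) B \<omega>)" using test[OF B] by (simp add: pred_def)
    show "(\<lambda>\<omega>. cell_weight R n k B * of_bool (arr.test n \<phi> (T n) B \<omega>)) \<in> borel_measurable M"
      unfolding of_bool_def by measurable
  qed
  have A: "A n \<in> arr.events" for n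
    using quenched_mean[of n] unfolding A_def by simp
  let ?C = "16 * real k ^ 4 * R ^ 4 / e\<^sup>2"
  have bound: "arr.prob (A n) \<le> ?C * (1 / (real n)\<^sup>2)" for n
  proof (cases "n = 0")
    case False
    then have n: "n \<ge> 1" by simp
    interpret cells P \<xi> U "real n" R "\<lambda>x. x" n "V n k" by (rule cells_std[OF n R])
    have lam: "lam = R / real n" by (rule lam_def)
    have w: "weight = cell_weight R n k" using cell_weight_eq[OF n R] by blast
    have "arr.prob {\<omega> \<in> space M. e \<le> \<bar>quenched_mean \<phi> R n k \<omega> - annealed_mean \<phi> R n k\<bar>} \<le>
      (real (card (V n k)))\<^sup>2 * (4 * lam\<^sup>2)\<^sup>2 / e\<^sup>2"
      unfolding quenched_mean_def annealed_mean_def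
    proof (rule arr.quenched_average_deviation[OF T_nonneg V_facts(1,2) _ _ e])
      show "0 \<le> cell_weight R n k B" if "B \<subseteq> V n k \<times> {1..n}" for B
        using R n unfolding cell_weight_def subset_weight_def by (intro prod_nonneg) auto
      show "(\<Sum>B\<in>{B \<in> Pow (V n k \<times> {1..n}). x \<in> fst ` B \<and> y \<in> fst ` B}. cell_weight R n k B) \<le> 4 * lam\<^sup>2"
        if "x \<in> V n k" "y \<in> V n k" "x \<noteq> y" for x y
        using sum_weight_edge[OF that] unfolding w .
    qed
    also have "\<dots> \<le> (real n * (real k)\<^sup>2)\<^sup>2 * (4 * lam\<^sup>2)\<^sup>2 / e\<^sup>2"
      using of_nat_mono[OF V_facts(3)[of n k], where 'a = real]
      by (intro divide_right_mono mult_right_mono power_mono) auto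
    also have "\<dots> = ?C * (1 / (real n)\<^sup>2)"
      using n e unfolding lam by (simp add: power4_eq_xxxx power2_eq_square divide_simps)
    finally show ?thesis using False by (simp add: A_def)
  qed (simp add: A_def)
  have "summable (\<lambda>n. arr.prob (A n))"
  proof (rule summable_comparison_test[of _ "\<lambda>n. ?C * (1 / (real n)\<^sup>2)"])
    show "\<exists>N. \<forall>n\<ge>N. norm (arr.prob (A n)) \<le> ?C * (1 / (real n)\<^sup>2)" using bound by simp
    have "summable (\<lambda>n. 1 / (real n)\<^sup>2)" using inverse_power_summable[of 2, where 'a = real] by (simp add: inverse_eq_divide)
    then show "summable (\<lambda>n. ?C * (1 / (real n)\<^sup>2))" by (rule summable_mult)
  qed
  then have "AE \<omega> in M. \<forall>\<^sub>F n in sequentially. \<omega> \<in> space M - A n"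
    using A by (intro borel_cantelli_AE1) (auto simp: less_top[symmetric])
  then show ?thesis
  proof eventually_elim
    case (elim \<omega>)
    show ?case
      using elim eventually_gt_at_top[of 0] by eventually_elim (auto simp: A_def)
  qed
qed

definition few_missed :: "nat \<Rightarrow> nat \<Rightarrow> 'w \<Rightarrow> bool" where
  "few_missed n k \<omega> \<longleftrightarrow> finite (arr.missed (n div k) (n * k\<^sup>2) (T n) (T (Suc n)) \<omega>) \<and>
     real (card (arr.missed (n div k) (n * k\<^sup>2) (T n) (T (Suc n)) \<omega>)) \<le> 8 * C0\<^sup>2 * G * tail k * (real n)\<^sup>2"

text \<open>
  The first term is for edges that leave the window, the second for edges that arrive between
  \<open>T n\<close> and \<open>T (Suc n)\<close>.
\<close>

lemma missed_rate_sum: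
  assumes k: "k \<ge> 1" "n \<ge> k" and F: "finite F" "F \<subseteq> {(x, y) \<in> edge_pairs. n div k < x}"
  shows "(\<Sum>(x, y)\<in>F. 2 * q x * q y * (if y \<le> n * k\<^sup>2 then T (Suc n) - T n else T (Suc n))) \<le>
     2 * C0\<^sup>2 * G * (real n)\<^sup>2 * (T (Suc n) / T n * tail k + (T (Suc n) / T n - 1) * (2 * real k) powr (2 * (\<gamma> - 1)))"
proof -
  let ?a = "n div k" and ?b = "n * k\<^sup>2"
  have n: "n \<ge> 1" using k by simp
  have a1: "1 \<le> ?a" using div_ge_half(2)[OF k] .
  have b1: "1 \<le> ?b" using n k by simp
  have Tn: "T n > 0" using n by (simp add: T_def)
  have dT: "0 \<le> T (Suc n) - T n" using T_mono[of n "Suc n"] by simp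
  let ?s = "\<lambda>F. \<Sum>(x, y)\<in>F. real x powr (- \<gamma>) * real y powr (- \<gamma>)"
  have inj: "inj_on (\<lambda>x :: nat. x) {x. 1 \<le> x}" by simp
  let ?F1 = "{(x, y) \<in> F. ?b < y}"
  have sub: "?F1 \<subseteq> F" by auto
  have fin1: "finite ?F1" using finite_subset[OF sub F(1)] .
  have s1: "?s ?F1 \<le> G * (real ?a powr (1 - \<gamma>) * real ?b powr (1 - \<gamma>))"
    unfolding G_def using F by (intro sum_powr_pairs_le[OF \<gamma> a1 b1 fin1 _ inj]) auto
  have s2: "?s F \<le> G * (real ?a powr (1 - \<gamma>) * real ?a powr (1 - \<gamma>))"
    unfolding G_def using F by (intro sum_powr_pairs_le[OF \<gamma> a1 a1 F(1) _ inj]) (auto simp: edge_pairs_def)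
  have "(\<Sum>(x, y)\<in>F. 2 * q x * q y * (if y \<le> ?b then T (Suc n) - T n else T (Suc n))) \<le>
    (\<Sum>(x, y)\<in>F. 2 * C0\<^sup>2 * T (Suc n) * (if ?b < y then real x powr (- \<gamma>) * real y powr (- \<gamma>) else 0) +
       2 * C0\<^sup>2 * (T (Suc n) - T n) * (real x powr (- \<gamma>) * real y powr (- \<gamma>)))"
  proof (rule sum_mono)
    fix e assume "e \<in> F"
    obtain x y where e: "e = (x, y)" by (cases e)
    have xy: "1 \<le> x" "1 \<le> y" using \<open>e \<in> F\<close> F e by (auto simp: edge_pairs_def)
    have "q x * q y \<le> (C0 * real x powr (- \<gamma>)) * (C0 * real y powr (- \<gamma>))"
      using q_le xy arr.q0 C0 by (intro mult_mono) auto
    then have qq: "2 * q x * q y \<le> 2 * C0\<^sup>2 * (real x powr (- \<gamma>) * real y powr (- \<gamma>))"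
      by (simp add: power2_eq_square mult_ac)
    have "2 * q x * q y * (if y \<le> ?b then T (Suc n) - T n else T (Suc n)) \<le>
      2 * C0\<^sup>2 * (real x powr (- \<gamma>) * real y powr (- \<gamma>)) * (if y \<le> ?b then T (Suc n) - T n else T (Suc n))"
      using qq dT T_nonneg by (intro mult_right_mono) auto
    also have "\<dots> \<le> 2 * C0\<^sup>2 * T (Suc n) * (if ?b < y then real x powr (- \<gamma>) * real y powr (- \<gamma>) else 0) +
       2 * C0\<^sup>2 * (T (Suc n) - T n) * (real x powr (- \<gamma>) * real y powr (- \<gamma>))"
      using dT by (simp add: mult_ac)
    finally show "(case e of (x, y) \<Rightarrow> 2 * q x * q y * (if y \<le> ?b then T (Suc n) - T n else T (Suc n))) \<le>
      (case e of (x, y) \<Rightarrow> 2 * C0\<^sup>2 * T (Suc n) * (if ?b < y then real x powr (- \<gamma>) * real y powr (- \<gamma>) else 0) +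
       2 * C0\<^sup>2 * (T (Suc n) - T n) * (real x powr (- \<gamma>) * real y powr (- \<gamma>)))" by (simp add: e)
  qed
  also have "\<dots> = 2 * C0\<^sup>2 * T (Suc n) * (\<Sum>(x, y)\<in>F. if ?b < y then real x powr (- \<gamma>) * real y powr (- \<gamma>) else 0) +
     2 * C0\<^sup>2 * (T (Suc n) - T n) * ?s F"
    by (simp add: case_prod_beta sum.distrib sum_distrib_left)
  also have "(\<Sum>(x, y)\<in>F. if ?b < y then real x powr (- \<gamma>) * real y powr (- \<gamma>) else 0) = ?s ?F1"
    using F(1) by (intro sum.mono_neutral_cong_right) (auto split: if_splits)
  also have "2 * C0\<^sup>2 * T (Suc n) * ?s ?F1 + 2 * C0\<^sup>2 * (T (Suc n) - T n) * ?s F \<le>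
    2 * C0\<^sup>2 * T (Suc n) * (G * (real ?a powr (1 - \<gamma>) * real ?b powr (1 - \<gamma>))) +
    2 * C0\<^sup>2 * (T (Suc n) - T n) * (G * (real ?a powr (1 - \<gamma>) * real ?a powr (1 - \<gamma>)))"
    using s1 s2 dT T_nonneg by (intro add_mono mult_left_mono) auto
  also have "\<dots> = 2 * C0\<^sup>2 * G * (T (Suc n) / T n * (T n * (real ?a powr (1 - \<gamma>) * real ?b powr (1 - \<gamma>))) +
     (T (Suc n) / T n - 1) * (T n * (real ?a powr (1 - \<gamma>) * real ?a powr (1 - \<gamma>))))"
    using Tn by (simp add: field_simps)
  also have "\<dots> \<le> 2 * C0\<^sup>2 * G * (T (Suc n) / T n * ((real n)\<^sup>2 * tail k) +
     (T (Suc n) / T n - 1) * ((real n)\<^sup>2 * (2 * real k) powr (2 * (\<gamma> - 1))))"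
    using tail_scaling[OF \<gamma> k] G_pos dT Tn T_nonneg[of "Suc n"] unfolding tail_def T_def[of n, symmetric]
    by (intro mult_left_mono add_mono) (auto simp: field_simps)
  also have "\<dots> = 2 * C0\<^sup>2 * G * (real n)\<^sup>2 * (T (Suc n) / T n * tail k + (T (Suc n) / T n - 1) * (2 * real k) powr (2 * (\<gamma> - 1)))"
    by (simp add: algebra_simps)
  finally show ?thesis .
qed

text \<open>
  For large \<open>n\<close> the expected number is at most half of the bound, and the probability of exceeding twice
  the bound for the mean is \<open>O(1 / n\<^sup>2)\<close>.
\<close>

lemma AE_few_missed:
  assumes k: "k \<ge> 1"
  shows "AE \<omega> in M. \<forall>\<^sub>F n in sequentially. few_missed n k \<omega>"
proof -
  have ratio: "(\<lambda>n. T (Suc n) / T n) \<longlonglongrightarrow> 1"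
    unfolding T_def using \<gamma> by real_asymp
  have "(\<lambda>n. T (Suc n) / T n * tail k + (T (Suc n) / T n - 1) * (2 * real k) powr (2 * (\<gamma> - 1))) \<longlonglongrightarrow>
    1 * tail k + (1 - 1) * (2 * real k) powr (2 * (\<gamma> - 1))"
    by (intro tendsto_intros ratio)
  then have "\<forall>\<^sub>F n in sequentially. T (Suc n) / T n * tail k + (T (Suc n) / T n - 1) * (2 * real k) powr (2 * (\<gamma> - 1)) < 2 * tail k"
    using tail_pos[OF k] by (intro order_tendstoD(2)) auto
  then have "\<forall>\<^sub>F n in sequentially. n \<ge> k \<and>
     T (Suc n) / T n * tail k + (T (Suc n) / T n - 1) * (2 * real k) powr (2 * (\<gamma> - 1)) < 2 * tail k"
    using eventually_ge_at_top[of k] by eventually_elim simp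
  then obtain n0 where n0: "\<And>n. n \<ge> n0 \<Longrightarrow> n \<ge> k \<and>
     T (Suc n) / T n * tail k + (T (Suc n) / T n - 1) * (2 * real k) powr (2 * (\<gamma> - 1)) < 2 * tail k"
    by (auto simp: eventually_sequentially)
  let ?D = "4 * C0\<^sup>2 * G * tail k"
  have D: "?D > 0" using C0 G_pos tail_pos[OF k] by simp
  have "\<exists>Z\<in>arr.events. arr.prob Z \<le> 1 / ?D * (1 / (real n)\<^sup>2) \<and> (\<forall>\<omega>\<in>space M - Z. few_missed n k \<omega>)" if n: "n \<ge> n0" for n
  proof -
    have nk: "n \<ge> k" using n0[OF n] by simp
    have npos: "real n > 0" using nk k by simp
    have "\<exists>Z\<in>arr.events. arr.prob Z \<le> 1 / (?D * (real n)\<^sup>2) \<and>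
     (\<forall>\<omega>\<in>space M - Z. finite (arr.missed (n div k) (n * k\<^sup>2) (T n) (T (Suc n)) \<omega>) \<and>
        real (card (arr.missed (n div k) (n * k\<^sup>2) (T n) (T (Suc n)) \<omega>)) \<le> 2 * (?D * (real n)\<^sup>2))"
    proof (rule arr.prob_many_missed[OF T_nonneg T_mono])
      show "0 < ?D * (real n)\<^sup>2" using D npos by simp
      fix F assume F: "finite F" "F \<subseteq> {(x, y) \<in> edge_pairs. n div k < x}"
      note missed_rate_sum[OF k nk F]
      also have "2 * C0\<^sup>2 * G * (real n)\<^sup>2 * (T (Suc n) / T n * tail k + (T (Suc n) / T n - 1) * (2 * real k) powr (2 * (\<gamma> - 1))) \<le>
        2 * C0\<^sup>2 * G * (real n)\<^sup>2 * (2 * tail k)"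
        using n0[OF n] G_pos by (intro mult_left_mono) auto
      finally show "(\<Sum>(x, y)\<in>F. 2 * q x * q y * (if y \<le> n * k\<^sup>2 then T (Suc n) - T n else T (Suc n))) \<le> ?D * (real n)\<^sup>2"
        by (simp add: mult_ac)
    qed simp
    then show ?thesis unfolding few_missed_def by (auto simp: mult_ac)
  qed
  then obtain Z where Z: "\<And>n. n \<ge> n0 \<Longrightarrow> Z n \<in> arr.events \<and> arr.prob (Z n) \<le> 1 / ?D * (1 / (real n)\<^sup>2) \<and>
      (\<forall>\<omega>\<in>space M - Z n. few_missed n k \<omega>)" by metis
  define A where "A n = (if n \<ge> n0 then Z n else {})" for n
  have "summable (\<lambda>n. arr.prob (A n))"
  proof (rule summable_comparison_test[of _ "\<lambda>n. 1 / ?D * (1 / (real n)\<^sup>2)"])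
    show "\<exists>N. \<forall>n\<ge>N. norm (arr.prob (A n)) \<le> 1 / ?D * (1 / (real n)\<^sup>2)" using Z by (auto simp: A_def)
    have "summable (\<lambda>n. 1 / (real n)\<^sup>2)" using inverse_power_summable[of 2, where 'a = real] by (simp add: inverse_eq_divide)
    then show "summable (\<lambda>n. 1 / ?D * (1 / (real n)\<^sup>2))" by (rule summable_mult)
  qed
  then have "AE \<omega> in M. \<forall>\<^sub>F n in sequentially. \<omega> \<in> space M - A n"
    using Z by (intro borel_cantelli_AE1) (auto simp: A_def less_top[symmetric])
  then show ?thesis
  proof eventually_elim
    case (elim \<omega>)
    show ?case using elim eventually_ge_at_top[of n0] by eventually_elim (use Z in \<open>auto simp: A_def\<close>)
  qed
qed

definition regular :: "'w \<Rightarrow> bool" where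
  "regular \<omega> \<longleftrightarrow> (\<forall>(x, y)\<in>edge_pairs. N x y 0 \<omega> = 0 \<and> mono_on {0..} (\<lambda>t. N x y t \<omega>)) \<and>
     (\<forall>j :: nat. finite (arr.present (real j) \<omega>))"

lemma AE_regular: "AE \<omega> in M. regular \<omega>"
  using arr.AE_mono arr.AE_finite_present[OF q_sum] unfolding regular_def by eventually_elim blast

definition empirical :: "'w \<Rightarrow> real \<Rightarrow> real \<Rightarrow> real \<Rightarrow> real \<Rightarrow> real" where
  "empirical \<omega> t u = stretched_graphon (arrived_graph N t \<omega>) (lab (arrived_graph N t \<omega>)) u"

lemma finite_present:
  assumes "regular \<omega>" "0 \<le> t"
  shows "finite (arr.present t \<omega>)"
proof -
  obtain j :: nat where "t \<le> real j" using real_arch_simple by blast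
  then have "arr.present t \<omega> \<subseteq> arr.present (real j) \<omega>"
    using assms by (intro arr.present_mono) (auto simp: regular_def)
  then show ?thesis using assms(1) finite_subset unfolding regular_def by blast
qed

text \<open>
  The labelling given by \<open>lab\<close> enters through \<open>pos\<close> only. Isolated vertices have no label; they get
  strips beyond all labels, where the stretched graphon vanishes, so that every vertex of the
  window has a strip.
\<close>

lemma empirical_close:
  assumes k: "k \<ge> 1" "n \<ge> k" and R: "R > 0" and u: "u > 0" and \<rho>: "\<rho> / u = R / real n"
    and \<omega>: "regular \<omega>" "few_missed n k \<omega>" and t: "T n \<le> t" "t \<le> T (Suc n)"
  shows "\<bar>history_prob \<phi> (empirical \<omega> t u) \<rho> - quenched_mean \<phi> R n k \<omega>\<bar> \<le>
      R / real k + R / real n + 32 * C0\<^sup>2 * G * R\<^sup>2 * tail k + (real k)\<^sup>2 * R\<^sup>2 / real n + ((real k)\<^sup>2 * R)\<^sup>2 / real n"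
    and "0 \<le> r \<Longrightarrow> r \<le> \<rho> \<Longrightarrow>
      smp.prob {\<omega>' \<in> space P. smp.graph_at (empirical \<omega> t u) r \<omega>' \<noteq> smp.graph_at (empirical \<omega> t u) \<rho> \<omega>'} \<le>
        R / real k + R / real n + 32 * C0\<^sup>2 * G * R\<^sup>2 * tail k + (real k)\<^sup>2 * (real n * (\<rho> - r) / u)"
proof -
  have n: "n \<ge> 1" using k by simp
  have "\<rho> = R / real n * u" using \<rho> u by (simp add: field_simps)
  then have \<rho>0: "\<rho> > 0" using R n u by simp
  have t0: "0 \<le> t" using t T_nonneg order_trans by blast
  define E where "E = arrived_graph N t \<omega>"
  define l where "l = lab E"
  define v where "v = card (\<Union>E)"
  \<comment> \<open>Numbers beyond \<open>v\<close> are unused labels; the shift by \<open>v + 1\<close> keeps \<open>pos\<close> injective.\<close>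
  define pos where "pos x = (if x \<in> \<Union>E then inv_into {1..v} l x else v + 1 + x)" for x
  have Eeq: "E = edges_of (arr.present t \<omega>)" by (simp add: E_def arr.arrived_graph_eq)
  have finE: "fin_graph E"
    unfolding fin_graph_def Eeq edges_of_def
    using finite_present[OF \<omega>(1) t0] by (auto simp: arr.present_def edge_pairs_def)
  have l: "bij_betw l {1..v} (\<Union>E)" using lab finE by (simp add: vertex_labelling_def l_def v_def)
  have pos_in: "pos x \<in> {1..v}" "l (pos x) = x" if "x \<in> \<Union>E" for x
    using that l inv_into_into[of x l "{1..v}"] f_inv_into_f[of x l "{1..v}"]
    by (auto simp: pos_def bij_betw_def)
  have inj: "inj pos"
  proof (rule injI)
    fix x y assume eq: "pos x = pos y"
    show "x = y"
    proof (cases "x \<in> \<Union>E")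
      case True
      then have "pos y \<le> v" using pos_in(1)[OF True] eq by simp
      then have "y \<in> \<Union>E" by (rule contrapos_pp) (simp add: pos_def)
      then show ?thesis using pos_in(2)[OF True] pos_in(2)[of y] eq by metis
    next
      case False
      then have "pos x > v" by (simp add: pos_def)
      then have "y \<notin> \<Union>E" using pos_in(1)[of y] eq by fastforce
      then show ?thesis using eq False unfolding pos_def by simp
    qed
  qed
  have pos1: "pos x \<ge> 1" for x
  proof (cases "x \<in> \<Union>E")
    case True then show ?thesis using pos_in(1) by simp
  next
    case False then show ?thesis unfolding pos_def by simp
  qed
  let ?missed = "arr.missed (n div k) (n * k\<^sup>2) (T n) (T (Suc n)) \<omega>"
  have fm: "finite ?missed" "real (card ?missed) \<le> 8 * C0\<^sup>2 * G * tail k * (real n)\<^sup>2"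
    using \<omega>(2) by (auto simp: few_missed_def)
  have pm1: "arr.present (T n) \<omega> \<subseteq> arr.present t \<omega>" and pm2: "arr.present t \<omega> \<subseteq> arr.present (T (Suc n)) \<omega>"
    using arr.present_mono[of \<omega>, OF _ T_nonneg t(1)] arr.present_mono[of \<omega>, OF _ t0 t(2)] \<omega>(1)
    unfolding regular_def by blast+
  define E0 where "E0 = edges_of (arr.present (T n) \<omega> \<inter> pairs_of (V n k))"
  interpret qu: quenched P \<xi> U u \<rho> pos n "V n k" E l "{..n div k}" "edges_of ?missed" E0
  proof unfold_locales
    show "fin_graph E" by (rule finE)
    show "bij_betw l {1..card (\<Union>E)} (\<Union>E)" using l by (simp add: v_def)
    show "pos (l j) = j" if "j \<in> {1..card (\<Union>E)}" for j
      using that l by (auto simp: pos_def bij_betw_def v_def)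
    show "finite (edges_of ?missed)" using fm by (simp add: edges_of_def)
    show "card e = 2" if "e \<in> edges_of ?missed" for e
      using that by (auto simp: edges_of_def arr.missed_def edge_pairs_def)
    show "E0 \<subseteq> E" using pm1 by (auto simp: E0_def Eeq edges_of_def)
    show "\<Union>E0 \<subseteq> V n k" by (auto simp: E0_def edges_of_def pairs_of_def)
    fix e assume "e \<in> E"
    then obtain x y where xy: "e = {x, y}" "(x, y) \<in> arr.present t \<omega>" by (auto simp: Eeq edges_of_def)
    then have p2: "(x, y) \<in> arr.present (T (Suc n)) \<omega>" and ep: "(x, y) \<in> edge_pairs" using pm2 by (auto simp: arr.present_def)
    then have lt: "x < y" by (auto simp: edge_pairs_def)
    show "e \<inter> {..n div k} \<noteq> {} \<or> e \<in> E0 \<or> e \<in> edges_of ?missed"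
    proof (cases "x \<le> n div k")
      case True then show ?thesis using xy by auto
    next
      case False
      show ?thesis
      proof (cases "y \<le> n * k\<^sup>2 \<and> 1 \<le> N x y (T n) \<omega>")
        case True
        then have "(x, y) \<in> arr.present (T n) \<omega> \<inter> pairs_of (V n k)"
          using False lt ep by (auto simp: arr.present_def pairs_of_def V_def)
        then show ?thesis using xy by (auto simp: E0_def edges_of_def)
      next
        case nT: False
        then have "(x, y) \<in> ?missed" using False ep p2 by (auto simp: arr.missed_def arr.present_def)
        then show ?thesis using xy by (auto simp: edges_of_def)
      qed
    qed
  qed (use u \<rho>0 inj pos1 n V_facts in auto)
  have lam: "qu.lam = R / real n" unfolding qu.lam_def by (rule \<rho>)
  have WE: "stretched_graphon E l u = empirical \<omega> t u" by (simp add: empirical_def E_def l_def)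
  have w: "qu.weight = cell_weight R n k" unfolding qu.weight_def[abs_def] cell_weight_def[abs_def] lam by simp
  have hist: "discrete_history n B E0 = discrete_history n B (edges_of (arr.present (T n) \<omega> \<inter> pairs_of (fst ` B)))"
    if "B \<in> Pow (V n k \<times> {1..n})" for B
  proof (rule discrete_history_cong)
    fix e assume e: "e \<subseteq> fst ` B"
    have "fst ` B \<subseteq> V n k" using that by auto
    then show "e \<in> E0 \<longleftrightarrow> e \<in> edges_of (arr.present (T n) \<omega> \<inter> pairs_of (fst ` B))"
      using e unfolding E0_def edges_of_def pairs_of_def by (auto simp: image_iff)
  qed
  have sum: "(\<Sum>B\<in>Pow (V n k \<times> {1..n}). qu.weight B * of_bool (\<phi> (discrete_history n B E0))) = quenched_mean \<phi> R n k \<omega>"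
    unfolding quenched_mean_def w arr.test_def by (intro sum.cong refl) (simp add: hist)
  have base: "card {..n div k} * qu.lam + 4 * card (edges_of ?missed) * qu.lam\<^sup>2 \<le>
    R / real k + R / real n + 32 * C0\<^sup>2 * G * R\<^sup>2 * tail k"
  proof -
    have 1: "card {..n div k} * qu.lam \<le> R / real k + R / real n"
      unfolding lam by (rule first_cells_le[OF k R])
    have "card (edges_of ?missed) \<le> card ?missed" unfolding edges_of_def by (rule card_image_le[OF fm(1)])
    then have cm: "real (card (edges_of ?missed)) \<le> 8 * C0\<^sup>2 * G * tail k * (real n)\<^sup>2" using fm(2) by linarith
    have "4 * real (card (edges_of ?missed)) * qu.lam\<^sup>2 \<le> 4 * (8 * C0\<^sup>2 * G * tail k * (real n)\<^sup>2) * qu.lam\<^sup>2"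
      by (rule mult_right_mono[OF mult_left_mono[OF cm]]) auto
    also have "\<dots> = 32 * C0\<^sup>2 * G * R\<^sup>2 * tail k" unfolding lam using n by (simp add: power_divide)
    finally show ?thesis using 1 unfolding of_nat_mult of_nat_numeral by linarith
  qed
  have cV: "real (card (V n k)) \<le> real n * (real k)\<^sup>2"
    using of_nat_mono[OF V_facts(3)[of n k], where 'a = real] by simp
  have lam0: "0 \<le> qu.lam" using lam R n by simp
  have cVlam: "card (V n k) * qu.lam \<le> (real k)\<^sup>2 * R"
    using mult_right_mono[OF cV lam0] n unfolding lam by simp
  have "card (V n k) * qu.lam * qu.lam \<le> (real k)\<^sup>2 * R * qu.lam" by (rule mult_right_mono[OF cVlam lam0])
  then have v1: "card (V n k) * qu.lam\<^sup>2 \<le> (real k)\<^sup>2 * R\<^sup>2 / real n"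
    unfolding lam by (simp add: power2_eq_square)
  have v2: "(card (V n k) * qu.lam)\<^sup>2 / real n \<le> ((real k)\<^sup>2 * R)\<^sup>2 / real n"
    using cVlam lam0 by (intro divide_right_mono power_mono) auto
  show "\<bar>history_prob \<phi> (empirical \<omega> t u) \<rho> - quenched_mean \<phi> R n k \<omega>\<bar> \<le>
      R / real k + R / real n + 32 * C0\<^sup>2 * G * R\<^sup>2 * tail k + (real k)\<^sup>2 * R\<^sup>2 / real n + ((real k)\<^sup>2 * R)\<^sup>2 / real n"
    using qu.history_law[of \<phi>] base v1 v2 unfolding history_prob_def sum WE by linarith
  assume r: "0 \<le> r" "r \<le> \<rho>"
  have "card (V n k) * (\<rho> - r) / u \<le> real n * (real k)\<^sup>2 * (\<rho> - r) / u"
    using cV r u by (intro divide_right_mono mult_right_mono) auto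
  then show "smp.prob {\<omega>' \<in> space P. smp.graph_at (empirical \<omega> t u) r \<omega>' \<noteq> smp.graph_at (empirical \<omega> t u) \<rho> \<omega>'} \<le>
        R / real k + R / real n + 32 * C0\<^sup>2 * G * R\<^sup>2 * tail k + (real k)\<^sup>2 * (real n * (\<rho> - r) / u)"
    using qu.graph_at_stable[OF r] base unfolding WE by (simp add: mult_ac)
qed

definition grid_index :: "real \<Rightarrow> nat" where "grid_index t = nat \<lfloor>t powr (1 / (2 * \<gamma>))\<rfloor>"

lemma grid_index_bounds:
  assumes "t \<ge> 0"
  shows "T (grid_index t) \<le> t" "t \<le> T (Suc (grid_index t))"
    "real (grid_index t) \<le> t powr (1 / (2 * \<gamma>))" "t powr (1 / (2 * \<gamma>)) < real (grid_index t) + 1"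
proof -
  let ?s = "t powr (1 / (2 * \<gamma>))"
  show 1: "real (grid_index t) \<le> ?s" "?s < real (grid_index t) + 1" unfolding grid_index_def by (simp, linarith)
  have s: "?s powr (2 * \<gamma>) = t" using assms \<gamma> by (simp add: powr_powr)
  show "T (grid_index t) \<le> t" unfolding T_def using powr_mono2[OF _ _ 1(1), of "2 * \<gamma>"] \<gamma> s by simp
  show "t \<le> T (Suc (grid_index t))" unfolding T_def using powr_mono2[of "2 * \<gamma>" ?s "real (Suc (grid_index t))"] 1(2) \<gamma> s by simp
qed

lemma grid_index_filterlim: "filterlim grid_index sequentially at_top"
proof -
  have "filterlim (\<lambda>t :: real. t powr (1 / (2 * \<gamma>))) at_top at_top" using \<gamma> by real_asymp
  then have "filterlim (\<lambda>t :: real. \<lfloor>t powr (1 / (2 * \<gamma>))\<rfloor>) at_top at_top"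
    by (rule filterlim_compose[OF filterlim_floor_sequentially])
  then show ?thesis unfolding grid_index_def by (rule filterlim_compose[OF filterlim_nat_sequentially])
qed

text \<open>
  What remains after \<open>t\<close> tends to infinity with the window parameter \<open>k\<close> fixed.
\<close>

definition err :: "real \<Rightarrow> nat \<Rightarrow> real" where
  "err R k = 2 * (R / real k) + (16 * c\<^sup>2 + 32 * C0\<^sup>2) * G * R\<^sup>2 * tail k"

lemma err_tendsto: "err R \<longlonglongrightarrow> 0"
proof -
  have "(\<lambda>k. 2 * (R / real k) + (16 * c\<^sup>2 + 32 * C0\<^sup>2) * G * R\<^sup>2 * tail k) \<longlonglongrightarrow> 2 * 0 + (16 * c\<^sup>2 + 32 * C0\<^sup>2) * G * R\<^sup>2 * 0"
    by (intro tendsto_intros tail_tendsto lim_const_over_n)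
  then show ?thesis unfolding err_def[abs_def] by simp
qed

definition typical :: "(ugraph set \<Rightarrow> bool) \<Rightarrow> real \<Rightarrow> 'w \<Rightarrow> bool" where
  "typical \<phi> R \<omega> \<longleftrightarrow> regular \<omega> \<and> (\<forall>k\<ge>1. (\<forall>\<^sub>F n in sequentially. few_missed n k \<omega>) \<and>
     (\<forall>e>0. \<forall>\<^sub>F n in sequentially. \<bar>quenched_mean \<phi> R n k \<omega> - annealed_mean \<phi> R n k\<bar> < e))"

lemma AE_typical:
  assumes R: "R > 0"
  shows "AE \<omega> in M. typical \<phi> R \<omega>"
proof -
  have 1: "AE \<omega> in M. \<forall>k j. k \<ge> 1 \<longrightarrow> (\<forall>\<^sub>F n in sequentially. \<bar>quenched_mean \<phi> R n k \<omega> - annealed_mean \<phi> R n k\<bar> < 1 / real (Suc j))"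
    using AE_quenched_mean_close[OF _ R] by (simp add: AE_all_countable)
  have 2: "AE \<omega> in M. \<forall>k. k \<ge> 1 \<longrightarrow> (\<forall>\<^sub>F n in sequentially. few_missed n k \<omega>)"
    using AE_few_missed by (simp add: AE_all_countable)
  show ?thesis
    using 1 2 AE_regular
  proof eventually_elim
    case (elim \<omega>)
    have "\<forall>\<^sub>F n in sequentially. \<bar>quenched_mean \<phi> R n k \<omega> - annealed_mean \<phi> R n k\<bar> < e" if "k \<ge> 1" "e > 0" for k and e :: real
    proof -
      obtain j where j: "1 / real (Suc j) < e" using \<open>e > 0\<close> nat_approx_posE by blast
      have "\<forall>\<^sub>F n in sequentially. \<bar>quenched_mean \<phi> R n k \<omega> - annealed_mean \<phi> R n k\<bar> < 1 / real (Suc j)" using elim(1) \<open>k \<ge> 1\<close> by blast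
      then show ?thesis by eventually_elim (use j in simp)
    qed
    then show ?case using elim unfolding typical_def by blast
  qed
qed

text \<open>
  The first part compares histories with equal \<open>\<rho> / u\<close>. The second part allows the horizon to move a
  little: the graph changes between \<open>r\<close> and \<open>\<rho>\<close> only if a point of the window arrives in between.
\<close>

lemma history_convergence:
  assumes \<omega>: "typical \<phi> R \<omega>" and R: "R > 0" and e: "e > 0" and k: "k \<ge> 1"
  shows "\<forall>\<^sub>F t in at_top. \<forall>u \<rho>. u > 0 \<longrightarrow> \<rho> / u = R / real (grid_index t) \<longrightarrow>
      \<bar>history_prob \<phi> (empirical \<omega> t u) \<rho> - history_prob \<phi> W R\<bar> \<le> err R k + e \<and>
      (\<forall>r. 0 \<le> r \<longrightarrow> r \<le> \<rho> \<longrightarrow>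
        smp.prob {\<omega>' \<in> space P. smp.graph_at (empirical \<omega> t u) r \<omega>' \<noteq> smp.graph_at (empirical \<omega> t u) \<rho> \<omega>'} \<le>
          err R k + e + (real k)\<^sup>2 * (real (grid_index t) * (\<rho> - r) / u))"
proof -
  have e3: "e / 3 > 0" using e by simp
  have regular: "regular \<omega>" and fm: "\<forall>\<^sub>F n in sequentially. few_missed n k \<omega>"
    and ec: "\<forall>\<^sub>F n in sequentially. \<bar>quenched_mean \<phi> R n k \<omega> - annealed_mean \<phi> R n k\<bar> < e / 3"
    using \<omega> k e3 unfolding typical_def by blast+
  have "(\<lambda>n. R / real n + (real k)\<^sup>2 * R\<^sup>2 / real n + ((real k)\<^sup>2 * R)\<^sup>2 / real n) \<longlonglongrightarrow> 0" by real_asymp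
  then have "\<forall>\<^sub>F n in sequentially. R / real n + (real k)\<^sup>2 * R\<^sup>2 / real n + ((real k)\<^sup>2 * R)\<^sup>2 / real n < e / 3"
    using e3 by (intro order_tendstoD(2)) auto
  then have "\<forall>\<^sub>F n in sequentially. few_missed n k \<omega> \<and> n \<ge> k \<and> \<bar>quenched_mean \<phi> R n k \<omega> - annealed_mean \<phi> R n k\<bar> < e / 3 \<and>
      \<bar>history_prob \<phi> W R - annealed_mean \<phi> R n k\<bar> \<le> R / real k + 16 * c\<^sup>2 * G * R\<^sup>2 * tail k + e / 3 \<and>
      R / real n + (real k)\<^sup>2 * R\<^sup>2 / real n + ((real k)\<^sup>2 * R)\<^sup>2 / real n < e / 3"
    using fm ec limit_close_to_annealed_mean[OF k R e3] eventually_ge_at_top[of k] by eventually_elim blast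
  then have "\<forall>\<^sub>F t in at_top. few_missed (grid_index t) k \<omega> \<and> grid_index t \<ge> k \<and> \<bar>quenched_mean \<phi> R (grid_index t) k \<omega> - annealed_mean \<phi> R (grid_index t) k\<bar> < e / 3 \<and>
      \<bar>history_prob \<phi> W R - annealed_mean \<phi> R (grid_index t) k\<bar> \<le> R / real k + 16 * c\<^sup>2 * G * R\<^sup>2 * tail k + e / 3 \<and>
      R / real (grid_index t) + (real k)\<^sup>2 * R\<^sup>2 / real (grid_index t) + ((real k)\<^sup>2 * R)\<^sup>2 / real (grid_index t) < e / 3"
    by (rule eventually_compose_filterlim[OF _ grid_index_filterlim])
  then show ?thesis
    using eventually_ge_at_top[of 0]
  proof eventually_elim
    case (elim t)
    let ?n = "grid_index t"
    have n: "?n \<ge> k" "few_missed ?n k \<omega>" using elim by auto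
    have g0: "0 \<le> G * R\<^sup>2 * tail k" using G_pos tail_pos[OF k] by simp
    have Rk: "0 \<le> R / real k" "0 \<le> R / real ?n" "0 \<le> (real k)\<^sup>2 * R\<^sup>2 / real ?n" "0 \<le> ((real k)\<^sup>2 * R)\<^sup>2 / real ?n" using R by auto
    have er: "err R k = 2 * (R / real k) + 16 * c\<^sup>2 * G * R\<^sup>2 * tail k + 32 * C0\<^sup>2 * G * R\<^sup>2 * tail k"
      by (simp add: err_def algebra_simps)
    have c0: "0 \<le> 16 * c\<^sup>2 * G * R\<^sup>2 * tail k" using G_pos tail_pos[OF k] by simp
    show ?case
    proof (intro allI impI conjI)
      fix u \<rho> :: real assume u: "u > 0" "\<rho> / u = R / real ?n"
      note ec = empirical_close[OF k n(1) R u regular n(2) grid_index_bounds(1,2)[OF elim(2)]]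
      show "\<bar>history_prob \<phi> (empirical \<omega> t u) \<rho> - history_prob \<phi> W R\<bar> \<le> err R k + e"
        using ec(1)[of \<phi>] elim(1) unfolding er by linarith
      fix r assume "0 \<le> r" "r \<le> \<rho>"
      from ec(2)[OF this] show "smp.prob {\<omega>' \<in> space P. smp.graph_at (empirical \<omega> t u) r \<omega>' \<noteq> smp.graph_at (empirical \<omega> t u) \<rho> \<omega>'} \<le>
          err R k + e + (real k)\<^sup>2 * (real (grid_index t) * (\<rho> - r) / u)"
        using elim(1) Rk c0 e unfolding er by linarith
    qed
  qed
qed

end

section \<open>The limit process changes infinitely often\<close>

context sampling
begin

lemma AE_points_unbounded: "AE \<omega> in P. \<forall>j :: nat. \<exists>i. fst (\<xi> i \<omega>) \<le> 1 \<and> real j < snd (\<xi> i \<omega>)"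
proof (subst AE_all_countable, intro allI)
  fix j :: nat
  let ?C = "\<lambda>L :: nat. {0<..1} \<times> {real j<..real j + real L}"
  have C: "?C L \<in> sets \<nu>" and "emeasure \<nu> (?C L) = emeasure lborel {0<..1 :: real} * emeasure lborel {real j<..real j + real L}" for L
    by (intro emeasure_Times; auto)+
  then have e: "emeasure \<nu> (?C L) = ennreal (real L)" for L by simp
  show "AE \<omega> in P. \<exists>i. fst (\<xi> i \<omega>) \<le> 1 \<and> real j < snd (\<xi> i \<omega>)"
  proof (rule AE_from_small_covers)
    fix L
    note [measurable] = C
    show "{\<omega> \<in> space P. \<forall>i. \<xi> i \<omega> \<notin> ?C L} \<in> events" by measurable
    have "measure \<nu> (?C L) = real L" using e by (simp add: measure_def)
    then show "prob {\<omega> \<in> space P. \<forall>i. \<xi> i \<omega> \<notin> ?C L} \<le> exp (- real L)"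
      using prob_no_point[OF C] e by simp
    show "{\<omega> \<in> space P. \<not> (\<exists>i. fst (\<xi> i \<omega>) \<le> 1 \<and> real j < snd (\<xi> i \<omega>))} \<subseteq> {\<omega> \<in> space P. \<forall>i. \<xi> i \<omega> \<notin> ?C L}"
      by (auto simp: mem_Times_iff)
  next
    show "(\<lambda>L :: nat. exp (- real L)) \<longlonglongrightarrow> 0" by real_asymp
  qed
qed

text \<open>
  Among the first \<open>2 * L\<close> points in \<open>C\<close> there are \<open>L\<close> disjoint pairs, whose coins are independent of
  each other and of the points. No edge appears with probability at most \<open>(1 - w0) ^ L\<close>.
\<close>

lemma AE_edge_among_infinitely_many:
  assumes C: "C \<in> sets \<nu>" and w0: "0 < w0" "w0 \<le> 1"
  shows "AE \<omega> in P. infinite {i. \<xi> i \<omega> \<in> C} \<longrightarrow> (\<exists>i j. i < j \<and> \<xi> i \<omega> \<in> C \<and> \<xi> j \<omega> \<in> C \<and> U i j \<omega> < w0)"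
proof -
  define K where "K L = {S :: nat set. finite S \<and> card S = 2 * L}" for L
  \<comment> \<open>\<open>S\<close> is an initial segment of the indices of the points in \<open>C\<close>.\<close>
  define A where "A S = {\<omega> \<in> space P. \<forall>i. i \<le> Max S \<longrightarrow> (\<xi> i \<omega> \<in> C \<longleftrightarrow> i \<in> S)}" for S
  define I where "I L = (\<lambda>l. (2 * l, 2 * l + 1)) ` {..<L}" for L :: nat
  define \<kappa> where "\<kappa> S x = sorted_list_of_set S ! x" for S :: "nat set" and x
  define B where "B L S = {\<omega> \<in> space P. {(x, y) \<in> I L. Usym (\<kappa> S x) (\<kappa> S y) \<omega> < w0} = {}}" for L S
  have K: "countable (K L)" for L
    unfolding K_def by (rule countable_subset[OF _ countable_Collect_finite]) auto
  have A\<sigma>: "A S \<in> sets \<sigma>\<xi>" for S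
  proof -
    note [measurable] = C
    have "{\<omega> \<in> space \<sigma>\<xi>. \<forall>i. i \<le> Max S \<longrightarrow> (\<xi> i \<omega> \<in> C \<longleftrightarrow> i \<in> S)} \<in> sets \<sigma>\<xi>" by measurable
    then show ?thesis unfolding A_def space_\<sigma> .
  qed
  have \<kappa>: "inj_on (\<kappa> S) {..<2 * L}" "\<And>x. x < 2 * L \<Longrightarrow> \<kappa> S x \<in> S" if "S \<in> K L" for S L
  proof -
    have len: "length (sorted_list_of_set S) = 2 * L" using that by (simp add: K_def)
    show "inj_on (\<kappa> S) {..<2 * L}" unfolding \<kappa>_def by (rule inj_on_nth) (use len in auto)
    show "\<kappa> S x \<in> S" if "x < 2 * L" for x
      using that len \<open>S \<in> K L\<close> nth_mem[of x "sorted_list_of_set S"] by (simp add: \<kappa>_def K_def)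
  qed
  have Isub: "fst ` I L \<union> snd ` I L \<subseteq> {..<2 * L}" for L by (auto simp: I_def)
  have B\<sigma>: "B L S \<in> sets \<sigma>U" if S: "S \<in> K L" for S L
  proof -
    have "B L S = {\<omega> \<in> space \<sigma>U. \<forall>l\<in>{..<L}. \<not> Usym (\<kappa> S (2 * l)) (\<kappa> S (2 * l + 1)) \<omega> < w0}"
      by (auto simp: B_def I_def)
    also have "\<dots> \<in> sets \<sigma>U"
    proof (intro sets.sets_Collect_finite_All)
      fix l assume l: "l \<in> {..<L}"
      have "\<kappa> S (2 * l) \<noteq> \<kappa> S (2 * l + 1)"
      proof
        assume "\<kappa> S (2 * l) = \<kappa> S (2 * l + 1)"
        then have "2 * l = 2 * l + 1" by (rule inj_onD[OF \<kappa>(1)[OF S]]) (use l in auto)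
        then show False by simp
      qed
      note [measurable] = Usym_\<sigma>U[OF this]
      show "{\<omega> \<in> space \<sigma>U. \<not> Usym (\<kappa> S (2 * l)) (\<kappa> S (2 * l + 1)) \<omega> < w0} \<in> sets \<sigma>U" by measurable
    qed simp
    finally show ?thesis .
  qed
  have Bp: "prob (B L S) = (1 - w0) ^ L" if S: "S \<in> K L" for S L
  proof -
    have "prob (B L S) = subset_weight (\<lambda>(x, y). w0) (I L) {}"
      unfolding B_def
    proof (rule prob_edges_between)
      show "inj_on (\<kappa> S) (fst ` I L \<union> snd ` I L)" using \<kappa>(1)[OF S] Isub by (rule inj_on_subset)
    qed (use w0 in \<open>auto simp: I_def\<close>)
    also have "\<dots> = (1 - w0) ^ card (I L)" by (simp add: subset_weight_def case_prod_beta)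
    also have "card (I L) = L" unfolding I_def by (subst card_image) (auto simp: inj_on_def)
    finally show ?thesis .
  qed
  have disj: "disjoint_family_on A (K L)" for L
  proof -
    have "S = S'" if S: "S \<in> K L" "S' \<in> K L" "\<omega> \<in> A S" "\<omega> \<in> A S'" "Max S \<le> Max S'" for S S' \<omega>
    proof -
      have "S \<subseteq> S'"
      proof
        fix i assume i: "i \<in> S"
        have "finite S" using S by (simp add: K_def)
        then have "i \<le> Max S" using i by simp
        then show "i \<in> S'" using S i by (auto simp: A_def)
      qed
      then show ?thesis using S by (intro card_subset_eq) (auto simp: K_def)
    qed
    then show ?thesis unfolding disjoint_family_on_def by (metis disjoint_iff linear)
  qed
  show ?thesis
  proof (rule AE_from_small_covers)
    fix i :: nat
    \<comment> \<open>Starting at 1 avoids the empty set of points, whose maximum is unspecified.\<close>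
    define L where "L = Suc i"
    let ?Z = "\<Union>S\<in>K L. A S \<inter> B L S"
    show "(\<Union>S\<in>K (Suc i). A S \<inter> B (Suc i) S) \<in> events"
      using K A\<sigma> B\<sigma> \<sigma>_events by (intro sets.countable_UN') (auto intro!: sets.Int)
    have "prob ?Z = prob (\<Union>S\<in>K L. A S) * (1 - w0) ^ L"
      by (rule prob_decoupled[OF K A\<sigma> B\<sigma> disj Bp])
    also have "\<dots> \<le> 1 * (1 - w0) ^ L" using w0 by (intro mult_right_mono) auto
    finally show "prob (\<Union>S\<in>K (Suc i). A S \<inter> B (Suc i) S) \<le> (1 - w0) ^ Suc i" by (simp add: L_def)
    show "{\<omega> \<in> space P. \<not> (infinite {i. \<xi> i \<omega> \<in> C} \<longrightarrow> (\<exists>i j. i < j \<and> \<xi> i \<omega> \<in> C \<and> \<xi> j \<omega> \<in> C \<and> U i j \<omega> < w0))} \<subseteq>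
      (\<Union>S\<in>K (Suc i). A S \<inter> B (Suc i) S)"
      unfolding L_def[symmetric]
    proof
      fix \<omega> assume "\<omega> \<in> {\<omega> \<in> space P. \<not> (infinite {i. \<xi> i \<omega> \<in> C} \<longrightarrow> (\<exists>i j. i < j \<and> \<xi> i \<omega> \<in> C \<and> \<xi> j \<omega> \<in> C \<and> U i j \<omega> < w0))}"
      then have \<omega>: "\<omega> \<in> space P" and inf: "infinite {i. \<xi> i \<omega> \<in> C}"
        and no: "\<And>i j. i < j \<Longrightarrow> \<xi> i \<omega> \<in> C \<Longrightarrow> \<xi> j \<omega> \<in> C \<Longrightarrow> \<not> U i j \<omega> < w0" by auto
      let ?Q = "{i. \<xi> i \<omega> \<in> C}"
      define S where "S = enumerate ?Q ` {..<2 * L}"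
      have mono: "strict_mono (enumerate ?Q)" using inf by (rule strict_mono_enumerate)
      have S: "S \<in> K L" unfolding K_def S_def
        using mono by (simp add: card_image strict_mono_imp_inj_on inj_on_subset[OF _ subset_UNIV])
      have SQ: "S \<subseteq> ?Q" using enumerate_in_set[OF inf] by (auto simp: S_def)
      have "\<omega> \<in> A S"
      proof -
        have max: "Max S = enumerate ?Q (2 * L - 1)"
          using mono by (intro Max_eqI) (auto simp: S_def L_def strict_mono_less_eq)
        show ?thesis unfolding A_def
        proof (intro CollectI conjI \<omega> allI impI)
          fix i assume i: "i \<le> Max S"
          show "\<xi> i \<omega> \<in> C \<longleftrightarrow> i \<in> S"
          proof
            assume "\<xi> i \<omega> \<in> C"
            then obtain n where n: "enumerate ?Q n = i" using enumerate_Ex[of ?Q i] inf by auto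
            then have "n \<le> 2 * L - 1" using i max strict_mono_less_eq[OF mono] by metis
            then show "i \<in> S" using n unfolding S_def by (intro image_eqI[of _ _ n]) (auto simp: L_def)
          qed (use SQ in auto)
        qed
      qed
      moreover have "\<omega> \<in> B L S"
      proof -
        have "\<not> Usym (\<kappa> S x) (\<kappa> S y) \<omega> < w0" if "(x, y) \<in> I L" for x y
        proof -
          have xy: "x < 2 * L" "y < 2 * L" "x \<noteq> y" using that by (auto simp: I_def)
          then have "\<kappa> S x \<noteq> \<kappa> S y" using inj_onD[OF \<kappa>(1)[OF S]] by auto
          moreover have "\<xi> (\<kappa> S x) \<omega> \<in> C" "\<xi> (\<kappa> S y) \<omega> \<in> C" using \<kappa>(2)[OF S] xy SQ by auto
          ultimately show ?thesis
            using no[of "\<kappa> S x" "\<kappa> S y"] no[of "\<kappa> S y" "\<kappa> S x"] Usym_less by (metis linorder_neqE_nat)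
        qed
        then show ?thesis using \<omega> by (auto simp: B_def)
      qed
      ultimately show "\<omega> \<in> ?Z" using S by blast
    qed
  next
    show "(\<lambda>i. (1 - w0) ^ Suc i) \<longlonglongrightarrow> 0"
      using w0 by (intro LIMSEQ_Suc LIMSEQ_realpow_zero) auto
  qed
qed

end

context rank1
begin

lemma W_lower:
  assumes "0 < x" "x \<le> 1" "0 < y" "y \<le> 1"
  shows "1 - exp (- 2 * c\<^sup>2) \<le> W x y"
proof -
  have "1 \<le> x powr (- \<gamma>)" "1 \<le> y powr (- \<gamma>)"
    using assms \<gamma> powr_mono2'[of "- \<gamma>" x 1] powr_mono2'[of "- \<gamma>" y 1] by auto
  then have "1 * 1 \<le> x powr (- \<gamma>) * y powr (- \<gamma>)" by (intro mult_mono) auto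
  then have "2 * c\<^sup>2 * 1 \<le> 2 * c\<^sup>2 * (x powr (- \<gamma>) * y powr (- \<gamma>))" by (intro mult_left_mono) auto
  then show ?thesis unfolding W by (simp add: mult_ac)
qed

text \<open>
  On the unit square \<open>W\<close> is bounded below, and infinitely many points fall into the unit interval after
  any given time.
\<close>

lemma AE_late_edges:
  "AE \<omega> in P. \<forall>j :: nat. \<exists>i l. i < l \<and> real j < snd (\<xi> i \<omega>) \<and> U i l \<omega> < W (fst (\<xi> i \<omega>)) (fst (\<xi> l \<omega>))"
proof (subst AE_all_countable, intro allI)
  fix j :: nat
  let ?C = "{0<..1} \<times> {real j<..}"
  let ?w = "1 - exp (- 2 * c\<^sup>2)"
  have C: "?C \<in> sets smp.\<nu>" by (intro smp.emeasure_Times) auto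
  have "AE \<omega> in P. infinite {i. \<xi> i \<omega> \<in> ?C} \<longrightarrow> (\<exists>i l. i < l \<and> \<xi> i \<omega> \<in> ?C \<and> \<xi> l \<omega> \<in> ?C \<and> U i l \<omega> < ?w)"
    using c by (intro smp.AE_edge_among_infinitely_many[OF C]) auto
  then show "AE \<omega> in P. \<exists>i l. i < l \<and> real j < snd (\<xi> i \<omega>) \<and> U i l \<omega> < W (fst (\<xi> i \<omega>)) (fst (\<xi> l \<omega>))"
    using smp.AE_points_unbounded AE_space
  proof eventually_elim
    case (elim \<omega>)
    have inf: "infinite {i. \<xi> i \<omega> \<in> ?C}"
    proof
      assume fin: "finite {i. \<xi> i \<omega> \<in> ?C}"
      define b where "b = Max (insert 0 ((\<lambda>i. snd (\<xi> i \<omega>)) ` {i. \<xi> i \<omega> \<in> ?C}))"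
      obtain j' :: nat where j': "b \<le> real j'" using real_arch_simple by blast
      obtain i where i: "fst (\<xi> i \<omega>) \<le> 1" "real (max j j') < snd (\<xi> i \<omega>)" using elim(2) by blast
      then have "\<xi> i \<omega> \<in> ?C" using smp.\<xi>_pos[OF elim(3)] by (simp add: mem_Times_iff)
      then have "snd (\<xi> i \<omega>) \<le> b" unfolding b_def using fin by (intro Max_ge) auto
      then show False using i j' by simp
    qed
    obtain i l where il: "i < l" "\<xi> i \<omega> \<in> ?C" "\<xi> l \<omega> \<in> ?C" "U i l \<omega> < ?w"
      using mp[OF elim(1) inf] by (elim exE conjE)
    then have "?w \<le> W (fst (\<xi> i \<omega>)) (fst (\<xi> l \<omega>))" by (intro W_lower) (auto simp: mem_Times_iff)
    then show ?case using il by (intro exI[of _ i] exI[of _ l]) (auto simp: mem_Times_iff)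
  qed
qed

lemma AE_finite_W_all: "AE \<omega> in P. \<forall>i :: nat. finite (smp.edges_at W (real i) \<omega>)"
  using AE_finite_W by (simp add: AE_all_countable)

lemma history_mono: "R \<le> R' \<Longrightarrow> smp.history W R \<omega> \<subseteq> smp.history W R' \<omega>"
  by (auto simp: smp.history_def)

text \<open>
  If the history stayed bounded, then so would the number of edges, and no edge could appear late.
\<close>

lemma AE_history_large: "AE \<omega> in P. \<exists>j :: nat. K \<le> card (smp.history W (real j) \<omega>)"
  using AE_late_edges AE_finite_W_all AE_space
proof eventually_elim
  case (elim \<omega>)
  interpret growing_graph "\<lambda>r. smp.edges_at W r \<omega>"
    using elim(2,3) by (intro smp.growing_graph_edges_at) auto
  have g: "g = (\<lambda>r. smp.graph_at W r \<omega>)" by (simp add: fun_eq_iff g_def graphon_graph_def)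
  have h: "smp.history W R \<omega> = g ` {0..R}" for R by (simp add: smp.history_def g)
  show ?case
  proof (rule ccontr)
    assume "\<not> ?case"
    then have small: "card (g ` {0..real j}) < K" for j :: nat unfolding h by (simp add: not_le)
    let ?S = "g ` {0..}"
    have "finite ?S \<and> card ?S \<le> K"
    proof (rule finite_if_finite_subsets_card_bdd)
      fix H assume H: "H \<subseteq> ?S" "finite H"
      then obtain D where D: "finite D" "D \<subseteq> {0..}" "H = g ` D" using finite_subset_image by meson
      obtain j :: nat where j: "Max (insert 0 D) \<le> real j" using real_arch_simple by blast
      have "H \<subseteq> g ` {0..real j}"
      proof -
        have "d \<le> real j" if "d \<in> D" for d using j D(1) that Max_ge[of "insert 0 D" d] by fastforce
        then show ?thesis using D by auto
      qed
      then have "card H \<le> card (g ` {0..real j})" using finite_history by (intro card_mono)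
      then show "card H \<le> K" using small[of j] by simp
    qed
    then have finS: "finite ?S" by simp
    obtain r0 where r0: "0 \<le> r0" "\<And>r. 0 \<le> r \<Longrightarrow> edge_count (g r) \<le> edge_count (g r0)"
    proof -
      have "finite (edge_count ` ?S)" "edge_count ` ?S \<noteq> {}" using finS by auto
      then have "Max (edge_count ` ?S) \<in> edge_count ` ?S" "\<And>x. x \<in> edge_count ` ?S \<Longrightarrow> x \<le> Max (edge_count ` ?S)"
        by simp_all
      then show thesis using that by auto
    qed
    have const: "smp.edges_at W r \<omega> \<subseteq> smp.edges_at W r0 \<omega>" if "0 \<le> r" for r
    proof -
      have "\<not> smp.edges_at W r0 \<omega> \<subset> smp.edges_at W r \<omega>"
        using r0(2)[OF that] unfolding ec_less_iff[symmetric] by simp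
      then show ?thesis using mono[of r r0] mono[of r0 r] by (metis linear psubsetI)
    qed
    obtain j :: nat where j: "r0 \<le> real j" using real_arch_simple by blast
    obtain i l where il: "i < l" "real j < snd (\<xi> i \<omega>)" "U i l \<omega> < W (fst (\<xi> i \<omega>)) (fst (\<xi> l \<omega>))" using elim(1) by blast
    obtain j' :: nat where "max (snd (\<xi> i \<omega>)) (snd (\<xi> l \<omega>)) \<le> real j'" using real_arch_simple by blast
    then have "{i, l} \<in> smp.edges_at W (real j') \<omega>" using il unfolding sampled_edges_def by auto
    then have "{i, l} \<in> smp.edges_at W r0 \<omega>" using const[of "real j'"] by auto
    then have "{i, l} \<in> smp.edges_at W (real j) \<omega>" using mono[OF j] by blast
    then have "snd (\<xi> i \<omega>) \<le> real j" unfolding sampled_edges_def by (auto simp: doubleton_eq_iff)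
    then show False using il by simp
  qed
qed

end

section \<open>Convergence of the random graphs and of the graph sequence\<close>

definition is_last :: "ugraph \<Rightarrow> ugraph set \<Rightarrow> bool" where
  "is_last v S \<longleftrightarrow> v \<in> S \<and> (\<forall>v'\<in>S. edge_count v' \<le> edge_count v)"

definition starts_with :: "ugraph list \<Rightarrow> ugraph set \<Rightarrow> bool" where
  "starts_with h S \<longleftrightarrow> (\<forall>i<length h. kth S i (h ! i))"

context sampling
begin

lemma is_last_history:
  assumes fin: "finite (edges_at W R \<omega>)" and R: "0 \<le> R"
  shows "is_last v (history W R \<omega>) \<longleftrightarrow> graph_at W R \<omega> = v"
proof -
  have fr: "finite (edges_at W r \<omega>)" if "r \<le> R" for r
    using fin edges_at_mono[OF that] finite_subset by blast
  have ec: "edge_count (graph_at W r \<omega>) = card (edges_at W r \<omega>)" if "r \<le> R" for r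
    unfolding graphon_graph_def by (rule edge_count_unlabelled[OF fin_graph_edges_at[OF fr[OF that]]])
  have le: "edge_count (graph_at W r \<omega>) \<le> edge_count (graph_at W R \<omega>)" if "r \<le> R" for r
    unfolding ec[OF that] ec[OF order_refl] using fin edges_at_mono[OF that] by (rule card_mono)
  have eq: "graph_at W r \<omega> = graph_at W R \<omega>"
    if "r \<le> R" "edge_count (graph_at W R \<omega>) \<le> edge_count (graph_at W r \<omega>)" for r
  proof -
    have "edges_at W r \<omega> = edges_at W R \<omega>"
      using that(2) unfolding ec[OF that(1)] ec[OF order_refl]
      by (intro card_seteq fin edges_at_mono that(1))
    then show ?thesis by (simp add: graphon_graph_def)
  qed
  show ?thesis
  proof
    assume l: "is_last v (history W R \<omega>)"
    then obtain r where r: "r \<le> R" "v = graph_at W r \<omega>" by (auto simp: is_last_def history_def)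
    have "graph_at W R \<omega> \<in> history W R \<omega>" using R by (simp add: history_def)
    then have "edge_count (graph_at W R \<omega>) \<le> edge_count v" using l by (simp add: is_last_def)
    then show "graph_at W R \<omega> = v" using eq[OF r(1)] r(2) by simp
  next
    assume v: "graph_at W R \<omega> = v"
    have "v \<in> history W R \<omega>" using R v by (auto simp: history_def)
    then show "is_last v (history W R \<omega>)" using le v by (auto simp: is_last_def history_def)
  qed
qed

lemma measurable_graph_at_borel: "graphon W \<Longrightarrow> (\<lambda>\<omega>. graph_at W r \<omega>) \<in> P \<rightarrow>\<^sub>M borel"
  using measurable_compose[OF measurable_graph_at[of W "\<lambda>_. r"], of "\<lambda>v. v" borel] by simp

lemma graph_at_event: "graphon W \<Longrightarrow> {\<omega> \<in> space P. graph_at W r \<omega> = v} \<in> events"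
  using measurable_sets[OF measurable_graph_at[of W "\<lambda>_. r"], of "{v}"] by (simp add: vimage_def Int_def conj_commute)

lemma graph_at_differ_event:
  assumes "graphon W"
  shows "{\<omega> \<in> space P. graph_at W r \<omega> \<noteq> graph_at W r' \<omega>} \<in> events"
proof -
  have "{\<omega> \<in> space P. graph_at W r \<omega> \<noteq> graph_at W r' \<omega>} =
    (\<Union>v. {\<omega> \<in> space P. graph_at W r \<omega> = v} - {\<omega> \<in> space P. graph_at W r' \<omega> = v})" by auto
  also have "\<dots> \<in> events" using graph_at_event[OF assms] by (intro sets.countable_UN'' sets.Diff) auto
  finally show ?thesis .
qed

end

lemma (in prob_space) prob_tendsto_0_of_eventually_not:
  assumes ev: "\<And>n. B n \<in> events" and ae: "AE \<omega> in M. \<forall>\<^sub>F n in sequentially. \<omega> \<notin> B n"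
  shows "(\<lambda>n. prob (B n)) \<longlonglongrightarrow> 0"
proof -
  have "(\<lambda>n. expectation (indicator (B n) :: 'a \<Rightarrow> real)) \<longlonglongrightarrow> expectation (\<lambda>_. 0 :: real)"
  proof (rule integral_dominated_convergence[where w = "\<lambda>_. 1"])
    show "AE \<omega> in M. (\<lambda>n. indicator (B n) \<omega> :: real) \<longlonglongrightarrow> 0"
      using ae
    proof eventually_elim
      case (elim \<omega>)
      have "\<forall>\<^sub>F n in sequentially. (indicator (B n) \<omega> :: real) = 0" using elim by eventually_elim simp
      then show ?case by (rule tendsto_eventually)
    qed
  qed (use ev in \<open>auto simp: indicator_def\<close>)
  then show ?thesis using ev by simp
qed

lemma (in prob_space) prob_le_add:
  assumes "A \<in> events" "B \<in> events" "C \<in> events" "AE \<omega> in M. \<omega> \<in> A \<longrightarrow> \<omega> \<in> B \<or> \<omega> \<in> C"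
  shows "prob A \<le> prob B + prob C"
proof -
  have "prob A \<le> prob (B \<union> C)" using assms by (intro finite_measure_mono_AE) auto
  also have "\<dots> \<le> prob B + prob C" using assms by (intro measure_Un_le) auto
  finally show ?thesis .
qed

text \<open>
  A basic open set of the product topology restricts finitely many coordinates.
\<close>

lemma continuous_on_cylinder:
  fixes f :: "(nat \<Rightarrow> 'c::discrete_topology) \<Rightarrow> real"
  assumes f: "continuous_on UNIV f" and e: "e > 0"
  shows "\<exists>k. \<forall>y y'. map y [0..<k] = map x [0..<k] \<longrightarrow> map y' [0..<k] = map x [0..<k] \<longrightarrow> \<bar>f y - f y'\<bar> < e"
proof -
  define O' where "O' = {y. \<bar>f y - f x\<bar> < e / 2}"
  have "open O'"
  proof -
    have "open ((\<lambda>y. \<bar>f y - f x\<bar>) -` {..<e / 2})"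
      using f by (intro open_vimage continuous_intros) auto
    then show ?thesis by (simp add: O'_def vimage_def)
  qed
  moreover have "x \<in> O'" using e by (simp add: O'_def)
  ultimately obtain X where X: "x \<in> Pi\<^sub>E UNIV X" "finite {i. X i \<noteq> UNIV}" "Pi\<^sub>E UNIV X \<subseteq> O'"
    using product_topology_open_contains_basis[of "\<lambda>_. euclidean" UNIV O' x] by (auto simp: open_fun_def)
  obtain k where k: "\<And>i. X i \<noteq> UNIV \<Longrightarrow> i < k"
    using X(2) unfolding finite_nat_iff_bounded by blast
  have "y \<in> O'" if "map y [0..<k] = map x [0..<k]" for y
  proof -
    have "y i \<in> X i" for i
    proof (cases "X i = UNIV")
      case False
      then have "y i = x i" using k[of i] that by simp
      then show ?thesis using X(1) by auto
    qed simp
    then show ?thesis using X(3) by auto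
  qed
  then have "\<bar>f y - f y'\<bar> < e" if "map y [0..<k] = map x [0..<k]" "map y' [0..<k] = map x [0..<k]" for y y'
    using that unfolding O'_def by (smt (verit) mem_Collect_eq field_sum_of_halves)
  then show ?thesis by blast
qed

lemma sets_borel_cylinder:
  "(\<lambda>x. map x [0..<k]) -` {b} \<in> sets (borel :: (nat \<Rightarrow> 'c::discrete_topology) measure)"
proof -
  have "open {x :: nat \<Rightarrow> 'c. x i = v}" for i v
  proof -
    have "open ((\<lambda>x :: nat \<Rightarrow> 'c. x i) -` {v})"
      by (intro open_vimage continuous_on_product_coordinates Topological_Spaces.open_discrete)
    then show ?thesis by (simp add: vimage_def)
  qed
  then have "(\<Inter>i\<in>{..<k}. {x :: nat \<Rightarrow> 'c. x i = b ! i}) \<inter> {x. length b = k} \<in> sets borel"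
    by (intro sets.Int borel_open open_INT) auto
  also have "(\<Inter>i\<in>{..<k}. {x :: nat \<Rightarrow> 'c. x i = b ! i}) \<inter> {x. length b = k} = (\<lambda>x. map x [0..<k]) -` {b}"
  proof (intro set_eqI iffI)
    fix x :: "nat \<Rightarrow> 'c"
    assume x: "x \<in> (\<Inter>i\<in>{..<k}. {x. x i = b ! i}) \<inter> {x. length b = k}"
    have "map x [0..<k] = b" by (rule nth_equalityI) (use x in \<open>auto split: if_splits\<close>)
    then show "x \<in> (\<lambda>x. map x [0..<k]) -` {b}" by simp
  qed auto
  finally show ?thesis .
qed

context rank1
begin

lemma graphon_empirical: "graphon (empirical \<omega> t u)"
  unfolding empirical_def by (rule graphon_stretched)

lemma admissible_empirical: "u \<ge> 0 \<Longrightarrow> admissible_graphon P \<xi> U (empirical \<omega> t u)"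
  unfolding empirical_def by (rule smp.admissible_stretched)

lemma history_prob_is_last:
  assumes R: "0 \<le> R" and adm: "admissible_graphon P \<xi> U W'"
  shows "history_prob (is_last v) W' R = smp.prob {\<omega> \<in> space P. smp.graph_at W' R \<omega> = v}"
  unfolding history_prob_def
proof (rule smp.finite_measure_eq_AE)
  have g: "graphon W'" using adm by (simp add: admissible_graphon_def)
  show "{\<omega> \<in> space P. finite (smp.edges_at W' R \<omega>) \<and> is_last v (smp.history W' R \<omega>)} \<in> smp.events"
    by (rule smp.history_event[OF g R])
  show "{\<omega> \<in> space P. smp.graph_at W' R \<omega> = v} \<in> smp.events" by (rule smp.graph_at_event[OF g])
  have "AE \<omega> in P. finite (smp.edges_at W' R \<omega>)" using adm R by (simp add: admissible_graphon_def)
  then show "AE \<omega> in P. \<omega> \<in> {\<omega> \<in> space P. finite (smp.edges_at W' R \<omega>) \<and> is_last v (smp.history W' R \<omega>)} \<longleftrightarrow>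
    \<omega> \<in> {\<omega> \<in> space P. smp.graph_at W' R \<omega> = v}"
    by eventually_elim (use smp.is_last_history[OF _ R] in auto)
qed

text \<open>
  It allows real sampling times to be replaced by rational ones, so that countably many almost sure
  statements suffice.
\<close>

lemma graph_at_W_right_continuous:
  assumes Rs: "Rs \<longlonglongrightarrow> r" "\<And>j. r < Rs j"
  shows "(\<lambda>j. smp.prob {\<omega> \<in> space P. smp.graph_at W r \<omega> \<noteq> smp.graph_at W (Rs j) \<omega>}) \<longlonglongrightarrow> 0"
proof (rule smp.prob_tendsto_0_of_eventually_not)
  fix j
  show "{\<omega> \<in> space P. smp.graph_at W r \<omega> \<noteq> smp.graph_at W (Rs j) \<omega>} \<in> smp.events"
    by (rule smp.graph_at_differ_event[OF graphon_W])
next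
  show "AE \<omega> in P. \<forall>\<^sub>F j in sequentially. \<omega> \<notin> {\<omega> \<in> space P. smp.graph_at W r \<omega> \<noteq> smp.graph_at W (Rs j) \<omega>}"
    using AE_finite_W_all AE_space
  proof eventually_elim
    case (elim \<omega>)
    interpret growing_graph "\<lambda>r. smp.edges_at W r \<omega>"
      using elim by (intro smp.growing_graph_edges_at) auto
    obtain d where d: "d > 0" "smp.edges_at W (r + d) \<omega> = smp.edges_at W r \<omega>" using right_const by blast
    have "\<forall>\<^sub>F j in sequentially. Rs j < r + d" using order_tendstoD(2)[OF Rs(1), of "r + d"] d by simp
    then show ?case
    proof eventually_elim
      case (elim j)
      have "smp.edges_at W (Rs j) \<omega> = smp.edges_at W r \<omega>"
        using mono[of r "Rs j"] mono[of "Rs j" "r + d"] d elim Rs(2)[of j] by (simp add: subset_antisym)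
      then show ?case by (simp add: graphon_graph_def)
    qed
  qed
qed

text \<open>
  The horizon \<open>\<rho> = R * s / n\<close> has the ratio \<open>\<rho> / s = R / n\<close> to the stretching \<open>s\<close>. It exceeds \<open>r\<close> only
  slightly if the rational \<open>R > r\<close> is close to \<open>r\<close>. The window parameter \<open>k\<close> has to be chosen before
  \<open>R\<close>, since moving the horizon costs \<open>k\<^sup>2 * (R - r)\<close>.
\<close>

lemma GP_lower_bound:
  assumes \<omega>: "\<And>R. R \<in> \<rat> \<Longrightarrow> R > 0 \<Longrightarrow> typical (is_last v) R \<omega>" and r: "r \<ge> 0" and e: "e > 0"
  shows "\<forall>\<^sub>F t in at_top. smp.prob {\<omega>' \<in> space P. smp.graph_at (empirical \<omega> t (t powr (1 / (2 * \<gamma>)))) r \<omega>' = v} \<ge>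
     smp.prob {\<omega>' \<in> space P. smp.graph_at W r \<omega>' = v} - e"
proof -
  define e' where "e' = e / 8"
  have e': "e' > 0" using e by (simp add: e'_def)
  have "\<forall>\<^sub>F k in sequentially. err (r + 1) k < e' \<and> 1 \<le> k"
    using order_tendstoD(2)[OF err_tendsto[of "r + 1"] e'] eventually_ge_at_top[of 1] by eventually_elim simp
  then obtain k where k: "err (r + 1) k < e'" "1 \<le> k"
    using eventually_happens'[OF sequentially_bot] by blast
  define \<eta> where "\<eta> = min 1 (e' / (real k)\<^sup>2)"
  have \<eta>: "\<eta> > 0" using e' k by (simp add: \<eta>_def)
  have "\<exists>R\<in>\<rat>. r < R \<and> R < r + \<eta> / real (Suc j)" for j
    using Rats_dense_in_real[of r "r + \<eta> / real (Suc j)"] \<eta> by auto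
  then obtain Rs where Rs: "\<And>j. Rs j \<in> \<rat>" "\<And>j. r < Rs j" "\<And>j. Rs j < r + \<eta> / real (Suc j)" by metis
  have "Rs \<longlonglongrightarrow> r"
  proof (rule tendsto_sandwich[of "\<lambda>_. r" _ _ "\<lambda>j. r + \<eta> / real (Suc j)"])
    show "(\<lambda>j. r + \<eta> / real (Suc j)) \<longlonglongrightarrow> r" by real_asymp
    show "\<forall>\<^sub>F j in sequentially. r \<le> Rs j" "\<forall>\<^sub>F j in sequentially. Rs j \<le> r + \<eta> / real (Suc j)"
      using Rs(2,3) by (auto intro!: always_eventually less_imp_le simp del: of_nat_Suc)
  qed simp
  then have "\<forall>\<^sub>F j in sequentially. smp.prob {\<omega> \<in> space P. smp.graph_at W r \<omega> \<noteq> smp.graph_at W (Rs j) \<omega>} < e'"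
    using Rs(2) e' by (intro order_tendstoD(2)[OF graph_at_W_right_continuous])
  then obtain j where j: "smp.prob {\<omega> \<in> space P. smp.graph_at W r \<omega> \<noteq> smp.graph_at W (Rs j) \<omega>} < e'"
    using eventually_happens'[OF sequentially_bot] by blast
  define R where "R = Rs j"
  have R: "R \<in> \<rat>" "r < R" "R > 0" using Rs(1,2)[of j] r by (auto simp: R_def)
  have "\<eta> / real (Suc j) \<le> \<eta>" using \<eta> by (simp add: field_simps)
  then have R\<eta>: "R < r + \<eta>" using Rs(3)[of j] by (simp add: R_def)
  have kR: "(real k)\<^sup>2 * (R - r) \<le> e'"
  proof -
    have "(real k)\<^sup>2 * (R - r) \<le> (real k)\<^sup>2 * (e' / (real k)\<^sup>2)"
      using R\<eta> by (intro mult_left_mono) (auto simp: \<eta>_def)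
    then show ?thesis using k by simp
  qed
  have errR: "err R k \<le> e'"
  proof -
    have "R \<le> r + 1" using R\<eta> by (simp add: \<eta>_def)
    then have "err R k \<le> err (r + 1) k"
      unfolding err_def using R G_pos tail_pos[OF k(2)] by (intro add_mono mult_left_mono mult_right_mono divide_right_mono power_mono) auto
    then show ?thesis using k by simp
  qed
  have ratio: "\<forall>\<^sub>F t in at_top. (real k)\<^sup>2 * r / (real (grid_index t) + 1) < e'"
  proof -
    have "(\<lambda>n :: nat. (real k)\<^sup>2 * r / (real n + 1)) \<longlonglongrightarrow> 0" by real_asymp
    then have "\<forall>\<^sub>F n :: nat in sequentially. (real k)\<^sup>2 * r / (real n + 1) < e'" using e' by (rule order_tendstoD(2))
    then show ?thesis by (rule eventually_compose_filterlim[OF _ grid_index_filterlim])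
  qed
  have idx1: "\<forall>\<^sub>F t in at_top. 1 \<le> grid_index t" using grid_index_filterlim by (simp add: filterlim_at_top)
  show ?thesis
    using history_convergence[OF \<omega>[OF R(1,3)] R(3) e' k(2)] ratio idx1 eventually_ge_at_top[of 0]
  proof eventually_elim
    case (elim t)
    define s where "s = t powr (1 / (2 * \<gamma>))"
    define n where "n = grid_index t"
    have sn: "real n \<le> s" "s < real n + 1" using grid_index_bounds(3,4)[OF elim(4)] by (auto simp: s_def n_def)
    have n1: "1 \<le> n" using elim(3) by (simp add: n_def)
    have s0: "s > 0" using sn n1 by simp
    \<comment> \<open>The horizon at which the stretched graph meets the grid ratio \<open>R / n\<close>.\<close>
    define \<rho> where "\<rho> = R * s / real n"
    have \<rho>s: "\<rho> / s = R / real n" using s0 by (simp add: \<rho>_def)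
    have "R * 1 \<le> R * (s / real n)" using sn n1 R by (intro mult_left_mono) auto
    then have r\<rho>: "r \<le> \<rho>" using R by (simp add: \<rho>_def)
    let ?E = "empirical \<omega> t s"
    have H: "\<bar>history_prob (is_last v) ?E \<rho> - history_prob (is_last v) W R\<bar> \<le> err R k + e'"
      and S: "smp.prob {\<omega>' \<in> space P. smp.graph_at ?E r \<omega>' \<noteq> smp.graph_at ?E \<rho> \<omega>'} \<le>
          err R k + e' + (real k)\<^sup>2 * (real n * (\<rho> - r) / s)"
      using elim(1) s0 \<rho>s r r\<rho> unfolding n_def by blast+
    have "real n * (\<rho> - r) / s = R - r * (real n / s)" using s0 n1 by (simp add: \<rho>_def field_simps)
    also have "\<dots> \<le> (R - r) + r * (1 / (real n + 1))"
    proof -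
      have "real n / (real n + 1) \<le> real n / s" using sn s0 by (intro divide_left_mono) auto
      then have "r * (real n / (real n + 1)) \<le> r * (real n / s)" using r by (intro mult_left_mono)
      moreover have "real n / (real n + 1) = 1 - 1 / (real n + 1)" by (simp add: field_simps)
      ultimately show ?thesis by (simp add: right_diff_distrib)
    qed
    finally have "(real k)\<^sup>2 * (real n * (\<rho> - r) / s) \<le> (real k)\<^sup>2 * ((R - r) + r * (1 / (real n + 1)))"
      by (intro mult_left_mono) auto
    also have "\<dots> = (real k)\<^sup>2 * (R - r) + (real k)\<^sup>2 * r / (real n + 1)" by (simp add: distrib_left)
    also have "\<dots> \<le> e' + e'" using kR elim(2) by (simp add: n_def)
    finally have kb: "(real k)\<^sup>2 * (real n * (\<rho> - r) / s) \<le> e' + e'" .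
    have adm: "admissible_graphon P \<xi> U ?E" using s0 by (intro admissible_empirical) simp
    have \<rho>0: "0 \<le> \<rho>" using r r\<rho> by simp
    have "smp.prob {\<omega>' \<in> space P. smp.graph_at W r \<omega>' = v} \<le>
      smp.prob {\<omega>' \<in> space P. smp.graph_at W R \<omega>' = v} + smp.prob {\<omega> \<in> space P. smp.graph_at W r \<omega> \<noteq> smp.graph_at W R \<omega>}"
      by (intro smp.prob_le_add smp.graph_at_event graphon_W smp.graph_at_differ_event) auto
    also have "smp.prob {\<omega>' \<in> space P. smp.graph_at W R \<omega>' = v} = history_prob (is_last v) W R"
      using history_prob_is_last[OF _ admissible_W] R by simp
    finally have 1: "smp.prob {\<omega>' \<in> space P. smp.graph_at W r \<omega>' = v} \<le> history_prob (is_last v) W R + e'"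
      using j by (simp add: R_def)
    have "history_prob (is_last v) ?E \<rho> = smp.prob {\<omega>' \<in> space P. smp.graph_at ?E \<rho> \<omega>' = v}"
      by (rule history_prob_is_last[OF \<rho>0 adm])
    also have "\<dots> \<le> smp.prob {\<omega>' \<in> space P. smp.graph_at ?E r \<omega>' = v} +
      smp.prob {\<omega>' \<in> space P. smp.graph_at ?E r \<omega>' \<noteq> smp.graph_at ?E \<rho> \<omega>'}"
      by (intro smp.prob_le_add smp.graph_at_event graphon_empirical smp.graph_at_differ_event) auto
    finally have 2: "history_prob (is_last v) ?E \<rho> \<le> smp.prob {\<omega>' \<in> space P. smp.graph_at ?E r \<omega>' = v} +
      smp.prob {\<omega>' \<in> space P. smp.graph_at ?E r \<omega>' \<noteq> smp.graph_at ?E \<rho> \<omega>'}" .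
    have "e = 8 * e'" by (simp add: e'_def)
    then show ?case using 1 2 H S kb errR e' unfolding s_def[symmetric] by linarith
  qed
qed

lemma GP:
  "AE \<omega> in M. GP_converges P \<xi> U (\<lambda>t. empirical \<omega> t (t powr (1 / (2 * \<gamma>)))) W at_top"
proof -
  have "AE \<omega> in M. \<forall>v. \<forall>R\<in>{R \<in> \<rat>. R > 0}. typical (is_last v) R \<omega>"
  proof (subst AE_all_countable, intro allI)
    fix v
    have "countable {R :: real. R \<in> \<rat> \<and> R > 0}" by (rule countable_subset[OF _ countable_rat]) auto
    then show "AE \<omega> in M. \<forall>R\<in>{R \<in> \<rat>. R > 0}. typical (is_last v) R \<omega>"
      using AE_typical by (subst AE_ball_countable) auto
  qed
  then show ?thesis
  proof eventually_elim
    case (elim \<omega>)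
    show ?case
      unfolding GP_converges_def
    proof (intro conjI allI impI)
      show "admissible_graphon P \<xi> U (empirical \<omega> t (t powr (1 / (2 * \<gamma>))))" for t by (intro admissible_empirical) simp
      show "admissible_graphon P \<xi> U W" by (rule admissible_W)
      fix r :: real assume r: "0 \<le> r"
      show "weakly_converges (\<lambda>t. distr P borel (smp.graph_at (empirical \<omega> t (t powr (1 / (2 * \<gamma>)))) r))
        (distr P borel (smp.graph_at W r)) at_top"
      proof (rule smp.weakly_converges_if_cells_converge[where d = "\<lambda>_ v. v"])
        show "(smp.graph_at (empirical \<omega> t (t powr (1 / (2 * \<gamma>)))) r) \<in> P \<rightarrow>\<^sub>M borel" for t
          by (rule smp.measurable_graph_at_borel[OF graphon_empirical])
        show "(smp.graph_at W r) \<in> P \<rightarrow>\<^sub>M borel" by (rule smp.measurable_graph_at_borel[OF graphon_W])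
        show "\<forall>\<^sub>F t in at_top. smp.prob {\<omega>' \<in> space P. smp.graph_at W r \<omega>' = v} - e \<le>
          smp.prob {\<omega>' \<in> space P. smp.graph_at (empirical \<omega> t (t powr (1 / (2 * \<gamma>)))) r \<omega>' = v}" if "e > 0" for v and e :: real
          using elim r that by (intro GP_lower_bound) auto
      qed (auto simp: borel_open Topological_Spaces.open_discrete)
    qed
  qed
qed

text \<open>
  Up to the event that fewer than \<open>length h\<close> graphs are seen by time \<open>R\<close>, which is unlikely for \<open>W\<close>
  when \<open>R\<close> is large, the first entries of the sequence are a property of the history. For the empirical
  graphon the implication from the history to the sequence yields the lower bound.
\<close>

lemma GS_lower_bound:
  assumes \<omega>: "\<And>j :: nat. typical (starts_with h) (real (Suc j)) \<omega>" and e: "e > 0"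
  shows "\<forall>\<^sub>F t in at_top. smp.prob {\<omega>' \<in> space P. map (graph_sequence \<xi> U (empirical \<omega> t 1) \<omega>') [0..<length h] = h} \<ge>
     smp.prob {\<omega>' \<in> space P. map (graph_sequence \<xi> U W \<omega>') [0..<length h] = h} - e"
proof -
  let ?K = "length h"
  have seq_ev: "{\<omega>' \<in> space P. map (graph_sequence \<xi> U W' \<omega>') [0..<?K] = h} \<in> smp.events" if "graphon W'" for W'
    using measurable_sets[OF smp.measurable_graph_sequence[OF that] sets_borel_cylinder[of ?K h]]
    by (simp add: vimage_def Int_def conj_commute)
  define B where "B j = {\<omega>' \<in> space P. \<not> (finite (smp.edges_at W (real (Suc j)) \<omega>') \<and> ?K \<le> card (smp.history W (real (Suc j)) \<omega>'))}" for j
  have B: "B j \<in> smp.events" for j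
  proof -
    have "{\<omega>' \<in> space P. finite (smp.edges_at W (real (Suc j)) \<omega>') \<and> ?K \<le> card (smp.history W (real (Suc j)) \<omega>')} \<in> smp.events"
      by (rule smp.history_event[OF graphon_W]) simp
    then show ?thesis unfolding B_def by (rule sets.sets_Collect_neg)
  qed
  have "(\<lambda>j. smp.prob (B j)) \<longlonglongrightarrow> 0"
  proof (rule smp.prob_tendsto_0_of_eventually_not[OF B])
    show "AE \<omega>' in P. \<forall>\<^sub>F j in sequentially. \<omega>' \<notin> B j"
      using AE_history_large[of ?K] AE_finite_W_all AE_space
    proof eventually_elim
      case (elim \<omega>')
      then obtain j0 :: nat where j0: "?K \<le> card (smp.history W (real j0) \<omega>')" by blast
      interpret growing_graph "\<lambda>r. smp.edges_at W r \<omega>'"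
        using elim(2,3) by (intro smp.growing_graph_edges_at) auto
      have g: "g = (\<lambda>r. smp.graph_at W r \<omega>')" by (simp add: fun_eq_iff g_def graphon_graph_def)
      have "?K \<le> card (smp.history W (real (Suc j)) \<omega>')" if "j \<ge> j0" for j
      proof -
        have "finite (smp.history W (real (Suc j)) \<omega>')"
          using finite_history unfolding smp.history_def g .
        then have "card (smp.history W (real j0) \<omega>') \<le> card (smp.history W (real (Suc j)) \<omega>')"
          using that by (intro card_mono history_mono) auto
        then show ?thesis using j0 by simp
      qed
      then show ?case
        unfolding B_def using elim(2) by (intro eventually_sequentiallyI[of j0]) (auto simp del: of_nat_Suc)
    qed
  qed
  then have "\<forall>\<^sub>F j in sequentially. smp.prob (B j) < e / 4"
    using e by (intro order_tendstoD(2)) auto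
  then obtain j where j: "smp.prob (B j) < e / 4"
    using eventually_happens'[OF sequentially_bot] by blast
  define R where "R = real (Suc j)"
  have R: "R > 0" by (simp add: R_def)
  have e4: "e / 4 > 0" using e by simp
  have "\<forall>\<^sub>F k in sequentially. err R k < e / 4 \<and> 1 \<le> k"
    using order_tendstoD(2)[OF err_tendsto[of R] e4] eventually_ge_at_top[of 1] by eventually_elim simp
  then obtain k where k: "err R k < e / 4" "1 \<le> k"
    using eventually_happens'[OF sequentially_bot] by blast
  have limit: "smp.prob {\<omega>' \<in> space P. map (graph_sequence \<xi> U W \<omega>') [0..<?K] = h} \<le> history_prob (starts_with h) W R + smp.prob (B j)"
    unfolding history_prob_def
  proof (rule smp.prob_le_add[OF seq_ev[OF graphon_W] smp.history_event[OF graphon_W] B])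
    show "0 \<le> R" using R by simp
    show "AE \<omega>' in P. \<omega>' \<in> {\<omega>' \<in> space P. map (graph_sequence \<xi> U W \<omega>') [0..<?K] = h} \<longrightarrow>
      \<omega>' \<in> {\<omega> \<in> space P. finite (smp.edges_at W R \<omega>) \<and> starts_with h (smp.history W R \<omega>)} \<or> \<omega>' \<in> B j"
      using AE_finite_W_all AE_space
    proof eventually_elim
      case (elim \<omega>')
      show ?case
      proof (intro impI disjCI)
        assume m: "\<omega>' \<in> {\<omega>' \<in> space P. map (graph_sequence \<xi> U W \<omega>') [0..<?K] = h}" and nB: "\<omega>' \<notin> B j"
        have fin: "finite (smp.edges_at W R \<omega>')" and card: "?K \<le> card (smp.history W R \<omega>')"
          using nB elim(2) by (auto simp: B_def R_def)
        have "kth (smp.history W R \<omega>') i (h ! i)" if "i < ?K" for i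
        proof -
          have "h ! i = map (graph_sequence \<xi> U W \<omega>') [0..<?K] ! i" using m by simp
          then have "h ! i = graph_sequence \<xi> U W \<omega>' i" using that by simp
          moreover have "kth (smp.history W R \<omega>') i (graph_sequence \<xi> U W \<omega>' i)"
            using that card elim by (intro smp.graph_sequence_kth(2)) auto
          ultimately show ?thesis by simp
        qed
        then show "\<omega>' \<in> {\<omega> \<in> space P. finite (smp.edges_at W R \<omega>) \<and> starts_with h (smp.history W R \<omega>)}"
          using fin elim(2) by (simp add: starts_with_def)
      qed
    qed
  qed
  show ?thesis
    using history_convergence[OF \<omega>[of j, folded R_def] R e4 k(2)]
  proof eventually_elim
    case (elim t)
    let ?E = "empirical \<omega> t 1"
    let ?\<rho> = "R / real (grid_index t)"
    have adm: "admissible_graphon P \<xi> U ?E" by (rule admissible_empirical) simp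
    have H: "\<bar>history_prob (starts_with h) ?E ?\<rho> - history_prob (starts_with h) W R\<bar> \<le> err R k + e / 4"
      using elim[rule_format, of 1 ?\<rho>] by simp
    have "history_prob (starts_with h) ?E ?\<rho> \<le> smp.prob {\<omega>' \<in> space P. map (graph_sequence \<xi> U ?E \<omega>') [0..<?K] = h}"
      unfolding history_prob_def
    proof (rule smp.finite_measure_mono_AE[OF _ seq_ev[OF graphon_empirical]])
      have "AE \<omega>' in P. \<forall>i :: nat. finite (smp.edges_at ?E (real i) \<omega>')"
        using adm by (simp add: admissible_graphon_def AE_all_countable)
      then show "AE \<omega>' in P. \<omega>' \<in> {\<omega>' \<in> space P. finite (smp.edges_at ?E ?\<rho> \<omega>') \<and> starts_with h (smp.history ?E ?\<rho> \<omega>')} \<longrightarrow>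
        \<omega>' \<in> {\<omega>' \<in> space P. map (graph_sequence \<xi> U ?E \<omega>') [0..<?K] = h}"
        using AE_space
      proof eventually_elim
        case (elim \<omega>')
        show ?case
        proof
          assume st: "\<omega>' \<in> {\<omega>' \<in> space P. finite (smp.edges_at ?E ?\<rho> \<omega>') \<and> starts_with h (smp.history ?E ?\<rho> \<omega>')}"
          have "graph_sequence \<xi> U ?E \<omega>' i = h ! i" if "i < ?K" for i
            using st that elim by (intro smp.graph_sequence_kth(1)[of _ _ ?\<rho>]) (auto simp: starts_with_def)
          then have "map (graph_sequence \<xi> U ?E \<omega>') [0..<?K] = h" by (intro nth_equalityI) auto
          then show "\<omega>' \<in> {\<omega>' \<in> space P. map (graph_sequence \<xi> U ?E \<omega>') [0..<?K] = h}" using elim(2) by simp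
        qed
      qed
    qed
    then show ?case using H limit j k by linarith
  qed
qed

lemma GS:
  "AE \<omega> in M. GS_converges P \<xi> U (\<lambda>t. empirical \<omega> t 1) W at_top"
proof -
  have "AE \<omega> in M. \<forall>h. \<forall>j :: nat. typical (starts_with h) (real (Suc j)) \<omega>"
    unfolding AE_all_countable by (intro allI AE_typical) simp
  then show ?thesis
  proof eventually_elim
    case (elim \<omega>)
    show ?case
      unfolding GS_converges_def
    proof (intro conjI allI)
      show "admissible_graphon P \<xi> U (empirical \<omega> t 1)" for t by (intro admissible_empirical) simp
      show "admissible_graphon P \<xi> U W" by (rule admissible_W)
      show "weakly_converges (\<lambda>t. distr P borel (graph_sequence \<xi> U (empirical \<omega> t 1)))
        (distr P borel (graph_sequence \<xi> U W)) at_top"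
      proof (rule smp.weakly_converges_if_cells_converge[where d = "\<lambda>k x. map x [0..<k]"])
        show "graph_sequence \<xi> U (empirical \<omega> t 1) \<in> P \<rightarrow>\<^sub>M borel" for t
          by (rule smp.measurable_graph_sequence[OF graphon_empirical])
        show "graph_sequence \<xi> U W \<in> P \<rightarrow>\<^sub>M borel" by (rule smp.measurable_graph_sequence[OF graphon_W])
        show "(\<lambda>x :: nat \<Rightarrow> ugraph. map x [0..<k]) -` {b} \<in> sets borel" for k b by (rule sets_borel_cylinder)
        show "map x [0..<k] = map y [0..<k]" if "k \<le> l" "map x [0..<l] = map y [0..<l]" for k l and x y :: "nat \<Rightarrow> ugraph"
          using that by auto
        show "\<exists>k. \<forall>y y'. map y [0..<k] = map x [0..<k] \<longrightarrow> map y' [0..<k] = map x [0..<k] \<longrightarrow> \<bar>f y - f y'\<bar> < e"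
          if "continuous_on UNIV f" "e > 0" for f :: "(nat \<Rightarrow> ugraph) \<Rightarrow> real" and x e
          using that by (rule continuous_on_cylinder)
        show "\<forall>\<^sub>F t in at_top. smp.prob {\<omega>' \<in> space P. map (graph_sequence \<xi> U W \<omega>') [0..<k] = h} - e \<le>
          smp.prob {\<omega>' \<in> space P. map (graph_sequence \<xi> U (empirical \<omega> t 1) \<omega>') [0..<k] = h}" if "e > 0" for k h and e :: real
        proof (cases "length h = k")
          case True
          then show ?thesis using GS_lower_bound[of h \<omega> e] elim that by blast
        next
          case False
          then have no: "map x [0..<k] \<noteq> h" for x :: "nat \<Rightarrow> ugraph" by auto
          show ?thesis using that by (simp add: no)
        qed
      qed
    qed
  qed
qed

end

theorem theorem9p3:
  fixes \<gamma> c :: real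
    and q :: "nat \<Rightarrow> real"
    and M :: "'w measure"
    and N :: "nat \<Rightarrow> nat \<Rightarrow> real \<Rightarrow> 'w \<Rightarrow> nat"
    and P :: "'p measure"
    and \<xi> :: "nat \<Rightarrow> 'p \<Rightarrow> real \<times> real"
    and U :: "nat \<Rightarrow> nat \<Rightarrow> 'p \<Rightarrow> real"
    and lab :: "nat set set \<Rightarrow> nat \<Rightarrow> nat"
    and W :: "real \<Rightarrow> real \<Rightarrow> real"
  assumes "\<gamma> > 1"
    and "\<forall>i\<ge>1. q i \<ge> 0" and "(q has_sum 1) {1..}"
    and "\<exists>c0>0. \<exists>C0>0. \<forall>i\<ge>1. c0 * real i powr (- \<gamma>) \<le> q i \<and> q i \<le> C0 * real i powr (- \<gamma>)"
    and "c > 0" and "q \<sim>[at_top] (\<lambda>i. c * real i powr (- \<gamma>))"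
    and "rank1_arrivals M q N"
    and "graphon_sampling P \<xi> U"
    and "vertex_labelling lab"
    and W_def: "W = (\<lambda>x y. 1 - exp (- 2 * c\<^sup>2 * x powr (- \<gamma>) * y powr (- \<gamma>)))"
  shows "(AE \<omega> in M.
           GP_converges P \<xi> U
             (\<lambda>t. stretched_graphon (arrived_graph N t \<omega>) (lab (arrived_graph N t \<omega>))
                    (t powr (1 / (2 * \<gamma>))))
             W at_top) \<and>
         (AE \<omega> in M.
           GS_converges P \<xi> U
             (\<lambda>t. stretched_graphon (arrived_graph N t \<omega>) (lab (arrived_graph N t \<omega>)) 1)
             W at_top)"
proof -
  obtain C0 where C0: "C0 > 0" "\<forall>i\<ge>1. q i \<le> C0 * real i powr (- \<gamma>)" using assms(4) by blast
  interpret rank1 P \<xi> U M q N \<gamma> c C0 lab W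
  proof (intro rank1.intro sampling.intro arrivals.intro sampling_axioms.intro arrivals_axioms.intro rank1_axioms.intro)
    show "prob_space P" using assms(8) by (simp add: graphon_sampling_def)
    show "prob_space M" using assms(7) by (simp add: rank1_arrivals_def)
  qed (use assms C0 in auto)
  show ?thesis using GP GS unfolding empirical_def by blast
qed

end
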